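(* Let $R$ be a noetherian graded commutative ring, $\mathsf{T}$ an essentially small $R$-linear triangulated category, and $F\in\operatorname{\mathsf{Coh}}\mathsf{T}$. Then $$\operatorname{\mathsf{Loc}}(F)=\operatorname{\mathsf{Loc}}(\{\varGamma_{\mathfrak p}F\mid\mathfrak p\in\operatorname{Spec}R\})=\operatorname{\mathsf{Loc}}(\{F_{\mathfrak p}\mid\mathfrak p\in\operatorname{Spec}R\}).$$
   Context: A graded commutative ring $R$ is $\mathbb{Z}$-graded with $rs=(-1)^{|r||s|}sr$ for homogeneous $r,s$. $\operatorname{Spec}R$ is the set of homogeneous prime ideals. A triangulated category $\mathsf{T}$ with suspension $\Sigma$ is $R$-linear if there is a given homomorphism of graded rings $R\to Z^*(\mathsf{T})$, where $Z^*(\mathsf{T})=\bigoplus_{n\in\mathbb{Z}}\{\eta\colon \mathrm{Id}_{\mathsf{T}}\to\Sigma^n\mid \eta\Sigma=(-1)^n\Sigma\eta\}$ is the graded centre; then $\operatorname{Hom}^*_{\mathsf{T}}(X,Y)=\bigoplus_n\operatorname{Hom}_{\mathsf{T}}(X,\Sigma^nY)$ is a graded $R$-module, and $\operatorname{End}^*_{\mathsf{T}}(X)=\operatorname{Hom}^*_{\mathsf{T}}(X,X)$. $\operatorname{\mathsf{Coh}}\mathsf{T}$ is the category of cohomological functors $\mathsf{T}^{\mathrm{op}}\to\mathsf{Ab}$ (additive functors taking exact triangles to exact sequences), with natural transformations as morphisms; $H_X=\operatorname{Hom}_{\mathsf{T}}(-,X)$. Suspension: $\Sigma F=F\circ\Sigma^{-1}$.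 A sequence in $\operatorname{\mathsf{Coh}}\mathsf{T}$ is exact if its evaluation at each object of $\mathsf{T}$ is exact. For $F\in\operatorname{\mathsf{Coh}}\mathsf{T}$, $F^*(X)=\bigoplus_nF(\Sigma^{-n}X)$ is a graded $R$-module. A full subcategory of $\operatorname{\mathsf{Coh}}\mathsf{T}$ is localising if it is closed under coproducts, suspensions (all $\Sigma^n$, $n\in\mathbb{Z}$), and extensions, where $F$ is an extension of $F'$ and $F''$ if there is an exact sequence $F'\to F\to F''$ in $\operatorname{\mathsf{Coh}}\mathsf{T}$. $\operatorname{\mathsf{Loc}}(\mathsf{C})$ is the smallest localising subcategory containing $\mathsf{C}$. For an exact functor $f\colon\mathsf{T}\to\mathsf{U}$ of essentially small triangulated categories put $f^*(F)=\operatorname{colim}_{H_X\to F}H_{f(X)}$ for $F\in\operatorname{\mathsf{Coh}}\mathsf{T}$ and $f_*(G)=G\circ f$ for $G\in\operatorname{\mathsf{Coh}}\mathsf{U}$. For $\mathfrak p\in\operatorname{Spec}R$ let $\mathcal V(\mathfrak p)=\{\mathfrak q\in\operatorname{Spec}R\mid\mathfrak p\subseteq\mathfrak q\}$, let $\mathsf{T}_{\mathcal V(\mathfrak p)}=\{X\in\mathsf{T}\mid\operatorname{End}^*_{\mathsf{T}}(X)_{\mathfrak q}=0\text{ for all }\mathfrak q\notin\mathcal V(\mathfrak p)\}$ with inclusion $i\colon\mathsf{T}_{\mathcal V(\mathfrak p)}\to\mathsf{T}$, and set $\varGamma_{\mathcal V(\mathfrak p)}=i^*\circ i_*\colon\operatorname{\mathsf{Coh}}\mathsf{T}\to\operatorname{\mathsf{Coh}}\mathsf{T}$.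 The functor $F_{\mathfrak p}\in\operatorname{\mathsf{Coh}}\mathsf{T}$ is defined by $(F_{\mathfrak p})^*(X)=F^*(X)_{\mathfrak p}$. Finally $\varGamma_{\mathfrak p}F=\varGamma_{\mathcal V(\mathfrak p)}(F_{\mathfrak p})$. *)

theory Defs
  imports "HOL-Algebra.Ring_Divisibility" "HOL-Algebra.Exact_Sequence"
    "HOL-Algebra.Product_Groups" "HOL-Library.Equipollence"
begin

section \<open>Graded commutative rings and homogeneous primes\<close>

text \<open>The element \<open>(-1)\<^sup>n x\<close> of an abelian group written multiplicatively.\<close>

definition sgn_act :: "('a, 'b) monoid_scheme \<Rightarrow> int \<Rightarrow> 'a \<Rightarrow> 'a"
  where "sgn_act G n x = (if even n then x else inv\<^bsub>G\<^esub> x)"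

text \<open>\<open>A n\<close> is the degree \<open>n\<close> part of \<open>R\<close>.\<close>

locale graded_commutative_ring = ring R
  for R :: "('r, 'x) ring_scheme" (structure) and A :: "int \<Rightarrow> 'r set" +
  assumes subgroup_degree: "additive_subgroup (A n) R"
    and one_degree: "\<one> \<in> A 0"
    and mult_degree: "\<lbrakk>r \<in> A m; s \<in> A n\<rbrakk> \<Longrightarrow> r \<otimes> s \<in> A (m + n)"
    and direct_sum: "r \<in> carrier R \<Longrightarrow>
          \<exists>!c. (\<forall>n. c n \<in> A n) \<and> finite {n. c n \<noteq> \<zero>} \<and> r = (\<Oplus>n\<in>{n. c n \<noteq> \<zero>}. c n)"
    and graded_comm: "\<lbrakk>r \<in> A m; s \<in> A n\<rbrakk> \<Longrightarrow>
          r \<otimes> s = (if even (m * n) then s \<otimes> r else \<ominus> (s \<otimes> r))"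

definition homogeneous_ideal :: "('r, 'x) ring_scheme \<Rightarrow> (int \<Rightarrow> 'r set) \<Rightarrow> 'r set \<Rightarrow> bool"
  where "homogeneous_ideal R A I \<longleftrightarrow> ideal I R \<and>
    (\<forall>c. (\<forall>n. c n \<in> A n) \<longrightarrow> finite {n. c n \<noteq> \<zero>\<^bsub>R\<^esub>} \<longrightarrow>
         (\<Oplus>\<^bsub>R\<^esub>n\<in>{n. c n \<noteq> \<zero>\<^bsub>R\<^esub>}. c n) \<in> I \<longrightarrow> (\<forall>n. c n \<in> I))"

text \<open>Primality is that of \<^locale>\<open>primeideal\<close>, which itself is not applicable because it
  includes commutativity of the ring.\<close>

definition Spec :: "('r, 'x) ring_scheme \<Rightarrow> (int \<Rightarrow> 'r set) \<Rightarrow> 'r set set"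
  where "Spec R A = {p. homogeneous_ideal R A p \<and> carrier R \<noteq> p \<and>
    (\<forall>a\<in>carrier R. \<forall>b\<in>carrier R. a \<otimes>\<^bsub>R\<^esub> b \<in> p \<longrightarrow> a \<in> p \<or> b \<in> p)}"

definition V :: "('r, 'x) ring_scheme \<Rightarrow> (int \<Rightarrow> 'r set) \<Rightarrow> 'r set \<Rightarrow> 'r set set"
  where "V R A p = {q \<in> Spec R A. p \<subseteq> q}"


section \<open>Localisation of graded modules\<close>

text \<open>A graded left \<open>R\<close>-module is given by its homogeneous parts \<open>M n\<close> (abelian groups, written
  multiplicatively) and the actions \<open>act d n r : M n \<rightarrow> M (n + d)\<close> for \<open>r \<in> A d\<close>.
  A triple \<open>(d, s, x)\<close> with \<open>s \<in> A d - p\<close> and \<open>x \<in> M (n + d)\<close> stands for the fraction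
  \<open>s\<^sup>-\<^sup>1x\<close> of degree \<open>n\<close>. As \<open>ts = (-1)\<^bsup>de\<^esup>st\<close>, one has
  \<open>s\<^sup>-\<^sup>1x = (ts)\<^sup>-\<^sup>1(tx)\<close> and \<open>t\<^sup>-\<^sup>1y = (ts)\<^sup>-\<^sup>1((-1)\<^bsup>de\<^esup>sy)\<close>, which explains the signs.\<close>

definition fractions ::
  "(int \<Rightarrow> 'r set) \<Rightarrow> 'r set \<Rightarrow> (int \<Rightarrow> 'a monoid) \<Rightarrow> int \<Rightarrow> (int \<times> 'r \<times> 'a) set"
  where "fractions A p M n = {(d, s, x). s \<in> A d - p \<and> x \<in> carrier (M (n + d))}"

definition frac_rel ::
  "(int \<Rightarrow> 'r set) \<Rightarrow> 'r set \<Rightarrow> (int \<Rightarrow> 'a monoid) \<Rightarrow> (int \<Rightarrow> int \<Rightarrow> 'r \<Rightarrow> 'a \<Rightarrow> 'a) \<Rightarrow> int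
    \<Rightarrow> ((int \<times> 'r \<times> 'a) \<times> (int \<times> 'r \<times> 'a)) set"
  where "frac_rel A p M act n =
    {((d, s, x), (e, t, y)). (d, s, x) \<in> fractions A p M n \<and> (e, t, y) \<in> fractions A p M n \<and>
       (\<exists>k. \<exists>w \<in> A k - p.
          act k (n + d + e) w (act e (n + d) t x) =
          act k (n + d + e) w (sgn_act (M (n + d + e)) (d * e) (act d (n + e) s y)))}"

definition localised_part ::
  "('r, 'x) ring_scheme \<Rightarrow> (int \<Rightarrow> 'r set) \<Rightarrow> 'r set \<Rightarrow> (int \<Rightarrow> 'a monoid)
    \<Rightarrow> (int \<Rightarrow> int \<Rightarrow> 'r \<Rightarrow> 'a \<Rightarrow> 'a) \<Rightarrow> int \<Rightarrow> (int \<times> 'r \<times> 'a) set monoid"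
  where "localised_part R A p M act n =
    \<lparr>carrier = fractions A p M n // frac_rel A p M act n,
     monoid.mult = (\<lambda>C D. \<Union>(d, s, x)\<in>C. \<Union>(e, t, y)\<in>D.
       frac_rel A p M act n ``
         {(d + e, t \<otimes>\<^bsub>R\<^esub> s,
           act e (n + d) t x \<otimes>\<^bsub>M (n + d + e)\<^esub>
             sgn_act (M (n + d + e)) (d * e) (act d (n + e) s y))}),
     one = frac_rel A p M act n `` {(0, \<one>\<^bsub>R\<^esub>, \<one>\<^bsub>M n\<^esub>)}\<rparr>"


section \<open>Triangulated categories\<close>

text \<open>The abelian groups \<open>Hom T X Y\<close> are written multiplicatively, so \<open>\<otimes>\<close> is the sum of
  morphisms and \<open>\<one>\<close> the zero morphism. An element \<open>(u, v, w)\<close> of \<open>tri T\<close> is an exact triangle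
  \<open>X \<rightarrow> Y \<rightarrow> Z \<rightarrow> \<Sigma>X\<close>.\<close>

record ('o, 'm) tricat =
  obj :: "'o set"
  Hom :: "'o \<Rightarrow> 'o \<Rightarrow> 'm monoid"
  src :: "'m \<Rightarrow> 'o"
  tgt :: "'m \<Rightarrow> 'o"
  idn :: "'o \<Rightarrow> 'm"
  cmp :: "'m \<Rightarrow> 'm \<Rightarrow> 'm"  (infixr \<open>\<cdot>\<index>\<close> 70)
  susp_obj :: "'o \<Rightarrow> 'o"
  susp_mor :: "'m \<Rightarrow> 'm"
  tri :: "('m \<times> 'm \<times> 'm) set"

abbreviation hom_set :: "('o, 'm) tricat \<Rightarrow> 'o \<Rightarrow> 'o \<Rightarrow> 'm set"
  where "hom_set T X Y \<equiv> carrier (Hom T X Y)"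

definition arrows :: "('o, 'm) tricat \<Rightarrow> 'm set"
  where "arrows T = (\<Union>X\<in>obj T. \<Union>Y\<in>obj T. hom_set T X Y)"

definition zero_object :: "('o, 'm) tricat \<Rightarrow> 'o \<Rightarrow> bool"
  where "zero_object T Z \<longleftrightarrow> Z \<in> obj T \<and>
    (\<forall>X\<in>obj T. hom_set T X Z = {\<one>\<^bsub>Hom T X Z\<^esub>} \<and> hom_set T Z X = {\<one>\<^bsub>Hom T Z X\<^esub>})"

definition isos :: "('o, 'm) tricat \<Rightarrow> 'o \<Rightarrow> 'o \<Rightarrow> 'm set"
  where "isos T X Y = {f \<in> hom_set T X Y.
    \<exists>g \<in> hom_set T Y X. g \<cdot>\<^bsub>T\<^esub> f = idn T X \<and> f \<cdot>\<^bsub>T\<^esub> g = idn T Y}"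

locale additive_category =
  fixes T :: "('o, 'm) tricat" (structure)
  assumes hom_group: "\<lbrakk>X \<in> obj T; Y \<in> obj T\<rbrakk> \<Longrightarrow> comm_group (Hom T X Y)"
    and hom_src_tgt: "\<lbrakk>X \<in> obj T; Y \<in> obj T; f \<in> hom_set T X Y\<rbrakk> \<Longrightarrow> src T f = X \<and> tgt T f = Y"
    and idn_in: "X \<in> obj T \<Longrightarrow> idn T X \<in> hom_set T X X"
    and cmp_in: "\<lbrakk>X \<in> obj T; Y \<in> obj T; Z \<in> obj T; f \<in> hom_set T X Y; g \<in> hom_set T Y Z\<rbrakk>
          \<Longrightarrow> g \<cdot> f \<in> hom_set T X Z"
    and idn_left: "\<lbrakk>X \<in> obj T; Y \<in> obj T; f \<in> hom_set T X Y\<rbrakk> \<Longrightarrow> idn T Y \<cdot> f = f"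
    and idn_right: "\<lbrakk>X \<in> obj T; Y \<in> obj T; f \<in> hom_set T X Y\<rbrakk> \<Longrightarrow> f \<cdot> idn T X = f"
    and cmp_assoc: "\<lbrakk>W \<in> obj T; X \<in> obj T; Y \<in> obj T; Z \<in> obj T;
          f \<in> hom_set T W X; g \<in> hom_set T X Y; h \<in> hom_set T Y Z\<rbrakk>
          \<Longrightarrow> (h \<cdot> g) \<cdot> f = h \<cdot> (g \<cdot> f)"
    and cmp_add_left: "\<lbrakk>X \<in> obj T; Y \<in> obj T; Z \<in> obj T;
          f \<in> hom_set T X Y; g \<in> hom_set T Y Z; h \<in> hom_set T Y Z\<rbrakk>
          \<Longrightarrow> (g \<otimes>\<^bsub>Hom T Y Z\<^esub> h) \<cdot> f = (g \<cdot> f) \<otimes>\<^bsub>Hom T X Z\<^esub> (h \<cdot> f)"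
    and cmp_add_right: "\<lbrakk>X \<in> obj T; Y \<in> obj T; Z \<in> obj T;
          f \<in> hom_set T X Y; g \<in> hom_set T X Y; h \<in> hom_set T Y Z\<rbrakk>
          \<Longrightarrow> h \<cdot> (f \<otimes>\<^bsub>Hom T X Y\<^esub> g) = (h \<cdot> f) \<otimes>\<^bsub>Hom T X Z\<^esub> (h \<cdot> g)"
    and zero_object: "\<exists>Z. zero_object T Z"
    and biproducts: "\<lbrakk>X \<in> obj T; Y \<in> obj T\<rbrakk> \<Longrightarrow>
          \<exists>P\<in>obj T. \<exists>i\<in>hom_set T X P. \<exists>j\<in>hom_set T Y P. \<exists>p\<in>hom_set T P X. \<exists>q\<in>hom_set T P Y.
            p \<cdot> i = idn T X \<and> q \<cdot> j = idn T Y \<and>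
            p \<cdot> j = \<one>\<^bsub>Hom T Y X\<^esub> \<and> q \<cdot> i = \<one>\<^bsub>Hom T X Y\<^esub> \<and>
            (i \<cdot> p) \<otimes>\<^bsub>Hom T P P\<^esub> (j \<cdot> q) = idn T P"

text \<open>The suspension is an automorphism of the category, so that \<open>\<Sigma>\<^sup>n\<close> is defined on the nose for
  every integer \<open>n\<close>.\<close>

locale triangulated_category = additive_category T
  for T :: "('o, 'm) tricat" (structure) +
  assumes susp_obj_bij: "bij_betw (susp_obj T) (obj T) (obj T)"
    and susp_mor_iso: "\<lbrakk>X \<in> obj T; Y \<in> obj T\<rbrakk> \<Longrightarrow>
          susp_mor T \<in> iso (Hom T X Y) (Hom T (susp_obj T X) (susp_obj T Y))"
    and susp_idn: "X \<in> obj T \<Longrightarrow> susp_mor T (idn T X) = idn T (susp_obj T X)"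
    and susp_cmp: "\<lbrakk>X \<in> obj T; Y \<in> obj T; Z \<in> obj T; f \<in> hom_set T X Y; g \<in> hom_set T Y Z\<rbrakk>
          \<Longrightarrow> susp_mor T (g \<cdot> f) = susp_mor T g \<cdot> susp_mor T f"
    and tri_mor: "(u, v, w) \<in> tri T \<Longrightarrow>
          \<exists>X\<in>obj T. \<exists>Y\<in>obj T. \<exists>Z\<in>obj T.
            u \<in> hom_set T X Y \<and> v \<in> hom_set T Y Z \<and> w \<in> hom_set T Z (susp_obj T X)"
    and tri_iso: "\<lbrakk>X \<in> obj T; Y \<in> obj T; Z \<in> obj T; X' \<in> obj T; Y' \<in> obj T; Z' \<in> obj T;
          (u, v, w) \<in> tri T;
          u \<in> hom_set T X Y; v \<in> hom_set T Y Z; w \<in> hom_set T Z (susp_obj T X);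
          u' \<in> hom_set T X' Y'; v' \<in> hom_set T Y' Z'; w' \<in> hom_set T Z' (susp_obj T X');
          f \<in> isos T X X'; g \<in> isos T Y Y'; h \<in> isos T Z Z';
          g \<cdot> u = u' \<cdot> f; h \<cdot> v = v' \<cdot> g; susp_mor T f \<cdot> w = w' \<cdot> h\<rbrakk>
          \<Longrightarrow> (u', v', w') \<in> tri T"
    and tri_idn: "\<lbrakk>X \<in> obj T; zero_object T Z\<rbrakk> \<Longrightarrow>
          (idn T X, \<one>\<^bsub>Hom T X Z\<^esub>, \<one>\<^bsub>Hom T Z (susp_obj T X)\<^esub>) \<in> tri T"
    and tri_complete: "\<lbrakk>X \<in> obj T; Y \<in> obj T; u \<in> hom_set T X Y\<rbrakk> \<Longrightarrow> \<exists>v w. (u, v, w) \<in> tri T"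
    and tri_rotate: "\<lbrakk>X \<in> obj T; Y \<in> obj T; Z \<in> obj T;
          u \<in> hom_set T X Y; v \<in> hom_set T Y Z; w \<in> hom_set T Z (susp_obj T X)\<rbrakk> \<Longrightarrow>
          (u, v, w) \<in> tri T \<longleftrightarrow>
          (v, w, inv\<^bsub>Hom T (susp_obj T X) (susp_obj T Y)\<^esub> (susp_mor T u)) \<in> tri T"
    and tri_fill: "\<lbrakk>X \<in> obj T; Y \<in> obj T; Z \<in> obj T; X' \<in> obj T; Y' \<in> obj T; Z' \<in> obj T;
          (u, v, w) \<in> tri T; (u', v', w') \<in> tri T;
          u \<in> hom_set T X Y; v \<in> hom_set T Y Z; w \<in> hom_set T Z (susp_obj T X);
          u' \<in> hom_set T X' Y'; v' \<in> hom_set T Y' Z'; w' \<in> hom_set T Z' (susp_obj T X');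
          f \<in> hom_set T X X'; g \<in> hom_set T Y Y'; g \<cdot> u = u' \<cdot> f\<rbrakk> \<Longrightarrow>
          \<exists>h\<in>hom_set T Z Z'. h \<cdot> v = v' \<cdot> g \<and> susp_mor T f \<cdot> w = w' \<cdot> h"
    and octahedral: "\<lbrakk>X \<in> obj T; Y \<in> obj T; Z \<in> obj T; X' \<in> obj T; Y' \<in> obj T; Z' \<in> obj T;
          u \<in> hom_set T X Y; v \<in> hom_set T Y Z;
          i \<in> hom_set T Y Z'; i' \<in> hom_set T Z' (susp_obj T X);
          j \<in> hom_set T Z X'; j' \<in> hom_set T X' (susp_obj T Y);
          k \<in> hom_set T Z Y'; k' \<in> hom_set T Y' (susp_obj T X);
          (u, i, i') \<in> tri T; (v, j, j') \<in> tri T; (v \<cdot> u, k, k') \<in> tri T\<rbrakk> \<Longrightarrow>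
          \<exists>f\<in>hom_set T Z' Y'. \<exists>g\<in>hom_set T Y' X'.
            (f, g, susp_mor T i \<cdot> j') \<in> tri T \<and>
            f \<cdot> i = k \<cdot> v \<and> k' \<cdot> f = i' \<and> g \<cdot> k = j \<and> j' \<cdot> g = susp_mor T u \<cdot> k'"

definition spow_obj :: "('o, 'm) tricat \<Rightarrow> int \<Rightarrow> 'o \<Rightarrow> 'o"
  where "spow_obj T n = (if n \<ge> 0 then susp_obj T ^^ nat n
    else inv_into (obj T) (susp_obj T) ^^ nat (- n))"

definition spow_mor :: "('o, 'm) tricat \<Rightarrow> int \<Rightarrow> 'm \<Rightarrow> 'm"
  where "spow_mor T n = (if n \<ge> 0 then susp_mor T ^^ nat n
    else inv_into (arrows T) (susp_mor T) ^^ nat (- n))"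

text \<open>Smallness is relative to a universe \<open>U\<close>: a set is small if it injects into \<open>U\<close>.\<close>

definition essentially_small :: "'a set \<Rightarrow> ('o, 'm) tricat \<Rightarrow> bool"
  where "essentially_small U T \<longleftrightarrow>
    (\<exists>S \<subseteq> obj T. S \<lesssim> U \<and> (\<forall>X\<in>obj T. \<exists>Y\<in>S. isos T X Y \<noteq> {})) \<and>
    (\<forall>X\<in>obj T. \<forall>Y\<in>obj T. hom_set T X Y \<lesssim> U)"

definition full_subcat :: "('o, 'm) tricat \<Rightarrow> 'o set \<Rightarrow> ('o, 'm) tricat"
  where "full_subcat T S = T\<lparr>obj := obj T \<inter> S,
    tri := {(u, v, w) \<in> tri T. {src T u, tgt T u, tgt T v} \<subseteq> S}\<rparr>"

definition graded_centre :: "('o, 'm) tricat \<Rightarrow> int \<Rightarrow> ('o \<Rightarrow> 'm) set"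
  where "graded_centre T n = {\<eta> \<in> \<Pi>\<^sub>E X\<in>obj T. hom_set T X (spow_obj T n X).
    (\<forall>X\<in>obj T. \<forall>Y\<in>obj T. \<forall>f\<in>hom_set T X Y. \<eta> Y \<cdot>\<^bsub>T\<^esub> f = spow_mor T n f \<cdot>\<^bsub>T\<^esub> \<eta> X) \<and>
    (\<forall>X\<in>obj T. \<eta> (susp_obj T X) =
       sgn_act (Hom T (susp_obj T X) (spow_obj T n (susp_obj T X))) n (susp_mor T (\<eta> X)))}"

text \<open>The homomorphism of graded rings \<open>R \<rightarrow> Z\<^sup>*(T)\<close> is given by its components
  \<open>\<phi> d : A d \<rightarrow> Z\<^sup>d(T)\<close>. The product in the graded centre is \<open>(\<eta>\<zeta>)\<^sub>X = \<Sigma>\<^sup>e(\<eta>\<^sub>X) \<circ> \<zeta>\<^sub>X\<close> for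
  \<open>\<zeta>\<close> of degree \<open>e\<close>, so that evaluation at \<open>X\<close> is multiplicative into \<open>End\<^sup>*(X)\<close>.\<close>

locale linear_triangulated_category =
  triangulated_category T + graded_commutative_ring R A
  for R :: "('r, 'x) ring_scheme" and A :: "int \<Rightarrow> 'r set" and T :: "('o, 'm) tricat"
    and \<phi> :: "int \<Rightarrow> 'r \<Rightarrow> 'o \<Rightarrow> 'm" +
  assumes phi_centre: "r \<in> A d \<Longrightarrow> \<phi> d r \<in> graded_centre T d"
    and phi_add: "\<lbrakk>r \<in> A d; s \<in> A d; X \<in> obj T\<rbrakk> \<Longrightarrow>
          \<phi> d (r \<oplus>\<^bsub>R\<^esub> s) X = \<phi> d r X \<otimes>\<^bsub>Hom T X (spow_obj T d X)\<^esub> \<phi> d s X"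
    and phi_one: "X \<in> obj T \<Longrightarrow> \<phi> 0 \<one>\<^bsub>R\<^esub> X = idn T X"
    and phi_mult: "\<lbrakk>r \<in> A d; s \<in> A e; X \<in> obj T\<rbrakk> \<Longrightarrow>
          \<phi> (d + e) (r \<otimes>\<^bsub>R\<^esub> s) X = spow_mor T e (\<phi> d r X) \<cdot>\<^bsub>T\<^esub> \<phi> e s X"

text \<open>\<open>End\<^sup>*(X)\<close> as a graded module: \<open>r\<close> sends \<open>f : X \<rightarrow> \<Sigma>\<^sup>nX\<close> to \<open>\<Sigma>\<^sup>n(\<phi> r X) \<circ> f\<close>.\<close>

definition End_part :: "('o, 'm) tricat \<Rightarrow> 'o \<Rightarrow> int \<Rightarrow> 'm monoid"
  where "End_part T X n = Hom T X (spow_obj T n X)"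

definition End_act ::
  "('o, 'm) tricat \<Rightarrow> (int \<Rightarrow> 'r \<Rightarrow> 'o \<Rightarrow> 'm) \<Rightarrow> 'o \<Rightarrow> int \<Rightarrow> int \<Rightarrow> 'r \<Rightarrow> 'm \<Rightarrow> 'm"
  where "End_act T \<phi> X d n r f = spow_mor T n (\<phi> d r X) \<cdot>\<^bsub>T\<^esub> f"

definition supported_subcat ::
  "('r, 'x) ring_scheme \<Rightarrow> (int \<Rightarrow> 'r set) \<Rightarrow> ('o, 'm) tricat \<Rightarrow> (int \<Rightarrow> 'r \<Rightarrow> 'o \<Rightarrow> 'm)
    \<Rightarrow> 'r set set \<Rightarrow> ('o, 'm) tricat"
  where "supported_subcat R A T \<phi> W = full_subcat T
    {X \<in> obj T. \<forall>q \<in> Spec R A - W. \<forall>n.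
       trivial_group (localised_part R A q (End_part T X) (End_act T \<phi> X) n)}"


section \<open>Cohomological functors\<close>

text \<open>A contravariant functor to abelian groups whose elements are taken from the type
  \<open>'a\<close>. This type serves as the universe: abelian groups and index sets of coproducts are
  small if they are carried by subsets of it. Only the values on \<open>obj T\<close>, on morphisms between
  such objects, and on the carriers are meaningful.\<close>

record ('o, 'm, 'a) presheaf =
  fobj :: "'o \<Rightarrow> 'a monoid"
  fmap :: "'m \<Rightarrow> 'a \<Rightarrow> 'a"

definition additive_functor :: "('o, 'm) tricat \<Rightarrow> ('o, 'm, 'a) presheaf \<Rightarrow> bool"
  where "additive_functor T F \<longleftrightarrow>
    (\<forall>X\<in>obj T. comm_group (fobj F X)) \<and>
    (\<forall>X\<in>obj T. \<forall>Y\<in>obj T. \<forall>f\<in>hom_set T X Y. fmap F f \<in> hom (fobj F Y) (fobj F X)) \<and>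
    (\<forall>X\<in>obj T. \<forall>x\<in>carrier (fobj F X). fmap F (idn T X) x = x) \<and>
    (\<forall>X\<in>obj T. \<forall>Y\<in>obj T. \<forall>Z\<in>obj T. \<forall>f\<in>hom_set T X Y. \<forall>g\<in>hom_set T Y Z.
       \<forall>x\<in>carrier (fobj F Z). fmap F (g \<cdot>\<^bsub>T\<^esub> f) x = fmap F f (fmap F g x)) \<and>
    (\<forall>X\<in>obj T. \<forall>Y\<in>obj T. \<forall>f\<in>hom_set T X Y. \<forall>g\<in>hom_set T X Y. \<forall>x\<in>carrier (fobj F Y).
       fmap F (f \<otimes>\<^bsub>Hom T X Y\<^esub> g) x = fmap F f x \<otimes>\<^bsub>fobj F X\<^esub> fmap F g x)"

text \<open>Note that \<^const>\<open>exact_seq\<close> lists groups and maps from right to left.\<close>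

definition Coh :: "('o, 'm) tricat \<Rightarrow> ('o, 'm, 'a) presheaf set"
  where "Coh T = {F. additive_functor T F \<and>
    (\<forall>(u, v, w) \<in> tri T.
       exact_seq ([fobj F (src T u), fobj F (tgt T u), fobj F (tgt T v), fobj F (tgt T w)],
                  [fmap F u, fmap F v, fmap F w]))}"

definition nat_trans ::
  "('o, 'm) tricat \<Rightarrow> ('o, 'm, 'a) presheaf \<Rightarrow> ('o, 'm, 'b) presheaf \<Rightarrow> ('o \<Rightarrow> 'a \<Rightarrow> 'b) set"
  where "nat_trans T F G =
    {\<eta> \<in> \<Pi>\<^sub>E X\<in>obj T. hom (fobj F X) (fobj G X) \<inter> extensional (carrier (fobj F X)).
       \<forall>X\<in>obj T. \<forall>Y\<in>obj T. \<forall>f\<in>hom_set T X Y. \<forall>x\<in>carrier (fobj F Y).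
         \<eta> X (fmap F f x) = fmap G f (\<eta> Y x)}"

definition representable :: "('o, 'm) tricat \<Rightarrow> 'o \<Rightarrow> ('o, 'm, 'm) presheaf"
  where "representable T X = \<lparr>fobj = (\<lambda>Y. Hom T Y X), fmap = (\<lambda>f g. g \<cdot>\<^bsub>T\<^esub> f)\<rparr>"

definition shift :: "('o, 'm) tricat \<Rightarrow> int \<Rightarrow> ('o, 'm, 'a) presheaf \<Rightarrow> ('o, 'm, 'a) presheaf"
  where "shift T n F = \<lparr>fobj = fobj F \<circ> spow_obj T (- n), fmap = fmap F \<circ> spow_mor T (- n)\<rparr>"

text \<open>Colimits and localisations of groups are constructed as groups of equivalence classes, whose
  elements are not of type \<open>'a\<close>. The following replaces a functor by an isomorphic one with
  values in the universe \<open>'a\<close>, along some injections of its values into \<open>'a\<close>, which exist when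
  the values are small.\<close>

definition transport_group :: "('b \<Rightarrow> 'a) \<Rightarrow> 'b monoid \<Rightarrow> 'a monoid"
  where "transport_group e G = \<lparr>carrier = e ` carrier G,
    monoid.mult = (\<lambda>x y. e (inv_into (carrier G) e x \<otimes>\<^bsub>G\<^esub> inv_into (carrier G) e y)),
    one = e \<one>\<^bsub>G\<^esub>\<rparr>"

definition to_universe ::
  "('o, 'm) tricat \<Rightarrow> ('o, 'm, 'b) presheaf \<Rightarrow> ('o, 'm, 'a) presheaf"
  where "to_universe T G =
    (let e = (\<lambda>X. SOME e :: 'b \<Rightarrow> 'a. inj_on e (carrier (fobj G X))) in
     \<lparr>fobj = (\<lambda>X. transport_group (e X) (fobj G X)),
      fmap = (\<lambda>f x. e (src T f)
        (fmap G f (inv_into (carrier (fobj G (tgt T f))) (e (tgt T f)) x)))\<rparr>)"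


section \<open>Localising subcategories\<close>

definition is_coproduct ::
  "('o, 'm) tricat \<Rightarrow> 'i set \<Rightarrow> ('i \<Rightarrow> ('o, 'm, 'a) presheaf) \<Rightarrow> ('o, 'm, 'a) presheaf
    \<Rightarrow> ('i \<Rightarrow> 'o \<Rightarrow> 'a \<Rightarrow> 'a) \<Rightarrow> bool"
  where "is_coproduct T I G P \<iota> \<longleftrightarrow> P \<in> Coh T \<and> (\<forall>i\<in>I. \<iota> i \<in> nat_trans T (G i) P) \<and>
    (\<forall>H :: ('o, 'm, 'a) presheaf. \<forall>\<alpha>. H \<in> Coh T \<longrightarrow> (\<forall>i\<in>I. \<alpha> i \<in> nat_trans T (G i) H) \<longrightarrow>
       (\<exists>!\<beta>. \<beta> \<in> nat_trans T P H \<and>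
          (\<forall>i\<in>I. \<forall>X\<in>obj T. \<forall>x\<in>carrier (fobj (G i) X). \<beta> X (\<iota> i X x) = \<alpha> i X x)))"

definition coh_exact ::
  "('o, 'm) tricat \<Rightarrow> ('o, 'm, 'a) presheaf \<Rightarrow> ('o \<Rightarrow> 'a \<Rightarrow> 'a) \<Rightarrow> ('o, 'm, 'a) presheaf
    \<Rightarrow> ('o \<Rightarrow> 'a \<Rightarrow> 'a) \<Rightarrow> ('o, 'm, 'a) presheaf \<Rightarrow> bool"
  where "coh_exact T F' \<alpha> F \<beta> F'' \<longleftrightarrow> \<alpha> \<in> nat_trans T F' F \<and> \<beta> \<in> nat_trans T F F'' \<and>
    (\<forall>X\<in>obj T. exact_seq ([fobj F'' X, fobj F X, fobj F' X], [\<beta> X, \<alpha> X]))"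

text \<open>A full subcategory is given by its set of objects. Index sets of coproducts are
  subsets of the universe.\<close>

definition localising :: "('o, 'm) tricat \<Rightarrow> ('o, 'm, 'a) presheaf set \<Rightarrow> bool"
  where "localising T \<C> \<longleftrightarrow> \<C> \<subseteq> Coh T \<and>
    (\<forall>(I :: 'a set) G P \<iota>. (\<forall>i\<in>I. G i \<in> \<C>) \<longrightarrow> is_coproduct T I G P \<iota> \<longrightarrow> P \<in> \<C>) \<and>
    (\<forall>F\<in>\<C>. \<forall>n. shift T n F \<in> \<C>) \<and>
    (\<forall>F'\<in>\<C>. \<forall>F''\<in>\<C>. \<forall>F\<in>Coh T. \<forall>\<alpha> \<beta>. coh_exact T F' \<alpha> F \<beta> F'' \<longrightarrow> F \<in> \<C>)"

definition Loc :: "('o, 'm) tricat \<Rightarrow> ('o, 'm, 'a) presheaf set \<Rightarrow> ('o, 'm, 'a) presheaf set"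
  where "Loc T \<C> = \<Inter> {\<D>. localising T \<D> \<and> \<C> \<subseteq> \<D>}"


section \<open>The functors \<open>f\<^sup>*\<close> and \<open>f\<^sub>*\<close>\<close>

text \<open>A functor \<open>f : T \<rightarrow> U\<close> is given by its maps \<open>fo\<close> on objects and \<open>fm\<close> on morphisms.\<close>

definition lower_star ::
  "('o \<Rightarrow> 'p) \<Rightarrow> ('m \<Rightarrow> 'n) \<Rightarrow> ('p, 'n, 'a) presheaf \<Rightarrow> ('o, 'm, 'a) presheaf"
  where "lower_star fo fm G = \<lparr>fobj = fobj G \<circ> fo, fmap = fmap G \<circ> fm\<rparr>"

text \<open>The category over which the colimit is taken: objects are the morphisms \<open>\<eta> : H\<^sub>X \<rightarrow> F\<close>, and a
  morphism \<open>(X, \<eta>) \<rightarrow> (X', \<eta>')\<close> is a morphism \<open>a : X \<rightarrow> X'\<close> with \<open>\<eta>' \<circ> H\<^sub>a = \<eta>\<close>.\<close>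

definition slice_obj ::
  "('o, 'm) tricat \<Rightarrow> ('o, 'm, 'a) presheaf \<Rightarrow> ('o \<times> ('o \<Rightarrow> 'm \<Rightarrow> 'a)) set"
  where "slice_obj T F = (SIGMA X:obj T. nat_trans T (representable T X) F)"

definition slice_hom ::
  "('o, 'm) tricat \<Rightarrow> 'o \<times> ('o \<Rightarrow> 'm \<Rightarrow> 'a) \<Rightarrow> 'o \<times> ('o \<Rightarrow> 'm \<Rightarrow> 'a) \<Rightarrow> 'm set"
  where "slice_hom T j j' = {a \<in> hom_set T (fst j) (fst j').
    \<forall>Y\<in>obj T. \<forall>g\<in>hom_set T Y (fst j). snd j' Y (a \<cdot>\<^bsub>T\<^esub> g) = snd j Y g}"

text \<open>The colimit of the \<open>H\<^bsub>f(X)\<^esub>\<close> is computed objectwise, at \<open>Y\<close> as the quotient of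
  \<open>\<Oplus>\<^bsub>(X, \<eta>)\<^esub> Hom(Y, f(X))\<close> by the subgroup identifying \<open>h\<close> in the summand of \<open>(X, \<eta>)\<close> with
  \<open>f(a) \<circ> h\<close> in that of \<open>(X', \<eta>')\<close>, for all \<open>a : (X, \<eta>) \<rightarrow> (X', \<eta>')\<close>.\<close>

definition colim_sum ::
  "('o, 'm) tricat \<Rightarrow> ('p, 'n) tricat \<Rightarrow> ('o \<Rightarrow> 'p) \<Rightarrow> ('o, 'm, 'a) presheaf \<Rightarrow> 'p
    \<Rightarrow> ('o \<times> ('o \<Rightarrow> 'm \<Rightarrow> 'a) \<Rightarrow> 'n) monoid"
  where "colim_sum T U fo F Y = sum_group (slice_obj T F) (\<lambda>j. Hom U Y (fo (fst j)))"

definition colim_inj ::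
  "('o, 'm) tricat \<Rightarrow> ('p, 'n) tricat \<Rightarrow> ('o \<Rightarrow> 'p) \<Rightarrow> ('o, 'm, 'a) presheaf \<Rightarrow> 'p
    \<Rightarrow> 'o \<times> ('o \<Rightarrow> 'm \<Rightarrow> 'a) \<Rightarrow> 'n \<Rightarrow> ('o \<times> ('o \<Rightarrow> 'm \<Rightarrow> 'a) \<Rightarrow> 'n)"
  where "colim_inj T U fo F Y j h =
    (\<lambda>i\<in>slice_obj T F. if i = j then h else \<one>\<^bsub>Hom U Y (fo (fst i))\<^esub>)"

definition colim_rel ::
  "('o, 'm) tricat \<Rightarrow> ('p, 'n) tricat \<Rightarrow> ('o \<Rightarrow> 'p) \<Rightarrow> ('m \<Rightarrow> 'n) \<Rightarrow> ('o, 'm, 'a) presheaf \<Rightarrow> 'p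
    \<Rightarrow> ('o \<times> ('o \<Rightarrow> 'm \<Rightarrow> 'a) \<Rightarrow> 'n) set"
  where "colim_rel T U fo fm F Y = generate (colim_sum T U fo F Y)
    {colim_inj T U fo F Y j h \<otimes>\<^bsub>colim_sum T U fo F Y\<^esub>
       inv\<^bsub>colim_sum T U fo F Y\<^esub> (colim_inj T U fo F Y j' (fm a \<cdot>\<^bsub>U\<^esub> h)) | j j' a h.
     j \<in> slice_obj T F \<and> j' \<in> slice_obj T F \<and> a \<in> slice_hom T j j' \<and>
     h \<in> hom_set U Y (fo (fst j))}"

definition colim_presheaf ::
  "('o, 'm) tricat \<Rightarrow> ('p, 'n) tricat \<Rightarrow> ('o \<Rightarrow> 'p) \<Rightarrow> ('m \<Rightarrow> 'n) \<Rightarrow> ('o, 'm, 'a) presheaf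
    \<Rightarrow> ('p, 'n, ('o \<times> ('o \<Rightarrow> 'm \<Rightarrow> 'a) \<Rightarrow> 'n) set) presheaf"
  where "colim_presheaf T U fo fm F =
    \<lparr>fobj = (\<lambda>Y. colim_sum T U fo F Y Mod colim_rel T U fo fm F Y),
     fmap = (\<lambda>k C. \<Union>c\<in>C. colim_rel T U fo fm F (src U k)
       #>\<^bsub>colim_sum T U fo F (src U k)\<^esub> (\<lambda>j\<in>slice_obj T F. c j \<cdot>\<^bsub>U\<^esub> k))\<rparr>"

definition upper_star ::
  "('o, 'm) tricat \<Rightarrow> ('p, 'n) tricat \<Rightarrow> ('o \<Rightarrow> 'p) \<Rightarrow> ('m \<Rightarrow> 'n)
    \<Rightarrow> ('o, 'm, 'a) presheaf \<Rightarrow> ('p, 'n, 'a) presheaf"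
  where "upper_star T U fo fm F = to_universe U (colim_presheaf T U fo fm F)"


section \<open>Local cohomology and localisation\<close>

definition Gamma_supp ::
  "('r, 'x) ring_scheme \<Rightarrow> (int \<Rightarrow> 'r set) \<Rightarrow> ('o, 'm) tricat \<Rightarrow> (int \<Rightarrow> 'r \<Rightarrow> 'o \<Rightarrow> 'm)
    \<Rightarrow> 'r set set \<Rightarrow> ('o, 'm, 'a) presheaf \<Rightarrow> ('o, 'm, 'a) presheaf"
  where "Gamma_supp R A T \<phi> W F =
    upper_star (supported_subcat R A T \<phi> W) T id id (lower_star id id F)"

text \<open>\<open>F\<^sup>*(X)\<close> as a graded module: \<open>r\<close> of degree \<open>d\<close> acts as
  \<open>F(\<Sigma>\<^bsup>-d\<^esup>(\<phi> r (\<Sigma>\<^bsup>-n\<^esup>X))) : F(\<Sigma>\<^bsup>-n\<^esup>X) \<rightarrow> F(\<Sigma>\<^bsup>-n-d\<^esup>X)\<close>. For \<open>F = H\<^sub>Y\<close> this corresponds, under the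
  isomorphisms \<open>\<Sigma>\<^sup>n : Hom(\<Sigma>\<^bsup>-n\<^esup>X, Y) \<rightarrow> Hom(X, \<Sigma>\<^sup>nY)\<close>, to composing with \<open>\<Sigma>\<^sup>n(\<phi> r Y)\<close>.\<close>

definition star_part :: "('o, 'm) tricat \<Rightarrow> ('o, 'm, 'a) presheaf \<Rightarrow> 'o \<Rightarrow> int \<Rightarrow> 'a monoid"
  where "star_part T F X n = fobj F (spow_obj T (- n) X)"

definition star_act ::
  "('o, 'm) tricat \<Rightarrow> (int \<Rightarrow> 'r \<Rightarrow> 'o \<Rightarrow> 'm) \<Rightarrow> ('o, 'm, 'a) presheaf \<Rightarrow> 'o
    \<Rightarrow> int \<Rightarrow> int \<Rightarrow> 'r \<Rightarrow> 'a \<Rightarrow> 'a"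
  where "star_act T \<phi> F X d n r = fmap F (spow_mor T (- d) (\<phi> d r (spow_obj T (- n) X)))"

text \<open>\<open>F\<^sub>p(X)\<close> is the degree \<open>0\<close> part of the localisation of \<open>F\<^sup>*(X)\<close> at \<open>p\<close>.\<close>

definition fractions_presheaf ::
  "('r, 'x) ring_scheme \<Rightarrow> (int \<Rightarrow> 'r set) \<Rightarrow> ('o, 'm) tricat \<Rightarrow> (int \<Rightarrow> 'r \<Rightarrow> 'o \<Rightarrow> 'm)
    \<Rightarrow> 'r set \<Rightarrow> ('o, 'm, 'a) presheaf \<Rightarrow> ('o, 'm, (int \<times> 'r \<times> 'a) set) presheaf"
  where "fractions_presheaf R A T \<phi> p F =
    \<lparr>fobj = (\<lambda>X. localised_part R A p (star_part T F X) (star_act T \<phi> F X) 0),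
     fmap = (\<lambda>f C. \<Union>(d, s, y)\<in>C.
       frac_rel A p (star_part T F (src T f)) (star_act T \<phi> F (src T f)) 0 ``
         {(d, s, fmap F (spow_mor T (- d) f) y)})\<rparr>"

definition localise ::
  "('r, 'x) ring_scheme \<Rightarrow> (int \<Rightarrow> 'r set) \<Rightarrow> ('o, 'm) tricat \<Rightarrow> (int \<Rightarrow> 'r \<Rightarrow> 'o \<Rightarrow> 'm)
    \<Rightarrow> 'r set \<Rightarrow> ('o, 'm, 'a) presheaf \<Rightarrow> ('o, 'm, 'a) presheaf"
  where "localise R A T \<phi> p F = to_universe T (fractions_presheaf R A T \<phi> p F)"

definition Gamma ::
  "('r, 'x) ring_scheme \<Rightarrow> (int \<Rightarrow> 'r set) \<Rightarrow> ('o, 'm) tricat \<Rightarrow> (int \<Rightarrow> 'r \<Rightarrow> 'o \<Rightarrow> 'm)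
    \<Rightarrow> 'r set \<Rightarrow> ('o, 'm, 'a) presheaf \<Rightarrow> ('o, 'm, 'a) presheaf"
  where "Gamma R A T \<phi> p F = Gamma_supp R A T \<phi> (V R A p) (localise R A T \<phi> p F)"

end

theory Submission
  imports Defs "HOL-Algebra.Free_Abelian_Groups"
begin

text \<open>For a thick subcategory \<open>D\<close> with inclusion \<open>i\<close> write \<open>\<Gamma>\<^sub>DF = i\<^sup>*i\<^sub>*F\<close>. An element of \<open>(\<Gamma>\<^sub>DF)(X)\<close> is represented by
  a morphism \<open>f : X \<rightarrow> C\<close> with \<open>C\<close> in \<open>D\<close> and an element \<open>c\<close> of \<open>F(C)\<close>; it vanishes iff there is \<open>a : C \<rightarrow> B\<close>
  in \<open>D\<close> with \<open>af = 0\<close> and \<open>c = F(a)b\<close> for some \<open>b\<close>. For a homogeneous \<open>r\<close> let \<open>D\<^sub>r\<close> consist of the objects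
  of \<open>D\<close> on which \<open>r\<close> is nilpotent. Taking cones of the powers of \<open>r\<close>, respectively of the elements of a
  multiplicative set \<open>S\<close> of homogeneous elements, one obtains exact sequences
  \<open>\<Oplus>\<^sub>n \<Sigma>\<^bsup>n|r|-1\<^esup>\<Gamma>\<^sub>DF \<rightarrow> \<Gamma>\<^bsub>D\<^sub>r\<^esub>F \<rightarrow> \<Gamma>\<^sub>DF\<close> and \<open>\<Oplus>\<^bsub>w\<in>S\<^esub> \<Gamma>\<^bsub>D\<^sub>w\<^esub>F \<rightarrow> \<Gamma>\<^sub>DF \<rightarrow> \<Gamma>\<^sub>D(S\<^sup>-\<^sup>1F)\<close>.

  As \<open>p\<close> is generated by finitely many homogeneous elements, the first sequence shows that \<open>\<Gamma>\<^sub>pF\<close> lies in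
  \<open>Loc(F\<^sub>p)\<close>, and \<open>F\<^sub>p\<close> lies in \<open>Loc(F)\<close> because it is a quotient of a coproduct of suspensions of \<open>F\<close>. The second
  sequence shows that \<open>\<Gamma>\<^sub>DF\<close> lies in \<open>Loc({\<Gamma>\<^sub>pF})\<close> by noetherian induction on the ideal \<open>I\<close> on which \<open>D\<close> is
  supported: if \<open>I\<close> is prime, \<open>S\<close> is its complement; if \<open>sr \<in> I\<close> while \<open>r\<close> and \<open>s\<close> are not in \<open>I\<close>, \<open>S\<close> consists of the
  powers of \<open>r\<close>, and then \<open>\<Gamma>\<^sub>D(S\<^sup>-\<^sup>1F)\<close> is a quotient of a coproduct of suspensions of \<open>\<Gamma>\<^bsub>D\<^sub>s\<^esub>F\<close>.
  For \<open>I = 0\<close> this is the statement about \<open>F\<close> itself.\<close>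

section \<open>Integer powers of a bijection\<close>

text \<open>The functors in question are quotient sets pushed into the type \<open>'a\<close> along
  chosen injections, so nothing is computed with them directly. Each is replaced by a list of
  properties of its elements: \<open>is_localisation\<close> for fractions, \<open>is_Gamma\<close>
  for classes of a morphism into D together with a point of F. Both descriptions make sense beyond
  prime ideals, for multiplicative sets of homogeneous elements and for thick subcategories, and
  this lets the induction pass through ideals that are not prime. The decisive clause of each says
  when an element vanishes. For the colimit it expresses that the index category is filtered, which
  rests on biproducts, on cones and on the exactness of F. Exactness of a sequence of functors then
  becomes a statement about single elements, for each of which suitable triangles are drawn. As the
  ring is only graded commutative, signs occur everywhere. They are carried along in the
  construction of fractions; elsewhere it is enough that a map and its negative have the same kernel
  and image.\<close>

definition zpow :: "'a set \<Rightarrow> ('a \<Rightarrow> 'a) \<Rightarrow> int \<Rightarrow> 'a \<Rightarrow> 'a"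
  where "zpow B f n = (if n \<ge> 0 then f ^^ nat n else inv_into B f ^^ nat (- n))"

context
  fixes B :: "'a set" and f :: "'a \<Rightarrow> 'a"
  assumes bij: "bij_betw f B B"
begin

lemma zpow_in: "x \<in> B \<Longrightarrow> zpow B f n x \<in> B"
proof -
  assume x: "x \<in> B"
  have 1: "(f ^^ k) x \<in> B" for k
    using x bij by (induction k) (auto simp: bij_betw_def)
  have 2: "(inv_into B f ^^ k) x \<in> B" for k
    using x bij by (induction k) (auto simp: bij_betw_def inv_into_into)
  show ?thesis using 1 2 by (simp add: zpow_def)
qed

lemma zpow_0 [simp]: "zpow B f 0 x = x"
  by (simp add: zpow_def)

lemma zpow_succ:
  assumes x: "x \<in> B" shows "zpow B f (n + 1) x = f (zpow B f n x)"
proof (cases "n \<ge> 0")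
  case True
  then have "nat (n + 1) = Suc (nat n)" by simp
  with True show ?thesis by (simp add: zpow_def)
next
  case False
  then have e: "nat (- n) = Suc (nat (- (n + 1)))" by simp
  have "zpow B f n x = inv_into B f (zpow B f (n + 1) x)"
  proof (cases "n = - 1")
    case True then show ?thesis using e by (simp add: zpow_def)
  next
    case False
    with \<open>\<not> n \<ge> 0\<close> have "\<not> n + 1 \<ge> 0" by simp
    then show ?thesis using \<open>\<not> n \<ge> 0\<close> e by (simp add: zpow_def)
  qed
  moreover have "zpow B f (n + 1) x \<in> f ` B" using zpow_in[OF x] bij by (simp add: bij_betw_def)
  ultimately show ?thesis by (simp add: f_inv_into_f)
qed

lemma zpow_add:
  assumes x: "x \<in> B" shows "zpow B f (m + n) x = zpow B f m (zpow B f n x)"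
proof (induction m rule: int_induct[where k = 0])
  case base then show ?case by simp
next
  case (step1 i)
  have "zpow B f (i + 1 + n) x = f (zpow B f (i + n) x)"
    using zpow_succ[OF x, of "i + n"] by (simp add: ac_simps)
  then show ?case using step1 zpow_succ[OF zpow_in[OF x]] by simp
next
  case (step2 i)
  have "f (zpow B f (i - 1 + n) x) = zpow B f (i + n) x"
    using zpow_succ[OF x, of "i - 1 + n"] by (simp add: ac_simps)
  also have "\<dots> = f (zpow B f (i - 1) (zpow B f n x))"
    using step2 zpow_succ[OF zpow_in[OF x], of "i - 1"] by simp
  finally show ?case
    using bij zpow_in[OF x] zpow_in[OF zpow_in[OF x]] by (meson bij_betw_def inj_onD)
qed

end

section \<open>Additive and triangulated categories\<close>

context additive_category
begin

abbreviation zer :: "'o \<Rightarrow> 'o \<Rightarrow> 'm"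
  where "zer X Y \<equiv> \<one>\<^bsub>Hom T X Y\<^esub>"

lemma hom_grp: "\<lbrakk>X \<in> obj T; Y \<in> obj T\<rbrakk> \<Longrightarrow> group (Hom T X Y)"
  using hom_group comm_group.axioms(2) by blast

lemma zer_in [simp]: "\<lbrakk>X \<in> obj T; Y \<in> obj T\<rbrakk> \<Longrightarrow> zer X Y \<in> hom_set T X Y"
  using hom_grp group.is_monoid monoid.one_closed by blast

lemma arrowI: "\<lbrakk>X \<in> obj T; Y \<in> obj T; f \<in> hom_set T X Y\<rbrakk> \<Longrightarrow> f \<in> arrows T"
  by (auto simp: arrows_def)

lemma hom_unique:
  "\<lbrakk>X \<in> obj T; Y \<in> obj T; f \<in> hom_set T X Y; X' \<in> obj T; Y' \<in> obj T; f \<in> hom_set T X' Y'\<rbrakk>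
    \<Longrightarrow> X = X' \<and> Y = Y'"
  using hom_src_tgt by metis

lemma precomp_hom:
  assumes "X \<in> obj T" "Y \<in> obj T" "Z \<in> obj T" "f \<in> hom_set T X Y"
  shows "group_hom (Hom T Y Z) (Hom T X Z) (\<lambda>g. g \<cdot> f)"
  using assms by (auto simp: group_hom_def group_hom_axioms_def hom_def hom_grp cmp_in cmp_add_left)

lemma postcomp_hom:
  assumes "X \<in> obj T" "Y \<in> obj T" "Z \<in> obj T" "g \<in> hom_set T Y Z"
  shows "group_hom (Hom T X Y) (Hom T X Z) (\<lambda>f. g \<cdot> f)"
  using assms by (auto simp: group_hom_def group_hom_axioms_def hom_def hom_grp cmp_in cmp_add_right)

lemma cmp_zer_left:
  "\<lbrakk>X \<in> obj T; Y \<in> obj T; Z \<in> obj T; f \<in> hom_set T X Y\<rbrakk> \<Longrightarrow> zer Y Z \<cdot> f = zer X Z"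
  using group_hom.hom_one[OF precomp_hom] by blast

lemma cmp_zer_right:
  "\<lbrakk>X \<in> obj T; Y \<in> obj T; Z \<in> obj T; g \<in> hom_set T Y Z\<rbrakk> \<Longrightarrow> g \<cdot> zer X Y = zer X Z"
  using group_hom.hom_one[OF postcomp_hom] by blast

lemma cmp_inv_left:
  "\<lbrakk>X \<in> obj T; Y \<in> obj T; Z \<in> obj T; f \<in> hom_set T X Y; g \<in> hom_set T Y Z\<rbrakk>
    \<Longrightarrow> (inv\<^bsub>Hom T Y Z\<^esub> g) \<cdot> f = inv\<^bsub>Hom T X Z\<^esub> (g \<cdot> f)"
  using group_hom.hom_inv[OF precomp_hom] by blast

lemma cmp_inv_right:
  "\<lbrakk>X \<in> obj T; Y \<in> obj T; Z \<in> obj T; f \<in> hom_set T X Y; g \<in> hom_set T Y Z\<rbrakk>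
    \<Longrightarrow> g \<cdot> (inv\<^bsub>Hom T X Y\<^esub> f) = inv\<^bsub>Hom T X Z\<^esub> (g \<cdot> f)"
  using group_hom.hom_inv[OF postcomp_hom] by blast

lemma to_zero_object: "\<lbrakk>zero_object T Z; X \<in> obj T; f \<in> hom_set T X Z\<rbrakk> \<Longrightarrow> f = zer X Z"
  by (auto simp: zero_object_def)

lemma zero_objectI:
  assumes X: "X \<in> obj T" and id0: "idn T X = zer X X"
  shows "zero_object T X"
  unfolding zero_object_def
proof (intro conjI ballI X)
  fix Y assume Y: "Y \<in> obj T"
  have "f = zer Y X" if "f \<in> hom_set T Y X" for f
    using idn_left[OF Y X that] id0 cmp_zer_left[OF Y X X that] by simp
  then show "hom_set T Y X = {zer Y X}" using X Y by auto
  have "f = zer X Y" if "f \<in> hom_set T X Y" for f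
    using idn_right[OF X Y that] id0 cmp_zer_right[OF X X Y that] by simp
  then show "hom_set T X Y = {zer X Y}" using X Y by auto
qed

end

text \<open>Both powers of the suspension are instances of one construction, so that the addition
  law is shown once for objects and morphisms. For morphisms the bijection lives on
  \<open>arrows T\<close>.\<close>

lemma spow_obj_zpow: "spow_obj T n = zpow (obj T) (susp_obj T) n"
  by (simp add: spow_obj_def zpow_def)

lemma spow_mor_zpow: "spow_mor T n = zpow (arrows T) (susp_mor T) n"
  by (simp add: spow_mor_def zpow_def)

context triangulated_category
begin

section \<open>Integer powers of the suspension\<close>

abbreviation SO :: "int \<Rightarrow> 'o \<Rightarrow> 'o" where "SO \<equiv> spow_obj T"
abbreviation SM :: "int \<Rightarrow> 'm \<Rightarrow> 'm" where "SM \<equiv> spow_mor T"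

lemma susp_in [simp]: "X \<in> obj T \<Longrightarrow> susp_obj T X \<in> obj T"
  using susp_obj_bij by (auto simp: bij_betw_def)

lemma susp_obj_inj: "\<lbrakk>X \<in> obj T; Y \<in> obj T; susp_obj T X = susp_obj T Y\<rbrakk> \<Longrightarrow> X = Y"
  using susp_obj_bij by (auto simp: bij_betw_def dest: inj_onD)

lemma susp_obj_ex: "X \<in> obj T \<Longrightarrow> \<exists>Y\<in>obj T. X = susp_obj T Y"
  using susp_obj_bij by (auto simp: bij_betw_def)

lemma susp_mor_in:
  "\<lbrakk>X \<in> obj T; Y \<in> obj T; f \<in> hom_set T X Y\<rbrakk> \<Longrightarrow> susp_mor T f \<in> hom_set T (susp_obj T X) (susp_obj T Y)"
  using susp_mor_iso[of X Y] by (auto simp: iso_def hom_def)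

lemma susp_mor_group_hom:
  "\<lbrakk>X \<in> obj T; Y \<in> obj T\<rbrakk> \<Longrightarrow> group_hom (Hom T X Y) (Hom T (susp_obj T X) (susp_obj T Y)) (susp_mor T)"
  using susp_mor_iso[of X Y] by (auto simp: iso_def group_hom_def group_hom_axioms_def hom_grp)

lemma susp_mor_inj:
  "\<lbrakk>X \<in> obj T; Y \<in> obj T; f \<in> hom_set T X Y; g \<in> hom_set T X Y; susp_mor T f = susp_mor T g\<rbrakk> \<Longrightarrow> f = g"
  using susp_mor_iso[of X Y] by (auto simp: iso_def bij_betw_def dest: inj_onD)

lemma susp_mor_ex:
  "\<lbrakk>X \<in> obj T; Y \<in> obj T; g \<in> hom_set T (susp_obj T X) (susp_obj T Y)\<rbrakk> \<Longrightarrow> \<exists>f\<in>hom_set T X Y. g = susp_mor T f"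
  using susp_mor_iso[of X Y] by (auto simp: iso_def bij_betw_def)

text \<open>Negative powers invert on the union of all Hom sets, so bijectivity on each single Hom
  set has to be globalised. Source and target of the suspended morphism determine those of the
  morphism, because the suspension is injective on objects.\<close>

lemma susp_mor_bij: "bij_betw (susp_mor T) (arrows T) (arrows T)"
  unfolding bij_betw_def
proof
  show "inj_on (susp_mor T) (arrows T)"
  proof (rule inj_onI)
    fix f g assume "f \<in> arrows T" "g \<in> arrows T" and eq: "susp_mor T f = susp_mor T g"
    then obtain X Y X' Y' where o: "X \<in> obj T" "Y \<in> obj T" "X' \<in> obj T" "Y' \<in> obj T"
      and f: "f \<in> hom_set T X Y" and g: "g \<in> hom_set T X' Y'" by (auto simp: arrows_def)
    have "susp_obj T X = susp_obj T X' \<and> susp_obj T Y = susp_obj T Y'"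
      using hom_unique[OF _ _ susp_mor_in[OF o(1,2) f] _ _ susp_mor_in[OF o(3,4) g, folded eq]] o by simp
    then have "X = X'" "Y = Y'" using susp_obj_inj o by auto
    then show "f = g" using susp_mor_inj o f g eq by auto
  qed
  show "susp_mor T ` arrows T = arrows T"
  proof
    show "susp_mor T ` arrows T \<subseteq> arrows T"
      by (auto simp: arrows_def intro!: bexI susp_mor_in)
    show "arrows T \<subseteq> susp_mor T ` arrows T"
    proof
      fix g assume "g \<in> arrows T"
      then obtain U W where "U \<in> obj T" "W \<in> obj T" "g \<in> hom_set T U W" by (auto simp: arrows_def)
      moreover obtain X where "X \<in> obj T" "U = susp_obj T X" using susp_obj_ex calculation(1) by blast
      moreover obtain Y where "Y \<in> obj T" "W = susp_obj T Y" using susp_obj_ex calculation(2) by blast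
      ultimately have "X \<in> obj T" "Y \<in> obj T" "g \<in> hom_set T (susp_obj T X) (susp_obj T Y)" by simp_all
      then show "g \<in> susp_mor T ` arrows T" using susp_mor_ex arrowI by blast
    qed
  qed
qed

lemma SO_in [simp]: "X \<in> obj T \<Longrightarrow> SO n X \<in> obj T"
  using zpow_in[OF susp_obj_bij] by (simp add: spow_obj_zpow)

lemma SO_0 [simp]: "SO 0 X = X" by (simp add: spow_obj_def)
lemma SM_0 [simp]: "SM 0 f = f" by (simp add: spow_mor_def)
lemma SO_1 [simp]: "SO 1 X = susp_obj T X" by (simp add: spow_obj_def)
lemma SM_1 [simp]: "SM 1 f = susp_mor T f" by (simp add: spow_mor_def)

lemma SO_SO: "X \<in> obj T \<Longrightarrow> SO m (SO n X) = SO (m + n) X"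
  using zpow_add[OF susp_obj_bij] by (simp add: spow_obj_zpow)

lemma SM_SM_arrow: "f \<in> arrows T \<Longrightarrow> SM m (SM n f) = SM (m + n) f"
  using zpow_add[OF susp_mor_bij] by (simp add: spow_mor_zpow)

lemma SM_SM: "\<lbrakk>f \<in> hom_set T X Y; X \<in> obj T; Y \<in> obj T\<rbrakk> \<Longrightarrow> SM m (SM n f) = SM (m + n) f"
  using SM_SM_arrow arrowI by blast

text \<open>The union \<open>arrows T\<close> forgets source and target; injectivity of the
  suspension on objects recovers them. This is what the downward step of an integer induction needs
  in order to stay in the right Hom set.\<close>

lemma susp_desusp_hom:
  assumes "f \<in> arrows T" "susp_mor T f \<in> hom_set T (susp_obj T U) (susp_obj T W)" "U \<in> obj T" "W \<in> obj T"
  shows "f \<in> hom_set T U W"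
proof -
  obtain X Y where o: "X \<in> obj T" "Y \<in> obj T" and f: "f \<in> hom_set T X Y"
    using assms(1) by (auto simp: arrows_def)
  have "susp_obj T X = susp_obj T U \<and> susp_obj T Y = susp_obj T W"
    using hom_unique[OF _ _ susp_mor_in[OF o f]] o assms susp_in by blast
  then show ?thesis using susp_obj_inj o f assms by metis
qed

lemma SO_succ: "X \<in> obj T \<Longrightarrow> SO (n + 1) X = susp_obj T (SO n X)"
  by (simp add: spow_obj_zpow zpow_succ[OF susp_obj_bij])

lemma SM_succ: "\<lbrakk>X \<in> obj T; Y \<in> obj T; f \<in> hom_set T X Y\<rbrakk> \<Longrightarrow> SM (n + 1) f = susp_mor T (SM n f)"
  by (simp add: spow_mor_zpow zpow_succ[OF susp_mor_bij] arrowI)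

lemma SM_in:
  assumes o: "X \<in> obj T" "Y \<in> obj T" and f: "f \<in> hom_set T X Y"
  shows "SM n f \<in> hom_set T (SO n X) (SO n Y)"
proof (induction n rule: int_induct[where k = 0])
  case base then show ?case using f by simp
next
  case (step1 i)
  then show ?case using SM_succ[OF o f] SO_succ o susp_mor_in by simp
next
  case (step2 i)
  have "susp_mor T (SM (i - 1) f) = SM i f"
    using SM_succ[OF o f, of "i - 1"] by simp
  moreover have "SO i X = susp_obj T (SO (i - 1) X)" "SO i Y = susp_obj T (SO (i - 1) Y)"
    using SO_succ[of _ "i - 1"] o by simp_all
  moreover have "SM (i - 1) f \<in> arrows T"
    using zpow_in[OF susp_mor_bij] arrowI[OF o f] by (simp add: spow_mor_zpow)
  ultimately show ?case using step2 susp_desusp_hom o by simp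
qed

text \<open>A family indexed by the integers and compatible with the suspension is determined by its
  member at 0. Additivity, functoriality and preservation of identities for all powers are reduced
  to the suspension itself in this way.\<close>

lemma SM_eqI:
  assumes o: "X \<in> obj T" "Y \<in> obj T" and h: "h \<in> hom_set T X Y"
    and k: "\<And>n. k n \<in> hom_set T (SO n X) (SO n Y)" and k0: "k 0 = h"
    and ks: "\<And>n. k (n + 1) = susp_mor T (k n)"
  shows "SM n h = k n"
proof (induction n rule: int_induct[where k = 0])
  case base then show ?case using k0 by simp
next
  case (step1 i)
  then show ?case using SM_succ[OF o h] ks by simp
next
  case (step2 i)
  then have "susp_mor T (SM (i - 1) h) = susp_mor T (k (i - 1))"
    using SM_succ[OF o h, of "i - 1"] ks[of "i - 1"] by simp
  then show ?case
    using susp_mor_inj[of "SO (i - 1) X" "SO (i - 1) Y"] SM_in[OF o h] k o by simp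
qed

lemma SM_mult:
  assumes o: "X \<in> obj T" "Y \<in> obj T" and f: "f \<in> hom_set T X Y" and g: "g \<in> hom_set T X Y"
  shows "SM n (f \<otimes>\<^bsub>Hom T X Y\<^esub> g) = SM n f \<otimes>\<^bsub>Hom T (SO n X) (SO n Y)\<^esub> SM n g"
proof (rule SM_eqI[OF o])
  show "f \<otimes>\<^bsub>Hom T X Y\<^esub> g \<in> hom_set T X Y"
    using hom_grp[OF o] f g group.is_monoid monoid.m_closed by metis
  show "SM n f \<otimes>\<^bsub>Hom T (SO n X) (SO n Y)\<^esub> SM n g \<in> hom_set T (SO n X) (SO n Y)" for n
    using hom_grp[of "SO n X" "SO n Y"] SM_in[OF o f] SM_in[OF o g] group.is_monoid monoid.m_closed o
    by (metis SO_in)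
  show "SM (n + 1) f \<otimes>\<^bsub>Hom T (SO (n + 1) X) (SO (n + 1) Y)\<^esub> SM (n + 1) g =
      susp_mor T (SM n f \<otimes>\<^bsub>Hom T (SO n X) (SO n Y)\<^esub> SM n g)" for n
    using group_hom.hom_mult[OF susp_mor_group_hom[of "SO n X" "SO n Y"] SM_in[OF o f] SM_in[OF o g]]
    by (simp add: SM_succ[OF o f] SM_succ[OF o g] SO_succ o)
qed simp

lemma SM_group_hom:
  "\<lbrakk>X \<in> obj T; Y \<in> obj T\<rbrakk> \<Longrightarrow> group_hom (Hom T X Y) (Hom T (SO n X) (SO n Y)) (SM n)"
  by (auto simp: group_hom_def group_hom_axioms_def hom_def hom_grp SM_in SM_mult)

lemma SM_zer: "\<lbrakk>X \<in> obj T; Y \<in> obj T\<rbrakk> \<Longrightarrow> SM n (zer X Y) = zer (SO n X) (SO n Y)"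
  using group_hom.hom_one[OF SM_group_hom] by blast

lemma SM_inv: "\<lbrakk>X \<in> obj T; Y \<in> obj T; f \<in> hom_set T X Y\<rbrakk>
    \<Longrightarrow> SM n (inv\<^bsub>Hom T X Y\<^esub> f) = inv\<^bsub>Hom T (SO n X) (SO n Y)\<^esub> (SM n f)"
  using group_hom.hom_inv[OF SM_group_hom] by blast

lemma SM_cmp:
  assumes o: "X \<in> obj T" "Y \<in> obj T" "Z \<in> obj T" and f: "f \<in> hom_set T X Y" and g: "g \<in> hom_set T Y Z"
  shows "SM n (g \<cdot> f) = SM n g \<cdot> SM n f"
proof (rule SM_eqI[OF o(1,3)])
  show "g \<cdot> f \<in> hom_set T X Z" using cmp_in o f g by blast
  show "SM n g \<cdot> SM n f \<in> hom_set T (SO n X) (SO n Z)" for n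
    using cmp_in[of "SO n X" "SO n Y" "SO n Z"] SM_in o f g by simp
  show "SM (n + 1) g \<cdot> SM (n + 1) f = susp_mor T (SM n g \<cdot> SM n f)" for n
    using susp_cmp[of "SO n X" "SO n Y" "SO n Z", OF _ _ _ SM_in[OF o(1,2) f] SM_in[OF o(2,3) g]]
    by (simp add: SM_succ[OF o(1,2) f] SM_succ[OF o(2,3) g] o)
qed simp

lemma SM_idn:
  assumes X: "X \<in> obj T" shows "SM n (idn T X) = idn T (SO n X)"
  by (rule SM_eqI[OF X X, where k = "\<lambda>n. idn T (SO n X)"]) (simp_all add: X idn_in SO_succ susp_idn)

section \<open>Exact triangles, weak kernels and weak cokernels\<close>

definition dtri :: "'o \<Rightarrow> 'o \<Rightarrow> 'o \<Rightarrow> 'm \<Rightarrow> 'm \<Rightarrow> 'm \<Rightarrow> bool"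
  where "dtri X Y Z u v w \<longleftrightarrow> X \<in> obj T \<and> Y \<in> obj T \<and> Z \<in> obj T \<and> u \<in> hom_set T X Y \<and>
    v \<in> hom_set T Y Z \<and> w \<in> hom_set T Z (susp_obj T X) \<and> (u, v, w) \<in> tri T"

lemma tri_dtri: "(u, v, w) \<in> tri T \<Longrightarrow> \<exists>X Y Z. dtri X Y Z u v w"
  using tri_mor unfolding dtri_def by metis

lemma inv_in: "\<lbrakk>X \<in> obj T; Y \<in> obj T; f \<in> hom_set T X Y\<rbrakk> \<Longrightarrow> inv\<^bsub>Hom T X Y\<^esub> f \<in> hom_set T X Y"
  using hom_grp group.inv_closed by metis

lemma inv_inv: "\<lbrakk>X \<in> obj T; Y \<in> obj T; f \<in> hom_set T X Y\<rbrakk> \<Longrightarrow> inv\<^bsub>Hom T X Y\<^esub> (inv\<^bsub>Hom T X Y\<^esub> f) = f"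
  using hom_grp group.inv_inv by metis

lemma dtri_rotate:
  "dtri X Y Z u v w \<Longrightarrow>
    dtri Y Z (susp_obj T X) v w (inv\<^bsub>Hom T (susp_obj T X) (susp_obj T Y)\<^esub> (susp_mor T u))"
  unfolding dtri_def using tri_rotate[of X Y Z u v w] by (simp add: inv_in susp_mor_in)

lemma dtri_unrotate:
  "\<lbrakk>dtri Y Z (susp_obj T X) v w (inv\<^bsub>Hom T (susp_obj T X) (susp_obj T Y)\<^esub> (susp_mor T u));
    X \<in> obj T; u \<in> hom_set T X Y\<rbrakk> \<Longrightarrow> dtri X Y Z u v w"
  unfolding dtri_def using tri_rotate[of X Y Z u v w] by simp

lemma dtri_fill:
  assumes "dtri X Y Z u v w" "dtri X' Y' Z' u' v' w'" "f \<in> hom_set T X X'" "g \<in> hom_set T Y Y'"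
    "g \<cdot> u = u' \<cdot> f"
  obtains h where "h \<in> hom_set T Z Z'" "h \<cdot> v = v' \<cdot> g" "susp_mor T f \<cdot> w = w' \<cdot> h"
  using assms tri_fill[of X Y Z X' Y' Z' u v w u' v' w' f g] unfolding dtri_def by blast

lemma dtri_cone:
  assumes "X \<in> obj T" "Y \<in> obj T" "u \<in> hom_set T X Y"
  obtains Z v w where "dtri X Y Z u v w"
proof -
  obtain v w where "(u, v, w) \<in> tri T" using tri_complete[OF assms] by blast
  then obtain X' Y' Z where d: "dtri X' Y' Z u v w" using tri_dtri by blast
  then have "X' = X \<and> Y' = Y" using hom_unique assms unfolding dtri_def by metis
  then show thesis using that d by blast
qed

text \<open>The cone of \<open>v\<close> is the suspension of some object, and its last map is the
  suspension of a morphism. Desuspending the negative of that map matches the sign in the rotation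
  axiom.\<close>

lemma dtri_fibre:
  assumes "Y \<in> obj T" "Z \<in> obj T" "v \<in> hom_set T Y Z"
  obtains X u w where "dtri X Y Z u v w"
proof -
  obtain W w c where d: "dtri Y Z W v w c" using dtri_cone[OF assms] by blast
  then have W: "W \<in> obj T" and c: "c \<in> hom_set T W (susp_obj T Y)" unfolding dtri_def by auto
  obtain X where X: "X \<in> obj T" "W = susp_obj T X" using susp_obj_ex[OF W] by blast
  then obtain u where u: "u \<in> hom_set T X Y"
    "inv\<^bsub>Hom T (susp_obj T X) (susp_obj T Y)\<^esub> c = susp_mor T u"
    using susp_mor_ex[OF X(1) assms(1)] inv_in[OF W _ c] assms(1) by auto
  have "inv\<^bsub>Hom T (susp_obj T X) (susp_obj T Y)\<^esub> (susp_mor T u) = c"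
    using inv_inv[OF W _ c] X assms(1) u(2)[symmetric] by simp
  then show thesis using that dtri_unrotate X u d by metis
qed

lemma dtri_idn:
  assumes "X \<in> obj T" "zero_object T Z"
  shows "dtri X X Z (idn T X) (zer X Z) (zer Z (susp_obj T X))"
proof -
  have "Z \<in> obj T" using assms(2) by (auto simp: zero_object_def)
  then show ?thesis using assms tri_idn[OF assms] unfolding dtri_def by (simp add: idn_in)
qed

text \<open>Mapping the trivial triangle on \<open>X\<close> into the given one factors the
  composite through a zero object.\<close>

lemma dtri_comp_zer:
  assumes d: "dtri X Y Z u v w" shows "v \<cdot> u = zer X Z"
proof -
  obtain N where N: "zero_object T N" using zero_object by blast
  then have No: "N \<in> obj T" by (auto simp: zero_object_def)
  have t: "X \<in> obj T" "Y \<in> obj T" "Z \<in> obj T" "u \<in> hom_set T X Y" "v \<in> hom_set T Y Z"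
    using d unfolding dtri_def by auto
  obtain h where h: "h \<in> hom_set T N Z" "h \<cdot> zer X N = v \<cdot> u"
    using dtri_fill[OF dtri_idn[OF t(1) N] d idn_in[OF t(1)] t(4)] by blast
  then show ?thesis using cmp_zer_right[OF t(1) No t(3) h(1)] by simp
qed

lemma susp_zero_object: "zero_object T (susp_obj T N) \<longleftrightarrow> zero_object T N" if N: "N \<in> obj T"
proof -
  have eq: "susp_mor T (zer N N) = zer (susp_obj T N) (susp_obj T N)"
    using group_hom.hom_one[OF susp_mor_group_hom[OF N N]] .
  have "zero_object T N \<longleftrightarrow> idn T N = zer N N" if "N \<in> obj T" for N
    using that zero_objectI to_zero_object idn_in by blast
  then show ?thesis using N susp_idn[OF N] eq susp_mor_inj[OF N N idn_in[OF N] zer_in[OF N N]]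
    by (metis susp_in)
qed

text \<open>The map \<open>g\<close> is completed to a morphism into the triangle consisting of a
  zero object and the identity of \<open>W\<close>. That triangle is an unrotation of the trivial
  one, which is why a desuspended zero object \<open>M\<close> appears.\<close>

lemma weak_cokernel:
  assumes d: "dtri X Y Z u v w" and W: "W \<in> obj T" and g: "g \<in> hom_set T Y W" and gu: "g \<cdot> u = zer X W"
  obtains h where "h \<in> hom_set T Z W" "g = h \<cdot> v"
proof -
  obtain N where N: "zero_object T N" using zero_object by blast
  then have No: "N \<in> obj T" by (auto simp: zero_object_def)
  then obtain M where M: "M \<in> obj T" "N = susp_obj T M" using susp_obj_ex by blast
  then have Mz: "zero_object T M" using N susp_zero_object by simp
  have "inv\<^bsub>Hom T (susp_obj T M) (susp_obj T W)\<^esub> (susp_mor T (zer M W)) = zer N (susp_obj T W)"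
    using group_hom.hom_one[OF susp_mor_group_hom[OF M(1) W]] M hom_grp[of N "susp_obj T W"] W No
      monoid.inv_one group.is_monoid by (metis susp_in)
  then have d': "dtri M W W (zer M W) (idn T W) (zer W N)"
    using dtri_unrotate[of W W M "idn T W" "zer W N" "zer M W"] dtri_idn[OF W N] M W by simp
  have t: "X \<in> obj T" "u \<in> hom_set T X Y" using d unfolding dtri_def by auto
  have "g \<cdot> u = zer M W \<cdot> zer X M" using gu cmp_zer_left[OF t(1) M(1) W] zer_in[OF t(1) M(1)] by simp
  then obtain h where h: "h \<in> hom_set T Z W" "h \<cdot> v = idn T W \<cdot> g"
    using dtri_fill[OF d d' zer_in[OF t(1) M(1)] g] by blast
  moreover have "Y \<in> obj T" using d unfolding dtri_def by auto
  ultimately show thesis using that idn_left[OF _ W g] by simp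
qed

text \<open>The filling axiom produces the third vertex of a morphism of triangles, so both
  triangles are rotated first and the resulting map between suspensions is desuspended. The rotation
  puts a minus sign on each side of the equation, and the two cancel.\<close>

lemma weak_kernel:
  assumes d: "dtri X Y Z u v w" and W: "W \<in> obj T" and f: "f \<in> hom_set T W Y" and vf: "v \<cdot> f = zer W Z"
  obtains f' where "f' \<in> hom_set T W X" "f = u \<cdot> f'"
proof -
  obtain N where N: "zero_object T N" using zero_object by blast
  then have No: "N \<in> obj T" by (auto simp: zero_object_def)
  let ?S = "susp_obj T" and ?s = "susp_mor T"
  have t: "X \<in> obj T" "Y \<in> obj T" "Z \<in> obj T" "u \<in> hom_set T X Y" using d unfolding dtri_def by auto
  have "zer N Z \<cdot> zer W N = v \<cdot> f" using vf cmp_zer_left[OF W No t(3)] zer_in[OF W No] by simp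
  then obtain h where h: "h \<in> hom_set T (?S W) (?S X)"
    and eq: "?s f \<cdot> (inv\<^bsub>Hom T (?S W) (?S W)\<^esub> (?s (idn T W))) = (inv\<^bsub>Hom T (?S X) (?S Y)\<^esub> (?s u)) \<cdot> h"
    using dtri_fill[OF dtri_rotate[OF dtri_idn[OF W N]] dtri_rotate[OF d] f zer_in[OF No t(3)]] by blast
  obtain f' where f': "f' \<in> hom_set T W X" "h = ?s f'" using susp_mor_ex[OF W t(1) h] by blast
  have o: "?S W \<in> obj T" "?S X \<in> obj T" "?S Y \<in> obj T" using W t by auto
  have sf: "?s f \<in> hom_set T (?S W) (?S Y)" using susp_mor_in W t f by blast
  have su: "?s u \<in> hom_set T (?S X) (?S Y)" using susp_mor_in t by blast
  have "inv\<^bsub>Hom T (?S W) (?S Y)\<^esub> (?s f) = inv\<^bsub>Hom T (?S W) (?S Y)\<^esub> (?s u \<cdot> h)"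
    using eq cmp_inv_right[OF o(1,1,3) idn_in[OF o(1)] sf] cmp_inv_left[OF o h su]
      idn_right[OF o(1,3) sf] susp_idn[OF W] by simp
  then have "?s f = ?s u \<cdot> h"
    using inv_inv[OF o(1,3)] sf cmp_in[OF o h su] by metis
  then have "?s f = ?s (u \<cdot> f')" using f' susp_cmp[OF W t(1,2) f'(1) t(4)] by simp
  then have "f = u \<cdot> f'" using susp_mor_inj[OF W t(2) f] cmp_in[OF W t(1,2) f'(1) t(4)] by blast
  then show thesis using that f' by blast
qed

lemma dtri_next:
  assumes "dtri X Y Z u v w" shows "w \<cdot> v = zer Y (susp_obj T X)" "susp_mor T u \<cdot> w = zer Z (susp_obj T Y)"
proof -
  show "w \<cdot> v = zer Y (susp_obj T X)" using dtri_comp_zer[OF dtri_rotate[OF assms]] .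
  have t: "X \<in> obj T" "Y \<in> obj T" "Z \<in> obj T" "u \<in> hom_set T X Y" "w \<in> hom_set T Z (susp_obj T X)"
    using assms unfolding dtri_def by auto
  have "inv\<^bsub>Hom T (susp_obj T X) (susp_obj T Y)\<^esub> (susp_mor T u) \<cdot> w = zer Z (susp_obj T Y)"
    using dtri_comp_zer[OF dtri_rotate[OF dtri_rotate[OF assms]]] .
  then have i: "inv\<^bsub>Hom T Z (susp_obj T Y)\<^esub> (susp_mor T u \<cdot> w) = zer Z (susp_obj T Y)"
    using cmp_inv_left[OF t(3) susp_in[OF t(1)] susp_in[OF t(2)] t(5) susp_mor_in[OF t(1,2,4)]] by simp
  have "susp_mor T u \<cdot> w \<in> hom_set T Z (susp_obj T Y)" 
    using cmp_in[OF t(3) susp_in[OF t(1)] susp_in[OF t(2)] t(5) susp_mor_in[OF t(1,2,4)]] .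
  then show "susp_mor T u \<cdot> w = zer Z (susp_obj T Y)"
    using i group.inv_eq_1_iff[OF hom_grp[of Z "susp_obj T Y"]] t(2,3) by simp
qed

text \<open>\<open>exact_pair\<close> consists of two consecutive maps of an exact triangle up to signs; in contrast to
  exact triangles it is stable under \<open>\<Sigma>\<^sup>n\<close> without a change of signs.\<close>

definition exact_pair :: "'o \<Rightarrow> 'o \<Rightarrow> 'o \<Rightarrow> 'm \<Rightarrow> 'm \<Rightarrow> bool"
  where "exact_pair X Y Z u v \<longleftrightarrow> u \<in> hom_set T X Y \<and> v \<in> hom_set T Y Z \<and> (\<exists>u' v' w. dtri X Y Z u' v' w \<and>
    (u' = u \<or> u' = inv\<^bsub>Hom T X Y\<^esub> u) \<and> (v' = v \<or> v' = inv\<^bsub>Hom T Y Z\<^esub> v))"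

lemma dtri_exact_pair: "dtri X Y Z u v w \<Longrightarrow> exact_pair X Y Z u v"
  unfolding exact_pair_def dtri_def by blast

lemma dtri_susp:
  assumes "dtri X Y Z u v w"
  shows "dtri (susp_obj T X) (susp_obj T Y) (susp_obj T Z)
    (inv\<^bsub>Hom T (susp_obj T X) (susp_obj T Y)\<^esub> (susp_mor T u))
    (inv\<^bsub>Hom T (susp_obj T Y) (susp_obj T Z)\<^esub> (susp_mor T v))
    (inv\<^bsub>Hom T (susp_obj T Z) (susp_obj T (susp_obj T X))\<^esub> (susp_mor T w))"
  using dtri_rotate[OF dtri_rotate[OF dtri_rotate[OF assms]]] .

lemma dtri_desusp:
  assumes "dtri (susp_obj T X) (susp_obj T Y) (susp_obj T Z) u v w" "X \<in> obj T" "Y \<in> obj T" "Z \<in> obj T"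
  shows "\<exists>u' v' w'. dtri X Y Z u' v' w' \<and> u = inv\<^bsub>Hom T (susp_obj T X) (susp_obj T Y)\<^esub> (susp_mor T u') \<and>
    v = inv\<^bsub>Hom T (susp_obj T Y) (susp_obj T Z)\<^esub> (susp_mor T v')"
proof -
  have *: "\<exists>f'\<in>hom_set T U W. f = inv\<^bsub>Hom T (susp_obj T U) (susp_obj T W)\<^esub> (susp_mor T f')"
    if "U \<in> obj T" "W \<in> obj T" "f \<in> hom_set T (susp_obj T U) (susp_obj T W)" for U W f
    using susp_mor_ex[OF that(1,2) inv_in[OF _ _ that(3)]] inv_inv[OF _ _ that(3)] that susp_in by metis
  have t: "u \<in> hom_set T (susp_obj T X) (susp_obj T Y)" "v \<in> hom_set T (susp_obj T Y) (susp_obj T Z)"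
    "w \<in> hom_set T (susp_obj T Z) (susp_obj T (susp_obj T X))"
    using assms unfolding dtri_def by auto
  obtain u' where u': "u' \<in> hom_set T X Y" "u = inv\<^bsub>Hom T (susp_obj T X) (susp_obj T Y)\<^esub> (susp_mor T u')"
    using *[OF assms(2,3) t(1)] by blast
  obtain v' where v': "v' \<in> hom_set T Y Z" "v = inv\<^bsub>Hom T (susp_obj T Y) (susp_obj T Z)\<^esub> (susp_mor T v')"
    using *[OF assms(3,4) t(2)] by blast
  obtain w' where w': "w' \<in> hom_set T Z (susp_obj T X)"
    "w = inv\<^bsub>Hom T (susp_obj T Z) (susp_obj T (susp_obj T X))\<^esub> (susp_mor T w')"
    using *[OF assms(4) susp_in[OF assms(2)] t(3)] by blast
  have "dtri Z (susp_obj T X) (susp_obj T Y) w' u v"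
    using dtri_unrotate assms w' by blast
  then have "dtri Y Z (susp_obj T X) v' w' u"
    using dtri_unrotate assms(3) v' by blast
  then have "dtri X Y Z u' v' w'" using dtri_unrotate assms(2) u' by blast
  then show ?thesis using u' v' by blast
qed

text \<open>Three rotations suspend a triangle and negate its maps, a change that
  \<open>exact_pair\<close> tolerates; the downward step reverses the three rotations.\<close>

lemma exact_pair_SM:
  assumes o: "X \<in> obj T" "Y \<in> obj T" "Z \<in> obj T" and e: "exact_pair X Y Z u v"
  shows "exact_pair (SO n X) (SO n Y) (SO n Z) (SM n u) (SM n v)"
proof (induction n rule: int_induct[where k = 0])
  case base then show ?case using e by simp
next
  have uv: "u \<in> hom_set T X Y" "v \<in> hom_set T Y Z" using e by (auto simp: exact_pair_def)
  have si: "susp_mor T (inv\<^bsub>Hom T U W\<^esub> f) = inv\<^bsub>Hom T (susp_obj T U) (susp_obj T W)\<^esub> (susp_mor T f)"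
    if "U \<in> obj T" "W \<in> obj T" "f \<in> hom_set T U W" for U W f
    using group_hom.hom_inv[OF susp_mor_group_hom] that by blast
  {
    case (step1 i)
    let ?X = "SO i X" and ?Y = "SO i Y" and ?Z = "SO i Z"
    let ?u = "SM i u" and ?v = "SM i v"
    have oi: "?X \<in> obj T" "?Y \<in> obj T" "?Z \<in> obj T" using o by auto
    have h: "?u \<in> hom_set T ?X ?Y" "?v \<in> hom_set T ?Y ?Z" using SM_in o uv by blast+
    obtain u' v' w where d: "dtri ?X ?Y ?Z u' v' w" and
      s: "u' = ?u \<or> u' = inv\<^bsub>Hom T ?X ?Y\<^esub> ?u" "v' = ?v \<or> v' = inv\<^bsub>Hom T ?Y ?Z\<^esub> ?v"
      using step1 unfolding exact_pair_def by blast
    have "inv\<^bsub>Hom T (susp_obj T ?X) (susp_obj T ?Y)\<^esub> (susp_mor T u') = susp_mor T ?u \<or>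
      inv\<^bsub>Hom T (susp_obj T ?X) (susp_obj T ?Y)\<^esub> (susp_mor T u') = inv\<^bsub>Hom T (susp_obj T ?X) (susp_obj T ?Y)\<^esub> (susp_mor T ?u)"
      using s(1) si[OF oi(1,2) h(1)] inv_inv[OF _ _ susp_mor_in[OF oi(1,2) h(1)]] oi by auto
    moreover have "inv\<^bsub>Hom T (susp_obj T ?Y) (susp_obj T ?Z)\<^esub> (susp_mor T v') = susp_mor T ?v \<or>
      inv\<^bsub>Hom T (susp_obj T ?Y) (susp_obj T ?Z)\<^esub> (susp_mor T v') = inv\<^bsub>Hom T (susp_obj T ?Y) (susp_obj T ?Z)\<^esub> (susp_mor T ?v)"
      using s(2) si[OF oi(2,3) h(2)] inv_inv[OF _ _ susp_mor_in[OF oi(2,3) h(2)]] oi by auto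
    ultimately show ?case
      using dtri_susp[OF d] susp_mor_in[OF oi(1,2) h(1)] susp_mor_in[OF oi(2,3) h(2)]
      unfolding exact_pair_def SO_succ[OF o(1)] SO_succ[OF o(2)] SO_succ[OF o(3)]
        SM_succ[OF o(1,2) uv(1)] SM_succ[OF o(2,3) uv(2)] by blast
  next
    case (step2 i)
    let ?X = "SO (i - 1) X" and ?Y = "SO (i - 1) Y" and ?Z = "SO (i - 1) Z"
    let ?u = "SM (i - 1) u" and ?v = "SM (i - 1) v"
    have oi: "?X \<in> obj T" "?Y \<in> obj T" "?Z \<in> obj T" using o by auto
    have h: "?u \<in> hom_set T ?X ?Y" "?v \<in> hom_set T ?Y ?Z" using SM_in o uv by blast+
    have eq: "SO i X = susp_obj T ?X" "SO i Y = susp_obj T ?Y" "SO i Z = susp_obj T ?Z"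
      "SM i u = susp_mor T ?u" "SM i v = susp_mor T ?v"
      using SO_succ[of _ "i - 1"] SM_succ[OF o(1,2) uv(1), of "i - 1"] SM_succ[OF o(2,3) uv(2), of "i - 1"] o
      by simp_all
    obtain u' v' w where d: "dtri (susp_obj T ?X) (susp_obj T ?Y) (susp_obj T ?Z) u' v' w" and
      s: "u' = susp_mor T ?u \<or> u' = inv\<^bsub>Hom T (susp_obj T ?X) (susp_obj T ?Y)\<^esub> (susp_mor T ?u)"
        "v' = susp_mor T ?v \<or> v' = inv\<^bsub>Hom T (susp_obj T ?Y) (susp_obj T ?Z)\<^esub> (susp_mor T ?v)"
      using step2 unfolding exact_pair_def eq by blast
    obtain u0 v0 w0 where d0: "dtri ?X ?Y ?Z u0 v0 w0"
      and u0: "u' = inv\<^bsub>Hom T (susp_obj T ?X) (susp_obj T ?Y)\<^esub> (susp_mor T u0)"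
      and v0: "v' = inv\<^bsub>Hom T (susp_obj T ?Y) (susp_obj T ?Z)\<^esub> (susp_mor T v0)"
      using dtri_desusp[OF d oi] by blast
    have h0: "u0 \<in> hom_set T ?X ?Y" "v0 \<in> hom_set T ?Y ?Z" using d0 unfolding dtri_def by auto
    have *: "f0 = f \<or> f0 = inv\<^bsub>Hom T U W\<^esub> f" if
      "U \<in> obj T" "W \<in> obj T" "f \<in> hom_set T U W" "f0 \<in> hom_set T U W"
      "f' = susp_mor T f \<or> f' = inv\<^bsub>Hom T (susp_obj T U) (susp_obj T W)\<^esub> (susp_mor T f)"
      "f' = inv\<^bsub>Hom T (susp_obj T U) (susp_obj T W)\<^esub> (susp_mor T f0)" for U W f f0 f'
    proof -
      have "f' = susp_mor T (inv\<^bsub>Hom T U W\<^esub> f0)" using that si by simp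
      then have "susp_mor T (inv\<^bsub>Hom T U W\<^esub> f0) = susp_mor T f \<or>
        susp_mor T (inv\<^bsub>Hom T U W\<^esub> f0) = susp_mor T (inv\<^bsub>Hom T U W\<^esub> f)"
        using that si[OF that(1,2,3)] by auto
      then have "inv\<^bsub>Hom T U W\<^esub> f0 = f \<or> inv\<^bsub>Hom T U W\<^esub> f0 = inv\<^bsub>Hom T U W\<^esub> f"
        using susp_mor_inj[OF that(1,2)] inv_in that by blast
      then show ?thesis using inv_inv that by metis
    qed
    show ?case using d0 h *[OF oi(1,2) h(1) h0(1) s(1) u0] *[OF oi(2,3) h(2) h0(2) s(2) v0]
      unfolding exact_pair_def by blast
  }
qed

end

section \<open>Additive and cohomological functors\<close>

context additive_category
begin

context
  fixes F :: "('o, 'm, 'a) presheaf"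
  assumes F: "additive_functor T F"
begin

lemma af_comm_group: "X \<in> obj T \<Longrightarrow> comm_group (fobj F X)"
  using F unfolding additive_functor_def by blast

lemma af_group: "X \<in> obj T \<Longrightarrow> group (fobj F X)"
  using af_comm_group comm_group.axioms(2) by blast

lemma af_hom: "\<lbrakk>X \<in> obj T; Y \<in> obj T; f \<in> hom_set T X Y\<rbrakk> \<Longrightarrow> fmap F f \<in> hom (fobj F Y) (fobj F X)"
  using F unfolding additive_functor_def by blast

lemma af_group_hom: "\<lbrakk>X \<in> obj T; Y \<in> obj T; f \<in> hom_set T X Y\<rbrakk> \<Longrightarrow> group_hom (fobj F Y) (fobj F X) (fmap F f)"
  by (simp add: group_hom_def group_hom_axioms_def af_group af_hom)

lemma af_closed:
  "\<lbrakk>X \<in> obj T; Y \<in> obj T; f \<in> hom_set T X Y; x \<in> carrier (fobj F Y)\<rbrakk> \<Longrightarrow> fmap F f x \<in> carrier (fobj F X)"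
  using af_hom unfolding hom_def by blast

lemma af_mult:
  "\<lbrakk>X \<in> obj T; Y \<in> obj T; f \<in> hom_set T X Y; x \<in> carrier (fobj F Y); y \<in> carrier (fobj F Y)\<rbrakk>
    \<Longrightarrow> fmap F f (x \<otimes>\<^bsub>fobj F Y\<^esub> y) = fmap F f x \<otimes>\<^bsub>fobj F X\<^esub> fmap F f y"
  using group_hom.hom_mult[OF af_group_hom] by blast

lemma af_one: "\<lbrakk>X \<in> obj T; Y \<in> obj T; f \<in> hom_set T X Y\<rbrakk> \<Longrightarrow> fmap F f \<one>\<^bsub>fobj F Y\<^esub> = \<one>\<^bsub>fobj F X\<^esub>"
  using group_hom.hom_one[OF af_group_hom] by blast

lemma af_m_inv:
  "\<lbrakk>X \<in> obj T; Y \<in> obj T; f \<in> hom_set T X Y; x \<in> carrier (fobj F Y)\<rbrakk>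
    \<Longrightarrow> fmap F f (inv\<^bsub>fobj F Y\<^esub> x) = inv\<^bsub>fobj F X\<^esub> (fmap F f x)"
  using group_hom.hom_inv[OF af_group_hom] by blast

lemma af_idn: "\<lbrakk>X \<in> obj T; x \<in> carrier (fobj F X)\<rbrakk> \<Longrightarrow> fmap F (idn T X) x = x"
  using F unfolding additive_functor_def by blast

lemma af_cmp:
  "\<lbrakk>X \<in> obj T; Y \<in> obj T; Z \<in> obj T; f \<in> hom_set T X Y; g \<in> hom_set T Y Z; x \<in> carrier (fobj F Z)\<rbrakk>
    \<Longrightarrow> fmap F (g \<cdot> f) x = fmap F f (fmap F g x)"
  using F unfolding additive_functor_def by blast

lemma af_add:
  "\<lbrakk>X \<in> obj T; Y \<in> obj T; f \<in> hom_set T X Y; g \<in> hom_set T X Y; x \<in> carrier (fobj F Y)\<rbrakk>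
    \<Longrightarrow> fmap F (f \<otimes>\<^bsub>Hom T X Y\<^esub> g) x = fmap F f x \<otimes>\<^bsub>fobj F X\<^esub> fmap F g x"
  using F unfolding additive_functor_def by blast

lemma af_eval_group_hom:
  "\<lbrakk>X \<in> obj T; Y \<in> obj T; x \<in> carrier (fobj F Y)\<rbrakk> \<Longrightarrow> group_hom (Hom T X Y) (fobj F X) (\<lambda>f. fmap F f x)"
  by (auto simp: group_hom_def group_hom_axioms_def hom_def hom_grp af_group af_closed af_add)

lemma af_zer: "\<lbrakk>X \<in> obj T; Y \<in> obj T; x \<in> carrier (fobj F Y)\<rbrakk> \<Longrightarrow> fmap F (zer X Y) x = \<one>\<^bsub>fobj F X\<^esub>"
  using group_hom.hom_one[OF af_eval_group_hom] by blast

lemma af_inv: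
  "\<lbrakk>X \<in> obj T; Y \<in> obj T; f \<in> hom_set T X Y; x \<in> carrier (fobj F Y)\<rbrakk>
    \<Longrightarrow> fmap F (inv\<^bsub>Hom T X Y\<^esub> f) x = inv\<^bsub>fobj F X\<^esub> (fmap F f x)"
  using group_hom.hom_inv[OF af_eval_group_hom] by blast

end

lemma additive_functorI:
  assumes "\<And>X. X \<in> obj T \<Longrightarrow> comm_group (fobj F X)"
    and "\<And>X Y f. \<lbrakk>X \<in> obj T; Y \<in> obj T; f \<in> hom_set T X Y\<rbrakk> \<Longrightarrow> fmap F f \<in> hom (fobj F Y) (fobj F X)"
    and "\<And>X x. \<lbrakk>X \<in> obj T; x \<in> carrier (fobj F X)\<rbrakk> \<Longrightarrow> fmap F (idn T X) x = x"
    and "\<And>X Y Z f g x. \<lbrakk>X \<in> obj T; Y \<in> obj T; Z \<in> obj T; f \<in> hom_set T X Y; g \<in> hom_set T Y Z;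
      x \<in> carrier (fobj F Z)\<rbrakk> \<Longrightarrow> fmap F (g \<cdot> f) x = fmap F f (fmap F g x)"
    and "\<And>X Y f g x. \<lbrakk>X \<in> obj T; Y \<in> obj T; f \<in> hom_set T X Y; g \<in> hom_set T X Y; x \<in> carrier (fobj F Y)\<rbrakk>
      \<Longrightarrow> fmap F (f \<otimes>\<^bsub>Hom T X Y\<^esub> g) x = fmap F f x \<otimes>\<^bsub>fobj F X\<^esub> fmap F g x"
  shows "additive_functor T F"
  using assms unfolding additive_functor_def by blast

lemma nat_transI:
  assumes "\<And>X. X \<in> obj T \<Longrightarrow> \<theta> X \<in> hom (fobj F X) (fobj G X)"
    and "\<And>X Y f x. \<lbrakk>X \<in> obj T; Y \<in> obj T; f \<in> hom_set T X Y; x \<in> carrier (fobj F Y)\<rbrakk>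
      \<Longrightarrow> \<theta> X (fmap F f x) = fmap G f (\<theta> Y x)"
    and "additive_functor T F"
  shows "(\<lambda>X\<in>obj T. \<lambda>x\<in>carrier (fobj F X). \<theta> X x) \<in> nat_trans T F G"
proof -
  have "restrict (\<theta> X) (carrier (fobj F X)) \<in> hom (fobj F X) (fobj G X)" if "X \<in> obj T" for X
    using assms(1)[OF that] group.is_monoid[OF af_group[OF assms(3) that]]
    by (auto simp: hom_def monoid.m_closed)
  then show ?thesis
    using assms(2) af_closed[OF assms(3)] by (auto simp: nat_trans_def)
qed

lemma nat_trans_hom: "\<lbrakk>\<eta> \<in> nat_trans T F G; X \<in> obj T\<rbrakk> \<Longrightarrow> \<eta> X \<in> hom (fobj F X) (fobj G X)"
  by (auto simp: nat_trans_def)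

lemma nat_trans_closed:
  "\<lbrakk>\<eta> \<in> nat_trans T F G; X \<in> obj T; x \<in> carrier (fobj F X)\<rbrakk> \<Longrightarrow> \<eta> X x \<in> carrier (fobj G X)"
  using nat_trans_hom unfolding hom_def by blast

lemma nat_trans_natural:
  "\<lbrakk>\<eta> \<in> nat_trans T F G; X \<in> obj T; Y \<in> obj T; f \<in> hom_set T X Y; x \<in> carrier (fobj F Y)\<rbrakk>
    \<Longrightarrow> \<eta> X (fmap F f x) = fmap G f (\<eta> Y x)"
  by (auto simp: nat_trans_def)

end

context triangulated_category
begin

text \<open>The two interior terms of the sequence are interchanged by rotating the triangle, so one
  exactness condition for all triangles suffices. Of that condition only one inclusion remains,
  since consecutive maps compose to zero and additive functors preserve zero.\<close>

lemma Coh_iff: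
  "F \<in> Coh T \<longleftrightarrow> additive_functor T F \<and>
    (\<forall>X Y Z u v w. dtri X Y Z u v w \<longrightarrow> (\<forall>y\<in>carrier (fobj F Y). fmap F u y = \<one>\<^bsub>fobj F X\<^esub> \<longrightarrow>
      (\<exists>z\<in>carrier (fobj F Z). y = fmap F v z)))" (is "_ \<longleftrightarrow> _ \<and> ?E")
proof (cases "additive_functor T F")
  case False then show ?thesis by (simp add: Coh_def)
next
  case A: True
  have ker: "kernel (fobj F Y) (fobj F X) (fmap F u) = fmap F v ` carrier (fobj F Z) \<longleftrightarrow>
    (\<forall>y\<in>carrier (fobj F Y). fmap F u y = \<one>\<^bsub>fobj F X\<^esub> \<longrightarrow> (\<exists>z\<in>carrier (fobj F Z). y = fmap F v z))"
    if d: "dtri X Y Z u v w" for X Y Z u v w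
  proof -
    have t: "X \<in> obj T" "Y \<in> obj T" "Z \<in> obj T" "u \<in> hom_set T X Y" "v \<in> hom_set T Y Z"
      using d unfolding dtri_def by auto
    have "fmap F u (fmap F v z) = \<one>\<^bsub>fobj F X\<^esub>" if "z \<in> carrier (fobj F Z)" for z
      using af_cmp[OF A t that] dtri_comp_zer[OF d] af_zer[OF A t(1,3) that] by simp
    then show ?thesis using af_closed[OF A t(2,3,5)] by (auto simp: kernel_def)
  qed
  have seq: "exact_seq ([fobj F (src T u), fobj F (tgt T u), fobj F (tgt T v), fobj F (tgt T w)],
      [fmap F u, fmap F v, fmap F w]) \<longleftrightarrow>
    kernel (fobj F Y) (fobj F X) (fmap F u) = fmap F v ` carrier (fobj F Z) \<and>
    kernel (fobj F Z) (fobj F Y) (fmap F v) = fmap F w ` carrier (fobj F (susp_obj T X))"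
    if d: "dtri X Y Z u v w" for X Y Z u v w
  proof -
    have t: "X \<in> obj T" "Y \<in> obj T" "Z \<in> obj T" "u \<in> hom_set T X Y" "v \<in> hom_set T Y Z"
      "w \<in> hom_set T Z (susp_obj T X)"
      using d unfolding dtri_def by auto
    have s: "src T u = X" "tgt T u = Y" "tgt T v = Z" "tgt T w = susp_obj T X"
      using hom_src_tgt t by auto
    show ?thesis
      unfolding s using af_group_hom[OF A] af_group[OF A] af_hom[OF A] t by auto
  qed
  show ?thesis
  proof
    assume F: "F \<in> Coh T"
    have ?E
    proof (intro allI impI)
      fix X Y Z u v w assume d: "dtri X Y Z u v w"
      then have "(u, v, w) \<in> tri T" by (simp add: dtri_def)
      then show "\<forall>y\<in>carrier (fobj F Y). fmap F u y = \<one>\<^bsub>fobj F X\<^esub> \<longrightarrow> (\<exists>z\<in>carrier (fobj F Z). y = fmap F v z)"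
        using F seq[OF d] ker[OF d] unfolding Coh_def by blast
    qed
    with A show "additive_functor T F \<and> ?E" by blast
  next
    assume "additive_functor T F \<and> ?E"
    then have E: ?E by blast
    have "exact_seq ([fobj F (src T u), fobj F (tgt T u), fobj F (tgt T v), fobj F (tgt T w)],
      [fmap F u, fmap F v, fmap F w])" if uvw: "(u, v, w) \<in> tri T" for u v w
    proof -
      obtain X Y Z where d: "dtri X Y Z u v w" using tri_dtri[OF uvw] by blast
      note r = dtri_rotate[OF d]
      have k1: "kernel (fobj F Y) (fobj F X) (fmap F u) = fmap F v ` carrier (fobj F Z)"
        unfolding ker[OF d] using E d by blast
      have k2: "kernel (fobj F Z) (fobj F Y) (fmap F v) = fmap F w ` carrier (fobj F (susp_obj T X))"
        unfolding ker[OF r] using E r by blast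
      show ?thesis using seq[OF d] k1 k2 by blast
    qed
    then show "F \<in> Coh T" using A unfolding Coh_def by blast
  qed
qed

lemma Coh_additive: "F \<in> Coh T \<Longrightarrow> additive_functor T F"
  by (simp add: Coh_iff)

text \<open>A change of sign affects neither the kernel nor the image, so exactness on triangles
  passes to \<open>exact_pair\<close>.\<close>

lemma Coh_exact_pair:
  assumes F: "F \<in> Coh T" and o: "X \<in> obj T" "Y \<in> obj T" "Z \<in> obj T" and e: "exact_pair X Y Z u v"
    and y: "y \<in> carrier (fobj F Y)" "fmap F u y = \<one>\<^bsub>fobj F X\<^esub>"
  obtains z where "z \<in> carrier (fobj F Z)" "y = fmap F v z"
proof -
  note A = Coh_additive[OF F]
  obtain u' v' w where d: "dtri X Y Z u' v' w" and u: "u \<in> hom_set T X Y" and v: "v \<in> hom_set T Y Z" and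
    s: "u' = u \<or> u' = inv\<^bsub>Hom T X Y\<^esub> u" "v' = v \<or> v' = inv\<^bsub>Hom T Y Z\<^esub> v"
    using e unfolding exact_pair_def by blast
  have "fmap F u' y = \<one>\<^bsub>fobj F X\<^esub>"
    using s(1) y af_inv[OF A o(1,2) u y(1)] monoid.inv_one[OF group.is_monoid[OF af_group[OF A o(1)]]] by auto
  then obtain z where z: "z \<in> carrier (fobj F Z)" "y = fmap F v' z"
    using F d y(1) unfolding Coh_iff by blast
  have "y = fmap F v z \<or> y = fmap F v (inv\<^bsub>fobj F Z\<^esub> z)"
    using s(2) z af_inv[OF A o(2,3) v z(1)] af_m_inv[OF A o(2,3) v z(1)] by auto
  moreover have "inv\<^bsub>fobj F Z\<^esub> z \<in> carrier (fobj F Z)"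
    using group.inv_closed[OF af_group[OF A o(3)] z(1)] .
  ultimately show thesis using that z(1) by blast
qed

lemma shift_obj [simp]: "fobj (shift T n F) X = fobj F (SO (- n) X)"
  and shift_map [simp]: "fmap (shift T n F) f = fmap F (SM (- n) f)"
  by (simp_all add: shift_def)

lemma shift_additive:
  assumes A: "additive_functor T F" shows "additive_functor T (shift T n F)"
proof (rule additive_functorI)
  fix X Y Z f g x
  assume o: "X \<in> obj T" "Y \<in> obj T" "Z \<in> obj T" and f: "f \<in> hom_set T X Y" and g: "g \<in> hom_set T Y Z"
    and x: "x \<in> carrier (fobj (shift T n F) Z)"
  show "fmap (shift T n F) (g \<cdot> f) x = fmap (shift T n F) f (fmap (shift T n F) g x)"
    using af_cmp[OF A SO_in[OF o(1)] SO_in[OF o(2)] SO_in[OF o(3)] SM_in[OF o(1,2) f] SM_in[OF o(2,3) g]]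
      SM_cmp[OF o f g] x by simp
qed (simp_all add: A SM_in SM_idn SM_mult af_comm_group af_hom af_idn af_add)

end

section \<open>The action of the ring\<close>

text \<open>The action of \<open>r\<close> as a map from the desuspension by \<open>d\<close> to
  \<open>X\<close>, ending in \<open>X\<close> instead of starting there. Applying a contravariant
  functor to it gives the action on graded values, and its cones are the Koszul objects from which
  all sequences below are made.\<close>

definition rho :: "('o, 'm) tricat \<Rightarrow> (int \<Rightarrow> 'r \<Rightarrow> 'o \<Rightarrow> 'm) \<Rightarrow> int \<Rightarrow> 'r \<Rightarrow> 'o \<Rightarrow> 'm"
  where "rho T \<phi> d r X = spow_mor T (- d) (\<phi> d r X)"

lemma star_act_rho: "star_act T \<phi> F X d n r = fmap F (rho T \<phi> d r (spow_obj T (- n) X))"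
  by (simp add: star_act_def rho_def)

context graded_commutative_ring
begin

lemma degree_carrier: "r \<in> A d \<Longrightarrow> r \<in> carrier R"
  using additive_subgroup.a_subset[OF subgroup_degree] by blast

lemma zero_degree: "\<zero> \<in> A d"
  using additive_subgroup.zero_closed[OF subgroup_degree] .

lemma power_degree: "r \<in> A d \<Longrightarrow> r [^] (n::nat) \<in> A (int n * d)"
proof (induction n)
  case 0 then show ?case using one_degree by simp
next
  case (Suc n)
  then show ?case using mult_degree[of "r [^] n" "int n * d" r d] by (simp add: algebra_simps)
qed

end

context linear_triangulated_category
begin

abbreviation rh :: "int \<Rightarrow> 'r \<Rightarrow> 'o \<Rightarrow> 'm" where "rh \<equiv> rho T \<phi>"

lemma phi_in: "\<lbrakk>r \<in> A d; X \<in> obj T\<rbrakk> \<Longrightarrow> \<phi> d r X \<in> hom_set T X (SO d X)"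
  using phi_centre unfolding graded_centre_def by blast

lemma phi_natural:
  "\<lbrakk>r \<in> A d; X \<in> obj T; Y \<in> obj T; f \<in> hom_set T X Y\<rbrakk> \<Longrightarrow> \<phi> d r Y \<cdot>\<^bsub>T\<^esub> f = SM d f \<cdot>\<^bsub>T\<^esub> \<phi> d r X"
  using phi_centre unfolding graded_centre_def by blast

lemma phi_susp:
  "\<lbrakk>r \<in> A d; X \<in> obj T\<rbrakk> \<Longrightarrow> \<phi> d r (susp_obj T X) =
    sgn_act (Hom T (susp_obj T X) (SO d (susp_obj T X))) d (susp_mor T (\<phi> d r X))"
  using phi_centre unfolding graded_centre_def by blast

lemma rho_in:
  assumes "r \<in> A d" "X \<in> obj T" shows "rh d r X \<in> hom_set T (SO (- d) X) X"
  using SM_in[OF _ _ phi_in[OF assms], of "- d"] assms(2) SO_SO[OF assms(2), of "- d" d]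
  by (simp add: rho_def)

lemma rho_natural:
  assumes r: "r \<in> A d" and o: "X \<in> obj T" "Y \<in> obj T" and f: "f \<in> hom_set T X Y"
  shows "f \<cdot>\<^bsub>T\<^esub> rh d r X = rh d r Y \<cdot>\<^bsub>T\<^esub> SM (- d) f"
proof -
  have "SM (- d) (\<phi> d r Y \<cdot>\<^bsub>T\<^esub> f) = SM (- d) (SM d f \<cdot>\<^bsub>T\<^esub> \<phi> d r X)" using phi_natural[OF r o f] by simp
  moreover have "SM (- d) (\<phi> d r Y \<cdot>\<^bsub>T\<^esub> f) = rh d r Y \<cdot>\<^bsub>T\<^esub> SM (- d) f"
    using SM_cmp[OF o(1,2) SO_in[OF o(2)] f phi_in[OF r o(2)]] by (simp add: rho_def)
  moreover have "SM (- d) (SM d f \<cdot>\<^bsub>T\<^esub> \<phi> d r X) = f \<cdot>\<^bsub>T\<^esub> rh d r X"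
    using SM_cmp[OF o(1) SO_in[OF o(1)] SO_in[OF o(2)] phi_in[OF r o(1)] SM_in[OF o f]] SM_SM[OF f o, of "- d" d]
    by (simp add: rho_def)
  ultimately show ?thesis by simp
qed

lemma rho_mult:
  assumes r: "r \<in> A d" and s: "s \<in> A e" and X: "X \<in> obj T"
  shows "rh (d + e) (r \<otimes>\<^bsub>R\<^esub> s) X = rh d r X \<cdot>\<^bsub>T\<^esub> SM (- d) (rh e s X)"
proof -
  have h: "SM e (\<phi> d r X) \<in> hom_set T (SO e X) (SO (d + e) X)"
    using SM_in[OF X SO_in[OF X] phi_in[OF r X], of e] SO_SO[OF X, of e d] by (simp add: ac_simps)
  have "rh (d + e) (r \<otimes>\<^bsub>R\<^esub> s) X = SM (- d - e) (SM e (\<phi> d r X)) \<cdot>\<^bsub>T\<^esub> SM (- d - e) (\<phi> e s X)"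
    using SM_cmp[OF X SO_in[OF X] SO_in[OF X] phi_in[OF s X] h, of "- d - e"] phi_mult[OF r s X]
    by (simp add: rho_def)
  also have "SM (- d - e) (SM e (\<phi> d r X)) = rh d r X"
    using SM_SM[OF phi_in[OF r X] X SO_in[OF X], of "- d - e" e] by (simp add: rho_def)
  also have "SM (- d - e) (\<phi> e s X) = SM (- d) (rh e s X)"
    using SM_SM[OF phi_in[OF s X] X SO_in[OF X], of "- d" "- e"] by (simp add: rho_def)
  finally show ?thesis .
qed

text \<open>Naturality of the action of \<open>r\<close> along the map \<open>rh e s X\<close>
  trades a suspended factor for the action of \<open>r\<close> on a shifted object. In this order a
  contravariant functor turns composition into the module law.\<close>

lemma rho_mult':
  assumes r: "r \<in> A d" and s: "s \<in> A e" and X: "X \<in> obj T"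
  shows "rh (d + e) (r \<otimes>\<^bsub>R\<^esub> s) X = rh e s X \<cdot>\<^bsub>T\<^esub> rh d r (SO (- e) X)"
  using rho_mult[OF r s X] rho_natural[OF r _ X rho_in[OF s X]] X by simp

lemma rho_one: "X \<in> obj T \<Longrightarrow> rh 0 \<one>\<^bsub>R\<^esub> X = idn T X"
  by (simp add: rho_def phi_one)

lemma rho_add:
  assumes r: "r \<in> A d" and s: "s \<in> A d" and X: "X \<in> obj T"
  shows "rh d (r \<oplus>\<^bsub>R\<^esub> s) X = rh d r X \<otimes>\<^bsub>Hom T (SO (- d) X) X\<^esub> rh d s X"
  using SM_mult[OF X SO_in[OF X] phi_in[OF r X] phi_in[OF s X], of "- d"] phi_add[OF r s X] SO_SO[OF X, of "- d" d]
  by (simp add: rho_def)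

lemma rho_zero:
  assumes X: "X \<in> obj T" shows "rh d \<zero>\<^bsub>R\<^esub> X = zer (SO (- d) X) X"
proof -
  interpret G: group "Hom T (SO (- d) X) X" using hom_grp X by simp
  have "rh d \<zero>\<^bsub>R\<^esub> X \<otimes>\<^bsub>Hom T (SO (- d) X) X\<^esub> rh d \<zero>\<^bsub>R\<^esub> X = rh d \<zero>\<^bsub>R\<^esub> X"
    using rho_add[OF zero_degree zero_degree X, of d] by simp
  then show ?thesis using G.r_cancel_one rho_in[OF zero_degree X, of d] by blast
qed

lemma rho_minus:
  assumes r: "r \<in> A d" and X: "X \<in> obj T"
  shows "rh d (\<ominus>\<^bsub>R\<^esub> r) X = inv\<^bsub>Hom T (SO (- d) X) X\<^esub> (rh d r X)"
proof -
  interpret G: group "Hom T (SO (- d) X) X" using hom_grp X by simp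
  have m: "\<ominus>\<^bsub>R\<^esub> r \<in> A d" using additive_subgroup.a_inv_closed[OF subgroup_degree r] .
  have "rh d (\<ominus>\<^bsub>R\<^esub> r) X \<otimes>\<^bsub>Hom T (SO (- d) X) X\<^esub> rh d r X = zer (SO (- d) X) X"
    using rho_add[OF m r X] rho_zero[OF X, of d] l_neg[OF degree_carrier[OF r]] by simp
  then show ?thesis using G.inv_equality rho_in[OF r X] rho_in[OF m X] by metis
qed

text \<open>The sign in the following lemma is \<open>(-1)\<^sup>d\<^sup>k\<close>, but it is irrelevant.\<close>

lemma rho_SO:
  assumes r: "r \<in> A d" and X: "X \<in> obj T"
  shows "rh d r (SO k X) = SM k (rh d r X) \<or>
    rh d r (SO k X) = inv\<^bsub>Hom T (SO (k - d) X) (SO k X)\<^esub> (SM k (rh d r X))"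
proof -
  have susp: "rh d r (susp_obj T Y) = susp_mor T (rh d r Y) \<or>
    rh d r (susp_obj T Y) = inv\<^bsub>Hom T (SO (1 - d) Y) (SO 1 Y)\<^esub> (susp_mor T (rh d r Y))" if Y: "Y \<in> obj T" for Y
  proof -
    have p: "susp_mor T (\<phi> d r Y) \<in> hom_set T (susp_obj T Y) (SO d (susp_obj T Y))"
      using susp_mor_in[OF Y SO_in[OF Y] phi_in[OF r Y]] SO_SO[OF Y, of 1 d] SO_SO[OF Y, of d 1]
      by (simp add: ac_simps)
    have "SM (- d) (susp_mor T (\<phi> d r Y)) = susp_mor T (rh d r Y)"
      using SM_SM[OF phi_in[OF r Y] Y SO_in[OF Y], of "- d" 1] SM_SM[OF phi_in[OF r Y] Y SO_in[OF Y], of 1 "- d"]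
      by (simp add: rho_def ac_simps)
    moreover have "SM (- d) (inv\<^bsub>Hom T (susp_obj T Y) (SO d (susp_obj T Y))\<^esub> (susp_mor T (\<phi> d r Y))) =
      inv\<^bsub>Hom T (SO (1 - d) Y) (SO 1 Y)\<^esub> (SM (- d) (susp_mor T (\<phi> d r Y)))"
      using SM_inv[OF susp_in[OF Y] SO_in[OF susp_in[OF Y]] p, of "- d"] SO_SO[OF Y, of "- d" 1]
        SO_SO[OF susp_in[OF Y], of "- d" d] by (simp add: ac_simps)
    ultimately show ?thesis using phi_susp[OF r Y] by (auto simp: rho_def sgn_act_def)
  qed
  have rk: "SM k (rh d r Y) \<in> hom_set T (SO (k - d) Y) (SO k Y)" if Y: "Y \<in> obj T" for Y k
    using SM_in[OF SO_in[OF Y] Y rho_in[OF r Y], of k] SO_SO[OF Y, of k "- d"] by simp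
  have rk': "rh d r (SO k Y) \<in> hom_set T (SO (k - d) Y) (SO k Y)" if Y: "Y \<in> obj T" for Y k
    using rho_in[OF r SO_in[OF Y], of k] SO_SO[OF Y, of "- d" k] by simp
  \<comment> \<open>An equivalence, so that one argument serves both directions of the integer
    induction.\<close>
  have step: "rh d r (SO k X) = SM k (rh d r X) \<or>
      rh d r (SO k X) = inv\<^bsub>Hom T (SO (k - d) X) (SO k X)\<^esub> (SM k (rh d r X)) \<longleftrightarrow>
    (rh d r (SO (k + 1) X) = SM (k + 1) (rh d r X) \<or>
      rh d r (SO (k + 1) X) = inv\<^bsub>Hom T (SO (k + 1 - d) X) (SO (k + 1) X)\<^esub> (SM (k + 1) (rh d r X)))" for k
  proof -
    let ?a = "SM k (rh d r X)" and ?b = "rh d r (SO k X)"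
    let ?G = "Hom T (SO (k - d) X) (SO k X)" and ?H = "Hom T (SO (k + 1 - d) X) (SO (k + 1) X)"
    have oX: "SO (k - d) X \<in> obj T" "SO k X \<in> obj T" "SO (k + 1 - d) X \<in> obj T" "SO (k + 1) X \<in> obj T"
      using X by auto
    have e: "SO (k + 1) X = susp_obj T (SO k X)" "SO (k + 1 - d) X = susp_obj T (SO (k - d) X)"
      using SO_succ[OF X, of k] SO_succ[OF X, of "k - d"] by (simp_all add: algebra_simps)
    have sa: "SM (k + 1) (rh d r X) = susp_mor T ?a"
      using SM_succ[OF SO_in[OF X] X rho_in[OF r X]] .
    have inv: "susp_mor T (inv\<^bsub>?G\<^esub> f) = inv\<^bsub>?H\<^esub> (susp_mor T f)" if "f \<in> carrier ?G" for f
      using group_hom.hom_inv[OF susp_mor_group_hom[OF oX(1,2)] that] e by simp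
    have H: "group ?H" and G: "group ?G" using hom_grp oX by auto
    have sbH: "susp_mor T ?b \<in> carrier ?H" "susp_mor T ?a \<in> carrier ?H"
      using susp_mor_in[OF oX(1,2) rk'[OF X]] susp_mor_in[OF oX(1,2) rk[OF X]] e by simp_all
    have "rh d r (SO (k + 1) X) = susp_mor T ?b \<or> rh d r (SO (k + 1) X) = inv\<^bsub>?H\<^esub> (susp_mor T ?b)"
      using susp[OF oX(2)] e SO_SO[OF X, of "1 - d" k] by (simp add: algebra_simps)
    then have "(rh d r (SO (k + 1) X) = susp_mor T ?a \<or> rh d r (SO (k + 1) X) = inv\<^bsub>?H\<^esub> (susp_mor T ?a)) \<longleftrightarrow>
      susp_mor T ?b = susp_mor T ?a \<or> susp_mor T ?b = inv\<^bsub>?H\<^esub> (susp_mor T ?a)"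
      using group.inv_inv[OF H sbH(1)] group.inv_inv[OF H sbH(2)] by metis
    also have "\<dots> \<longleftrightarrow> ?b = ?a \<or> ?b = inv\<^bsub>?G\<^esub> ?a"
      using inv[OF rk[OF X]] susp_mor_inj[OF oX(1,2) rk'[OF X]] rk[OF X, of k] group.inv_closed[OF G rk[OF X]]
      by metis
    finally show ?thesis unfolding sa by blast
  qed
  show ?thesis
  proof (induction k rule: int_induct[where k = 0])
    case base then show ?case by simp
  next
    case (step1 i) then show ?case using step[of i] by blast
  next
    case (step2 i) then show ?case using step[of "i - 1"] by simp
  qed
qed

lemma rho_SO_zer:
  assumes r: "r \<in> A d" and X: "X \<in> obj T" and z: "rh d r X = zer (SO (- d) X) X"
  shows "rh d r (SO k X) = zer (SO (- d) (SO k X)) (SO k X)"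
proof -
  have "SM k (rh d r X) = zer (SO (k - d) X) (SO k X)"
    using SM_zer[OF SO_in[OF X] X, of k "- d"] z SO_SO[OF X, of k "- d"] by simp
  moreover have "inv\<^bsub>Hom T (SO (k - d) X) (SO k X)\<^esub> (zer (SO (k - d) X) (SO k X)) = zer (SO (k - d) X) (SO k X)"
    using monoid.inv_one[OF group.is_monoid[OF hom_grp]] X by simp
  ultimately show ?thesis using rho_SO[OF r X, of k] SO_SO[OF X, of "- d" k] by auto
qed

end

section \<open>Localisation of graded modules\<close>

locale graded_module = graded_commutative_ring R A
  for R :: "('r, 'x) ring_scheme" (structure) and A :: "int \<Rightarrow> 'r set" +
  fixes M :: "int \<Rightarrow> 'a monoid" and act :: "int \<Rightarrow> int \<Rightarrow> 'r \<Rightarrow> 'a \<Rightarrow> 'a"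
  assumes part_group: "comm_group (M n)"
    and act_hom: "r \<in> A d \<Longrightarrow> act d n r \<in> hom (M n) (M (n + d))"
    and act_one: "x \<in> carrier (M n) \<Longrightarrow> act 0 n \<one> x = x"
    and act_mult: "\<lbrakk>r \<in> A d; s \<in> A e; x \<in> carrier (M n)\<rbrakk> \<Longrightarrow>
      act (d + e) n (r \<otimes> s) x = act d (n + e) r (act e n s x)"
    and act_minus: "\<lbrakk>r \<in> A d; x \<in> carrier (M n)\<rbrakk> \<Longrightarrow> act d n (\<ominus> r) x = inv\<^bsub>M (n + d)\<^esub> (act d n r x)"
begin

text \<open>Carrying the degree along with each element of the ring and of the module avoids transport
  between equal but differently written degrees.\<close>

definition H :: "(int \<times> 'r) set" where "H = {a. snd a \<in> A (fst a)}"
definition E :: "(int \<times> 'a) set" where "E = {X. snd X \<in> carrier (M (fst X))}"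
definition dt :: "int \<times> 'r \<Rightarrow> int \<times> 'a \<Rightarrow> int \<times> 'a"
  where "dt a X = (fst X + fst a, act (fst a) (fst X) (snd a) (snd X))"
definition sg :: "int \<Rightarrow> int \<times> 'a \<Rightarrow> int \<times> 'a"
  where "sg k X = (fst X, sgn_act (M (fst X)) k (snd X))"
definition pl :: "int \<times> 'a \<Rightarrow> int \<times> 'a \<Rightarrow> int \<times> 'a"
  where "pl X Y = (fst X, snd X \<otimes>\<^bsub>M (fst X)\<^esub> snd Y)"
definition mu :: "int \<times> 'r \<Rightarrow> int \<times> 'r \<Rightarrow> int \<times> 'r"
  where "mu a b = (fst a + fst b, snd a \<otimes> snd b)"

lemma part_grp: "group (M n)"
  using part_group comm_group.axioms(2) by blast

lemma act_group_hom: "r \<in> A d \<Longrightarrow> group_hom (M n) (M (n + d)) (act d n r)"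
  by (simp add: group_hom_def group_hom_axioms_def part_grp act_hom)

lemma fst_dt [simp]: "fst (dt a X) = fst X + fst a"
  and fst_sg [simp]: "fst (sg k X) = fst X"
  and fst_pl [simp]: "fst (pl X Y) = fst X"
  and fst_mu [simp]: "fst (mu a b) = fst a + fst b"
  by (simp_all add: dt_def sg_def pl_def mu_def)

lemma mu_in [simp]: "\<lbrakk>a \<in> H; b \<in> H\<rbrakk> \<Longrightarrow> mu a b \<in> H"
  using mult_degree by (auto simp: H_def mu_def)

lemma dt_in [simp]: "\<lbrakk>a \<in> H; X \<in> E\<rbrakk> \<Longrightarrow> dt a X \<in> E"
  using act_hom by (force simp: H_def E_def dt_def hom_def)

lemma sg_in [simp]: "X \<in> E \<Longrightarrow> sg k X \<in> E"
  using group.inv_closed[OF part_grp] by (auto simp: E_def sg_def sgn_act_def)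

lemma pl_in [simp]: "\<lbrakk>X \<in> E; Y \<in> E; fst Y = fst X\<rbrakk> \<Longrightarrow> pl X Y \<in> E"
  using monoid.m_closed[OF group.is_monoid[OF part_grp]] by (auto simp: E_def pl_def)

lemma dt_mu: "\<lbrakk>a \<in> H; b \<in> H; X \<in> E\<rbrakk> \<Longrightarrow> dt (mu a b) X = dt a (dt b X)"
  using act_mult by (auto simp: H_def E_def dt_def mu_def ac_simps)

lemma sg_sg [simp]: "X \<in> E \<Longrightarrow> sg j (sg k X) = sg (j + k) X"
  using group.inv_inv[OF part_grp] by (auto simp: E_def sg_def sgn_act_def)

lemma sg_cong: "even j \<longleftrightarrow> even k \<Longrightarrow> sg j X = sg k X"
  by (simp add: sg_def sgn_act_def)

lemma sg_even: "even k \<Longrightarrow> sg k X = X"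
  by (simp add: sg_def sgn_act_def)

lemma dt_sg [simp]: "\<lbrakk>a \<in> H; X \<in> E\<rbrakk> \<Longrightarrow> dt a (sg k X) = sg k (dt a X)"
  using group_hom.hom_inv[OF act_group_hom] by (auto simp: H_def E_def dt_def sg_def sgn_act_def)

lemma dt_pl: "\<lbrakk>a \<in> H; X \<in> E; Y \<in> E; fst Y = fst X\<rbrakk> \<Longrightarrow> dt a (pl X Y) = pl (dt a X) (dt a Y)"
  using group_hom.hom_mult[OF act_group_hom] by (auto simp: H_def E_def dt_def pl_def)

lemma sg_pl: "\<lbrakk>X \<in> E; Y \<in> E; fst Y = fst X\<rbrakk> \<Longrightarrow> sg k (pl X Y) = pl (sg k X) (sg k Y)"
  using comm_group.inv_mult[OF part_group] by (auto simp: E_def sg_def pl_def sgn_act_def)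

lemma pl_comm: "\<lbrakk>X \<in> E; Y \<in> E; fst Y = fst X\<rbrakk> \<Longrightarrow> pl X Y = pl Y X"
  using comm_monoid.m_comm[OF comm_group.axioms(1)[OF part_group]] by (auto simp: E_def pl_def)

lemma dt_swap: assumes "a \<in> H" "b \<in> H" "X \<in> E" shows "dt a (dt b X) = sg (fst a * fst b) (dt b (dt a X))"
proof -
  obtain d r where a: "a = (d, r)" "r \<in> A d" using assms by (cases a) (auto simp: H_def)
  obtain e s where b: "b = (e, s)" "s \<in> A e" using assms by (cases b) (auto simp: H_def)
  have "dt (mu a b) X = sg (d * e) (dt (mu b a) X)"
  proof -
    have *: "s \<otimes> r \<in> A (e + d)" using mult_degree a b by blast
    have "snd X \<in> carrier (M (fst X))" using assms by (simp add: E_def)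
    then show ?thesis using act_minus[OF *, of "snd X" "fst X"] graded_comm[OF a(2) b(2)]
      by (auto simp: dt_def sg_def mu_def a b sgn_act_def ac_simps)
  qed
  then show ?thesis using assms a b dt_mu by simp
qed

text \<open>Swapping \<open>a\<close> with itself costs a sign of the parity of its degree, so the
  double action of an odd element equals its own negative. Sign discrepancies of that parity are
  absorbed below by arranging for such a double action.\<close>

lemma dt_square: assumes "a \<in> H" "X \<in> E" shows "sg (fst a) (dt a (dt a X)) = dt a (dt a X)"
proof -
  have "dt a (dt a X) = sg (fst a * fst a) (dt a (dt a X))" using dt_swap assms by blast
  also have "\<dots> = sg (fst a) (dt a (dt a X))" by (rule sg_cong) simp
  finally show ?thesis by simp
qed

end

section \<open>Equivalence of fractions and their addition\<close>

locale module_localisation = graded_module R A M act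
  for R :: "('r, 'x) ring_scheme" (structure) and A :: "int \<Rightarrow> 'r set"
    and M :: "int \<Rightarrow> 'a monoid" and act +
  fixes p :: "'r set"
  assumes one_notin: "\<one> \<notin> p"
    and mult_notin: "\<lbrakk>r \<in> A d; r \<notin> p; s \<in> A e; s \<notin> p\<rbrakk> \<Longrightarrow> r \<otimes> s \<notin> p"
begin

definition S :: "(int \<times> 'r) set" where "S = {a \<in> H. snd a \<notin> p}"

lemma S_H [simp]: "a \<in> S \<Longrightarrow> a \<in> H" by (simp add: S_def)

lemma mu_S [simp]: "\<lbrakk>a \<in> S; b \<in> S\<rbrakk> \<Longrightarrow> mu a b \<in> S"
  using mult_notin by (auto simp: S_def H_def mu_def mult_degree)

text \<open>This is \<open>frac_rel\<close> read through the encoding \<open>enc\<close>, in which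
  numerators and denominators carry their degrees.\<close>

definition eqv :: "(int \<times> 'r) \<times> (int \<times> 'a) \<Rightarrow> (int \<times> 'r) \<times> (int \<times> 'a) \<Rightarrow> bool"
  where "eqv P Q \<longleftrightarrow> (\<exists>w\<in>S. dt w (dt (fst Q) (snd P)) =
    sg (fst (fst P) * fst (fst Q)) (dt w (dt (fst P) (snd Q))))"

context
  fixes n :: int
begin

definition Fr :: "((int \<times> 'r) \<times> (int \<times> 'a)) set"
  where "Fr = {(a, X). a \<in> S \<and> X \<in> E \<and> fst X = n + fst a}"

definition op :: "(int \<times> 'r) \<times> (int \<times> 'a) \<Rightarrow> (int \<times> 'r) \<times> (int \<times> 'a) \<Rightarrow> (int \<times> 'r) \<times> (int \<times> 'a)"
  where "op P Q = (mu (fst Q) (fst P), pl (dt (fst Q) (snd P)) (sg (fst (fst P) * fst (fst Q)) (dt (fst P) (snd Q))))"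

lemma FrE: "P \<in> Fr \<Longrightarrow> fst P \<in> S \<and> snd P \<in> E \<and> fst (snd P) = n + fst (fst P)"
  by (auto simp: Fr_def)

lemma op_in: "\<lbrakk>P \<in> Fr; Q \<in> Fr\<rbrakk> \<Longrightarrow> op P Q \<in> Fr"
  by (auto simp: Fr_def op_def)

lemma eqv_refl: assumes "P \<in> Fr" shows "eqv P P"
proof -
  obtain a X where P: "P = (a, X)" "a \<in> S" "X \<in> E" using assms by (auto simp: Fr_def)
  have "sg (fst a * fst a) (dt a (dt a X)) = sg (fst a) (dt a (dt a X))" by (rule sg_cong) simp
  then have "sg (fst a * fst a) (dt a (dt a X)) = dt a (dt a X)" using dt_square P by simp
  moreover from this have "dt a (dt a X) = sg (fst a * fst a) (dt a (dt a X))" by simp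
  ultimately show ?thesis using P unfolding eqv_def by auto
qed

lemma eqv_sym: assumes "P \<in> Fr" "Q \<in> Fr" "eqv P Q" shows "eqv Q P"
proof -
  obtain w where w: "w \<in> S" and eq: "dt w (dt (fst Q) (snd P)) =
    sg (fst (fst P) * fst (fst Q)) (dt w (dt (fst P) (snd Q)))"
    using assms unfolding eqv_def by blast
  have "sg (fst (fst Q) * fst (fst P)) (dt w (dt (fst Q) (snd P))) =
    sg (2 * (fst (fst Q) * fst (fst P))) (dt w (dt (fst P) (snd Q)))"
    using eq w FrE[OF assms(1)] FrE[OF assms(2)] by (simp add: mult.commute)
  also have "\<dots> = dt w (dt (fst P) (snd Q))" by (rule sg_even) simp
  finally show ?thesis using w unfolding eqv_def by metis
qed

text \<open>The new witness is the product of the two given witnesses with the middle denominator,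
  in the order \<open>v\<close>, \<open>w\<close>, \<open>b\<close>. Each step moves one factor past
  another or uses one of the hypotheses; the exponents of the signs are collected, and only their
  parity is compared at the end.\<close>

lemma eqv_trans: assumes "P \<in> Fr" "Q \<in> Fr" "L \<in> Fr" "eqv P Q" "eqv Q L" shows "eqv P L"
proof -
  obtain a X where P: "P = (a, X)" "a \<in> S" "X \<in> E" using assms by (auto simp: Fr_def)
  obtain b Y where Q: "Q = (b, Y)" "b \<in> S" "Y \<in> E" using assms by (auto simp: Fr_def)
  obtain c Z where L: "L = (c, Z)" "c \<in> S" "Z \<in> E" using assms by (auto simp: Fr_def)
  obtain w where w: "w \<in> S" "dt w (dt b X) = sg (fst a * fst b) (dt w (dt a Y))"
    using assms(4) P Q unfolding eqv_def by auto
  obtain v where v: "v \<in> S" "dt v (dt c Y) = sg (fst b * fst c) (dt v (dt b Z))"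
    using assms(5) L Q unfolding eqv_def by auto
  note m = P Q L w(1) v(1)
  let ?a = "fst a" and ?b = "fst b" and ?c = "fst c" and ?w = "fst w" and ?v = "fst v"
  have "dt v (dt w (dt b (dt c X))) = sg (?b * ?c) (dt v (dt w (dt c (dt b X))))"
    using m dt_swap[of b c X] by simp
  also have "\<dots> = sg (?b * ?c + ?w * ?c) (dt v (dt c (dt w (dt b X))))"
    using m dt_swap[of w c "dt b X"] by simp
  also have "\<dots> = sg (?b * ?c + ?w * ?c + ?a * ?b) (dt v (dt c (dt w (dt a Y))))"
    using m w(2) by simp
  also have "\<dots> = sg (?b * ?c + ?w * ?c + ?a * ?b + ?c * ?w) (dt v (dt w (dt c (dt a Y))))"
    using m dt_swap[of c w "dt a Y"] by simp
  also have "\<dots> = sg (?b * ?c + ?w * ?c + ?a * ?b + ?c * ?w + ?c * ?a) (dt v (dt w (dt a (dt c Y))))"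
    using m dt_swap[of c a Y] by simp
  also have "\<dots> = sg (?b * ?c + ?w * ?c + ?a * ?b + ?c * ?w + ?c * ?a + ?v * ?w) (dt w (dt v (dt a (dt c Y))))"
    using m dt_swap[of v w "dt a (dt c Y)"] by simp
  also have "\<dots> = sg (?b * ?c + ?w * ?c + ?a * ?b + ?c * ?w + ?c * ?a + ?v * ?w + ?v * ?a) (dt w (dt a (dt v (dt c Y))))"
    using m dt_swap[of v a "dt c Y"] by simp
  also have "\<dots> = sg (?b * ?c + ?w * ?c + ?a * ?b + ?c * ?w + ?c * ?a + ?v * ?w + ?v * ?a + ?b * ?c)
      (dt w (dt a (dt v (dt b Z))))"
    using m v(2) by simp
  also have "\<dots> = sg (?b * ?c + ?w * ?c + ?a * ?b + ?c * ?w + ?c * ?a + ?v * ?w + ?v * ?a + ?b * ?c + ?a * ?v)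
      (dt w (dt v (dt a (dt b Z))))"
    using m dt_swap[of a v "dt b Z"] by simp
  also have "\<dots> = sg (?b * ?c + ?w * ?c + ?a * ?b + ?c * ?w + ?c * ?a + ?v * ?w + ?v * ?a + ?b * ?c + ?a * ?v + ?w * ?v)
      (dt v (dt w (dt a (dt b Z))))"
    using m dt_swap[of w v "dt a (dt b Z)"] by simp
  also have "\<dots> = sg (?b * ?c + ?w * ?c + ?a * ?b + ?c * ?w + ?c * ?a + ?v * ?w + ?v * ?a + ?b * ?c + ?a * ?v + ?w * ?v + ?a * ?b)
      (dt v (dt w (dt b (dt a Z))))"
    using m dt_swap[of a b Z] by simp
  also have "\<dots> = sg (?a * ?c) (dt v (dt w (dt b (dt a Z))))"
    by (rule sg_cong) auto
  finally have "dt (mu v (mu w b)) (dt c X) = sg (?a * ?c) (dt (mu v (mu w b)) (dt a Z))"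
    using m by (simp add: dt_mu)
  then show ?thesis using m unfolding eqv_def by (intro bexI[of _ "mu v (mu w b)"]) auto
qed

text \<open>Taking the denominator \<open>a\<close> itself as the witness creates a double action of
  \<open>a\<close>, which absorbs the sign left over from moving \<open>b\<close> past
  \<open>a\<close>.\<close>

lemma eqv_expand: assumes "(a, X) \<in> Fr" "b \<in> S" shows "(mu b a, dt b X) \<in> Fr" "eqv (a, X) (mu b a, dt b X)"
proof -
  have m: "a \<in> S" "X \<in> E" using assms by (auto simp: Fr_def)
  show "(mu b a, dt b X) \<in> Fr" using assms by (auto simp: Fr_def)
  let ?a = "fst a" and ?b = "fst b"
  have "dt a (dt b (dt a X)) = sg (?a * ?b) (dt b (dt a (dt a X)))"
    using m assms dt_swap[of a b "dt a X"] by simp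
  also have "\<dots> = sg (?a * ?b + ?a) (dt b (dt a (dt a X)))"
    using m assms dt_square[of a X] dt_sg[of b "dt a (dt a X)" ?a] by (metis S_H dt_in sg_sg)
  also have "\<dots> = sg (?a * ?b + ?a + ?b * ?a) (dt a (dt b (dt a X)))"
    using m assms dt_swap[of b a "dt a X"] by simp
  also have "\<dots> = sg (?a * ?b + ?a + ?b * ?a + ?b * ?a) (dt a (dt a (dt b X)))"
    using m assms dt_swap[of b a X] by simp
  also have "\<dots> = sg (?a * (?b + ?a)) (dt a (dt a (dt b X)))"
    by (rule sg_cong) auto
  finally show "eqv (a, X) (mu b a, dt b X)"
    using m assms unfolding eqv_def by (intro bexI[of _ a]) (auto simp: dt_mu)
qed

text \<open>The two products of the denominators agree up to a sign, which moves into the numerator.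
  The witness is again the denominator, so that its double action takes care of the remaining
  parity.\<close>

lemma eqv_mu_swap: assumes "(mu b a, X) \<in> Fr" "a \<in> S" "b \<in> S"
  shows "eqv (mu b a, X) (mu a b, sg (fst a * fst b) X)"
proof -
  have m: "X \<in> E" using assms by (auto simp: Fr_def)
  let ?a = "fst a" and ?b = "fst b" and ?c = "mu a b"
  have "dt ?c (dt ?c X) = sg (?a + ?b) (dt ?c (dt ?c X))" using dt_square[of ?c X] m assms by simp
  also have "\<dots> = sg (?a + ?b) (dt ?c (dt a (dt b X)))" using m assms by (simp add: dt_mu)
  also have "\<dots> = sg (?a + ?b + ?a * ?b) (dt ?c (dt b (dt a X)))"
    using m assms dt_swap[of a b X] by simp
  also have "\<dots> = sg ((?b + ?a) * (?a + ?b) + ?a * ?b) (dt ?c (dt b (dt a X)))"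
    by (rule sg_cong) auto
  finally show ?thesis
    using m assms unfolding eqv_def by (intro bexI[of _ ?c]) (auto simp: dt_mu)
qed

text \<open>Over a common denominator \<open>a\<close> the formula for the sum carries the sign
  belonging to the square of the degree of \<open>a\<close>. It disappears once \<open>a\<close>
  acts twice on the numerators.\<close>

lemma op_same: assumes "(a, X) \<in> Fr" "(a, Y) \<in> Fr" shows "eqv (op (a, X) (a, Y)) (a, pl X Y)"
proof -
  have m: "a \<in> S" "X \<in> E" "Y \<in> E" "fst Y = fst X" using assms by (auto simp: Fr_def)
  let ?a = "fst a" and ?c = "mu a a"
  have Z: "pl X Y \<in> E" using m by simp
  have YY: "dt a (dt a (sg (?a * ?a) (dt a Y))) = dt a (dt a (dt a Y))"
    using m dt_square[of a "dt a Y"] sg_cong[of "?a * ?a" ?a "dt a (dt a (dt a Y))"] by simp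
  have "dt a (dt a (pl (dt a X) (sg (?a * ?a) (dt a Y)))) = dt a (dt a (dt a (pl X Y)))"
    using m YY dt_pl[of a "dt a X" "sg (?a * ?a) (dt a Y)"]
      dt_pl[of a "dt a (dt a X)" "dt a (sg (?a * ?a) (dt a Y))"]
      dt_pl[of a X Y] dt_pl[of a "dt a X" "dt a Y"] dt_pl[of a "dt a (dt a X)" "dt a (dt a Y)"]
    by simp
  also have "\<dots> = sg ((?a + ?a) * ?a) (dt a (dt a (dt a (pl X Y))))"
    by (rule sg_even[symmetric]) auto
  finally show ?thesis
    using m Z unfolding eqv_def op_def by (intro bexI[of _ a]) (auto simp: dt_mu)
qed

lemma op_comm: assumes "P \<in> Fr" "Q \<in> Fr" shows "eqv (op P Q) (op Q P)"
proof -
  obtain a X where P: "P = (a, X)" "a \<in> S" "X \<in> E" "fst X = n + fst a" using assms by (auto simp: Fr_def)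
  obtain b Y where Q: "Q = (b, Y)" "b \<in> S" "Y \<in> E" "fst Y = n + fst b" using assms by (auto simp: Fr_def)
  let ?a = "fst a" and ?b = "fst b"
  let ?Z = "pl (dt b X) (sg (?a * ?b) (dt a Y))"
  have "sg (?a * ?b) ?Z = pl (sg (?a * ?b) (dt b X)) (sg (2 * (?a * ?b)) (dt a Y))"
    using P Q sg_pl[of "dt b X" "sg (?a * ?b) (dt a Y)" "?a * ?b"] by simp
  also have "\<dots> = pl (dt a Y) (sg (?b * ?a) (dt b X))"
    using P Q pl_comm[of "dt a Y" "sg (?b * ?a) (dt b X)"] by (simp add: sg_even mult.commute)
  finally have e: "op Q P = (mu a b, sg (?a * ?b) ?Z)" using P Q by (simp add: op_def)
  have "op P Q = (mu b a, ?Z)" using P Q by (simp add: op_def)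
  then show ?thesis using eqv_mu_swap[of b a ?Z] e P Q op_in[OF assms] by simp
qed

text \<open>The witness is \<open>w\<close> times \<open>b\<close> and not \<open>w\<close> alone:
  together with the factor \<open>b\<close> in the new denominators it yields a double action of
  \<open>b\<close>, which absorbs a sign of the parity of \<open>b\<close>. The numerators stemming
  from \<open>P\<close>, \<open>P'\<close> and those stemming from \<open>Q\<close> are treated
  separately in \<open>xx\<close> and \<open>yy\<close>.\<close>

lemma op_cong1: assumes "P \<in> Fr" "P' \<in> Fr" "Q \<in> Fr" "eqv P P'" shows "eqv (op P Q) (op P' Q)"
proof -
  obtain a X where P: "P = (a, X)" "a \<in> S" "X \<in> E" "fst X = n + fst a" using assms by (auto simp: Fr_def)
  obtain c Z where P': "P' = (c, Z)" "c \<in> S" "Z \<in> E" "fst Z = n + fst c" using assms by (auto simp: Fr_def)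
  obtain b Y where Q: "Q = (b, Y)" "b \<in> S" "Y \<in> E" "fst Y = n + fst b" using assms by (auto simp: Fr_def)
  obtain w where w: "w \<in> S" "dt w (dt c X) = sg (fst a * fst c) (dt w (dt a Z))"
    using assms(4) P P' unfolding eqv_def by auto
  note m = P Q P' w(1)
  let ?a = "fst a" and ?b = "fst b" and ?c = "fst c" and ?w = "fst w"
  let ?s = "(?a + ?b) * (?c + ?b)"
  have sq: "sg (k + ?b) (dt w (dt b (dt b L))) = sg k (dt w (dt b (dt b L)))" if "L \<in> E" for L k
    using m that dt_square[of b L] dt_sg[of w "dt b (dt b L)" ?b] sg_sg[of "dt w (dt b (dt b L))" k ?b] by simp
  have w3: "dt w (dt b (dt b (dt b L))) = sg (?w * ?b) (dt b (dt b (dt b (dt w L))))" if "L \<in> E" for L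
  proof -
    have "dt w (dt b (dt b (dt b L))) = sg (?w * ?b + ?w * ?b + ?w * ?b) (dt b (dt b (dt b (dt w L))))"
      using m that dt_swap[of w b "dt b (dt b L)"] dt_swap[of w b "dt b L"] dt_swap[of w b L] by (simp add: add.assoc)
    also have "\<dots> = sg (?w * ?b) (dt b (dt b (dt b (dt w L))))" by (rule sg_cong) auto
    finally show ?thesis .
  qed
  have w3': "dt b (dt b (dt b (dt w L))) = sg (?w * ?b) (dt w (dt b (dt b (dt b L))))" if "L \<in> E" for L
  proof -
    have "sg (?w * ?b) (dt w (dt b (dt b (dt b L)))) = sg (?w * ?b + ?w * ?b) (dt b (dt b (dt b (dt w L))))"
      using m that w3[OF that] by simp
    also have "\<dots> = dt b (dt b (dt b (dt w L)))" by (rule sg_even) simp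
    finally show ?thesis by simp
  qed
  have xx: "dt w (dt b (dt b (dt c (dt b X)))) = sg ?s (dt w (dt b (dt b (dt a (dt b Z)))))"
  proof -
    have "dt w (dt b (dt b (dt c (dt b X)))) = sg (?c * ?b) (dt w (dt b (dt b (dt b (dt c X)))))"
      using m dt_swap[of c b X] by simp
    also have "\<dots> = sg (?c * ?b + ?w * ?b) (dt b (dt b (dt b (dt w (dt c X)))))" using m w3[of "dt c X"] by simp
    also have "\<dots> = sg (?c * ?b + ?w * ?b + ?a * ?c) (dt b (dt b (dt b (dt w (dt a Z)))))" using m w(2) by simp
    also have "\<dots> = sg (?c * ?b + ?w * ?b + ?a * ?c + ?w * ?b) (dt w (dt b (dt b (dt b (dt a Z)))))"
      using m w3'[of "dt a Z"] by simp
    also have "\<dots> = sg (?c * ?b + ?w * ?b + ?a * ?c + ?w * ?b + ?b * ?a) (dt w (dt b (dt b (dt a (dt b Z)))))"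
      using m dt_swap[of b a Z] by simp
    also have "\<dots> = sg (?c * ?b + ?w * ?b + ?a * ?c + ?w * ?b + ?b * ?a + ?b) (dt w (dt b (dt b (dt a (dt b Z)))))"
      using sq[of "dt a (dt b Z)"] m by simp
    also have "\<dots> = sg ?s (dt w (dt b (dt b (dt a (dt b Z)))))" by (rule sg_cong) auto
    finally show ?thesis .
  qed
  have yy: "dt w (dt b (dt b (dt c (sg (?a * ?b) (dt a Y))))) = sg ?s (dt w (dt b (dt b (dt a (sg (?c * ?b) (dt c Y))))))"
  proof -
    have "dt w (dt b (dt b (dt c (sg (?a * ?b) (dt a Y))))) = sg (?a * ?b + ?c * ?a) (dt w (dt b (dt b (dt a (dt c Y)))))"
      using m dt_swap[of c a Y] by simp
    also have "\<dots> = sg (?a * ?b + ?c * ?a + ?b) (dt w (dt b (dt b (dt a (dt c Y)))))"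
      using sq[of "dt a (dt c Y)"] m by simp
    also have "\<dots> = sg (?s + ?c * ?b) (dt w (dt b (dt b (dt a (dt c Y)))))" by (rule sg_cong) auto
    also have "\<dots> = sg ?s (dt w (dt b (dt b (dt a (sg (?c * ?b) (dt c Y))))))" using m by simp
    finally show ?thesis .
  qed
  have dist: "dt w (dt b (dt b (dt e (pl K L)))) = pl (dt w (dt b (dt b (dt e K)))) (dt w (dt b (dt b (dt e L))))"
    if "e \<in> S" "K \<in> E" "L \<in> E" "fst L = fst K" for e K L
    using that m by (simp add: dt_pl)
  have "dt (mu w b) (dt (mu b c) (pl (dt b X) (sg (?a * ?b) (dt a Y)))) =
      sg ?s (dt (mu w b) (dt (mu b a) (pl (dt b Z) (sg (?c * ?b) (dt c Y)))))"
    using m xx yy dist[of c "dt b X" "sg (?a * ?b) (dt a Y)"] dist[of a "dt b Z" "sg (?c * ?b) (dt c Y)"]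
    by (simp add: dt_mu sg_pl)
  then show ?thesis
    using m unfolding eqv_def op_def by (intro bexI[of _ "mu w b"]) (auto simp: add.commute)
qed

lemma op_cong2: assumes "P \<in> Fr" "Q \<in> Fr" "Q' \<in> Fr" "eqv Q Q'" shows "eqv (op P Q) (op P Q')"
  using op_comm[OF assms(1,2)] op_cong1[OF assms(2,3,1,4)] op_comm[OF assms(3,1)]
    eqv_trans op_in assms by metis

end

section \<open>The groups of fractions\<close>

definition enc :: "int \<Rightarrow> int \<times> 'r \<times> 'a \<Rightarrow> (int \<times> 'r) \<times> (int \<times> 'a)"
  where "enc n = (\<lambda>(d, s, x). ((d, s), (n + d, x)))"

definition frac :: "int \<Rightarrow> int \<Rightarrow> 'r \<Rightarrow> 'a \<Rightarrow> (int \<times> 'r \<times> 'a) set"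
  where "frac n d s x = frac_rel A p M act n `` {(d, s, x)}"

definition opt :: "int \<Rightarrow> int \<times> 'r \<times> 'a \<Rightarrow> int \<times> 'r \<times> 'a \<Rightarrow> int \<times> 'r \<times> 'a"
  where "opt n = (\<lambda>(d, s, x) (e, t, y). (d + e, t \<otimes> s, act e (n + d) t x \<otimes>\<^bsub>M (n + d + e)\<^esub>
             sgn_act (M (n + d + e)) (d * e) (act d (n + e) s y)))"

lemma enc_Fr: "enc n a \<in> Fr n \<longleftrightarrow> a \<in> fractions A p M n"
  by (auto simp: enc_def Fr_def S_def H_def E_def fractions_def)

lemma enc_opt: "enc n (opt n a b) = op (enc n a) (enc n b)"
  by (cases a; cases b) (simp add: enc_def opt_def op_def mu_def pl_def dt_def sg_def ac_simps)

lemma frac_rel_eqv: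
  "(a, b) \<in> frac_rel A p M act n \<longleftrightarrow> a \<in> fractions A p M n \<and> b \<in> fractions A p M n \<and> eqv (enc n a) (enc n b)"
proof -
  obtain d s x e t y where ab: "a = (d, s, x)" "b = (e, t, y)" by (cases a, cases b) auto
  have e: "eqv (enc n a) (enc n b) \<longleftrightarrow> (\<exists>k. \<exists>w \<in> A k - p. act k (n + d + e) w (act e (n + d) t x) =
          act k (n + d + e) w (sgn_act (M (n + d + e)) (d * e) (act d (n + e) s y)))"
    if "a \<in> fractions A p M n" "b \<in> fractions A p M n"
  proof -
    have m: "(d, s) \<in> H" "(n + e, y) \<in> E" using that ab by (auto simp: fractions_def H_def E_def)
    have "eqv (enc n a) (enc n b) \<longleftrightarrow> (\<exists>w\<in>S. dt w (dt (e, t) (n + d, x)) = dt w (sg (d * e) (dt (d, s) (n + e, y))))"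
      using m by (auto simp: eqv_def enc_def ab)
    also have "\<dots> \<longleftrightarrow> (\<exists>k. \<exists>w \<in> A k - p. dt (k, w) (dt (e, t) (n + d, x)) = dt (k, w) (sg (d * e) (dt (d, s) (n + e, y))))"
      by (force simp: S_def H_def)
    finally show ?thesis by (simp add: dt_def sg_def ac_simps)
  qed
  show ?thesis using e by (auto simp: frac_rel_def ab)
qed

lemma equiv_frac_rel: "equiv (fractions A p M n) (frac_rel A p M act n)"
proof (rule equivI)
  show "frac_rel A p M act n \<subseteq> fractions A p M n \<times> fractions A p M n"
    by (auto simp: frac_rel_def)
  show "refl_on (fractions A p M n) (frac_rel A p M act n)"
    using eqv_refl enc_Fr unfolding refl_on_def frac_rel_eqv by blast
  show "sym (frac_rel A p M act n)"
    using eqv_sym enc_Fr unfolding sym_def frac_rel_eqv by blast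
  show "trans (frac_rel A p M act n)"
    using eqv_trans enc_Fr unfolding trans_def frac_rel_eqv by blast
qed

abbreviation L :: "int \<Rightarrow> (int \<times> 'r \<times> 'a) set monoid"
  where "L n \<equiv> localised_part R A p M act n"

lemma frac_in: "\<lbrakk>s \<in> A d; s \<notin> p; x \<in> carrier (M (n + d))\<rbrakk> \<Longrightarrow> frac n d s x \<in> carrier (L n)"
  by (auto simp: localised_part_def frac_def fractions_def intro!: quotientI)

lemma frac_cases:
  assumes "C \<in> carrier (L n)"
  obtains d s x where "s \<in> A d" "s \<notin> p" "x \<in> carrier (M (n + d))" "C = frac n d s x"
  using assms by (auto simp: localised_part_def frac_def fractions_def elim!: quotientE)

lemma frac_eq_iff:
  "\<lbrakk>(d, s, x) \<in> fractions A p M n; (e, t, y) \<in> fractions A p M n\<rbrakk> \<Longrightarrow>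
    frac n d s x = frac n e t y \<longleftrightarrow> eqv (enc n (d, s, x)) (enc n (e, t, y))"
  unfolding frac_def by (subst eq_equiv_class_iff[OF equiv_frac_rel]) (auto simp: frac_rel_eqv)

lemma frac_self: "(d, s, x) \<in> fractions A p M n \<Longrightarrow> (d, s, x) \<in> frac n d s x"
  unfolding frac_def using equiv_class_self[OF equiv_frac_rel] by blast

lemma opt_cong:
  assumes "a \<in> fractions A p M n" "a' \<in> fractions A p M n" "b \<in> fractions A p M n" "b' \<in> fractions A p M n"
    "eqv (enc n a) (enc n a')" "eqv (enc n b) (enc n b')"
  shows "frac_rel A p M act n `` {opt n a b} = frac_rel A p M act n `` {opt n a' b'}"
proof -
  have e: "enc n a \<in> Fr n" "enc n a' \<in> Fr n" "enc n b \<in> Fr n" "enc n b' \<in> Fr n"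
    using assms enc_Fr by auto
  have i: "op (enc n a) (enc n b) \<in> Fr n" "op (enc n a') (enc n b) \<in> Fr n" "op (enc n a') (enc n b') \<in> Fr n"
    using op_in e by auto
  have "eqv (op (enc n a) (enc n b)) (op (enc n a') (enc n b'))"
    using eqv_trans[OF i op_cong1[OF e(1,2,3) assms(5)] op_cong2[OF e(2,3,4) assms(6)]] .
  then have "(opt n a b, opt n a' b') \<in> frac_rel A p M act n"
    using i unfolding frac_rel_eqv enc_Fr[symmetric] enc_opt by blast
  then show ?thesis using equiv_class_eq[OF equiv_frac_rel] by blast
qed

lemma L_mult_opt:
  assumes "(d, s, x) \<in> fractions A p M n" "(e, t, y) \<in> fractions A p M n"
  shows "frac n d s x \<otimes>\<^bsub>L n\<^esub> frac n e t y = frac_rel A p M act n `` {opt n (d, s, x) (e, t, y)}"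
proof -
  have "(\<Union>(d', s', x')\<in>frac n d s x. \<Union>(e', t', y')\<in>frac n e t y. frac_rel A p M act n `` {opt n (d', s', x') (e', t', y')})
    = frac_rel A p M act n `` {opt n (d, s, x) (e, t, y)}" (is "?l = ?r")
  proof
    have "frac_rel A p M act n `` {opt n (d', s', x') (e', t', y')} = ?r"
      if "(d', s', x') \<in> frac n d s x" "(e', t', y') \<in> frac n e t y" for d' s' x' e' t' y'
      using that assms by (intro opt_cong) (auto simp: frac_def frac_rel_eqv enc_Fr intro!: eqv_sym[of _ n])
    then show "?l \<subseteq> ?r" by blast
    show "?r \<subseteq> ?l" using frac_self[OF assms(1)] frac_self[OF assms(2)] by blast
  qed
  then show ?thesis by (simp add: localised_part_def opt_def)
qed

lemma frac_mult:
  assumes "s \<in> A d" "s \<notin> p" "x \<in> carrier (M (n + d))" "y \<in> carrier (M (n + d))"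
  shows "frac n d s x \<otimes>\<^bsub>L n\<^esub> frac n d s y = frac n d s (x \<otimes>\<^bsub>M (n + d)\<^esub> y)"
proof -
  have m: "(d, s, x) \<in> fractions A p M n" "(d, s, y) \<in> fractions A p M n"
    "(d, s, x \<otimes>\<^bsub>M (n + d)\<^esub> y) \<in> fractions A p M n"
    using assms monoid.m_closed[OF group.is_monoid[OF part_grp]] by (auto simp: fractions_def)
  have e: "op (enc n (d, s, x)) (enc n (d, s, y)) \<in> Fr n"
    using op_in m by (simp add: enc_Fr)
  have "eqv (op (enc n (d, s, x)) (enc n (d, s, y))) (enc n (d, s, x \<otimes>\<^bsub>M (n + d)\<^esub> y))"
    using op_same[of "(d, s)" "(n + d, x)" n "(n + d, y)"] m[folded enc_Fr] by (simp add: enc_def pl_def)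
  then have "(opt n (d, s, x) (d, s, y), (d, s, x \<otimes>\<^bsub>M (n + d)\<^esub> y)) \<in> frac_rel A p M act n"
    using e m unfolding frac_rel_eqv enc_Fr[symmetric] enc_opt by blast
  then show ?thesis using L_mult_opt[OF m(1,2)] equiv_class_eq[OF equiv_frac_rel] by (simp add: frac_def)
qed

lemma frac_expand:
  assumes "s \<in> A d" "s \<notin> p" "x \<in> carrier (M (n + d))" "t \<in> A e" "t \<notin> p"
  shows "frac n d s x = frac n (d + e) (t \<otimes> s) (act e (n + d) t x)"
proof -
  have a: "((d, s), (n + d, x)) \<in> Fr n" and t: "(e, t) \<in> S"
    using assms by (auto simp: Fr_def S_def H_def E_def)
  have m: "(d, s, x) \<in> fractions A p M n" using assms by (auto simp: fractions_def)
  have eq: "(mu (e, t) (d, s), dt (e, t) (n + d, x)) = enc n (d + e, t \<otimes> s, act e (n + d) t x)"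
    by (simp add: enc_def mu_def dt_def ac_simps)
  have "(d + e, t \<otimes> s, act e (n + d) t x) \<in> fractions A p M n"
    using eqv_expand(1)[OF a t] unfolding eq enc_Fr .
  moreover have "eqv (enc n (d, s, x)) (enc n (d + e, t \<otimes> s, act e (n + d) t x))"
    using eqv_expand(2)[OF a t] unfolding eq by (simp add: enc_def)
  ultimately show ?thesis using frac_eq_iff m by blast
qed

text \<open>Expanding by \<open>s\<close> produces the denominator with the factors in the other
  order; exchanging them costs a sign, which is put into the numerator. Two fractions thereby get
  literally the same denominator.\<close>

lemma frac_expand_right:
  assumes s: "s \<in> A d" "s \<notin> p" and t: "t \<in> A e" "t \<notin> p" and y: "y \<in> carrier (M (n + e))"
  obtains z where "z \<in> carrier (M (n + (d + e)))" "frac n e t y = frac n (d + e) (t \<otimes> s) z"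
proof -
  have m: "(mu (d, s) (e, t), dt (d, s) (n + e, y)) \<in> Fr n" "(d, s) \<in> S" "(e, t) \<in> S"
    using s t y eqv_expand(1)[of "(e, t)" "(n + e, y)" n "(d, s)"] by (auto simp: Fr_def S_def H_def E_def)
  let ?z = "sg (e * d) (dt (d, s) (n + e, y))"
  have E: "?z \<in> E" using m by (simp add: Fr_def)
  have f: "fst ?z = n + (d + e)" by (simp add: ac_simps)
  have z: "snd ?z \<in> carrier (M (n + (d + e)))" using E f unfolding E_def by (metis mem_Collect_eq)
  have ts: "t \<otimes> s \<in> A (d + e)" "t \<otimes> s \<notin> p" "s \<otimes> t \<in> A (e + d)" "s \<otimes> t \<notin> p"
    using mult_degree[OF t(1) s(1)] mult_degree[OF s(1) t(1)] mult_notin s t by (auto simp: ac_simps)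
  have tx: "act d (n + e) s y \<in> carrier (M (n + (e + d)))"
    using group_hom.hom_closed[OF act_group_hom[OF s(1)] y] by (simp add: ac_simps)
  have "frac n e t y = frac n (e + d) (s \<otimes> t) (act d (n + e) s y)" using s t y frac_expand by auto
  also have "\<dots> = frac n (d + e) (t \<otimes> s) (snd ?z)"
  proof (subst frac_eq_iff)
    show "(e + d, s \<otimes> t, act d (n + e) s y) \<in> fractions A p M n" using ts tx by (auto simp: fractions_def)
    show "(d + e, t \<otimes> s, snd ?z) \<in> fractions A p M n" using ts z by (auto simp: fractions_def)
    have "(mu (e, t) (d, s), ?z) = enc n (d + e, t \<otimes> s, snd ?z)"
      using f by (simp add: enc_def mu_def ac_simps prod_eq_iff)
    moreover have "(mu (d, s) (e, t), dt (d, s) (n + e, y)) = enc n (e + d, s \<otimes> t, act d (n + e) s y)"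
      by (simp add: enc_def mu_def dt_def ac_simps)
    ultimately show "eqv (enc n (e + d, s \<otimes> t, act d (n + e) s y)) (enc n (d + e, t \<otimes> s, snd ?z))"
      using eqv_mu_swap[OF m(1,3,2)] by simp
  qed
  finally show thesis using that z by blast
qed

lemma frac_expand_left:
  assumes s: "s \<in> A d" "s \<notin> p" and t: "t \<in> A e" "t \<notin> p" and x: "x \<in> carrier (M (n + d))"
  obtains z where "z \<in> carrier (M (n + (d + e)))" "frac n d s x = frac n (d + e) (t \<otimes> s) z"
  using frac_expand[OF s x t] group_hom.hom_closed[OF act_group_hom[OF t(1)] x] that by (simp add: ac_simps)

lemma common_denominator:
  assumes s: "s \<in> A d" "s \<notin> p" and t: "t \<in> A e" "t \<notin> p"
  shows "t \<otimes> s \<in> A (d + e)" "t \<otimes> s \<notin> p"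
  using mult_degree[OF t(1) s(1)] mult_notin s t by (auto simp: ac_simps)

lemma frac_common:
  assumes "C \<in> carrier (L n)" "D \<in> carrier (L n)"
  obtains d s x y where "s \<in> A d" "s \<notin> p" "x \<in> carrier (M (n + d))" "y \<in> carrier (M (n + d))"
    "C = frac n d s x" "D = frac n d s y"
proof -
  obtain d s x where c: "s \<in> A d" "s \<notin> p" "x \<in> carrier (M (n + d))" "C = frac n d s x"
    using frac_cases[OF assms(1)] .
  obtain e t y where d: "t \<in> A e" "t \<notin> p" "y \<in> carrier (M (n + e))" "D = frac n e t y"
    using frac_cases[OF assms(2)] .
  show thesis
    using frac_expand_left[OF c(1,2) d(1,2) c(3)] frac_expand_right[OF c(1,2) d(1,2,3)]
      common_denominator[OF c(1,2) d(1,2)] that c(4) d(4) by metis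
qed

lemma frac_common3:
  assumes "C \<in> carrier (L n)" "D \<in> carrier (L n)" "C' \<in> carrier (L n)"
  obtains d s x y z where "s \<in> A d" "s \<notin> p" "x \<in> carrier (M (n + d))" "y \<in> carrier (M (n + d))"
    "z \<in> carrier (M (n + d))" "C = frac n d s x" "D = frac n d s y" "C' = frac n d s z"
proof -
  obtain d s x y where c: "s \<in> A d" "s \<notin> p" "x \<in> carrier (M (n + d))" "y \<in> carrier (M (n + d))"
    "C = frac n d s x" "D = frac n d s y" using frac_common[OF assms(1,2)] .
  obtain e t w where w: "t \<in> A e" "t \<notin> p" "w \<in> carrier (M (n + e))" "C' = frac n e t w"
    using frac_cases[OF assms(3)] .
  obtain z where z: "z \<in> carrier (M (n + (d + e)))" "C' = frac n (d + e) (t \<otimes> s) z"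
    using frac_expand_right[OF c(1,2) w(1,2,3)] w(4) by metis
  obtain x' where x': "x' \<in> carrier (M (n + (d + e)))" "C = frac n (d + e) (t \<otimes> s) x'"
    using frac_expand_left[OF c(1,2) w(1,2) c(3)] c(5) by metis
  obtain y' where y': "y' \<in> carrier (M (n + (d + e)))" "D = frac n (d + e) (t \<otimes> s) y'"
    using frac_expand_left[OF c(1,2) w(1,2) c(4)] c(6) by metis
  show thesis using that common_denominator[OF c(1,2) w(1,2)] x' y' z by blast
qed

lemma one_L: "\<one>\<^bsub>L n\<^esub> = frac n 0 \<one> \<one>\<^bsub>M n\<^esub>"
  by (simp add: localised_part_def frac_def)

lemma part_one_closed: "\<one>\<^bsub>M n\<^esub> \<in> carrier (M n)"
  using monoid.one_closed[OF group.is_monoid[OF part_grp]] .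

lemma frac_one:
  assumes "s \<in> A d" "s \<notin> p" shows "frac n d s \<one>\<^bsub>M (n + d)\<^esub> = \<one>\<^bsub>L n\<^esub>"
  using frac_expand[OF one_degree one_notin _ assms, of "\<one>\<^bsub>M n\<^esub>" n] part_one_closed[of n]
    group_hom.hom_one[OF act_group_hom[OF assms(1)], of n] assms degree_carrier[OF assms(1)]
  by (simp add: one_L)

lemma one_L_in: "\<one>\<^bsub>L n\<^esub> \<in> carrier (L n)"
  unfolding one_L using frac_in[OF one_degree one_notin] part_one_closed by simp

text \<open>Up to three fractions are brought over one denominator, where the group laws are those
  of a single part of the module.\<close>

lemma comm_group_L: "comm_group (L n)"
proof (rule comm_groupI)
  fix C D assume CD: "C \<in> carrier (L n)" "D \<in> carrier (L n)"
  obtain d s x y where c: "s \<in> A d" "s \<notin> p" "x \<in> carrier (M (n + d))" "y \<in> carrier (M (n + d))"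
    "C = frac n d s x" "D = frac n d s y" using frac_common[OF CD] .
  interpret G: comm_group "M (n + d)" using part_group .
  show "C \<otimes>\<^bsub>L n\<^esub> D \<in> carrier (L n)" using c frac_mult frac_in by simp
  show "C \<otimes>\<^bsub>L n\<^esub> D = D \<otimes>\<^bsub>L n\<^esub> C" using c frac_mult G.m_comm by simp
next
  show "\<one>\<^bsub>L n\<^esub> \<in> carrier (L n)" by (rule one_L_in)
next
  fix C D C' assume CD: "C \<in> carrier (L n)" "D \<in> carrier (L n)" "C' \<in> carrier (L n)"
  obtain d s x y z where c: "s \<in> A d" "s \<notin> p" "x \<in> carrier (M (n + d))" "y \<in> carrier (M (n + d))"
    "z \<in> carrier (M (n + d))" "C = frac n d s x" "D = frac n d s y" "C' = frac n d s z"
    using frac_common3[OF CD] .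
  interpret G: comm_group "M (n + d)" using part_group .
  show "C \<otimes>\<^bsub>L n\<^esub> D \<otimes>\<^bsub>L n\<^esub> C' = C \<otimes>\<^bsub>L n\<^esub> (D \<otimes>\<^bsub>L n\<^esub> C')"
    using c frac_mult G.m_assoc by simp
next
  fix C assume C: "C \<in> carrier (L n)"
  obtain d s x where c: "s \<in> A d" "s \<notin> p" "x \<in> carrier (M (n + d))" "C = frac n d s x"
    using frac_cases[OF C] .
  interpret G: comm_group "M (n + d)" using part_group .
  show "\<one>\<^bsub>L n\<^esub> \<otimes>\<^bsub>L n\<^esub> C = C" using c frac_mult frac_one[OF c(1,2), of n, symmetric] by simp
  have "frac n d s (inv\<^bsub>M (n + d)\<^esub> x) \<otimes>\<^bsub>L n\<^esub> C = \<one>\<^bsub>L n\<^esub>"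
    using c frac_mult frac_one[OF c(1,2), of n] by simp
  then show "\<exists>D\<in>carrier (L n). D \<otimes>\<^bsub>L n\<^esub> C = \<one>\<^bsub>L n\<^esub>" using c frac_in by (metis G.inv_closed)
qed

text \<open>Comparison with the zero fraction over the same denominator yields a \<open>w\<close>
  that kills the product of \<open>s\<close> and \<open>x\<close>; then the product of
  \<open>w\<close> and \<open>s\<close>, still outside \<open>p\<close>, kills \<open>x\<close>. The
  converse is an expansion by \<open>w\<close>.\<close>

lemma frac_eq_one_iff:
  assumes "s \<in> A d" "s \<notin> p" "x \<in> carrier (M (n + d))"
  shows "frac n d s x = \<one>\<^bsub>L n\<^esub> \<longleftrightarrow> (\<exists>k. \<exists>w\<in>A k - p. act k (n + d) w x = \<one>\<^bsub>M (n + d + k)\<^esub>)"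
proof
  assume "frac n d s x = \<one>\<^bsub>L n\<^esub>"
  then have "frac n d s x = frac n d s \<one>\<^bsub>M (n + d)\<^esub>" using frac_one assms by simp
  then have "((d, s, x), (d, s, \<one>\<^bsub>M (n + d)\<^esub>)) \<in> frac_rel A p M act n"
    using assms part_one_closed eq_equiv_class[OF _ equiv_frac_rel] by (auto simp: frac_def fractions_def)
  then obtain k w where w: "w \<in> A k - p" "act k (n + d + d) w (act d (n + d) s x) =
    act k (n + d + d) w (sgn_act (M (n + d + d)) (d * d) (act d (n + d) s \<one>\<^bsub>M (n + d)\<^esub>))"
    by (auto simp: frac_rel_def)
  have "sgn_act (M (n + d + d)) (d * d) (act d (n + d) s \<one>\<^bsub>M (n + d)\<^esub>) = \<one>\<^bsub>M (n + d + d)\<^esub>"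
    using group_hom.hom_one[OF act_group_hom[OF assms(1)]] monoid.inv_one[OF group.is_monoid[OF part_grp]]
    by (simp add: sgn_act_def)
  then have "act k (n + d + d) w (act d (n + d) s x) = \<one>\<^bsub>M (n + d + (k + d))\<^esub>"
    using w group_hom.hom_one[OF act_group_hom[of w k], of "n + d + d"] by (simp add: ac_simps)
  then have "act (k + d) (n + d) (w \<otimes> s) x = \<one>\<^bsub>M (n + d + (k + d))\<^esub>"
    using act_mult w assms by simp
  moreover have "w \<otimes> s \<in> A (k + d) - p" using mult_degree mult_notin assms w by auto
  ultimately show "\<exists>k. \<exists>w\<in>A k - p. act k (n + d) w x = \<one>\<^bsub>M (n + d + k)\<^esub>" by blast
next
  assume "\<exists>k. \<exists>w\<in>A k - p. act k (n + d) w x = \<one>\<^bsub>M (n + d + k)\<^esub>"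
  then obtain k w where w: "w \<in> A k" "w \<notin> p" "act k (n + d) w x = \<one>\<^bsub>M (n + (d + k))\<^esub>"
    by (auto simp: ac_simps)
  have "w \<otimes> s \<in> A (d + k)" using mult_degree[OF w(1) assms(1)] by (simp add: ac_simps)
  then show "frac n d s x = \<one>\<^bsub>L n\<^esub>"
    using frac_expand[OF assms w(1,2)] w(3) frac_one mult_notin[OF w(1,2) assms(1,2)] by simp
qed

end

lemma homogeneous_prime_localisation:
  assumes "graded_module R A M act" "q \<in> Spec R A"
  shows "module_localisation R A M act q"
proof -
  interpret graded_module R A M act by fact
  have I: "ideal q R" and nq: "carrier R \<noteq> q"
    and pr: "\<And>a b. \<lbrakk>a \<in> carrier R; b \<in> carrier R; a \<otimes>\<^bsub>R\<^esub> b \<in> q\<rbrakk> \<Longrightarrow> a \<in> q \<or> b \<in> q"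
    using assms(2) by (auto simp: Spec_def homogeneous_ideal_def)
  show ?thesis
  proof
    show "\<one>\<^bsub>R\<^esub> \<notin> q" using nq ideal.one_imp_carrier[OF I] by auto
    show "r \<otimes>\<^bsub>R\<^esub> s \<notin> q" if "r \<in> A d" "r \<notin> q" "s \<in> A e" "s \<notin> q" for r d s e
      using pr that degree_carrier by blast
  qed
qed

section \<open>Homogeneous ideals\<close>

context graded_commutative_ring
begin

definition homog :: "'r set" where "homog = (\<Union>d. A d)"

lemma homog_carrier: "homog \<subseteq> carrier R"
  using degree_carrier by (auto simp: homog_def)

section \<open>Homogeneous components\<close>

definition cmpt :: "'r \<Rightarrow> int \<Rightarrow> 'r"
  where "cmpt x = (THE c. (\<forall>n. c n \<in> A n) \<and> finite {n. c n \<noteq> \<zero>} \<and> x = (\<Oplus>n\<in>{n. c n \<noteq> \<zero>}. c n))"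

lemma
  assumes "x \<in> carrier R"
  shows cmpt_degree: "cmpt x n \<in> A n" and cmpt_finite: "finite {n. cmpt x n \<noteq> \<zero>}"
    and cmpt_sum: "x = (\<Oplus>n\<in>{n. cmpt x n \<noteq> \<zero>}. cmpt x n)"
  using theI'[OF direct_sum[OF assms], folded cmpt_def] by blast+

lemma cmpt_carrier: "x \<in> carrier R \<Longrightarrow> cmpt x n \<in> carrier R"
  using cmpt_degree degree_carrier by blast

lemma cmpt_unique:
  assumes c: "\<And>n. c n \<in> A n" and K: "finite K" "\<And>n. n \<notin> K \<Longrightarrow> c n = \<zero>" and x: "x = (\<Oplus>n\<in>K. c n)"
  shows "cmpt x = c"
proof -
  have cc: "c n \<in> carrier R" for n using c degree_carrier by blast
  have sub: "{n. c n \<noteq> \<zero>} \<subseteq> K" using K by blast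
  have "(\<Oplus>n\<in>{n. c n \<noteq> \<zero>}. c n) = (\<Oplus>n\<in>K. c n)"
    by (rule add.finprod_mono_neutral_cong_left) (use K sub cc in auto)
  then have P: "(\<forall>n. c n \<in> A n) \<and> finite {n. c n \<noteq> \<zero>} \<and> x = (\<Oplus>n\<in>{n. c n \<noteq> \<zero>}. c n)"
    using c x finite_subset[OF sub K(1)] by simp
  have "x \<in> carrier R" using x cc by (simp add: finsum_closed)
  then show ?thesis unfolding cmpt_def using the1_equality[OF direct_sum] P by blast
qed

lemma cmpt_sum_superset:
  assumes x: "x \<in> carrier R" and K: "finite K" "{n. cmpt x n \<noteq> \<zero>} \<subseteq> K"
  shows "x = (\<Oplus>n\<in>K. cmpt x n)"
proof -
  have "(\<Oplus>n\<in>{n. cmpt x n \<noteq> \<zero>}. cmpt x n) = (\<Oplus>n\<in>K. cmpt x n)"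
    by (rule add.finprod_mono_neutral_cong_left) (use K cmpt_carrier[OF x] in auto)
  then show ?thesis using cmpt_sum[OF x] by simp
qed

lemma cmpt_homog:
  assumes "r \<in> A d" shows "cmpt r n = (if n = d then r else \<zero>)"
proof -
  have "r = (\<Oplus>n\<in>{d}. if n = d then r else \<zero>)"
    using finsum_insert[of "{}" d] degree_carrier[OF assms] by simp
  then have "cmpt r = (\<lambda>n. if n = d then r else \<zero>)"
    using cmpt_unique[of "\<lambda>n. if n = d then r else \<zero>" "{d}" r] assms zero_degree by auto
  then show ?thesis by simp
qed

lemma cmpt_zero: "cmpt \<zero> n = \<zero>"
  using cmpt_homog[OF zero_degree[of n], of n] by simp

lemma cmpt_add:
  assumes "x \<in> carrier R" "y \<in> carrier R" shows "cmpt (x \<oplus> y) n = cmpt x n \<oplus> cmpt y n"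
proof -
  let ?K = "{n. cmpt x n \<noteq> \<zero>} \<union> {n. cmpt y n \<noteq> \<zero>}"
  have fin: "finite ?K" using cmpt_finite assms by blast
  have "x \<oplus> y = (\<Oplus>n\<in>?K. cmpt x n) \<oplus> (\<Oplus>n\<in>?K. cmpt y n)"
    using cmpt_sum_superset[OF assms(1) fin] cmpt_sum_superset[OF assms(2) fin] by simp
  also have "\<dots> = (\<Oplus>n\<in>?K. cmpt x n \<oplus> cmpt y n)"
    using finsum_addf[of "cmpt x" ?K "cmpt y"] cmpt_carrier assms by simp
  finally have "cmpt (x \<oplus> y) = (\<lambda>n. cmpt x n \<oplus> cmpt y n)"
    using fin cmpt_degree assms additive_subgroup.a_closed[OF subgroup_degree]
    by (intro cmpt_unique[where K = ?K]) auto
  then show ?thesis by simp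
qed

lemma cmpt_minus:
  assumes "x \<in> carrier R" shows "cmpt (\<ominus> x) n = \<ominus> (cmpt x n)"
proof -
  have "cmpt (\<ominus> x) n \<oplus> cmpt x n = \<zero>" using cmpt_add[of "\<ominus> x" x n] assms l_neg cmpt_zero by simp
  then show ?thesis using minus_equality cmpt_carrier assms by (metis a_inv_closed)
qed

lemma cmpt_finsum:
  assumes "finite K" "\<And>i. i \<in> K \<Longrightarrow> f i \<in> carrier R"
  shows "cmpt (\<Oplus>i\<in>K. f i) n = (\<Oplus>i\<in>K. cmpt (f i) n)"
  using assms
proof (induction K)
  case empty then show ?case by (simp add: cmpt_zero)
next
  case (insert i K)
  have "cmpt (\<Oplus>i\<in>insert i K. f i) n = cmpt (f i) n \<oplus> cmpt (\<Oplus>i\<in>K. f i) n"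
    using insert by (subst finsum_insert) (auto simp: cmpt_add finsum_closed)
  then show ?case using insert cmpt_carrier by (subst finsum_insert) auto
qed

lemma cmpt_mult_homog:
  assumes r: "r \<in> A d" and x: "x \<in> carrier R"
  shows "cmpt (r \<otimes> x) n = r \<otimes> cmpt x (n - d)" "cmpt (x \<otimes> r) n = cmpt x (n - d) \<otimes> r"
proof -
  let ?K = "{n. cmpt x n \<noteq> \<zero>}" and ?L = "(\<lambda>n. n + d) ` {n. cmpt x n \<noteq> \<zero>}"
  have rc: "r \<in> carrier R" and fin: "finite ?K" "finite ?L"
    using degree_carrier r cmpt_finite[OF x] by auto
  have inj: "inj_on (\<lambda>n. n + d) ?K" by (auto simp: inj_on_def)
  have xc: "cmpt x n \<in> carrier R" for n using cmpt_carrier x by blast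
  have out: "n \<notin> ?L \<Longrightarrow> cmpt x (n - d) = \<zero>" for n
    by (metis (mono_tags, lifting) diff_add_cancel image_eqI mem_Collect_eq)
  have "r \<otimes> x = (\<Oplus>n\<in>?K. r \<otimes> cmpt x n)"
    using finsum_rdistr[OF fin(1) rc, of "cmpt x"] cmpt_sum[OF x] xc by auto
  also have "\<dots> = (\<Oplus>n\<in>?L. r \<otimes> cmpt x (n - d))"
    using finsum_reindex[OF _ inj, of "\<lambda>n. r \<otimes> cmpt x (n - d)"] rc xc by auto
  finally have "cmpt (r \<otimes> x) = (\<lambda>n. r \<otimes> cmpt x (n - d))"
    using fin out rc mult_degree[OF r cmpt_degree[OF x]] by (intro cmpt_unique[where K = ?L]) (auto, metis add_diff_cancel_left' diff_add_cancel)
  then show "cmpt (r \<otimes> x) n = r \<otimes> cmpt x (n - d)" by simp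
  have "x \<otimes> r = (\<Oplus>n\<in>?K. cmpt x n \<otimes> r)"
    using finsum_ldistr[OF fin(1) rc, of "cmpt x"] cmpt_sum[OF x] xc by auto
  also have "\<dots> = (\<Oplus>n\<in>?L. cmpt x (n - d) \<otimes> r)"
    using finsum_reindex[OF _ inj, of "\<lambda>n. cmpt x (n - d) \<otimes> r"] rc xc by auto
  finally have "cmpt (x \<otimes> r) = (\<lambda>n. cmpt x (n - d) \<otimes> r)"
    using fin out rc mult_degree[OF cmpt_degree[OF x] r] by (intro cmpt_unique[where K = ?L]) (auto, metis diff_add_cancel)
  then show "cmpt (x \<otimes> r) n = cmpt x (n - d) \<otimes> r" by simp
qed

lemma cmpt_mult:
  assumes x: "x \<in> carrier R" and y: "y \<in> carrier R"
  shows "cmpt (y \<otimes> x) n = (\<Oplus>i\<in>{i. cmpt y i \<noteq> \<zero>}. cmpt y i \<otimes> cmpt x (n - i))"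
    and "cmpt (x \<otimes> y) n = (\<Oplus>i\<in>{i. cmpt y i \<noteq> \<zero>}. cmpt x (n - i) \<otimes> cmpt y i)"
proof -
  let ?K = "{i. cmpt y i \<noteq> \<zero>}"
  have fin: "finite ?K" using cmpt_finite[OF y] .
  have yc: "cmpt y i \<in> carrier R" for i using cmpt_carrier y by blast
  have "y \<otimes> x = (\<Oplus>i\<in>?K. cmpt y i \<otimes> x)"
    using finsum_ldistr[OF fin x, of "cmpt y"] cmpt_sum[OF y] yc by auto
  then have "cmpt (y \<otimes> x) n = (\<Oplus>i\<in>?K. cmpt (cmpt y i \<otimes> x) n)"
    using cmpt_finsum[OF fin, of "\<lambda>i. cmpt y i \<otimes> x" n] yc x by simp
  then show "cmpt (y \<otimes> x) n = (\<Oplus>i\<in>?K. cmpt y i \<otimes> cmpt x (n - i))"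
    using cmpt_mult_homog(1)[OF cmpt_degree[OF y] x] by simp
  have "x \<otimes> y = (\<Oplus>i\<in>?K. x \<otimes> cmpt y i)"
    using finsum_rdistr[OF fin x, of "cmpt y"] cmpt_sum[OF y] yc by auto
  then have "cmpt (x \<otimes> y) n = (\<Oplus>i\<in>?K. cmpt (x \<otimes> cmpt y i) n)"
    using cmpt_finsum[OF fin, of "\<lambda>i. x \<otimes> cmpt y i" n] yc x by simp
  then show "cmpt (x \<otimes> y) n = (\<Oplus>i\<in>?K. cmpt x (n - i) \<otimes> cmpt y i)"
    using cmpt_mult_homog(2)[OF cmpt_degree[OF y] x] by simp
qed

lemma finsum_in_subgroup:
  assumes I: "additive_subgroup I R" and "finite K" "\<And>i. i \<in> K \<Longrightarrow> f i \<in> I"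
  shows "(\<Oplus>i\<in>K. f i) \<in> I"
  using assms(2,3)
proof (induction K)
  case empty then show ?case using additive_subgroup.zero_closed[OF I] by simp
next
  case (insert i K)
  then show ?case
    using additive_subgroup.a_closed[OF I] additive_subgroup.a_subset[OF I]
    by (subst finsum_insert) auto
qed

text \<open>Each component of a product is a finite sum of products of components, so closure needs
  to be checked for homogeneous factors only. It is applied to a fixed ideal in every degree, giving
  homogeneity, and to the homogeneous annihilators of an object.\<close>

lemma ideal_componentwise:
  assumes sub: "\<And>n. additive_subgroup (K n) R"
    and l: "\<And>r d x n. \<lbrakk>r \<in> A d; x \<in> K n; x \<in> A n\<rbrakk> \<Longrightarrow> r \<otimes> x \<in> K (d + n)"
    and r: "\<And>r d x n. \<lbrakk>r \<in> A d; x \<in> K n; x \<in> A n\<rbrakk> \<Longrightarrow> x \<otimes> r \<in> K (n + d)"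
  shows "ideal {x \<in> carrier R. \<forall>n. cmpt x n \<in> K n} R" (is "ideal ?J R")
proof (rule idealI[OF ring_axioms])
  note sg = additive_subgroup.a_closed[OF sub] additive_subgroup.zero_closed[OF sub]
    additive_subgroup.a_inv_closed[OF sub]
  show "subgroup ?J (add_monoid R)"
  proof
    show "?J \<subseteq> carrier (add_monoid R)" by auto
    show "x \<otimes>\<^bsub>add_monoid R\<^esub> y \<in> ?J" if "x \<in> ?J" "y \<in> ?J" for x y
      using that sg by (auto simp: cmpt_add)
    show "\<one>\<^bsub>add_monoid R\<^esub> \<in> ?J" using sg by (auto simp: cmpt_zero)
    show "inv\<^bsub>add_monoid R\<^esub> x \<in> ?J" if "x \<in> ?J" for x
      using that sg cmpt_minus a_inv_closed unfolding a_inv_def by auto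
  qed
  fix x y assume x: "x \<in> ?J" and y: "y \<in> carrier R"
  have "cmpt (y \<otimes> x) n \<in> K n" for n
  proof -
    have "cmpt y i \<otimes> cmpt x (n - i) \<in> K n" for i
      using l[OF cmpt_degree[OF y], of "cmpt x (n - i)" "n - i" i] x cmpt_degree by auto
    then show ?thesis using cmpt_mult(1) x y finsum_in_subgroup[OF sub cmpt_finite[OF y]] by simp
  qed
  then show "y \<otimes> x \<in> ?J" using x y by simp
  have "cmpt (x \<otimes> y) n \<in> K n" for n
  proof -
    have "cmpt x (n - i) \<otimes> cmpt y i \<in> K n" for i
      using r[OF cmpt_degree[OF y], of "cmpt x (n - i)" "n - i" i] x cmpt_degree by auto
    then show ?thesis using cmpt_mult(2) x y finsum_in_subgroup[OF sub cmpt_finite[OF y]] by simp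
  qed
  then show "x \<otimes> y \<in> ?J" using x y by simp
qed

lemma homogeneous_idealI:
  assumes "ideal I R" "\<And>x n. x \<in> I \<Longrightarrow> cmpt x n \<in> I"
  shows "homogeneous_ideal R A I"
  unfolding homogeneous_ideal_def
proof (intro conjI allI impI assms(1))
  fix c n assume c: "\<forall>n. c n \<in> A n" "finite {n. c n \<noteq> \<zero>}" "(\<Oplus>n\<in>{n. c n \<noteq> \<zero>}. c n) \<in> I"
  then have "cmpt (\<Oplus>n\<in>{n. c n \<noteq> \<zero>}. c n) = c" by (intro cmpt_unique) auto
  then show "c n \<in> I" using assms(2)[OF c(3), of n] by simp
qed

lemma homogeneous_ideal_cmpt:
  assumes "homogeneous_ideal R A I" "x \<in> I" shows "cmpt x n \<in> I"
proof -
  have "ideal I R" using assms by (simp add: homogeneous_ideal_def)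
  then have "x \<in> carrier R" using assms additive_subgroup.a_subset ideal.axioms(1) by blast
  then show ?thesis
    using assms cmpt_degree cmpt_finite cmpt_sum unfolding homogeneous_ideal_def by metis
qed

text \<open>The elements all of whose components lie in the generated ideal form an ideal containing
  \<open>B\<close>, so by minimality this is no restriction.\<close>

lemma genideal_homogeneous:
  assumes B: "B \<subseteq> homog" shows "homogeneous_ideal R A (Idl B)"
proof (rule homogeneous_idealI)
  have Bc: "B \<subseteq> carrier R" using B homog_carrier by blast
  show I: "ideal (Idl B) R" using genideal_ideal[OF Bc] .
  let ?J = "{x \<in> carrier R. \<forall>n. cmpt x n \<in> Idl B}"
  have "ideal ?J R"
    using ideal.axioms(1)[OF I] ideal.I_l_closed[OF I] ideal.I_r_closed[OF I] degree_carrier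
    by (intro ideal_componentwise) auto
  moreover have "B \<subseteq> ?J"
  proof
    fix b assume b: "b \<in> B"
    then obtain d where "b \<in> A d" using B by (auto simp: homog_def)
    then show "b \<in> ?J"
      using b genideal_self[OF Bc] additive_subgroup.zero_closed[OF ideal.axioms(1)[OF I]] degree_carrier
      by (auto simp: cmpt_homog)
  qed
  ultimately have "Idl B \<subseteq> ?J" using genideal_minimal by blast
  then show "cmpt x n \<in> Idl B" if "x \<in> Idl B" for x n using that by blast
qed

text \<open>The argument with the components of highest degree outside \<open>I\<close>.\<close>

lemma homogeneous_prime:
  assumes I: "homogeneous_ideal R A I" "\<one> \<notin> I"
    and pr: "\<And>r d s e. \<lbrakk>r \<in> A d; s \<in> A e; r \<otimes> s \<in> I\<rbrakk> \<Longrightarrow> r \<in> I \<or> s \<in> I"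
  shows "I \<in> Spec R A"
proof -
  have id: "ideal I R" using I by (simp add: homogeneous_ideal_def)
  note ad = ideal.axioms(1)[OF id]
  have ex: "\<exists>m. cmpt a m \<notin> I \<and> (\<forall>i>m. cmpt a i \<in> I)" if a: "a \<in> carrier R" "a \<notin> I" for a
  proof -
    let ?S = "{i. cmpt a i \<notin> I}"
    have "?S \<subseteq> {i. cmpt a i \<noteq> \<zero>}" using additive_subgroup.zero_closed[OF ad] by auto
    then have fin: "finite ?S" using cmpt_finite[OF a(1)] finite_subset by blast
    have "?S \<noteq> {}"
      using cmpt_sum[OF a(1)] finsum_in_subgroup[OF ad cmpt_finite[OF a(1)], of "cmpt a"] a by auto
    then have "Max ?S \<in> ?S" "\<forall>i\<in>?S. i \<le> Max ?S"
      using Max_in[OF fin] Max_ge[OF fin] by blast+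
    then show ?thesis by (metis (mono_tags, lifting) mem_Collect_eq not_le)
  qed
  have "a \<in> I \<or> b \<in> I" if ab: "a \<in> carrier R" "b \<in> carrier R" "a \<otimes> b \<in> I" for a b
  proof (rule ccontr)
    assume "\<not> (a \<in> I \<or> b \<in> I)"
    then obtain m k where m: "cmpt a m \<notin> I" "\<And>i. i > m \<Longrightarrow> cmpt a i \<in> I"
      and k: "cmpt b k \<notin> I" "\<And>i. i > k \<Longrightarrow> cmpt b i \<in> I"
      using ex[OF ab(1)] ex[OF ab(2)] by blast
    let ?K = "{i. cmpt a i \<noteq> \<zero>} - {m}"
    have c: "cmpt a i \<in> carrier R" "cmpt b i \<in> carrier R" for i using cmpt_carrier ab by auto
    have "cmpt a m \<noteq> \<zero>" using m additive_subgroup.zero_closed[OF ad] by auto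
    then have K: "{i. cmpt a i \<noteq> \<zero>} = insert m ?K" "finite ?K" "m \<notin> ?K"
      using cmpt_finite[OF ab(1)] by auto
    let ?r = "\<Oplus>i\<in>?K. cmpt a i \<otimes> cmpt b (m + k - i)"
    \<comment> \<open>For \<open>i\<close> above \<open>m\<close> the first factor lies in
      \<open>I\<close> by the choice of \<open>m\<close>; for \<open>i\<close> below
      \<open>m\<close> the complementary degree exceeds \<open>k\<close> and the second factor
      does.\<close>
    have rest: "cmpt a i \<otimes> cmpt b (m + k - i) \<in> I" if "i \<in> ?K" for i
    proof (cases "i > m")
      case True then show ?thesis using m ideal.I_r_closed[OF id] c by blast
    next
      case False
      then have "m + k - i > k" using that by auto
      then show ?thesis using k ideal.I_l_closed[OF id] c by blast
    qed
    have r: "?r \<in> I" by (rule finsum_in_subgroup[OF ad K(2) rest])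
    have "cmpt (a \<otimes> b) (m + k) = (\<Oplus>i\<in>insert m ?K. cmpt a i \<otimes> cmpt b (m + k - i))"
      using cmpt_mult(1)[OF ab(2,1), of "m + k"] K(1) by simp
    also have "\<dots> = cmpt a m \<otimes> cmpt b k \<oplus> ?r"
      using K c by (subst finsum_insert) auto
    finally have "cmpt a m \<otimes> cmpt b k \<oplus> ?r \<in> I"
      using homogeneous_ideal_cmpt[OF I(1) ab(3)] by metis
    then have "(cmpt a m \<otimes> cmpt b k \<oplus> ?r) \<oplus> \<ominus> ?r \<in> I"
      using r additive_subgroup.a_closed[OF ad] additive_subgroup.a_inv_closed[OF ad] by blast
    moreover have "?r \<in> carrier R" using r additive_subgroup.a_subset[OF ad] by blast
    ultimately have "cmpt a m \<otimes> cmpt b k \<in> I" using c by (simp add: a_assoc r_neg)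
    then show False using pr[OF cmpt_degree cmpt_degree] ab m k by blast
  qed
  then show ?thesis using I one_closed by (auto simp: Spec_def)
qed

lemma prime_ideal:
  assumes "p \<in> Spec R A"
  shows "ideal p R" "homogeneous_ideal R A p" "\<one> \<notin> p" "p \<subseteq> carrier R"
    "\<And>a b. \<lbrakk>a \<in> carrier R; b \<in> carrier R; a \<otimes> b \<in> p\<rbrakk> \<Longrightarrow> a \<in> p \<or> b \<in> p"
proof -
  show I: "ideal p R" and "homogeneous_ideal R A p"
    "\<And>a b. \<lbrakk>a \<in> carrier R; b \<in> carrier R; a \<otimes> b \<in> p\<rbrakk> \<Longrightarrow> a \<in> p \<or> b \<in> p"
    using assms by (auto simp: Spec_def homogeneous_ideal_def)
  show "\<one> \<notin> p" using assms ideal.one_imp_carrier[OF I] by (auto simp: Spec_def)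
  show "p \<subseteq> carrier R" using additive_subgroup.a_subset[OF ideal.axioms(1)[OF I]] .
qed

lemma prime_power: "\<lbrakk>p \<in> Spec R A; r \<in> carrier R; r \<notin> p\<rbrakk> \<Longrightarrow> r [^] (n::nat) \<notin> p"
proof (induction n)
  case 0 then show ?case using prime_ideal(3) by simp
next
  case (Suc n) then show ?case using prime_ideal(5)[of p "r [^] n" r] by auto
qed

text \<open>In a noetherian ring a chain of ideals contains its own union, so upper bounds remain
  inside any given family and Zorn applies to it.\<close>

lemma maximal_ideal_exists:
  assumes noeth: "noetherian_ring R" and ne: "\<C> \<noteq> {}" and id: "\<And>I. I \<in> \<C> \<Longrightarrow> ideal I R"
  obtains M where "M \<in> \<C>" "\<And>I. \<lbrakk>I \<in> \<C>; M \<subseteq> I\<rbrakk> \<Longrightarrow> I = M"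
proof -
  have "\<Union>C \<in> \<C>" if "C \<noteq> {}" "subset.chain \<C> C" for C
  proof -
    have "subset.chain {I. ideal I R} C" using that(2) id unfolding pred_on.chain_def by blast
    then have "\<Union>C \<in> C" using noetherian_ring.ideal_chain_is_trivial[OF noeth that(1)] by blast
    then show ?thesis using that(2) unfolding pred_on.chain_def by blast
  qed
  then show thesis using subset_Zorn_nonempty[OF ne] that by blast
qed

text \<open>The components of finitely many generators are again finitely many, lie in
  \<open>p\<close> by homogeneity, and generate the original generators.\<close>

lemma homogeneous_generators:
  assumes noeth: "noetherian_ring R" and p: "homogeneous_ideal R A p"
  obtains B where "finite B" "B \<subseteq> homog" "B \<subseteq> p" "\<And>I. \<lbrakk>ideal I R; B \<subseteq> I\<rbrakk> \<Longrightarrow> p \<subseteq> I"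
proof -
  have "ideal p R" using p by (simp add: homogeneous_ideal_def)
  then obtain G where G: "G \<subseteq> carrier R" "finite G" "p = Idl G"
    using noetherian_ring.finetely_gen[OF noeth] by blast
  let ?B = "\<Union>g\<in>G. cmpt g ` {n. cmpt g n \<noteq> \<zero>}"
  have Gp: "G \<subseteq> p" using G genideal_self by blast
  show thesis
  proof
    show "finite ?B" using G cmpt_finite by blast
    show "?B \<subseteq> homog" using G cmpt_degree by (auto simp: homog_def)
    show "?B \<subseteq> p" using Gp homogeneous_ideal_cmpt[OF p] by blast
    fix I assume I: "ideal I R" "?B \<subseteq> I"
    have "g \<in> I" if "g \<in> G" for g
    proof -
      have g: "g \<in> carrier R" using that G by blast
      have "(\<Oplus>n\<in>{n. cmpt g n \<noteq> \<zero>}. cmpt g n) \<in> I"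
        using I(2) that by (intro finsum_in_subgroup[OF ideal.axioms(1)[OF I(1)] cmpt_finite[OF g]]) auto
      then show ?thesis using cmpt_sum[OF g] by simp
    qed
    then show "p \<subseteq> I" using genideal_minimal[OF I(1)] G by blast
  qed
qed

text \<open>A homogeneous \<open>y\<close> can be moved past \<open>s\<close> at the cost of a sign,
  which an ideal does not notice; a general \<open>y\<close> is the sum of its components. This
  takes the place of commutativity in the following product of ideals.\<close>

lemma homog_commute_in_ideal:
  assumes I: "ideal I R" and s: "s \<in> A d" and t: "t \<in> A e" and st: "s \<otimes> t \<in> I" and y: "y \<in> carrier R"
  shows "s \<otimes> y \<otimes> t \<in> I"
proof -
  note ad = ideal.axioms(1)[OF I]
  have c: "s \<in> carrier R" "t \<in> carrier R" using degree_carrier s t by auto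
  have h: "s \<otimes> u \<otimes> t \<in> I" if u: "u \<in> A k" for u k
  proof -
    have uc: "u \<in> carrier R" using degree_carrier u by blast
    have us: "u \<otimes> s \<otimes> t \<in> I" using ideal.I_l_closed[OF I st uc] uc c by (simp add: m_assoc)
    have "s \<otimes> u = u \<otimes> s \<or> s \<otimes> u = \<ominus> (u \<otimes> s)" using graded_comm[OF s u] by auto
    then show ?thesis
      using us additive_subgroup.a_inv_closed[OF ad us] uc c by (auto simp: l_minus)
  qed
  let ?K = "{n. cmpt y n \<noteq> \<zero>}"
  have yc: "cmpt y n \<in> carrier R" for n using cmpt_carrier y by blast
  have "s \<otimes> y = (\<Oplus>n\<in>?K. s \<otimes> cmpt y n)"
    using finsum_rdistr[OF cmpt_finite[OF y] c(1), of "cmpt y"] cmpt_sum[OF y] yc by auto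
  then have "s \<otimes> y \<otimes> t = (\<Oplus>n\<in>?K. s \<otimes> cmpt y n \<otimes> t)"
    using finsum_ldistr[OF cmpt_finite[OF y] c(2), of "\<lambda>n. s \<otimes> cmpt y n"] yc c by auto
  also have "\<dots> \<in> I"
    using h cmpt_degree[OF y] by (intro finsum_in_subgroup[OF ad cmpt_finite[OF y]]) blast
  finally show ?thesis .
qed

text \<open>Both factors are handled by residuals: the admissible left factors, and then the
  admissible right factors, form ideals, and they contain the respective generators.\<close>

lemma genideal_insert_mult:
  assumes I: "ideal I R" and s: "s \<in> A d" and t: "t \<in> A e" and st: "s \<otimes> t \<in> I"
    and x: "x \<in> Idl (insert s I)" and y: "y \<in> Idl (insert t I)"
  shows "x \<otimes> y \<in> I"
proof -
  interpret I: ideal I R by fact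
  have c: "s \<in> carrier R" "t \<in> carrier R" using degree_carrier s t by auto
  have Ic: "insert s I \<subseteq> carrier R" "insert t I \<subseteq> carrier R" using c I.a_subset by auto
  have idl: "ideal (Idl (insert s I)) R" "Idl (insert s I) \<subseteq> carrier R"
    using genideal_ideal[OF Ic(1)] additive_subgroup.a_subset[OF ideal.axioms(1)[OF genideal_ideal[OF Ic(1)]]] by auto
  \<comment> \<open>The intermediate factor \<open>y\<close> makes this set closed under
    multiplication from the right as well as from the left.\<close>
  let ?X = "{x \<in> carrier R. \<forall>y\<in>carrier R. x \<otimes> y \<otimes> t \<in> I}"
  have "ideal ?X R"
  proof (rule idealI[OF ring_axioms])
    show "subgroup ?X (add_monoid R)"
    proof
      show "?X \<subseteq> carrier (add_monoid R)" by auto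
      show "a \<otimes>\<^bsub>add_monoid R\<^esub> b \<in> ?X" if "a \<in> ?X" "b \<in> ?X" for a b
        using that c by (auto simp: l_distr)
      show "\<one>\<^bsub>add_monoid R\<^esub> \<in> ?X" using c by auto
      show "inv\<^bsub>add_monoid R\<^esub> a \<in> ?X" if "a \<in> ?X" for a
        using that c unfolding a_inv_def[symmetric] by (auto simp: l_minus)
    qed
    fix a z assume a: "a \<in> ?X" and z: "z \<in> carrier R"
    then show "z \<otimes> a \<in> ?X" using c I.I_l_closed by (auto simp: m_assoc)
    show "a \<otimes> z \<in> ?X" using a z c m_assoc[of a z] by auto
  qed
  moreover have "insert s I \<subseteq> ?X"
    using homog_commute_in_ideal[OF I s t st] c I.a_subset I.I_r_closed by auto
  ultimately have X: "Idl (insert s I) \<subseteq> ?X" using genideal_minimal by blast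
  let ?Y = "{y \<in> carrier R. \<forall>x\<in>Idl (insert s I). x \<otimes> y \<in> I}"
  have sc: "x \<in> Idl (insert s I) \<Longrightarrow> x \<in> carrier R" for x using idl by blast
  have "ideal ?Y R"
  proof (rule idealI[OF ring_axioms])
    show "subgroup ?Y (add_monoid R)"
    proof
      show "?Y \<subseteq> carrier (add_monoid R)" by auto
      show "a \<otimes>\<^bsub>add_monoid R\<^esub> b \<in> ?Y" if "a \<in> ?Y" "b \<in> ?Y" for a b
        using that sc by (auto simp: r_distr)
      show "\<one>\<^bsub>add_monoid R\<^esub> \<in> ?Y" using sc by auto
      show "inv\<^bsub>add_monoid R\<^esub> a \<in> ?Y" if "a \<in> ?Y" for a
        using that sc unfolding a_inv_def[symmetric] by (auto simp: r_minus)
    qed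
    fix a z assume a: "a \<in> ?Y" and z: "z \<in> carrier R"
    then show "z \<otimes> a \<in> ?Y" using sc ideal.I_r_closed[OF idl(1)] by (auto simp: m_assoc[symmetric])
    show "a \<otimes> z \<in> ?Y" using a z sc I.I_r_closed by (auto simp: m_assoc[symmetric])
  qed
  moreover have "insert t I \<subseteq> ?Y"
  proof -
    have "x \<otimes> t \<in> I" if "x \<in> Idl (insert s I)" for x
    proof -
      have "x \<otimes> \<one> \<otimes> t \<in> I" using X that one_closed by blast
      then show ?thesis using sc[OF that] by simp
    qed
    then show ?thesis using c sc I.a_subset I.I_l_closed by auto
  qed
  ultimately have "Idl (insert t I) \<subseteq> ?Y" using genideal_minimal by blast
  then show ?thesis using x y by blast
qed

end

section \<open>Thick subcategories and supports\<close>

context triangulated_category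
begin

definition thick :: "'o set \<Rightarrow> bool"
  where "thick D \<longleftrightarrow> D \<subseteq> obj T \<and> (\<forall>X. zero_object T X \<longrightarrow> X \<in> D) \<and> (\<forall>X\<in>D. \<forall>k. SO k X \<in> D) \<and>
    (\<forall>X Y Z u v w. dtri X Y Z u v w \<longrightarrow> X \<in> D \<longrightarrow> Z \<in> D \<longrightarrow> Y \<in> D) \<and>
    (\<forall>X\<in>D. \<forall>Y\<in>obj T. \<forall>a\<in>hom_set T Y X. \<forall>b\<in>hom_set T X Y. b \<cdot> a = idn T Y \<longrightarrow> Y \<in> D) \<and>
    (\<forall>X Y P i j p q. X \<in> D \<longrightarrow> Y \<in> D \<longrightarrow> P \<in> obj T \<longrightarrow> i \<in> hom_set T X P \<longrightarrow> j \<in> hom_set T Y P \<longrightarrow>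
      p \<in> hom_set T P X \<longrightarrow> q \<in> hom_set T P Y \<longrightarrow> (i \<cdot> p) \<otimes>\<^bsub>Hom T P P\<^esub> (j \<cdot> q) = idn T P \<longrightarrow> P \<in> D)"

lemma thick_obj: "\<lbrakk>thick D; X \<in> D\<rbrakk> \<Longrightarrow> X \<in> obj T"
  unfolding thick_def by (elim conjE) (erule subsetD)

lemma thick_zero: "\<lbrakk>thick D; zero_object T X\<rbrakk> \<Longrightarrow> X \<in> D"
  unfolding thick_def by (elim conjE) blast

lemma thick_SO: "\<lbrakk>thick D; X \<in> D\<rbrakk> \<Longrightarrow> SO k X \<in> D"
  unfolding thick_def by (elim conjE) blast

lemma thick_mid: "\<lbrakk>thick D; dtri X Y Z u v w; X \<in> D; Z \<in> D\<rbrakk> \<Longrightarrow> Y \<in> D"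
  unfolding thick_def by (elim conjE) blast

lemma thick_retract:
  "\<lbrakk>thick D; X \<in> D; Y \<in> obj T; a \<in> hom_set T Y X; b \<in> hom_set T X Y; b \<cdot> a = idn T Y\<rbrakk> \<Longrightarrow> Y \<in> D"
  unfolding thick_def by (elim conjE) blast

lemma thick_biproduct:
  "\<lbrakk>thick D; X \<in> D; Y \<in> D; P \<in> obj T; i \<in> hom_set T X P; j \<in> hom_set T Y P; p \<in> hom_set T P X;
    q \<in> hom_set T P Y; (i \<cdot> p) \<otimes>\<^bsub>Hom T P P\<^esub> (j \<cdot> q) = idn T P\<rbrakk> \<Longrightarrow> P \<in> D"
  by (rule thick_def[THEN iffD1, THEN conjunct2, THEN conjunct2, THEN conjunct2, THEN conjunct2, THEN conjunct2,
    rule_format])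

lemma thick_cone: "\<lbrakk>thick D; dtri X Y Z u v w; X \<in> D; Y \<in> D\<rbrakk> \<Longrightarrow> Z \<in> D"
  using thick_mid[OF _ dtri_rotate, of D X Y Z u v w] thick_SO[of D X 1] by simp

lemma thick_fibre:
  assumes D: "thick D" and d: "dtri X Y Z u v w" and "Y \<in> D" "Z \<in> D" shows "X \<in> D"
proof -
  have "SO 1 Y \<in> D" using thick_SO[OF D] assms by blast
  then have "SO 1 X \<in> D" using thick_mid[OF D dtri_rotate[OF dtri_rotate[OF d]]] assms by simp
  then have "SO (- 1) (SO 1 X) \<in> D" using thick_SO[OF D] by blast
  moreover have "X \<in> obj T" using d by (simp add: dtri_def)
  ultimately show ?thesis by (simp del: SO_1 add: SO_SO)
qed

lemma thick_full: "thick (obj T)"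
  unfolding thick_def by (auto simp: dtri_def zero_object_def)

end

context linear_triangulated_category
begin

section \<open>Annihilation, nilpotence and supports of objects\<close>

definition kills :: "'o \<Rightarrow> int \<Rightarrow> 'r \<Rightarrow> bool"
  where "kills X d r \<longleftrightarrow> rh d r X = zer (SO (- d) X) X"

definition nil :: "'o \<Rightarrow> int \<Rightarrow> 'r \<Rightarrow> bool"
  where "nil X d r \<longleftrightarrow> (\<exists>n::nat. kills X (int n * d) (r [^]\<^bsub>R\<^esub> n))"

text \<open>Vanishing of the graded endomorphism ring localised at \<open>q\<close>, tested on the
  identity; see \<open>trivial_End_iff\<close>.\<close>

definition vanish :: "'o \<Rightarrow> 'r set \<Rightarrow> bool"
  where "vanish X q \<longleftrightarrow> (\<exists>k. \<exists>w\<in>A k - q. kills X k w)"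

text \<open>The parameter is any set of ring elements and not just an ideal, so that adding one
  generator amounts to intersecting two subcategories.\<close>

definition objsupp :: "'r set \<Rightarrow> 'o set"
  where "objsupp B = {X \<in> obj T. \<forall>q\<in>Spec R A. \<not> B \<subseteq> q \<longrightarrow> vanish X q}"

lemma phi_rho: "\<lbrakk>r \<in> A d; X \<in> obj T\<rbrakk> \<Longrightarrow> \<phi> d r X = SM d (rh d r X)"
  using SM_SM[OF phi_in, of r d X d "- d"] by (simp add: rho_def)

lemma rho_SO_eq: "X \<in> obj T \<Longrightarrow> SO d (SO (- d) X) = X"
  using SO_SO[of X d "- d"] by simp

lemma phi_minus:
  assumes "r \<in> A d" "X \<in> obj T"
  shows "\<phi> d (\<ominus>\<^bsub>R\<^esub> r) X = inv\<^bsub>Hom T X (SO d X)\<^esub> (\<phi> d r X)"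
proof -
  have m: "\<ominus>\<^bsub>R\<^esub> r \<in> A d" using additive_subgroup.a_inv_closed[OF subgroup_degree assms(1)] .
  show ?thesis
    using phi_rho[OF assms] phi_rho[OF m assms(2)] rho_minus[OF assms] assms(2)
      SM_inv[OF SO_in[OF assms(2)] assms(2) rho_in[OF assms], of d] rho_SO_eq[OF assms(2)] by simp
qed

lemma kills_phi:
  assumes "r \<in> A d" "X \<in> obj T" shows "kills X d r \<longleftrightarrow> \<phi> d r X = zer X (SO d X)"
proof
  assume "kills X d r"
  then show "\<phi> d r X = zer X (SO d X)"
    using phi_rho[OF assms] SM_zer[OF SO_in[OF assms(2)] assms(2)] rho_SO_eq[OF assms(2)] by (simp add: kills_def)
next
  assume "\<phi> d r X = zer X (SO d X)"
  then show "kills X d r"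
    using SM_zer[OF assms(2) SO_in[OF assms(2)], of "- d" d] SO_SO[OF assms(2), of "- d" d]
    by (simp add: kills_def rho_def)
qed

lemma End_module:
  assumes X: "X \<in> obj T" shows "graded_module R A (End_part T X) (End_act T \<phi> X)"
proof -
  have s: "SM n (\<phi> d r X) \<in> hom_set T (SO n X) (SO (n + d) X)" if "r \<in> A d" for n d r
    using SM_in[OF X SO_in[OF X] phi_in[OF that X], of n] SO_SO[OF X, of n d] by simp
  show ?thesis
  proof (intro graded_module.intro graded_module_axioms.intro graded_commutative_ring_axioms)
    show "comm_group (End_part T X n)" for n
      using hom_group X by (simp add: End_part_def)
    show "End_act T \<phi> X d n r \<in> hom (End_part T X n) (End_part T X (n + d))" if "r \<in> A d" for r d n
      using group_hom.homh[OF postcomp_hom[OF X SO_in[OF X] SO_in[OF X] s[OF that]]]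
      by (simp add: End_part_def End_act_def[abs_def])
    show "End_act T \<phi> X 0 n \<one>\<^bsub>R\<^esub> x = x" if "x \<in> carrier (End_part T X n)" for x n
      using that X by (simp add: End_part_def End_act_def phi_one SM_idn idn_left)
    show "End_act T \<phi> X (d + e) n (r \<otimes>\<^bsub>R\<^esub> s) x = End_act T \<phi> X d (n + e) r (End_act T \<phi> X e n s x)"
      if r: "r \<in> A d" and t: "s \<in> A e" and x: "x \<in> carrier (End_part T X n)" for r d s e n x
    proof -
      have h: "SM e (\<phi> d r X) \<in> hom_set T (SO e X) (SO (e + d) X)" using s[OF r] .
      have "SM n (\<phi> (d + e) (r \<otimes>\<^bsub>R\<^esub> s) X) = SM n (SM e (\<phi> d r X)) \<cdot>\<^bsub>T\<^esub> SM n (\<phi> e s X)"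
        using phi_mult[OF r t X] SM_cmp[OF X SO_in[OF X] SO_in[OF X] phi_in[OF t X] h] by simp
      also have "SM n (SM e (\<phi> d r X)) = SM (n + e) (\<phi> d r X)"
        using SM_SM[OF phi_in[OF r X] X SO_in[OF X]] by simp
      finally show ?thesis
        using cmp_assoc[OF X SO_in[OF X] SO_in[OF X] SO_in[OF X] _ s[OF t] s[OF r]] x
        by (simp add: End_act_def End_part_def)
    qed
    show "End_act T \<phi> X d n (\<ominus>\<^bsub>R\<^esub> r) x = inv\<^bsub>End_part T X (n + d)\<^esub> (End_act T \<phi> X d n r x)"
      if "r \<in> A d" "x \<in> carrier (End_part T X n)" for r d x n
      using phi_minus[OF that(1) X] SM_inv[OF X SO_in[OF X] phi_in[OF that(1) X], of n] SO_SO[OF X, of n d]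
        cmp_inv_left[OF X SO_in[OF X] SO_in[OF X] _ s[OF that(1)]] that(2) X
      by (simp add: End_act_def End_part_def)
  qed
qed

text \<open>The fraction of the identity is zero iff some \<open>w\<close> outside \<open>q\<close>
  has zero \<open>\<phi> k w X\<close>; every other graded endomorphism is then killed by
  composition with this zero map.\<close>

lemma trivial_End_iff:
  assumes X: "X \<in> obj T" and q: "q \<in> Spec R A"
  shows "(\<forall>n. trivial_group (localised_part R A q (End_part T X) (End_act T \<phi> X) n)) \<longleftrightarrow> vanish X q"
proof -
  interpret L: module_localisation R A "End_part T X" "End_act T \<phi> X" q
    using homogeneous_prime_localisation[OF End_module[OF X] q] .
  have one: "\<one>\<^bsub>R\<^esub> \<notin> q" using prime_ideal(3)[OF q] .
  show ?thesis
  proof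
    assume "\<forall>n. trivial_group (L.L n)"
    moreover have i: "idn T X \<in> carrier (End_part T X (0 + 0))" using X by (simp add: End_part_def idn_in)
    ultimately have "L.frac 0 0 \<one>\<^bsub>R\<^esub> (idn T X) = \<one>\<^bsub>L.L 0\<^esub>"
      using L.frac_in[OF one_degree one, of "idn T X" 0] by (auto simp: trivial_group_def)
    then obtain k w where w: "w \<in> A k - q" "End_act T \<phi> X k (0 + 0) w (idn T X) = \<one>\<^bsub>End_part T X (0 + 0 + k)\<^esub>"
      using L.frac_eq_one_iff[OF one_degree one i] by blast
    then have "\<phi> k w X = zer X (SO k X)"
      using idn_right[OF X SO_in[OF X] phi_in[of w k X]] X by (simp add: End_act_def End_part_def)
    then show "vanish X q" using w kills_phi X unfolding vanish_def by blast
  next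
    assume "vanish X q"
    then obtain k w where w: "w \<in> A k - q" and kw: "\<phi> k w X = zer X (SO k X)"
      using kills_phi X unfolding vanish_def by blast
    show "\<forall>n. trivial_group (L.L n)"
    proof
      fix n
      have "C = \<one>\<^bsub>L.L n\<^esub>" if C: "C \<in> carrier (L.L n)" for C
      proof -
        obtain d s x where c: "s \<in> A d" "s \<notin> q" "x \<in> carrier (End_part T X (n + d))" "C = L.frac n d s x"
          using L.frac_cases[OF C] .
        have "SM (n + d) (\<phi> k w X) = zer (SO (n + d) X) (SO (n + d + k) X)"
          using kw SM_zer[OF X SO_in[OF X], of "n + d" k] SO_SO[OF X, of "n + d" k] by simp
        then have "End_act T \<phi> X k (n + d) w x = \<one>\<^bsub>End_part T X (n + d + k)\<^esub>"
          using c(3) cmp_zer_left[OF X SO_in[OF X] SO_in[OF X]] by (simp add: End_act_def End_part_def)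
        then show ?thesis using L.frac_eq_one_iff[OF c(1,2,3)] w c(4) by blast
      qed
      then show "trivial_group (L.L n)"
        using L.one_L_in comm_group.axioms(2)[OF L.comm_group_L] by (auto simp: trivial_group_def)
    qed
  qed
qed

lemma supported_subcat_eq:
  assumes p: "p \<in> Spec R A"
  shows "supported_subcat R A T \<phi> (V R A p) = full_subcat T (objsupp p)"
proof -
  have "Spec R A - V R A p = {q \<in> Spec R A. \<not> p \<subseteq> q}" by (auto simp: V_def)
  then have "{X \<in> obj T. \<forall>q \<in> Spec R A - V R A p. \<forall>n.
       trivial_group (localised_part R A q (End_part T X) (End_act T \<phi> X) n)} = objsupp p"
    using trivial_End_iff unfolding objsupp_def by blast
  then show ?thesis by (simp add: supported_subcat_def)
qed

lemma kills_mult: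
  assumes r: "r \<in> A d" and s: "s \<in> A e" and X: "X \<in> obj T"
  shows "kills X e s \<Longrightarrow> kills X (d + e) (r \<otimes>\<^bsub>R\<^esub> s)" "kills X d r \<Longrightarrow> kills X (d + e) (r \<otimes>\<^bsub>R\<^esub> s)"
proof -
  have sr: "SM (- d) (rh e s X) \<in> hom_set T (SO (- (d + e)) X) (SO (- d) X)"
    using SM_in[OF SO_in[OF X] X rho_in[OF s X], of "- d"] SO_SO[OF X, of "- d" "- e"] by simp
  show "kills X (d + e) (r \<otimes>\<^bsub>R\<^esub> s)" if "kills X e s"
    using that rho_mult[OF r s X] cmp_zer_right[OF SO_in[OF X] SO_in[OF X] X rho_in[OF r X], of "- (d + e)"]
      SM_zer[OF SO_in[OF X] X, of "- d" "- e"] SO_SO[OF X, of "- d" "- e"] by (simp add: kills_def)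
  show "kills X (d + e) (r \<otimes>\<^bsub>R\<^esub> s)" if "kills X d r"
    using that rho_mult[OF r s X] cmp_zer_left[OF SO_in[OF X] SO_in[OF X] X sr] by (simp add: kills_def)
qed

lemma kills_subgroup:
  assumes X: "X \<in> obj T" shows "additive_subgroup {r \<in> A d. kills X d r} R"
proof
  interpret G: group "Hom T (SO (- d) X) X" using hom_grp X by simp
  note sg = additive_subgroup.a_closed[OF subgroup_degree] additive_subgroup.a_inv_closed[OF subgroup_degree]
  let ?I = "{r \<in> A d. kills X d r}"
  show "?I \<subseteq> carrier (add_monoid R)" using degree_carrier by auto
  show "x \<otimes>\<^bsub>add_monoid R\<^esub> y \<in> ?I" if "x \<in> ?I" "y \<in> ?I" for x y
    using that sg rho_add[OF _ _ X, of x d y] by (auto simp: kills_def)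
  show "\<one>\<^bsub>add_monoid R\<^esub> \<in> ?I" using zero_degree rho_zero[OF X] by (auto simp: kills_def)
  show "inv\<^bsub>add_monoid R\<^esub> x \<in> ?I" if "x \<in> ?I" for x
    using that sg rho_minus[OF _ X, of x d] unfolding a_inv_def[symmetric] by (auto simp: kills_def)
qed

lemma kills_power_mono:
  assumes r: "r \<in> A d" and X: "X \<in> obj T" and k: "kills X (int n * d) (r [^]\<^bsub>R\<^esub> n)" and nm: "n \<le> m"
  shows "kills X (int m * d) (r [^]\<^bsub>R\<^esub> m)"
proof -
  obtain l where m: "m = l + n" using nm by (metis add.commute le_Suc_ex)
  have "kills X (int l * d + int n * d) (r [^]\<^bsub>R\<^esub> l \<otimes>\<^bsub>R\<^esub> r [^]\<^bsub>R\<^esub> n)"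
    using kills_mult(1)[OF power_degree[OF r] power_degree[OF r] X k] .
  then show ?thesis using nat_pow_mult[OF degree_carrier[OF r], of l n] m by (simp add: algebra_simps)
qed

text \<open>If no power of \<open>r\<close> kills \<open>X\<close>, then a homogeneous ideal that is maximal among those containing the
  annihilator of \<open>X\<close> and no power of \<open>r\<close> is prime.\<close>

lemma nil_iff_vanish:
  assumes noeth: "noetherian_ring R" and X: "X \<in> obj T" and r: "r \<in> A d"
  shows "nil X d r \<longleftrightarrow> (\<forall>q\<in>Spec R A. r \<notin> q \<longrightarrow> vanish X q)"
proof
  assume "nil X d r"
  then obtain n :: nat where "kills X (int n * d) (r [^]\<^bsub>R\<^esub> n)" by (auto simp: nil_def)
  then show "\<forall>q\<in>Spec R A. r \<notin> q \<longrightarrow> vanish X q"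
    using prime_power degree_carrier[OF r] power_degree[OF r] unfolding vanish_def by blast
next
  assume v: "\<forall>q\<in>Spec R A. r \<notin> q \<longrightarrow> vanish X q"
  show "nil X d r"
  proof (rule ccontr)
    assume nn: "\<not> nil X d r"
    let ?N = "\<Union>n. {r \<in> A n. kills X n r}"
    let ?J = "{x \<in> carrier R. \<forall>n. cmpt x n \<in> {r \<in> A n. kills X n r}}"
    \<comment> \<open>Generation by homogeneous elements keeps a maximal member homogeneous. The
      zeroth power of \<open>r\<close> is among those excluded, so the members are proper
      ideals.\<close>
    define \<C> where "\<C> = {genideal R B | B. B \<subseteq> homog \<and> ?N \<subseteq> B \<and> (\<forall>n::nat. r [^]\<^bsub>R\<^esub> n \<notin> genideal R B)}"
    have CI: "genideal R B \<in> \<C>" if "B \<subseteq> homog" "?N \<subseteq> B" "\<And>n::nat. r [^]\<^bsub>R\<^esub> n \<notin> genideal R B" for B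
      unfolding \<C>_def using that by blast
    have CE: "\<exists>B. I = genideal R B \<and> B \<subseteq> homog \<and> ?N \<subseteq> B \<and> (\<forall>n::nat. r [^]\<^bsub>R\<^esub> n \<notin> genideal R B)" if "I \<in> \<C>" for I
      using that unfolding \<C>_def by blast
    have Nh: "?N \<subseteq> homog" by (auto simp: homog_def)
    then have Nc: "?N \<subseteq> carrier R" using homog_carrier by blast
    have J: "ideal ?J R"
      using kills_subgroup[OF X] kills_mult[OF _ _ X] mult_degree by (intro ideal_componentwise) auto
    have "?N \<subseteq> ?J"
    proof
      fix x assume "x \<in> ?N"
      then obtain n where x: "x \<in> A n" "kills X n x" by auto
      have "kills X m \<zero>\<^bsub>R\<^esub>" for m using rho_zero[OF X] by (simp add: kills_def)
      then show "x \<in> ?J" using x zero_degree degree_carrier by (auto simp: cmpt_homog)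
    qed
    then have "genideal R ?N \<subseteq> ?J" using genideal_minimal[OF J] by blast
    \<comment> \<open>A power of \<open>r\<close> is its own only nonzero component, if any, so it
      belongs to \<open>?J\<close> only if it kills \<open>X\<close>.\<close>
    moreover have "r [^]\<^bsub>R\<^esub> n \<notin> ?J" for n :: nat
    proof
      assume "r [^]\<^bsub>R\<^esub> n \<in> ?J"
      then have "kills X (int n * d) (cmpt (r [^]\<^bsub>R\<^esub> n) (int n * d))" by blast
      then show False using nn cmpt_homog[OF power_degree[OF r, of n]] by (auto simp: nil_def)
    qed
    ultimately have "genideal R ?N \<in> \<C>" using Nh by (intro CI) blast+
    then have ne: "\<C> \<noteq> {}" by blast
    have id: "ideal I R" if I: "I \<in> \<C>" for I
    proof -
      obtain B where "I = genideal R B" "B \<subseteq> homog" using CE[OF I] by blast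
      then show ?thesis using genideal_ideal homog_carrier by blast
    qed
    obtain M where M: "M \<in> \<C>" and max: "\<And>I. \<lbrakk>I \<in> \<C>; M \<subseteq> I\<rbrakk> \<Longrightarrow> I = M"
      using maximal_ideal_exists[OF noeth ne id] by metis
    obtain B where B: "M = genideal R B" "B \<subseteq> homog" "?N \<subseteq> B"
      and Br: "\<forall>n::nat. r [^]\<^bsub>R\<^esub> n \<notin> genideal R B"
      using CE[OF M] by blast
    have Mr: "r [^]\<^bsub>R\<^esub> n \<notin> M" for n :: nat using Br B(1) by simp
    have Bc: "B \<subseteq> carrier R" using B homog_carrier by blast
    note Mi = id[OF M]
    have Mh: "homogeneous_ideal R A M" using genideal_homogeneous B by simp
    \<comment> \<open>Otherwise the ideal generated by \<open>insert s B\<close> would be a larger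
      member of the family.\<close>
    have ins: "\<exists>n::nat. r [^]\<^bsub>R\<^esub> n \<in> genideal R (insert s M)" if s: "s \<in> A e" "s \<notin> M" for s e
    proof (rule ccontr)
      assume no: "\<not> ?thesis"
      have "M \<subseteq> carrier R" using additive_subgroup.a_subset[OF ideal.axioms(1)[OF Mi]] .
      then have sc: "insert s M \<subseteq> carrier R" "insert s B \<subseteq> carrier R"
        using degree_carrier[OF s(1)] Bc by auto
      have BM: "B \<subseteq> M" using genideal_self[OF Bc] B by simp
      have 1: "genideal R (insert s B) \<subseteq> genideal R (insert s M)"
        using genideal_minimal[OF genideal_ideal[OF sc(1)]] genideal_self[OF sc(1)] BM by blast
      have "M \<subseteq> genideal R (insert s B)"
        unfolding B(1) using genideal_minimal[OF genideal_ideal[OF sc(2)]] genideal_self[OF sc(2)] by blast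
      moreover have "genideal R (insert s B) \<in> \<C>"
        using B no 1 s by (intro CI) (auto simp: homog_def)
      ultimately have "genideal R (insert s B) = M" using max by blast
      then show False using s genideal_self[OF sc(2)] by blast
    qed
    have "M \<in> Spec R A"
    proof (rule homogeneous_prime[OF Mh])
      show "\<one>\<^bsub>R\<^esub> \<notin> M" using Mr[of 0] by simp
      fix s e t k assume st: "s \<in> A e" "t \<in> A k" "s \<otimes>\<^bsub>R\<^esub> t \<in> M"
      show "s \<in> M \<or> t \<in> M"
      proof (rule ccontr)
        assume "\<not> (s \<in> M \<or> t \<in> M)"
        then obtain n m :: nat where "r [^]\<^bsub>R\<^esub> n \<in> genideal R (insert s M)" "r [^]\<^bsub>R\<^esub> m \<in> genideal R (insert t M)"
          using ins st by blast
        then have "r [^]\<^bsub>R\<^esub> n \<otimes>\<^bsub>R\<^esub> r [^]\<^bsub>R\<^esub> m \<in> M" using genideal_insert_mult[OF Mi st] by blast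
        then show False using Mr[of "n + m"] nat_pow_mult[OF degree_carrier[OF r]] by simp
      qed
    qed
    moreover have "r \<notin> M" using Mr[of 1] degree_carrier[OF r] by simp
    ultimately have "vanish X M" using v by blast
    then obtain k w where "w \<in> A k" "w \<notin> M" "kills X k w" by (auto simp: vanish_def)
    then have "w \<in> ?N" "w \<notin> M" by auto
    then show False using B genideal_self[OF Bc] by blast
  qed
qed

text \<open>Nilpotence of single elements replaces a condition on all primes. Exponents can be added
  and compared, and in this form the closure properties of supports are proved.\<close>

lemma objsupp_iff:
  assumes noeth: "noetherian_ring R" and B: "B \<subseteq> homog"
  shows "X \<in> objsupp B \<longleftrightarrow> X \<in> obj T \<and> (\<forall>d. \<forall>r\<in>B \<inter> A d. nil X d r)"
proof
  assume "X \<in> objsupp B"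
  then have X: "X \<in> obj T" "\<And>q. \<lbrakk>q \<in> Spec R A; \<not> B \<subseteq> q\<rbrakk> \<Longrightarrow> vanish X q" by (auto simp: objsupp_def)
  have "nil X d r" if "r \<in> B \<inter> A d" for d r
    using that X unfolding nil_iff_vanish[OF noeth X(1), of r d] by (subst nil_iff_vanish[OF noeth X(1)]) auto
  then show "X \<in> obj T \<and> (\<forall>d. \<forall>r\<in>B \<inter> A d. nil X d r)" using X by blast
next
  assume X: "X \<in> obj T \<and> (\<forall>d. \<forall>r\<in>B \<inter> A d. nil X d r)"
  have "vanish X q" if q: "q \<in> Spec R A" "\<not> B \<subseteq> q" for q
  proof -
    obtain r where r: "r \<in> B" "r \<notin> q" using q by blast
    then obtain d where d: "r \<in> A d" using B by (auto simp: homog_def)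
    then have "nil X d r" using X r by blast
    then show ?thesis using nil_iff_vanish[OF noeth _ d] X r q by blast
  qed
  then show "X \<in> objsupp B" using X by (auto simp: objsupp_def)
qed

lemma objsupp_insert: "objsupp (insert s B) = objsupp B \<inter> objsupp {s}"
  by (auto simp: objsupp_def)

lemma objsupp_genideal:
  assumes "B \<subseteq> carrier R" shows "objsupp (genideal R B) = objsupp B"
proof -
  have "genideal R B \<subseteq> q \<longleftrightarrow> B \<subseteq> q" if "q \<in> Spec R A" for q
    using genideal_minimal[OF prime_ideal(1)[OF that]] genideal_self[OF assms] by blast
  then show ?thesis by (auto simp: objsupp_def)
qed

section \<open>Closure properties of supports\<close>

lemma nil_SO: "\<lbrakk>r \<in> A d; X \<in> obj T; nil X d r\<rbrakk> \<Longrightarrow> nil (SO k X) d r"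
  using rho_SO_zer[OF power_degree] unfolding nil_def kills_def by blast

text \<open>By naturality the action on \<open>Y\<close>, restricted along the composite, passes
  through the action on \<open>X\<close>. The composite is left general so that the lemma serves for
  retracts and for both idempotents of a biproduct.\<close>

lemma kills_retract:
  assumes r: "r \<in> A d" and o: "X \<in> obj T" "Y \<in> obj T" and a: "a \<in> hom_set T Y X" and b: "b \<in> hom_set T X Y"
    and k: "kills X d r"
  shows "rh d r Y \<cdot>\<^bsub>T\<^esub> SM (- d) (b \<cdot>\<^bsub>T\<^esub> a) = zer (SO (- d) Y) Y"
proof -
  have sa: "SM (- d) a \<in> hom_set T (SO (- d) Y) (SO (- d) X)" using SM_in[OF o(2,1) a] .
  have sb: "SM (- d) b \<in> hom_set T (SO (- d) X) (SO (- d) Y)" using SM_in[OF o b] .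
  have "rh d r Y \<cdot>\<^bsub>T\<^esub> SM (- d) (b \<cdot>\<^bsub>T\<^esub> a) = (rh d r Y \<cdot>\<^bsub>T\<^esub> SM (- d) b) \<cdot>\<^bsub>T\<^esub> SM (- d) a"
    using SM_cmp[OF o(2,1,2) a b] cmp_assoc[OF SO_in[OF o(2)] SO_in[OF o(1)] SO_in[OF o(2)] o(2) sa sb rho_in[OF r o(2)]]
    by simp
  also have "rh d r Y \<cdot>\<^bsub>T\<^esub> SM (- d) b = b \<cdot>\<^bsub>T\<^esub> zer (SO (- d) X) X"
    using rho_natural[OF r o b] k by (simp add: kills_def)
  also have "\<dots> = zer (SO (- d) X) Y" using cmp_zer_right[OF SO_in[OF o(1)] o b] .
  also have "zer (SO (- d) X) Y \<cdot>\<^bsub>T\<^esub> SM (- d) a = zer (SO (- d) Y) Y"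
    using cmp_zer_left[OF SO_in[OF o(2)] SO_in[OF o(1)] o(2) sa] .
  finally show ?thesis .
qed

lemma nil_retract:
  assumes r: "r \<in> A d" and o: "X \<in> obj T" "Y \<in> obj T" and a: "a \<in> hom_set T Y X" and b: "b \<in> hom_set T X Y"
    and ba: "b \<cdot>\<^bsub>T\<^esub> a = idn T Y" and n: "nil X d r"
  shows "nil Y d r"
proof -
  obtain n :: nat where k: "kills X (int n * d) (r [^]\<^bsub>R\<^esub> n)" using n by (auto simp: nil_def)
  have "kills Y (int n * d) (r [^]\<^bsub>R\<^esub> n)"
    using kills_retract[OF power_degree[OF r] o a b k] ba SM_idn[OF o(2)]
      idn_right[OF SO_in[OF o(2)] o(2) rho_in[OF power_degree[OF r] o(2)]] by (simp add: kills_def)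
  then show ?thesis by (auto simp: nil_def)
qed

text \<open>With one exponent for both summands, the action on \<open>P\<close> is split along the
  decomposition of the identity, and each part factors through a summand.\<close>

lemma nil_biproduct:
  assumes r: "r \<in> A d" and o: "X \<in> obj T" "Y \<in> obj T" "P \<in> obj T"
    and h: "i \<in> hom_set T X P" "j \<in> hom_set T Y P" "p \<in> hom_set T P X" "q \<in> hom_set T P Y"
    and ij: "(i \<cdot>\<^bsub>T\<^esub> p) \<otimes>\<^bsub>Hom T P P\<^esub> (j \<cdot>\<^bsub>T\<^esub> q) = idn T P" and nX: "nil X d r" and nY: "nil Y d r"
  shows "nil P d r"
proof -
  obtain m n :: nat where "kills X (int m * d) (r [^]\<^bsub>R\<^esub> m)" "kills Y (int n * d) (r [^]\<^bsub>R\<^esub> n)"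
    using nX nY by (auto simp: nil_def)
  then obtain n :: nat where k: "kills X (int n * d) (r [^]\<^bsub>R\<^esub> n)" "kills Y (int n * d) (r [^]\<^bsub>R\<^esub> n)"
    using kills_power_mono[OF r o(1) _ max.cobounded1[of m n]] kills_power_mono[OF r o(2) _ max.cobounded2[of n m]]
    by blast
  let ?d = "int n * d" and ?r = "r [^]\<^bsub>R\<^esub> n"
  note rd = power_degree[OF r, of n]
  let ?\<rho> = "rh ?d ?r P"
  have \<rho>: "?\<rho> \<in> hom_set T (SO (- ?d) P) P" using rho_in[OF rd o(3)] .
  have c: "i \<cdot>\<^bsub>T\<^esub> p \<in> hom_set T P P" "j \<cdot>\<^bsub>T\<^esub> q \<in> hom_set T P P"
    using cmp_in[OF o(3,1,3) h(3,1)] cmp_in[OF o(3,2,3) h(4,2)] by auto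
  have "?\<rho> = ?\<rho> \<cdot>\<^bsub>T\<^esub> SM (- ?d) ((i \<cdot>\<^bsub>T\<^esub> p) \<otimes>\<^bsub>Hom T P P\<^esub> (j \<cdot>\<^bsub>T\<^esub> q))"
    using ij SM_idn[OF o(3)] idn_right[OF SO_in[OF o(3)] o(3) \<rho>] by simp
  also have "\<dots> = (?\<rho> \<cdot>\<^bsub>T\<^esub> SM (- ?d) (i \<cdot>\<^bsub>T\<^esub> p)) \<otimes>\<^bsub>Hom T (SO (- ?d) P) P\<^esub> (?\<rho> \<cdot>\<^bsub>T\<^esub> SM (- ?d) (j \<cdot>\<^bsub>T\<^esub> q))"
    using SM_mult[OF o(3,3) c] SM_in[OF o(3,3) c(1)] SM_in[OF o(3,3) c(2)]
      cmp_add_right[OF SO_in[OF o(3)] SO_in[OF o(3)] o(3) _ _ \<rho>] by simp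
  also have "\<dots> = zer (SO (- ?d) P) P"
    using kills_retract[OF rd o(1,3) h(3,1) k(1)] kills_retract[OF rd o(2,3) h(4,2) k(2)]
      group.is_monoid[OF hom_grp[OF SO_in[OF o(3)] o(3)]] by (simp add: monoid.r_one)
  finally have "kills P ?d ?r" by (simp add: kills_def)
  then show ?thesis by (auto simp: nil_def)
qed

text \<open>The exponents add up. The power killing \<open>Z\<close> acts on \<open>Y\<close>
  through a map to \<open>X\<close>, by the weak kernel property; the power killing
  \<open>X\<close>, moved across that map by naturality, then annihilates it.\<close>

lemma nil_mid:
  assumes r: "r \<in> A d" and t: "dtri X Y Z u v w" and nX: "nil X d r" and nZ: "nil Z d r"
  shows "nil Y d r"
proof -
  obtain m n :: nat where m: "kills X (int m * d) (r [^]\<^bsub>R\<^esub> m)" and n: "kills Z (int n * d) (r [^]\<^bsub>R\<^esub> n)"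
    using nX nZ by (auto simp: nil_def)
  let ?d = "int m * d" and ?r = "r [^]\<^bsub>R\<^esub> m" and ?e = "int n * d" and ?s = "r [^]\<^bsub>R\<^esub> n"
  note rd = power_degree[OF r, of m] and sd = power_degree[OF r, of n]
  have o: "X \<in> obj T" "Y \<in> obj T" "Z \<in> obj T" and u: "u \<in> hom_set T X Y" and v: "v \<in> hom_set T Y Z"
    using t unfolding dtri_def by auto
  have "v \<cdot>\<^bsub>T\<^esub> rh ?e ?s Y = zer (SO (- ?e) Y) Z"
    using rho_natural[OF sd o(2,3) v] n cmp_zer_left[OF SO_in[OF o(2)] SO_in[OF o(3)] o(3) SM_in[OF o(2,3) v]]
    by (simp add: kills_def)
  then obtain g where g: "g \<in> hom_set T (SO (- ?e) Y) X" "rh ?e ?s Y = u \<cdot>\<^bsub>T\<^esub> g"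
    using weak_kernel[OF t SO_in[OF o(2)] rho_in[OF sd o(2)]] by blast
  note sY = SO_in[OF o(2), of "- ?e"]
  have ss: "SO (- ?d) (SO (- ?e) Y) = SO (- (?d + ?e)) Y" using SO_SO[OF o(2)] by simp
  have "rh (?d + ?e) (?r \<otimes>\<^bsub>R\<^esub> ?s) Y = (u \<cdot>\<^bsub>T\<^esub> g) \<cdot>\<^bsub>T\<^esub> rh ?d ?r (SO (- ?e) Y)"
    using rho_mult'[OF rd sd o(2)] g by simp
  also have "\<dots> = u \<cdot>\<^bsub>T\<^esub> (g \<cdot>\<^bsub>T\<^esub> rh ?d ?r (SO (- ?e) Y))"
    using cmp_assoc[OF SO_in[OF sY] sY o(1,2) rho_in[OF rd sY] g(1) u] .
  also have "g \<cdot>\<^bsub>T\<^esub> rh ?d ?r (SO (- ?e) Y) = rh ?d ?r X \<cdot>\<^bsub>T\<^esub> SM (- ?d) g"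
    using rho_natural[OF rd sY o(1) g(1)] .
  also have "\<dots> = zer (SO (- (?d + ?e)) Y) X"
    using m cmp_zer_left[OF SO_in[OF sY] SO_in[OF o(1)] o(1) SM_in[OF sY o(1) g(1)]] ss by (simp add: kills_def)
  also have "u \<cdot>\<^bsub>T\<^esub> zer (SO (- (?d + ?e)) Y) X = zer (SO (- (?d + ?e)) Y) Y"
    using cmp_zer_right[OF SO_in[OF o(2)] o(1,2) u] .
  finally have "kills Y (int (m + n) * d) (r [^]\<^bsub>R\<^esub> (m + n))"
    using nat_pow_mult[OF degree_carrier[OF r], of m n] by (simp add: kills_def algebra_simps)
  then show ?thesis unfolding nil_def by blast
qed

lemma thick_objsupp:
  assumes noeth: "noetherian_ring R" and B: "B \<subseteq> homog" shows "thick (objsupp B)"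
proof -
  note iff = objsupp_iff[OF noeth B]
  have z: "X \<in> objsupp B" if "zero_object T X" for X
  proof -
    have X: "X \<in> obj T" using that by (simp add: zero_object_def)
    have "kills X (int 0 * d) (r [^]\<^bsub>R\<^esub> (0::nat))" for d r
      using rho_one[OF X] to_zero_object[OF that X idn_in[OF X]] by (simp add: kills_def)
    then show ?thesis unfolding iff nil_def using X by blast
  qed
  show ?thesis
    unfolding thick_def
  proof (intro conjI allI impI ballI)
    show "objsupp B \<subseteq> obj T" by (auto simp: objsupp_def)
  next
    fix X assume "zero_object T X" then show "X \<in> objsupp B" using z by blast
  next
    fix X k assume "X \<in> objsupp B" then show "SO k X \<in> objsupp B" unfolding iff using nil_SO by auto
  next
    fix X Y Z u v w assume t: "dtri X Y Z u v w" "X \<in> objsupp B" "Z \<in> objsupp B"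
    have "Y \<in> obj T" using t by (simp add: dtri_def)
    then show "Y \<in> objsupp B" using t unfolding iff using nil_mid by blast
  next
    fix X Y a b assume "X \<in> objsupp B" "Y \<in> obj T" "a \<in> hom_set T Y X" "b \<in> hom_set T X Y" "b \<cdot>\<^bsub>T\<^esub> a = idn T Y"
    then show "Y \<in> objsupp B" unfolding iff using nil_retract by blast
  next
    fix X Y P i j p q
    assume a: "X \<in> objsupp B" "Y \<in> objsupp B" "P \<in> obj T" "i \<in> hom_set T X P" "j \<in> hom_set T Y P"
      "p \<in> hom_set T P X" "q \<in> hom_set T P Y" "(i \<cdot>\<^bsub>T\<^esub> p) \<otimes>\<^bsub>Hom T P P\<^esub> (j \<cdot>\<^bsub>T\<^esub> q) = idn T P"
    then have "nil P d r" if "r \<in> B \<inter> A d" for d r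
      using that nil_biproduct[of r d X Y P i j p q] unfolding iff by auto
    then show "P \<in> objsupp B" using a unfolding iff by blast
  qed
qed

text \<open>It is the square of \<open>s\<close> that kills the cone. One action of \<open>s\<close>
  on \<open>Z\<close> vanishes after \<open>i\<close> and hence factors through the connecting map
  \<open>j\<close>. The second action is moved across \<open>j\<close> by naturality, where it meets
  a composite of consecutive maps of the triangle.\<close>

lemma cone_nil:
  assumes s: "s \<in> A d" and E: "E \<in> obj T" and t: "dtri (SO (- d) E) E Z (rh d s E) i j"
  shows "nil Z d s"
proof -
  let ?W = "susp_obj T (SO (- d) E)"
  have o: "Z \<in> obj T" "?W \<in> obj T" using t E unfolding dtri_def by auto
  have i: "i \<in> hom_set T E Z" and j: "j \<in> hom_set T Z ?W" using t unfolding dtri_def by auto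
  \<comment> \<open>The action in its form as a map out of \<open>Z\<close>, because the weak
    cokernel property concerns maps out of the cone.\<close>
  let ?g = "SM d (rh d s Z)"
  have g: "?g \<in> hom_set T Z (SO d Z)"
    using SM_in[OF SO_in[OF o(1)] o(1) rho_in[OF s o(1)], of d] rho_SO_eq[OF o(1)] by simp
  have "rh d s Z \<cdot>\<^bsub>T\<^esub> SM (- d) i = zer (SO (- d) E) Z"
    using rho_natural[OF s E o(1) i] dtri_comp_zer[OF t] by simp
  then have "SM d (rh d s Z) \<cdot>\<^bsub>T\<^esub> SM d (SM (- d) i) = SM d (zer (SO (- d) E) Z)"
    using SM_cmp[OF SO_in[OF E] SO_in[OF o(1)] o(1) SM_in[OF E o(1) i] rho_in[OF s o(1)], of d] by simp
  then have "?g \<cdot>\<^bsub>T\<^esub> i = zer E (SO d Z)"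
    using SM_SM[OF i E o(1), of d "- d"] SM_zer[OF SO_in[OF E] o(1), of d "- d"] rho_SO_eq[OF E] by simp
  note gi = this
  have t2: "dtri E Z ?W i j (inv\<^bsub>Hom T ?W (susp_obj T E)\<^esub> (susp_mor T (rh d s E)))" using dtri_rotate[OF t] .
  obtain h where h: "h \<in> hom_set T ?W (SO d Z)" "?g = h \<cdot>\<^bsub>T\<^esub> j"
    using weak_cokernel[OF t2 SO_in[OF o(1)] g gi] by blast
  let ?Wd = "SO (- d) ?W"
  have Wd: "?Wd = SO (1 - 2 * d) E" using SO_SO[OF E, of 1 "- d"] SO_SO[OF E, of "- d" "1 - d"] E by simp
  have sj: "SM (- d) j \<in> hom_set T (SO (- d) Z) ?Wd" using SM_in[OF o j] .
  have sh: "SM (- d) h \<in> hom_set T ?Wd Z"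
    using SM_in[OF o(2) SO_in[OF o(1)] h(1), of "- d"] SO_SO[OF o(1), of "- d" d] by simp
  have \<rho>: "rh d s Z = SM (- d) h \<cdot>\<^bsub>T\<^esub> SM (- d) j"
    using SM_cmp[OF o SO_in[OF o(1)] j h(1), of "- d"] h(2)
      SM_SM[OF rho_in[OF s o(1)] SO_in[OF o(1)] o(1), of "- d" d] by simp
  have Zd: "SO (- d) Z \<in> obj T" "?Wd \<in> obj T" using o by auto
  have sjj: "SM (- d) (SM (- d) j) \<in> hom_set T (SO (- d) (SO (- d) Z)) (SO (- d) ?Wd)" using SM_in[OF Zd sj] .
  \<comment> \<open>The last map of the triangle followed by the suspended action is zero. The
    action on the suspension differs from the suspended action by a sign at most, which is harmless
    here.\<close>
  have key: "rh d s ?Wd \<cdot>\<^bsub>T\<^esub> SM (- d) (SM (- d) j) = zer (SO (- d) (SO (- d) Z)) ?Wd"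
  proof -
    have sr: "susp_mor T (rh d s E) \<in> hom_set T ?W (susp_obj T E)"
      using susp_mor_in[OF SO_in[OF E] E rho_in[OF s E]] .
    have "SM (- (2 * d)) (susp_mor T (rh d s E) \<cdot>\<^bsub>T\<^esub> j) = SM (- (2 * d)) (zer Z (susp_obj T E))"
      using dtri_next(2)[OF t] by simp
    then have "SM (- (2 * d)) (susp_mor T (rh d s E)) \<cdot>\<^bsub>T\<^esub> SM (- (2 * d)) j = SM (- (2 * d)) (zer Z (susp_obj T E))"
      using SM_cmp[OF o susp_in[OF E] j sr] by simp
    moreover have "SM (- (2 * d)) (susp_mor T (rh d s E)) = SM (1 - 2 * d) (rh d s E)"
      using SM_SM[OF rho_in[OF s E] SO_in[OF E] E, of "- (2 * d)" 1] by simp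
    moreover have "SM (- (2 * d)) j = SM (- d) (SM (- d) j)" using SM_SM[OF j o, of "- d" "- d"] by simp
    moreover have "SM (- (2 * d)) (zer Z (susp_obj T E)) = zer (SO (- d) (SO (- d) Z)) ?Wd"
      using SM_zer[OF o(1) susp_in[OF E]] SO_SO[OF o(1), of "- d" "- d"] SO_SO[OF E, of "- (2 * d)" 1] Wd by simp
    ultimately have k: "SM (1 - 2 * d) (rh d s E) \<cdot>\<^bsub>T\<^esub> SM (- d) (SM (- d) j) = zer (SO (- d) (SO (- d) Z)) ?Wd"
      by simp
    have Wdd: "SO (- d) ?Wd = SO (1 - 2 * d - d) E" using Wd SO_SO[OF E, of "- d" "1 - 2 * d"] by simp
    have sm: "SM (1 - 2 * d) (rh d s E) \<in> hom_set T (SO (- d) ?Wd) ?Wd"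
      using SM_in[OF SO_in[OF E] E rho_in[OF s E], of "1 - 2 * d"] SO_SO[OF E, of "1 - 2 * d" "- d"] Wd Wdd by simp
    have "rh d s ?Wd = SM (1 - 2 * d) (rh d s E) \<or>
      rh d s ?Wd = inv\<^bsub>Hom T (SO (- d) ?Wd) ?Wd\<^esub> (SM (1 - 2 * d) (rh d s E))"
      using rho_SO[OF s E, of "1 - 2 * d"] Wd Wdd by simp
    then show ?thesis
      using k cmp_inv_left[OF SO_in[OF Zd(1)] SO_in[OF Zd(2)] Zd(2) sjj sm]
        monoid.inv_one[OF group.is_monoid[OF hom_grp[OF SO_in[OF Zd(1)] Zd(2)]]] by auto
  qed
  have "rh (d + d) (s \<otimes>\<^bsub>R\<^esub> s) Z = (SM (- d) h \<cdot>\<^bsub>T\<^esub> SM (- d) j) \<cdot>\<^bsub>T\<^esub> rh d s (SO (- d) Z)"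
    using rho_mult'[OF s s o(1)] \<rho> by simp
  also have "\<dots> = SM (- d) h \<cdot>\<^bsub>T\<^esub> (SM (- d) j \<cdot>\<^bsub>T\<^esub> rh d s (SO (- d) Z))"
    using cmp_assoc[OF SO_in[OF Zd(1)] Zd o(1) rho_in[OF s Zd(1)] sj sh] .
  also have "SM (- d) j \<cdot>\<^bsub>T\<^esub> rh d s (SO (- d) Z) = rh d s ?Wd \<cdot>\<^bsub>T\<^esub> SM (- d) (SM (- d) j)"
    using rho_natural[OF s Zd sj] .
  also have "SM (- d) h \<cdot>\<^bsub>T\<^esub> \<dots> = zer (SO (- (d + d)) Z) Z"
    using key cmp_zer_right[OF SO_in[OF o(1)] Zd(2) o(1) sh] SO_SO[OF o(1), of "- d" "- d"] by simp
  finally have "kills Z (int 2 * d) (s [^]\<^bsub>R\<^esub> (2::nat))"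
    using degree_carrier[OF s] by (simp add: kills_def numeral_2_eq_2 algebra_simps)
  then show ?thesis unfolding nil_def by blast
qed

end

section \<open>Direct sums of groups\<close>

definition sum_inj :: "'i set \<Rightarrow> ('i \<Rightarrow> ('g, 'z) monoid_scheme) \<Rightarrow> 'i \<Rightarrow> 'g \<Rightarrow> 'i \<Rightarrow> 'g"
  where "sum_inj I G i g = (\<lambda>j\<in>I. if j = i then g else \<one>\<^bsub>G j\<^esub>)"

context
  fixes I :: "'i set" and G :: "'i \<Rightarrow> 'g monoid"
  assumes G: "\<And>i. i \<in> I \<Longrightarrow> comm_group (G i)"
begin

lemma sum_part_group: "i \<in> I \<Longrightarrow> group (G i)"
  using G comm_group.axioms(2) by blast

lemma sum_carrier: "carrier (sum_group I G) = {x \<in> \<Pi>\<^sub>E i\<in>I. carrier (G i). finite {i \<in> I. x i \<noteq> \<one>\<^bsub>G i\<^esub>}}"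
  by (rule carrier_sum_group) (rule sum_part_group)

lemma sum_comm_group: "comm_group (sum_group I G)"
proof (rule group.group_comm_groupI)
  show "group (sum_group I G)" using sum_part_group by simp
  fix x y assume "x \<in> carrier (sum_group I G)" "y \<in> carrier (sum_group I G)"
  then show "x \<otimes>\<^bsub>sum_group I G\<^esub> y = y \<otimes>\<^bsub>sum_group I G\<^esub> x"
    using comm_monoid.m_comm[OF comm_group.axioms(1)[OF G]]
    by (auto simp: sum_carrier PiE_iff intro!: restrict_ext)
qed

lemma sum_inj_in: "\<lbrakk>i \<in> I; g \<in> carrier (G i)\<rbrakk> \<Longrightarrow> sum_inj I G i g \<in> carrier (sum_group I G)"
  using monoid.one_closed[OF group.is_monoid[OF sum_part_group]] finite_subset[of _ "{i}"]
  by (auto simp: sum_carrier sum_inj_def)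

lemma sum_inj_hom: "i \<in> I \<Longrightarrow> sum_inj I G i \<in> hom (G i) (sum_group I G)"
  using sum_inj_in monoid.l_one[OF group.is_monoid[OF sum_part_group]]
    monoid.one_closed[OF group.is_monoid[OF sum_part_group]]
  by (auto simp: hom_def sum_inj_def intro!: restrict_ext)

lemma sum_group_induct:
  assumes x: "x \<in> carrier (sum_group I G)" and K: "{i \<in> I. x i \<noteq> \<one>\<^bsub>G i\<^esub>} \<subseteq> K"
    and one: "P \<one>\<^bsub>sum_group I G\<^esub>"
    and step: "\<And>i g y. \<lbrakk>i \<in> I; i \<in> K; g \<in> carrier (G i); y \<in> carrier (sum_group I G); P y\<rbrakk>
      \<Longrightarrow> P (sum_inj I G i g \<otimes>\<^bsub>sum_group I G\<^esub> y)"
  shows "P x"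
proof -
  note one_in = monoid.one_closed[OF group.is_monoid[OF sum_part_group]]
  have "finite S \<Longrightarrow> S \<subseteq> K \<Longrightarrow> x \<in> carrier (sum_group I G) \<Longrightarrow> {i \<in> I. x i \<noteq> \<one>\<^bsub>G i\<^esub>} \<subseteq> S \<Longrightarrow> P x" for S x
  proof (induction S arbitrary: x rule: finite_induct)
    case empty
    then have "x = \<one>\<^bsub>sum_group I G\<^esub>"
      by (auto simp: sum_carrier PiE_iff extensional_def restrict_def fun_eq_iff)
    then show ?case using one by metis
  next
    case (insert i S)
    show ?case
    proof (cases "i \<in> I")
      case False
      then show ?thesis using insert by (intro insert.IH) auto
    next
      case i: True
      let ?y = "x(i := \<one>\<^bsub>G i\<^esub>)"
      have xi: "x i \<in> carrier (G i)" using insert.prems i by (auto simp: sum_carrier)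
      have "{j \<in> I. ?y j \<noteq> \<one>\<^bsub>G j\<^esub>} \<subseteq> {j \<in> I. x j \<noteq> \<one>\<^bsub>G j\<^esub>}" by auto
      moreover have "finite {j \<in> I. x j \<noteq> \<one>\<^bsub>G j\<^esub>}" using insert.prems by (simp add: sum_carrier)
      ultimately have "finite {j \<in> I. ?y j \<noteq> \<one>\<^bsub>G j\<^esub>}" by (rule finite_subset)
      then have y: "?y \<in> carrier (sum_group I G)"
        using insert.prems i one_in[OF i] unfolding sum_carrier by (simp add: PiE_iff extensional_def)
      have "{j \<in> I. ?y j \<noteq> \<one>\<^bsub>G j\<^esub>} \<subseteq> S" using insert.prems by auto
      then have "P ?y" using insert.prems(1) y by (intro insert.IH) (simp_all del: fun_upd_apply)
      moreover have "x = sum_inj I G i (x i) \<otimes>\<^bsub>sum_group I G\<^esub> ?y"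
      proof
        fix j show "x j = (sum_inj I G i (x i) \<otimes>\<^bsub>sum_group I G\<^esub> ?y) j"
          using insert.prems monoid.r_one[OF group.is_monoid[OF sum_part_group[OF i]] xi]
            monoid.l_one[OF group.is_monoid[OF sum_part_group]]
          by (auto simp: sum_carrier sum_inj_def PiE_iff extensional_def)
      qed
      ultimately show ?thesis using step[OF i _ xi y] insert.prems(1) by simp
    qed
  qed
  then show ?thesis using x K by (auto simp: sum_carrier)
qed

text \<open>Elements have finite support and are built up by adding one summand at a time. Agreement
  is required only on indices in \<open>K\<close>, which lets \<open>dat_extend\<close> prescribe a
  homomorphism anew on a summand that the element does not meet.\<close>

lemma sum_hom_ext:
  assumes h: "h \<in> hom (sum_group I G) H" and k: "k \<in> hom (sum_group I G) H" and H: "group H"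
    and K: "{i \<in> I. x i \<noteq> \<one>\<^bsub>G i\<^esub>} \<subseteq> K"
    and eq: "\<And>i g. \<lbrakk>i \<in> I; i \<in> K; g \<in> carrier (G i)\<rbrakk> \<Longrightarrow> h (sum_inj I G i g) = k (sum_inj I G i g)"
    and x: "x \<in> carrier (sum_group I G)"
  shows "h x = k x"
proof (induction rule: sum_group_induct[OF x K])
  have g: "group (sum_group I G)" using sum_part_group by simp
  case 1 show ?case using hom_one[OF h g H] hom_one[OF k g H] by (rule trans[OF _ sym])
next
  case (2 i g y)
  then show ?case
    by (simp only: hom_mult[OF h sum_inj_in[OF 2(1,3)] 2(4)] hom_mult[OF k sum_inj_in[OF 2(1,3)] 2(4)] eq)
qed

lemma sum_hom_exists:
  assumes H: "comm_group H" and f: "\<And>i. i \<in> I \<Longrightarrow> f i \<in> hom (G i) H"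
  shows "\<exists>h\<in>hom (sum_group I G) H. \<forall>i\<in>I. \<forall>g\<in>carrier (G i). h (sum_inj I G i g) = f i g"
proof (intro bexI ballI)
  interpret H: comm_group H by fact
  let ?h = "\<lambda>x. gfinprod H (\<lambda>i. f i (x i)) I"
  show "?h \<in> hom (sum_group I G) H" using H.hom_group_sum f sum_part_group by blast
  fix i g assume i: "i \<in> I" and g: "g \<in> carrier (G i)"
  have fg: "f i g \<in> carrier H" using f[OF i] g by (auto simp: hom_def)
  have "{j \<in> I. f j (sum_inj I G i g j) \<noteq> \<one>\<^bsub>H\<^esub>} = (if f i g = \<one>\<^bsub>H\<^esub> then {} else {i})"
    using i hom_one[OF f sum_part_group H.is_group] by (auto simp: sum_inj_def)
  then show "?h (sum_inj I G i g) = f i g"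
    using fg i by (auto simp: gfinprod_def sum_inj_def)
qed

end

section \<open>Transport of functors to the universe\<close>

lemma transport_group_iso:
  assumes inj: "inj_on e (carrier G)" and G: "comm_group G"
  shows "comm_group (transport_group e G)" "e \<in> iso G (transport_group e G)"
proof -
  interpret G: comm_group G by fact
  have m: "e x \<otimes>\<^bsub>transport_group e G\<^esub> e y = e (x \<otimes>\<^bsub>G\<^esub> y)" if "x \<in> carrier G" "y \<in> carrier G" for x y
    using that inj by (simp add: transport_group_def)
  have c: "carrier (transport_group e G) = e ` carrier G" and o: "\<one>\<^bsub>transport_group e G\<^esub> = e \<one>\<^bsub>G\<^esub>"
    by (simp_all add: transport_group_def)
  show "comm_group (transport_group e G)"
  proof (rule comm_groupI, unfold c o)
    fix x assume "x \<in> e ` carrier G"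
    then obtain g where g: "x = e g" "g \<in> carrier G" by blast
    then have "e (inv\<^bsub>G\<^esub> g) \<otimes>\<^bsub>transport_group e G\<^esub> x = e \<one>\<^bsub>G\<^esub>" using m by simp
    then show "\<exists>y\<in>e ` carrier G. y \<otimes>\<^bsub>transport_group e G\<^esub> x = e \<one>\<^bsub>G\<^esub>" using g by blast
  qed (auto simp: m G.m_ac)
  show "e \<in> iso G (transport_group e G)"
    using m inj by (auto simp: iso_def hom_def c bij_betw_def)
qed

lemma iso_surjE:
  assumes "h \<in> iso G H" "y \<in> carrier H" obtains x where "x \<in> carrier G" "y = h x"
  using assms by (auto simp: iso_def bij_betw_def)

context triangulated_category
begin

text \<open>The injections behind \<open>to_universe\<close> are arbitrary choices. All that is kept
  of them is a natural isomorphism, and smallness of the values guarantees that the choice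
  succeeds.\<close>

lemma to_universe_iso:
  fixes G :: "('o, 'm, 'b) presheaf"
  assumes G: "additive_functor T G"
    and small: "\<And>X. X \<in> obj T \<Longrightarrow> carrier (fobj G X) \<lesssim> (UNIV :: 'a set)"
  obtains e :: "'o \<Rightarrow> 'b \<Rightarrow> 'a" where
    "\<And>X. X \<in> obj T \<Longrightarrow> comm_group (fobj (to_universe T G :: ('o, 'm, 'a) presheaf) X)"
    "\<And>X. X \<in> obj T \<Longrightarrow> e X \<in> iso (fobj G X) (fobj (to_universe T G) X)"
    "\<And>X Y f x. \<lbrakk>X \<in> obj T; Y \<in> obj T; f \<in> hom_set T X Y; x \<in> carrier (fobj G Y)\<rbrakk>
      \<Longrightarrow> fmap (to_universe T G) f (e Y x) = e X (fmap G f x)"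
proof
  let ?e = "\<lambda>X. SOME e :: 'b \<Rightarrow> 'a. inj_on e (carrier (fobj G X))"
  have inj: "inj_on (?e X) (carrier (fobj G X))" if "X \<in> obj T" for X
  proof (rule someI_ex[where P = "\<lambda>e :: 'b \<Rightarrow> 'a. inj_on e (carrier (fobj G X))"])
    show "\<exists>e :: 'b \<Rightarrow> 'a. inj_on e (carrier (fobj G X))" using small[OF that] by (auto simp: lepoll_def)
  qed
  have f: "fobj (to_universe T G :: ('o, 'm, 'a) presheaf) X = transport_group (?e X) (fobj G X)" for X
    by (simp add: to_universe_def Let_def)
  fix X assume X: "X \<in> obj T"
  show "comm_group (fobj (to_universe T G :: ('o, 'm, 'a) presheaf) X)"
    unfolding f using transport_group_iso(1)[OF inj[OF X]] af_comm_group[OF G X] .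
  show "?e X \<in> iso (fobj G X) (fobj (to_universe T G) X)"
    unfolding f using transport_group_iso(2)[OF inj[OF X]] af_comm_group[OF G X] .
next
  let ?e = "\<lambda>X. SOME e :: 'b \<Rightarrow> 'a. inj_on e (carrier (fobj G X))"
  fix X Y f x assume a: "X \<in> obj T" "Y \<in> obj T" "f \<in> hom_set T X Y" "x \<in> carrier (fobj G Y)"
  have "inj_on (?e Y) (carrier (fobj G Y))"
  proof (rule someI_ex[where P = "\<lambda>e :: 'b \<Rightarrow> 'a. inj_on e (carrier (fobj G Y))"])
    show "\<exists>e :: 'b \<Rightarrow> 'a. inj_on e (carrier (fobj G Y))" using small[OF a(2)] by (auto simp: lepoll_def)
  qed
  then show "fmap (to_universe T G) f (?e Y x) = ?e X (fmap G f x)"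
    using hom_src_tgt[OF a(1,2,3)] a(4) by (simp add: to_universe_def Let_def)
qed

lemma Coh_iso:
  fixes G :: "('o, 'm, 'b) presheaf" and U :: "('o, 'm, 'c) presheaf"
  assumes G: "G \<in> Coh T"
    and cg: "\<And>X. X \<in> obj T \<Longrightarrow> comm_group (fobj U X)"
    and e: "\<And>X. X \<in> obj T \<Longrightarrow> e X \<in> iso (fobj G X) (fobj U X)"
    and nat: "\<And>X Y f x. \<lbrakk>X \<in> obj T; Y \<in> obj T; f \<in> hom_set T X Y; x \<in> carrier (fobj G Y)\<rbrakk>
      \<Longrightarrow> fmap U f (e Y x) = e X (fmap G f x)"
  shows "U \<in> Coh T"
proof -
  note A = Coh_additive[OF G]
  have h: "e X \<in> hom (fobj G X) (fobj U X)" if "X \<in> obj T" for X using e[OF that] by (simp add: iso_def)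
  have mult: "e X (x \<otimes>\<^bsub>fobj G X\<^esub> y) = e X x \<otimes>\<^bsub>fobj U X\<^esub> e X y"
    if "X \<in> obj T" "x \<in> carrier (fobj G X)" "y \<in> carrier (fobj G X)" for X x y
    using hom_mult[OF h] that by blast
  have one: "e X \<one>\<^bsub>fobj G X\<^esub> = \<one>\<^bsub>fobj U X\<^esub>" if "X \<in> obj T" for X
    using hom_one[OF h[OF that] af_group[OF A that] comm_group.axioms(2)[OF cg[OF that]]] .
  have cl: "e X x \<in> carrier (fobj U X)" if "X \<in> obj T" "x \<in> carrier (fobj G X)" for X x
    using hom_in_carrier[OF h] that by blast
  have inj: "inj_on (e X) (carrier (fobj G X))" if "X \<in> obj T" for X using e[OF that] by (simp add: iso_def bij_betw_def)
  show ?thesis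
    unfolding Coh_iff
  proof (intro conjI allI impI ballI additive_functorI)
    fix X assume "X \<in> obj T" then show "comm_group (fobj U X)" by (rule cg)
  next
    fix X Y f assume a: "X \<in> obj T" "Y \<in> obj T" "f \<in> hom_set T X Y"
    show "fmap U f \<in> hom (fobj U Y) (fobj U X)"
    proof (rule homI)
      fix u assume "u \<in> carrier (fobj U Y)"
      then obtain x where x: "x \<in> carrier (fobj G Y)" "u = e Y x" using iso_surjE[OF e[OF a(2)]] by metis
      then show "fmap U f u \<in> carrier (fobj U X)" using nat[OF a x(1)] cl[OF a(1)] af_closed[OF A a] by simp
      fix v assume "v \<in> carrier (fobj U Y)"
      then obtain y where y: "y \<in> carrier (fobj G Y)" "v = e Y y" using iso_surjE[OF e[OF a(2)]] by metis
      have "x \<otimes>\<^bsub>fobj G Y\<^esub> y \<in> carrier (fobj G Y)"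
        using x y group.is_monoid[OF af_group[OF A a(2)]] monoid.m_closed by metis
      then show "fmap U f (u \<otimes>\<^bsub>fobj U Y\<^esub> v) = fmap U f u \<otimes>\<^bsub>fobj U X\<^esub> fmap U f v"
        using x y nat[OF a] mult[OF a(2) x(1) y(1), symmetric] mult[OF a(1)] af_mult[OF A a x(1) y(1)]
          af_closed[OF A a] by simp
    qed
  next
    fix X u assume X: "X \<in> obj T" and "u \<in> carrier (fobj U X)"
    then obtain x where x: "x \<in> carrier (fobj G X)" "u = e X x" using iso_surjE[OF e[OF X]] by metis
    then show "fmap U (idn T X) u = u" using nat[OF X X idn_in[OF X]] af_idn[OF A X] by simp
  next
    fix X Y Z f g u assume a: "X \<in> obj T" "Y \<in> obj T" "Z \<in> obj T" "f \<in> hom_set T X Y" "g \<in> hom_set T Y Z"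
      and "u \<in> carrier (fobj U Z)"
    then obtain x where x: "x \<in> carrier (fobj G Z)" "u = e Z x" using iso_surjE[OF e[OF a(3)]] by metis
    then show "fmap U (g \<cdot> f) u = fmap U f (fmap U g u)"
      using nat[OF a(1,3) cmp_in[OF a(1-5)] x(1)] nat[OF a(2,3,5) x(1)] nat[OF a(1,2,4)] af_cmp[OF A a x(1)]
        af_closed[OF A a(2,3,5) x(1)] by simp
  next
    fix X Y f g u assume a: "X \<in> obj T" "Y \<in> obj T" "f \<in> hom_set T X Y" "g \<in> hom_set T X Y"
      and "u \<in> carrier (fobj U Y)"
    then obtain x where x: "x \<in> carrier (fobj G Y)" "u = e Y x" using iso_surjE[OF e[OF a(2)]] by metis
    have fg: "f \<otimes>\<^bsub>Hom T X Y\<^esub> g \<in> hom_set T X Y"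
      using hom_grp[OF a(1,2)] a group.is_monoid monoid.m_closed by metis
    show "fmap U (f \<otimes>\<^bsub>Hom T X Y\<^esub> g) u = fmap U f u \<otimes>\<^bsub>fobj U X\<^esub> fmap U g u"
      using x nat[OF a(1,2) fg x(1)] nat[OF a(1,2,3) x(1)] nat[OF a(1,2,4) x(1)] af_add[OF A a x(1)]
        mult[OF a(1) af_closed[OF A a(1,2,3) x(1)] af_closed[OF A a(1,2,4) x(1)]] by simp
  next
    fix X Y Z u v w y assume d: "dtri X Y Z u v w" and y: "y \<in> carrier (fobj U Y)" "fmap U u y = \<one>\<^bsub>fobj U X\<^esub>"
    have o: "X \<in> obj T" "Y \<in> obj T" "Z \<in> obj T" "u \<in> hom_set T X Y" "v \<in> hom_set T Y Z"
      using d unfolding dtri_def by auto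
    obtain x where x: "x \<in> carrier (fobj G Y)" "y = e Y x" using iso_surjE[OF e[OF o(2)] y(1)] .
    have "e X (fmap G u x) = e X \<one>\<^bsub>fobj G X\<^esub>" using nat[OF o(1,2,4) x(1)] y x one[OF o(1)] by simp
    then have "fmap G u x = \<one>\<^bsub>fobj G X\<^esub>"
      using inj_onD[OF inj[OF o(1)]] af_closed[OF A o(1,2,4) x(1)]
        monoid.one_closed[OF group.is_monoid[OF af_group[OF A o(1)]]] by blast
    then obtain z where z: "z \<in> carrier (fobj G Z)" "x = fmap G v z"
      using G d x unfolding Coh_iff by blast
    then show "\<exists>z\<in>carrier (fobj U Z). y = fmap U v z"
      using nat[OF o(2,3,5) z(1)] cl[OF o(3) z(1)] x by (intro bexI[of _ "e Z z"]) simp_all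
  qed
qed

end

section \<open>Coproducts of cohomological functors\<close>

definition sum_presheaf :: "'i set \<Rightarrow> ('i \<Rightarrow> ('o, 'm, 'a) presheaf) \<Rightarrow> ('o, 'm, 'i \<Rightarrow> 'a) presheaf"
  where "sum_presheaf I G = \<lparr>fobj = (\<lambda>X. sum_group I (\<lambda>i. fobj (G i) X)), fmap = (\<lambda>f x. \<lambda>i\<in>I. fmap (G i) f (x i))\<rparr>"

text \<open>An element of the sum is encoded by the finite set of its nonzero entries paired with
  their indices, and an infinite set has no more finite subsets than elements.\<close>

lemma finite_support_functions_lepoll:
  assumes inf: "infinite (UNIV :: 'a set)"
    and G: "\<And>i. i \<in> (I :: 'a set) \<Longrightarrow> comm_group (G i :: 'a monoid)"
  shows "carrier (sum_group I G) \<lesssim> (UNIV :: 'a set)"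
proof -
  let ?g = "\<lambda>x. {(i, x i) | i. i \<in> I \<and> x i \<noteq> \<one>\<^bsub>G i\<^esub>}"
  have "inj_on ?g (carrier (sum_group I G))"
  proof (rule inj_onI)
    fix x y assume x: "x \<in> carrier (sum_group I G)" and y: "y \<in> carrier (sum_group I G)" and eq: "?g x = ?g y"
    show "x = y"
    proof
      fix i
      show "x i = y i"
      proof (cases "i \<in> I")
        case True
        have "(i, x i) \<in> ?g x \<longleftrightarrow> x i \<noteq> \<one>\<^bsub>G i\<^esub>" "(i, x i) \<in> ?g y \<longleftrightarrow> x i = y i \<and> y i \<noteq> \<one>\<^bsub>G i\<^esub>"
          "(i, y i) \<in> ?g y \<longleftrightarrow> y i \<noteq> \<one>\<^bsub>G i\<^esub>" "(i, y i) \<in> ?g x \<longleftrightarrow> x i = y i \<and> x i \<noteq> \<one>\<^bsub>G i\<^esub>"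
          using True by auto
        then show ?thesis using eq by metis
      next
        case False
        then show ?thesis using x y by (auto simp: sum_carrier[OF G] PiE_iff extensional_def)
      qed
    qed
  qed
  moreover have "?g ` carrier (sum_group I G) \<subseteq> Fpow (UNIV :: ('a \<times> 'a) set)"
  proof
    fix S assume "S \<in> ?g ` carrier (sum_group I G)"
    then obtain x where x: "x \<in> carrier (sum_group I G)" "S = ?g x" by blast
    have "?g x = (\<lambda>i. (i, x i)) ` {i \<in> I. x i \<noteq> \<one>\<^bsub>G i\<^esub>}" by auto
    then show "S \<in> Fpow UNIV" using x by (auto simp: sum_carrier[OF G] Fpow_def)
  qed
  ultimately have 1: "carrier (sum_group I G) \<lesssim> Fpow (UNIV :: ('a \<times> 'a) set)"
    unfolding lepoll_def by blast
  have "infinite (UNIV :: ('a \<times> 'a) set)" using inf by (simp add: finite_prod)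
  then have 2: "Fpow (UNIV :: ('a \<times> 'a) set) \<approx> (UNIV :: ('a \<times> 'a) set)" by (rule eqpoll_Fpow)
  have 3: "(UNIV :: ('a \<times> 'a) set) \<approx> (UNIV :: 'a set)"
    using card_of_Times_same_infinite[OF inf] by (simp add: eqpoll_iff_card_of_ordIso)
  show ?thesis using 1 2 3 by (meson eqpoll_imp_lepoll lepoll_trans)
qed

context triangulated_category
begin

lemma sum_presheaf_Coh:
  assumes G: "\<And>i. i \<in> I \<Longrightarrow> G i \<in> Coh T"
  shows "sum_presheaf I G \<in> Coh T"
proof -
  let ?S = "sum_presheaf I G"
  note A = Coh_additive[OF G]
  have S: "fobj ?S X = sum_group I (\<lambda>i. fobj (G i) X)" for X by (simp add: sum_presheaf_def)
  have M: "fmap ?S f x = (\<lambda>i\<in>I. fmap (G i) f (x i))" for f x by (simp add: sum_presheaf_def)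
  have car: "x \<in> carrier (fobj ?S X) \<longleftrightarrow> x \<in> (\<Pi>\<^sub>E i\<in>I. carrier (fobj (G i) X)) \<and> finite {i \<in> I. x i \<noteq> \<one>\<^bsub>fobj (G i) X\<^esub>}"
    if "X \<in> obj T" for X x
    unfolding S using sum_carrier[of I "\<lambda>i. fobj (G i) X"] af_comm_group[OF A] that by auto
  have mem: "x i \<in> carrier (fobj (G i) X)" if "X \<in> obj T" "x \<in> carrier (fobj ?S X)" "i \<in> I" for X x i
    using that(2,3) unfolding car[OF that(1)] by (auto simp: PiE_iff)
  have cl: "fmap ?S f x \<in> carrier (fobj ?S X)"
    if o: "X \<in> obj T" "Y \<in> obj T" "f \<in> hom_set T X Y" and x: "x \<in> carrier (fobj ?S Y)" for X Y f x
  proof -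
    have "{i \<in> I. fmap ?S f x i \<noteq> \<one>\<^bsub>fobj (G i) X\<^esub>} \<subseteq> {i \<in> I. x i \<noteq> \<one>\<^bsub>fobj (G i) Y\<^esub>}"
      using af_one[OF A o] by (auto simp: M)
    moreover have "finite {i \<in> I. x i \<noteq> \<one>\<^bsub>fobj (G i) Y\<^esub>}" using x car[OF o(2)] by blast
    ultimately have "finite {i \<in> I. fmap ?S f x i \<noteq> \<one>\<^bsub>fobj (G i) X\<^esub>}" by (rule finite_subset)
    moreover have "fmap ?S f x \<in> (\<Pi>\<^sub>E i\<in>I. carrier (fobj (G i) X))"
      using x af_closed[OF A o] unfolding car[OF o(2)] by (auto simp: M PiE_iff)
    ultimately show ?thesis unfolding car[OF o(1)] by blast
  qed
  show ?thesis
    unfolding Coh_iff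
  proof (intro conjI allI impI ballI additive_functorI)
    show "comm_group (fobj ?S X)" if "X \<in> obj T" for X
      unfolding S using that A af_comm_group by (intro sum_comm_group) blast
    show "fmap ?S f \<in> hom (fobj ?S Y) (fobj ?S X)" if o: "X \<in> obj T" "Y \<in> obj T" "f \<in> hom_set T X Y" for X Y f
      using cl[OF o] af_mult[OF A o] mem[OF o(2)] by (intro homI) (auto simp: S M intro!: restrict_ext)
    show "fmap ?S (idn T X) x = x" if "X \<in> obj T" "x \<in> carrier (fobj ?S X)" for X x
      using that af_idn[OF A] by (auto simp: car M PiE_iff extensional_def fun_eq_iff)
    show "fmap ?S (g \<cdot> f) x = fmap ?S f (fmap ?S g x)"
      if "X \<in> obj T" "Y \<in> obj T" "Z \<in> obj T" "f \<in> hom_set T X Y" "g \<in> hom_set T Y Z" "x \<in> carrier (fobj ?S Z)" for X Y Z f g x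
      using af_cmp[OF A that(1-5)] mem[OF that(3,6)] by (auto simp: M intro!: restrict_ext)
    show "fmap ?S (f \<otimes>\<^bsub>Hom T X Y\<^esub> g) x = fmap ?S f x \<otimes>\<^bsub>fobj ?S X\<^esub> fmap ?S g x"
      if "X \<in> obj T" "Y \<in> obj T" "f \<in> hom_set T X Y" "g \<in> hom_set T X Y" "x \<in> carrier (fobj ?S Y)" for X Y f g x
      using af_add[OF A that(1-4)] mem[OF that(2,5)] by (auto simp: S M intro!: restrict_ext)
    fix X Y Z u v w y assume d: "dtri X Y Z u v w" and y: "y \<in> carrier (fobj ?S Y)" "fmap ?S u y = \<one>\<^bsub>fobj ?S X\<^esub>"
    have o: "X \<in> obj T" "Y \<in> obj T" "Z \<in> obj T" "u \<in> hom_set T X Y" "v \<in> hom_set T Y Z"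
      using d unfolding dtri_def by auto
    \<comment> \<open>The preimage is required to be zero wherever \<open>y i\<close> is zero, so
      that the chosen family has finite support again.\<close>
    have "\<exists>z. z \<in> carrier (fobj (G i) Z) \<and> y i = fmap (G i) v z \<and> (y i = \<one>\<^bsub>fobj (G i) Y\<^esub> \<longrightarrow> z = \<one>\<^bsub>fobj (G i) Z\<^esub>)"
      if i: "i \<in> I" for i
    proof (cases "y i = \<one>\<^bsub>fobj (G i) Y\<^esub>")
      case True
      then show ?thesis
        using af_one[OF A[OF i] o(2,3,5)] monoid.one_closed[OF group.is_monoid[OF af_group[OF A[OF i] o(3)]]] by auto
    next
      case False
      have "y i \<in> carrier (fobj (G i) Y)" using y(1) i car[OF o(2)] by auto
      moreover have "fmap (G i) u (y i) = \<one>\<^bsub>fobj (G i) X\<^esub>"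
        using fun_cong[OF y(2), of i] i by (simp add: S M)
      ultimately show ?thesis using G[OF i] d False unfolding Coh_iff by blast
    qed
    then obtain z where z: "\<And>i. i \<in> I \<Longrightarrow> z i \<in> carrier (fobj (G i) Z) \<and> y i = fmap (G i) v (z i) \<and>
        (y i = \<one>\<^bsub>fobj (G i) Y\<^esub> \<longrightarrow> z i = \<one>\<^bsub>fobj (G i) Z\<^esub>)"
      by metis
    have "{i \<in> I. restrict z I i \<noteq> \<one>\<^bsub>fobj (G i) Z\<^esub>} \<subseteq> {i \<in> I. y i \<noteq> \<one>\<^bsub>fobj (G i) Y\<^esub>}" using z by auto
    moreover have "finite {i \<in> I. y i \<noteq> \<one>\<^bsub>fobj (G i) Y\<^esub>}" using y(1) car[OF o(2)] by blast
    ultimately have "finite {i \<in> I. restrict z I i \<noteq> \<one>\<^bsub>fobj (G i) Z\<^esub>}" by (rule finite_subset)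
    moreover have "restrict z I \<in> (\<Pi>\<^sub>E i\<in>I. carrier (fobj (G i) Z))" using z by auto
    ultimately have "restrict z I \<in> carrier (fobj ?S Z)" unfolding car[OF o(3)] by blast
    moreover have "y = fmap ?S v (restrict z I)"
      using z y(1) by (auto simp: M car[OF o(2)] PiE_iff extensional_def fun_eq_iff)
    ultimately show "\<exists>z\<in>carrier (fobj ?S Z). y = fmap ?S v z" by blast
  qed
qed

text \<open>The closure condition in \<open>localising\<close> speaks of coproducts that are given.
  Here they are supplied, as finitely supported families transported into \<open>'a\<close>.\<close>

lemma coproduct_exists:
  fixes G :: "'a \<Rightarrow> ('o, 'm, 'a) presheaf"
  assumes inf: "infinite (UNIV :: 'a set)" and G: "\<And>i. i \<in> I \<Longrightarrow> G i \<in> Coh T"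
  shows "\<exists>P \<iota>. is_coproduct T I G P \<iota>"
proof -
  let ?S = "sum_presheaf I G" and ?P = "to_universe T (sum_presheaf I G) :: ('o, 'm, 'a) presheaf"
  have SC: "?S \<in> Coh T" using sum_presheaf_Coh G by blast
  note A = Coh_additive[OF G] and SA = Coh_additive[OF SC]
  have S: "fobj ?S X = sum_group I (\<lambda>i. fobj (G i) X)" for X by (simp add: sum_presheaf_def)
  have M: "fmap ?S f x = (\<lambda>i\<in>I. fmap (G i) f (x i))" for f x by (simp add: sum_presheaf_def)
  have cg: "i \<in> I \<Longrightarrow> X \<in> obj T \<Longrightarrow> comm_group (fobj (G i) X)" for i X using af_comm_group[OF A] .
  have small: "carrier (fobj ?S X) \<lesssim> (UNIV :: 'a set)" if "X \<in> obj T" for X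
    unfolding S by (rule finite_support_functions_lepoll[OF inf]) (rule cg[OF _ that])
  obtain e where Pg: "\<And>X. X \<in> obj T \<Longrightarrow> comm_group (fobj ?P X)"
    and e: "\<And>X. X \<in> obj T \<Longrightarrow> e X \<in> iso (fobj ?S X) (fobj ?P X)"
    and nat: "\<And>X Y f x. \<lbrakk>X \<in> obj T; Y \<in> obj T; f \<in> hom_set T X Y; x \<in> carrier (fobj ?S Y)\<rbrakk>
      \<Longrightarrow> fmap ?P f (e Y x) = e X (fmap ?S f x)"
    using to_universe_iso[OF SA small] by metis
  have P: "?P \<in> Coh T" by (rule Coh_iso[OF SC, where e = e]) (rule Pg e nat; assumption)+
  have eh: "e X \<in> hom (fobj ?S X) (fobj ?P X)" if "X \<in> obj T" for X using e[OF that] by (simp add: iso_def)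
  let ?s = "\<lambda>i X. sum_inj I (\<lambda>i. fobj (G i) X) i"
  let ?\<iota> = "\<lambda>i. \<lambda>X\<in>obj T. \<lambda>x\<in>carrier (fobj (G i) X). e X (?s i X x)"
  have s_in: "?s i X x \<in> carrier (fobj ?S X)" if "i \<in> I" "X \<in> obj T" "x \<in> carrier (fobj (G i) X)" for i X x
    unfolding S by (rule sum_inj_in[OF cg[OF _ that(2)]]) (use that in auto)
  have s_hom: "?s i X \<in> hom (fobj (G i) X) (fobj ?S X)" if "i \<in> I" "X \<in> obj T" for i X
    unfolding S by (rule sum_inj_hom[OF cg[OF _ that(2)]]) (use that in auto)
  have s_nat: "fmap ?S f (?s i Y x) = ?s i X (fmap (G i) f x)"
    if "i \<in> I" "X \<in> obj T" "Y \<in> obj T" "f \<in> hom_set T X Y" for i X Y f x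
    using af_one[OF A that(2-4)] by (auto simp: M sum_inj_def fun_eq_iff)
  have \<iota>: "?\<iota> i \<in> nat_trans T (G i) ?P" if i: "i \<in> I" for i
  proof (rule nat_transI)
    show "(\<lambda>x. e X (?s i X x)) \<in> hom (fobj (G i) X) (fobj ?P X)" if "X \<in> obj T" for X
      using hom_compose[OF s_hom[OF i that] eh[OF that]] by (simp add: comp_def)
    show "e X (?s i X (fmap (G i) f x)) = fmap ?P f (e Y (?s i Y x))"
      if "X \<in> obj T" "Y \<in> obj T" "f \<in> hom_set T X Y" "x \<in> carrier (fobj (G i) Y)" for X Y f x
      using nat[OF that(1-3) s_in[OF i that(2,4)]] s_nat[OF i that(1-3)] by simp
    show "additive_functor T (G i)" using A i by blast
  qed
  have "\<exists>!\<beta>. \<beta> \<in> nat_trans T ?P H \<and> (\<forall>i\<in>I. \<forall>X\<in>obj T. \<forall>x\<in>carrier (fobj (G i) X). \<beta> X (?\<iota> i X x) = \<alpha> i X x)"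
    if H: "H \<in> Coh T" and \<alpha>: "\<forall>i\<in>I. \<alpha> i \<in> nat_trans T (G i) H" for H :: "('o, 'm, 'a) presheaf" and \<alpha>
  proof -
    note HA = Coh_additive[OF H]
    have "\<exists>h\<in>hom (fobj ?S X) (fobj H X). \<forall>i\<in>I. \<forall>x\<in>carrier (fobj (G i) X). h (?s i X x) = \<alpha> i X x"
      if X: "X \<in> obj T" for X
      unfolding S using \<alpha> nat_trans_hom[OF _ X]
      by (intro sum_hom_exists[OF cg[OF _ X] af_comm_group[OF HA X]]) auto
    then obtain h where h: "\<And>X. X \<in> obj T \<Longrightarrow> h X \<in> hom (fobj ?S X) (fobj H X)"
      and h\<alpha>: "\<And>X i x. \<lbrakk>X \<in> obj T; i \<in> I; x \<in> carrier (fobj (G i) X)\<rbrakk> \<Longrightarrow> h X (?s i X x) = \<alpha> i X x"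
      by metis
    have h_nat: "h X (fmap ?S f x) = fmap H f (h Y x)"
      if o: "X \<in> obj T" "Y \<in> obj T" "f \<in> hom_set T X Y" and x: "x \<in> carrier (fobj ?S Y)" for X Y f x
    proof (rule sum_hom_ext[OF cg[OF _ o(2)] _ _ af_group[OF HA o(1)] subset_UNIV _ x[unfolded S]])
      show "(\<lambda>x. h X (fmap ?S f x)) \<in> hom (sum_group I (\<lambda>i. fobj (G i) Y)) (fobj H X)"
        using hom_compose[OF af_hom[OF SA o] h[OF o(1)]] by (simp add: comp_def S)
      show "(\<lambda>x. fmap H f (h Y x)) \<in> hom (sum_group I (\<lambda>i. fobj (G i) Y)) (fobj H X)"
        using hom_compose[OF h[OF o(2)] af_hom[OF HA o]] by (simp add: comp_def S)
      show "h X (fmap ?S f (?s i Y g)) = fmap H f (h Y (?s i Y g))" if "i \<in> I" "g \<in> carrier (fobj (G i) Y)" for i g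
        using s_nat[OF that(1) o] h\<alpha>[OF o(1) that(1) af_closed[OF A[OF that(1)] o that(2)]] h\<alpha>[OF o(2) that]
          nat_trans_natural[OF bspec[OF \<alpha> that(1)] o that(2)] by simp
    qed
    let ?i = "\<lambda>X. inv_into (carrier (fobj ?S X)) (e X)"
    have ii: "?i X (e X x) = x" if "X \<in> obj T" "x \<in> carrier (fobj ?S X)" for X x
      using e[OF that(1)] that(2) by (auto simp: iso_def bij_betw_def)
    let ?\<beta> = "\<lambda>X\<in>obj T. \<lambda>x\<in>carrier (fobj ?P X). h X (?i X x)"
    have \<beta>: "?\<beta> \<in> nat_trans T ?P H"
    proof (rule nat_transI)
      show "(\<lambda>x. h X (?i X x)) \<in> hom (fobj ?P X) (fobj H X)" if X: "X \<in> obj T" for X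
      proof -
        have "?i X \<in> iso (fobj ?P X) (fobj ?S X)"
          using group.iso_set_sym[OF af_group[OF SA X] e[OF X]] .
        then have "?i X \<in> hom (fobj ?P X) (fobj ?S X)" by (simp add: iso_def)
        then show ?thesis using hom_compose[OF _ h[OF X]] by (simp add: comp_def)
      qed
      show "h X (?i X (fmap ?P f x)) = fmap H f (h Y (?i Y x))"
        if o: "X \<in> obj T" "Y \<in> obj T" "f \<in> hom_set T X Y" and x: "x \<in> carrier (fobj ?P Y)" for X Y f x
      proof -
        obtain y where y: "y \<in> carrier (fobj ?S Y)" "x = e Y y" using iso_surjE[OF e[OF o(2)] x] .
        then show ?thesis using nat[OF o y(1)] ii[OF o(2) y(1)] ii[OF o(1) af_closed[OF SA o y(1)]] h_nat[OF o y(1)] by simp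
      qed
      show "additive_functor T ?P" using Coh_additive[OF P] .
    qed
    have es: "e X (?s i X x) \<in> carrier (fobj ?P X)" if "i \<in> I" "X \<in> obj T" "x \<in> carrier (fobj (G i) X)" for i X x
      using hom_in_carrier[OF eh[OF that(2)] s_in[OF that]] .
    show ?thesis
    proof (rule ex1I[of _ ?\<beta>])
      show "?\<beta> \<in> nat_trans T ?P H \<and> (\<forall>i\<in>I. \<forall>X\<in>obj T. \<forall>x\<in>carrier (fobj (G i) X). ?\<beta> X (?\<iota> i X x) = \<alpha> i X x)"
        using \<beta> es ii s_in h\<alpha> by simp
    next
      fix \<gamma> assume \<gamma>: "\<gamma> \<in> nat_trans T ?P H \<and> (\<forall>i\<in>I. \<forall>X\<in>obj T. \<forall>x\<in>carrier (fobj (G i) X). \<gamma> X (?\<iota> i X x) = \<alpha> i X x)"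
      have eq: "\<gamma> X (e X x) = h X x" if X: "X \<in> obj T" and x: "x \<in> carrier (fobj ?S X)" for X x
      proof (rule sum_hom_ext[OF cg[OF _ X] _ _ af_group[OF HA X] subset_UNIV _ x[unfolded S]])
        show "(\<lambda>x. \<gamma> X (e X x)) \<in> hom (sum_group I (\<lambda>i. fobj (G i) X)) (fobj H X)"
          using hom_compose[OF eh[OF X] nat_trans_hom[OF conjunct1[OF \<gamma>] X]] by (simp add: comp_def S)
        show "h X \<in> hom (sum_group I (\<lambda>i. fobj (G i) X)) (fobj H X)" using h[OF X] by (simp add: S)
        show "\<gamma> X (e X (?s i X g)) = h X (?s i X g)" if "i \<in> I" "g \<in> carrier (fobj (G i) X)" for i g
          using \<gamma> h\<alpha>[OF X that] that X by simp
      qed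
      have cong: "\<gamma> X y = ?\<beta> X y" if X: "X \<in> obj T" for X y
      proof (cases "y \<in> carrier (fobj ?P X)")
        case True
        then obtain x where x: "x \<in> carrier (fobj ?S X)" "y = e X x" using iso_surjE[OF e[OF X]] by metis
        then show ?thesis using True X eq[OF X x(1)] ii[OF X x(1)] by simp
      next
        case False
        have "\<gamma> X \<in> extensional (carrier (fobj ?P X))" using \<gamma> X by (auto simp: nat_trans_def)
        then show ?thesis using False X by (simp add: extensional_def)
      qed
      show "\<gamma> = ?\<beta>"
      proof
        fix X show "\<gamma> X = ?\<beta> X"
        proof (cases "X \<in> obj T")
          case True then show ?thesis using cong by blast
        next
          case False
          have "\<gamma> \<in> extensional (obj T)" using \<gamma> by (auto simp: nat_trans_def PiE_def)
          then show ?thesis using False by (simp add: extensional_def)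
        qed
      qed
    qed
  qed
  then have "is_coproduct T I G ?P ?\<iota>" unfolding is_coproduct_def using P \<iota> by blast
  then show ?thesis by blast
qed

end

section \<open>Membership in localising subcategories\<close>

context triangulated_category
begin

lemma ex1_unique: "\<lbrakk>\<exists>!x. P x; P a; P b\<rbrakk> \<Longrightarrow> a = b"
  by auto

lemma zero_nat_trans:
  assumes F: "additive_functor T F" and G: "additive_functor T G"
  shows "(\<lambda>X\<in>obj T. \<lambda>x\<in>carrier (fobj F X). \<one>\<^bsub>fobj G X\<^esub>) \<in> nat_trans T F G"
proof (rule nat_transI[OF _ _ F])
  show "(\<lambda>x. \<one>\<^bsub>fobj G X\<^esub>) \<in> hom (fobj F X) (fobj G X)" if "X \<in> obj T" for X
    using group.is_monoid[OF af_group[OF G that]] by (auto simp: hom_def)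
  show "\<one>\<^bsub>fobj G X\<^esub> = fmap G f \<one>\<^bsub>fobj G Y\<^esub>" if "X \<in> obj T" "Y \<in> obj T" "f \<in> hom_set T X Y" for X Y f
    using af_one[OF G that] by simp
qed

lemma comp_nat_trans:
  assumes F: "additive_functor T F" and b: "\<beta> \<in> nat_trans T F G" and g: "\<gamma> \<in> nat_trans T G H"
  shows "(\<lambda>X\<in>obj T. \<lambda>x\<in>carrier (fobj F X). \<gamma> X (\<beta> X x)) \<in> nat_trans T F H"
proof (rule nat_transI[OF _ _ F])
  show "(\<lambda>x. \<gamma> X (\<beta> X x)) \<in> hom (fobj F X) (fobj H X)" if "X \<in> obj T" for X
    using hom_compose[OF nat_trans_hom[OF b that] nat_trans_hom[OF g that]] by (simp add: comp_def)
  show "\<gamma> X (\<beta> X (fmap F f x)) = fmap H f (\<gamma> Y (\<beta> Y x))"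
    if "X \<in> obj T" "Y \<in> obj T" "f \<in> hom_set T X Y" "x \<in> carrier (fobj F Y)" for X Y f x
    using nat_trans_natural[OF b that] nat_trans_natural[OF g that(1-3) nat_trans_closed[OF b that(2,4)]] by simp
qed

lemma localising_Coh: "localising T \<C> \<Longrightarrow> F \<in> \<C> \<Longrightarrow> F \<in> Coh T"
  unfolding localising_def by blast

lemma localising_shift: "localising T \<C> \<Longrightarrow> F \<in> \<C> \<Longrightarrow> shift T n F \<in> \<C>"
  unfolding localising_def by blast

text \<open>The criterion by which all memberships are shown: the \<open>G j\<close> together form
  an exact sequence with \<open>H\<close> and \<open>H''\<close>. Each kernel element need only be
  hit from a single \<open>G j\<close>, since that map factors through the coproduct. The index set
  may live in any type and is moved into the universe along an injection \<open>g\<close>.\<close>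

lemma localising_extension:
  fixes \<C> :: "('o, 'm, 'a) presheaf set" and J :: "'j set"
  assumes inf: "infinite (UNIV :: 'a set)" and loc: "localising T \<C>" and J: "J \<lesssim> (UNIV :: 'a set)"
    and G: "\<And>j. j \<in> J \<Longrightarrow> G j \<in> \<C>" and H: "H \<in> Coh T" and H'': "H'' \<in> \<C>"
    and \<alpha>: "\<And>j. j \<in> J \<Longrightarrow> \<alpha> j \<in> nat_trans T (G j) H" and \<beta>: "\<beta> \<in> nat_trans T H H''"
    and comp: "\<And>j X x. \<lbrakk>j \<in> J; X \<in> obj T; x \<in> carrier (fobj (G j) X)\<rbrakk> \<Longrightarrow> \<beta> X (\<alpha> j X x) = \<one>\<^bsub>fobj H'' X\<^esub>"
    and ker: "\<And>X x. \<lbrakk>X \<in> obj T; x \<in> carrier (fobj H X); \<beta> X x = \<one>\<^bsub>fobj H'' X\<^esub>\<rbrakk>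
      \<Longrightarrow> \<exists>j\<in>J. \<exists>y\<in>carrier (fobj (G j) X). x = \<alpha> j X y"
  shows "H \<in> \<C>"
proof -
  obtain g :: "'j \<Rightarrow> 'a" where g: "inj_on g J" using J by (auto simp: lepoll_def)
  let ?I = "g ` J" and ?k = "inv_into J g"
  have k: "?k i \<in> J" if "i \<in> ?I" for i using inv_into_into[OF that] .
  have GC: "G (?k i) \<in> Coh T" if "i \<in> ?I" for i using localising_Coh[OF loc G[OF k[OF that]]] .
  obtain P \<iota> where P: "is_coproduct T ?I (\<lambda>i. G (?k i)) P \<iota>"
    using coproduct_exists[OF inf, of ?I "\<lambda>i. G (?k i)"] GC by blast
  have PC: "P \<in> \<C>" using loc P G k unfolding localising_def by metis
  then have PCoh: "P \<in> Coh T" using localising_Coh[OF loc] by blast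
  note PA = Coh_additive[OF PCoh] and HA = Coh_additive[OF H] and HA'' = Coh_additive[OF localising_Coh[OF loc H'']]
  have \<iota>: "\<iota> i \<in> nat_trans T (G (?k i)) P" if "i \<in> ?I" for i
    using P that unfolding is_coproduct_def by blast
  have univ: "\<exists>!\<beta>. \<beta> \<in> nat_trans T P K \<and> (\<forall>i\<in>?I. \<forall>X\<in>obj T. \<forall>x\<in>carrier (fobj (G (?k i)) X). \<beta> X (\<iota> i X x) = \<alpha> i X x)"
    if "K \<in> Coh T" "\<forall>i\<in>?I. \<alpha> i \<in> nat_trans T (G (?k i)) K" for K :: "('o, 'm, 'a) presheaf" and \<alpha>
    using P[unfolded is_coproduct_def, THEN conjunct2, THEN conjunct2, THEN spec, THEN spec, THEN mp, THEN mp, OF that] .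
  have "\<forall>i\<in>?I. \<alpha> (?k i) \<in> nat_trans T (G (?k i)) H" using \<alpha> k by blast
  from ex1_implies_ex[OF univ[OF H this]] obtain \<gamma> where \<gamma>0: "\<gamma> \<in> nat_trans T P H \<and>
    (\<forall>i\<in>?I. \<forall>X\<in>obj T. \<forall>x\<in>carrier (fobj (G (?k i)) X). \<gamma> X (\<iota> i X x) = \<alpha> (?k i) X x)"
    by (rule exE)
  note \<gamma> = conjunct1[OF \<gamma>0] and \<gamma>\<iota> = conjunct2[OF \<gamma>0, rule_format]
  let ?z = "\<lambda>X\<in>obj T. \<lambda>x\<in>carrier (fobj P X). \<one>\<^bsub>fobj H'' X\<^esub>"
  let ?c = "\<lambda>X\<in>obj T. \<lambda>x\<in>carrier (fobj P X). \<beta> X (\<gamma> X x)"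
  let ?\<zeta> = "\<lambda>i X x. \<one>\<^bsub>fobj H'' X\<^esub>"
  have z: "?z \<in> nat_trans T P H''" using zero_nat_trans[OF PA HA''] .
  have c: "?c \<in> nat_trans T P H''" using comp_nat_trans[OF PA \<gamma> \<beta>] .
  let ?\<alpha>0 = "\<lambda>i. \<lambda>X\<in>obj T. \<lambda>x\<in>carrier (fobj (G (?k i)) X). \<one>\<^bsub>fobj H'' X\<^esub>"
  have a0: "\<forall>i\<in>?I. ?\<alpha>0 i \<in> nat_trans T (G (?k i)) H''"
    using zero_nat_trans[OF Coh_additive[OF GC] HA''] by blast
  have zi: "?z X (\<iota> i X x) = ?\<alpha>0 i X x" and ci: "?c X (\<iota> i X x) = ?\<alpha>0 i X x"
    if "i \<in> ?I" "X \<in> obj T" "x \<in> carrier (fobj (G (?k i)) X)" for i X x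
    using nat_trans_closed[OF \<iota>[OF that(1)] that(2,3)] that \<gamma>\<iota>[OF that] comp[OF k[OF that(1)] that(2,3)] by simp_all
  note u = univ[OF localising_Coh[OF loc H''] a0]
  \<comment> \<open>The coproduct is known by its universal property alone, so the composite is
    shown to vanish by uniqueness: both transformations vanish on every summand.\<close>
  have cz: "?c = ?z"
  proof (rule ex1_unique[OF u], goal_cases)
    case 1 show ?case
    proof (intro conjI ballI)
      show "?c \<in> nat_trans T P H''" by (rule c)
      fix i X x assume "i \<in> ?I" "X \<in> obj T" "x \<in> carrier (fobj (G (?k i)) X)"
      then show "?c X (\<iota> i X x) = ?\<alpha>0 i X x" by (rule ci)
    qed
  next
    case 2 show ?case
    proof (intro conjI ballI)
      show "?z \<in> nat_trans T P H''" by (rule z)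
      fix i X x assume "i \<in> ?I" "X \<in> obj T" "x \<in> carrier (fobj (G (?k i)) X)"
      then show "?z X (\<iota> i X x) = ?\<alpha>0 i X x" by (rule zi)
    qed
  qed
  have \<beta>\<gamma>: "\<beta> X (\<gamma> X x) = \<one>\<^bsub>fobj H'' X\<^esub>" if "X \<in> obj T" "x \<in> carrier (fobj P X)" for X x
    using fun_cong[OF fun_cong[OF cz], of X x] that by simp
  have "coh_exact T P \<gamma> H \<beta> H''"
    unfolding coh_exact_def
  proof (intro conjI ballI \<gamma> \<beta>)
    fix X assume X: "X \<in> obj T"
    have "kernel (fobj H X) (fobj H'' X) (\<beta> X) = \<gamma> X ` carrier (fobj P X)"
    proof
      show "\<gamma> X ` carrier (fobj P X) \<subseteq> kernel (fobj H X) (fobj H'' X) (\<beta> X)"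
        using \<beta>\<gamma> X nat_trans_closed[OF \<gamma> X] by (auto simp: kernel_def)
      show "kernel (fobj H X) (fobj H'' X) (\<beta> X) \<subseteq> \<gamma> X ` carrier (fobj P X)"
      proof
        fix x assume "x \<in> kernel (fobj H X) (fobj H'' X) (\<beta> X)"
        then have x: "x \<in> carrier (fobj H X)" "\<beta> X x = \<one>\<^bsub>fobj H'' X\<^esub>" by (auto simp: kernel_def)
        obtain j y where j: "j \<in> J" "y \<in> carrier (fobj (G j) X)" "x = \<alpha> j X y" using ker[OF X x] by blast
        have i: "g j \<in> ?I" "?k (g j) = j" using j g by auto
        have "x = \<gamma> X (\<iota> (g j) X y)" using \<gamma>\<iota>[OF i(1) X] i(2) j by simp
        then show "x \<in> \<gamma> X ` carrier (fobj P X)" using nat_trans_closed[OF \<iota>[OF i(1)] X] i(2) j by auto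
      qed
    qed
    then show "exact_seq ([fobj H'' X, fobj H X, fobj P X], [\<beta> X, \<gamma> X])"
      using af_group[OF PA X] af_group[OF HA X] af_group[OF HA'' X] nat_trans_hom[OF \<gamma> X] nat_trans_hom[OF \<beta> X]
      by (simp add: group_hom_def group_hom_axioms_def)
  qed
  then show ?thesis using loc PC H'' H unfolding localising_def by blast
qed

text \<open>The empty coproduct is a member that can serve as the target of a zero map, whose kernel
  is all of \<open>H\<close>.\<close>

lemma localising_quotient:
  fixes \<C> :: "('o, 'm, 'a) presheaf set" and J :: "'j set"
  assumes inf: "infinite (UNIV :: 'a set)" and loc: "localising T \<C>" and J: "J \<lesssim> (UNIV :: 'a set)"
    and G: "\<And>j. j \<in> J \<Longrightarrow> G j \<in> \<C>" and H: "H \<in> Coh T"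
    and \<alpha>: "\<And>j. j \<in> J \<Longrightarrow> \<alpha> j \<in> nat_trans T (G j) H"
    and surj: "\<And>X x. \<lbrakk>X \<in> obj T; x \<in> carrier (fobj H X)\<rbrakk> \<Longrightarrow> \<exists>j\<in>J. \<exists>y\<in>carrier (fobj (G j) X). x = \<alpha> j X y"
  shows "H \<in> \<C>"
proof -
  obtain P \<iota> where P: "is_coproduct T ({} :: 'a set) (\<lambda>i. H) P \<iota>"
    using coproduct_exists[OF inf, of "{}" "\<lambda>i. H"] by blast
  have PC: "P \<in> \<C>" using loc P unfolding localising_def by (metis empty_iff)
  note HA = Coh_additive[OF H]
  let ?\<beta> = "\<lambda>X\<in>obj T. \<lambda>x\<in>carrier (fobj H X). \<one>\<^bsub>fobj P X\<^esub>"
  have "?\<beta> \<in> nat_trans T H P" using zero_nat_trans[OF HA Coh_additive[OF localising_Coh[OF loc PC]]] .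
  from localising_extension[OF inf loc J G H PC \<alpha> this]
  show ?thesis using nat_trans_closed[OF \<alpha>] surj by auto
qed

end

section \<open>Localisation of cohomological functors\<close>

context linear_triangulated_category
begin

text \<open>\<open>\<psi> X d s y\<close> is the fraction \<open>s\<^sup>-\<^sup>1y\<close> in \<open>L(X)\<close>. The complement of \<open>p\<close> need only be
  multiplicative, so that \<open>p\<close> may also be the complement of the set of powers of an element.\<close>

definition is_localisation ::
  "'r set \<Rightarrow> ('o, 'm, 'a) presheaf \<Rightarrow> ('o, 'm, 'b) presheaf \<Rightarrow> ('o \<Rightarrow> int \<Rightarrow> 'r \<Rightarrow> 'a \<Rightarrow> 'b) \<Rightarrow> bool"
  where "is_localisation p F L \<psi> \<longleftrightarrow> L \<in> Coh T \<and>
    (\<forall>X\<in>obj T. \<forall>d. \<forall>s\<in>A d - p. \<psi> X d s \<in> hom (fobj F (SO (- d) X)) (fobj L X)) \<and>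
    (\<forall>X\<in>obj T. \<forall>x\<in>carrier (fobj L X). \<exists>d. \<exists>s\<in>A d - p. \<exists>y\<in>carrier (fobj F (SO (- d) X)). x = \<psi> X d s y) \<and>
    (\<forall>X\<in>obj T. \<forall>d. \<forall>s\<in>A d - p. \<forall>y\<in>carrier (fobj F (SO (- d) X)). \<psi> X d s y = \<one>\<^bsub>fobj L X\<^esub> \<longrightarrow>
      (\<exists>k. \<exists>w\<in>A k - p. fmap F (rh k w (SO (- d) X)) y = \<one>\<^bsub>fobj F (SO (- k) (SO (- d) X))\<^esub>)) \<and>
    (\<forall>X\<in>obj T. \<forall>d. \<forall>s\<in>A d - p. \<forall>y\<in>carrier (fobj F (SO (- d) X)). \<forall>e. \<forall>t\<in>A e - p.
      \<psi> X d s y = \<psi> X (d + e) (t \<otimes>\<^bsub>R\<^esub> s) (fmap F (rh e t (SO (- d) X)) y)) \<and>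
    (\<forall>X\<in>obj T. \<forall>Y\<in>obj T. \<forall>f\<in>hom_set T X Y. \<forall>d. \<forall>s\<in>A d - p. \<forall>y\<in>carrier (fobj F (SO (- d) Y)).
      fmap L f (\<psi> Y d s y) = \<psi> X d s (fmap F (SM (- d) f) y))"

lemma star_module:
  assumes F: "additive_functor T F" and X: "X \<in> obj T"
  shows "graded_module R A (star_part T F X) (star_act T \<phi> F X)"
proof (intro graded_module.intro graded_module_axioms.intro graded_commutative_ring_axioms)
  have Xn: "SO (- n) X \<in> obj T" for n using X by simp
  have e: "SO (- d) (SO (- n) X) = SO (- (n + d)) X" for n d using SO_SO[OF X, of "- d" "- n"] by (simp add: algebra_simps)
  show "comm_group (star_part T F X n)" for n
    using af_comm_group[OF F Xn] by (simp add: star_part_def)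
  show "star_act T \<phi> F X d n r \<in> hom (star_part T F X n) (star_part T F X (n + d))" if "r \<in> A d" for r d n
    using af_hom[OF F SO_in[OF Xn] Xn rho_in[OF that Xn]] e by (simp add: star_part_def star_act_rho[abs_def] star_act_rho)
  show "star_act T \<phi> F X 0 n \<one>\<^bsub>R\<^esub> x = x" if "x \<in> carrier (star_part T F X n)" for x n
    using that rho_one[OF Xn] af_idn[OF F Xn] by (simp add: star_part_def star_act_rho)
  show "star_act T \<phi> F X (d + e) n (r \<otimes>\<^bsub>R\<^esub> s) x = star_act T \<phi> F X d (n + e) r (star_act T \<phi> F X e n s x)"
    if r: "r \<in> A d" and s: "s \<in> A e" and x: "x \<in> carrier (star_part T F X n)" for r d s e n x
    using rho_mult'[OF r s Xn] x
      af_cmp[OF F SO_in[OF SO_in[OF Xn]] SO_in[OF Xn] Xn rho_in[OF r SO_in[OF Xn]] rho_in[OF s Xn]] e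
    by (simp add: star_part_def star_act_rho)
  show "star_act T \<phi> F X d n (\<ominus>\<^bsub>R\<^esub> r) x = inv\<^bsub>star_part T F X (n + d)\<^esub> (star_act T \<phi> F X d n r x)"
    if "r \<in> A d" "x \<in> carrier (star_part T F X n)" for r d x n
    using rho_minus[OF that(1) Xn] af_inv[OF F SO_in[OF Xn] Xn rho_in[OF that(1) Xn]] that(2) e
    by (simp add: star_part_def star_act_rho)
qed

lemma star_act_natural:
  assumes F: "additive_functor T F" and o: "X \<in> obj T" "Y \<in> obj T" and f: "f \<in> hom_set T X Y" and r: "r \<in> A d"
    and x: "x \<in> carrier (star_part T F Y n)"
  shows "fmap F (SM (- (n + d)) f) (star_act T \<phi> F Y d n r x) = star_act T \<phi> F X d n r (fmap F (SM (- n) f) x)"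
proof -
  let ?X = "SO (- n) X" and ?Y = "SO (- n) Y"
  have o': "?X \<in> obj T" "?Y \<in> obj T" using o by auto
  have f': "SM (- n) f \<in> hom_set T ?X ?Y" using SM_in[OF o f] .
  have e: "SM (- (n + d)) f = SM (- d) (SM (- n) f)" using SM_SM[OF f o, of "- d" "- n"] by (simp add: algebra_simps)
  have x': "x \<in> carrier (fobj F ?Y)" using x by (simp add: star_part_def)
  show ?thesis
    unfolding e star_act_rho
    using af_cmp[OF F SO_in[OF o'(1)] SO_in[OF o'(2)] o'(2) SM_in[OF o' f'] rho_in[OF r o'(2)] x']
      af_cmp[OF F SO_in[OF o'(1)] o' rho_in[OF r o'(1)] f' x'] rho_natural[OF r o' f'] by simp
qed

context
  fixes F :: "('o, 'm, 'a) presheaf" and p :: "'r set"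
  assumes F: "F \<in> Coh T" and one_p: "\<one>\<^bsub>R\<^esub> \<notin> p"
    and mult_p: "\<And>r d s e. \<lbrakk>r \<in> A d; r \<notin> p; s \<in> A e; s \<notin> p\<rbrakk> \<Longrightarrow> r \<otimes>\<^bsub>R\<^esub> s \<notin> p"
begin

lemma star_localisation:
  "X \<in> obj T \<Longrightarrow> module_localisation R A (star_part T F X) (star_act T \<phi> F X) p"
  using star_module[OF Coh_additive[OF F]] one_p mult_p
  by (simp add: module_localisation_def module_localisation_axioms_def)

abbreviation Q :: "('o, 'm, (int \<times> 'r \<times> 'a) set) presheaf"
  where "Q \<equiv> fractions_presheaf R A T \<phi> p F"

definition fr :: "'o \<Rightarrow> int \<Rightarrow> 'r \<Rightarrow> 'a \<Rightarrow> (int \<times> 'r \<times> 'a) set"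
  where "fr X d s y = frac_rel A p (star_part T F X) (star_act T \<phi> F X) 0 `` {(d, s, y)}"

lemma Q_obj: "fobj Q X = localised_part R A p (star_part T F X) (star_act T \<phi> F X) 0"
  by (simp add: fractions_presheaf_def)

lemma fr_frac: "X \<in> obj T \<Longrightarrow> fr X = module_localisation.frac A (star_part T F X) (star_act T \<phi> F X) p 0"
  using module_localisation.frac_def[OF star_localisation] by (simp add: fr_def fun_eq_iff)

lemma star_part_neg [simp]: "star_part T F X (0 + d) = fobj F (SO (- d) X)"
  "star_part T F X d = fobj F (SO (- d) X)"
  by (simp_all add: star_part_def)

lemma fr_hom:
  assumes X: "X \<in> obj T" and s: "s \<in> A d - p" shows "fr X d s \<in> hom (fobj F (SO (- d) X)) (fobj Q X)"
proof -
  interpret L: module_localisation R A "star_part T F X" "star_act T \<phi> F X" p using star_localisation[OF X] .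
  show ?thesis
    using L.frac_in[of s d _ 0] L.frac_mult[of s d _ 0] s fr_frac[OF X] unfolding Q_obj by (intro homI) auto
qed

lemma fr_surj:
  assumes X: "X \<in> obj T" and x: "x \<in> carrier (fobj Q X)"
  shows "\<exists>d. \<exists>s\<in>A d - p. \<exists>y\<in>carrier (fobj F (SO (- d) X)). x = fr X d s y"
proof -
  interpret L: module_localisation R A "star_part T F X" "star_act T \<phi> F X" p using star_localisation[OF X] .
  obtain d s y where "s \<in> A d" "s \<notin> p" "y \<in> carrier (star_part T F X (0 + d))" "x = L.frac 0 d s y"
    using L.frac_cases[OF x[unfolded Q_obj]] .
  then have "s \<in> A d - p" "y \<in> carrier (fobj F (SO (- d) X))" "x = fr X d s y"
    by (simp_all add: fr_frac[OF X])
  then show ?thesis by blast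
qed

lemma fr_common:
  assumes X: "X \<in> obj T" and x: "x \<in> carrier (fobj Q X)" and x': "x' \<in> carrier (fobj Q X)"
  shows "\<exists>d. \<exists>s\<in>A d - p. \<exists>y\<in>carrier (fobj F (SO (- d) X)). \<exists>y'\<in>carrier (fobj F (SO (- d) X)).
    x = fr X d s y \<and> x' = fr X d s y'"
proof -
  interpret L: module_localisation R A "star_part T F X" "star_act T \<phi> F X" p using star_localisation[OF X] .
  obtain d s y y' where "s \<in> A d" "s \<notin> p" "y \<in> carrier (star_part T F X (0 + d))"
    "y' \<in> carrier (star_part T F X (0 + d))" "x = L.frac 0 d s y" "x' = L.frac 0 d s y'"
    using L.frac_common[OF x[unfolded Q_obj] x'[unfolded Q_obj]] .
  then have "s \<in> A d - p" "y \<in> carrier (fobj F (SO (- d) X))" "y' \<in> carrier (fobj F (SO (- d) X))"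
    "x = fr X d s y" "x' = fr X d s y'"
    by (simp_all add: fr_frac[OF X])
  then show ?thesis by blast
qed

lemma fr_zero:
  assumes X: "X \<in> obj T" and s: "s \<in> A d - p" and y: "y \<in> carrier (fobj F (SO (- d) X))"
  shows "fr X d s y = \<one>\<^bsub>fobj Q X\<^esub> \<longleftrightarrow>
    (\<exists>k. \<exists>w\<in>A k - p. fmap F (rh k w (SO (- d) X)) y = \<one>\<^bsub>fobj F (SO (- k) (SO (- d) X))\<^esub>)"
proof -
  interpret L: module_localisation R A "star_part T F X" "star_act T \<phi> F X" p using star_localisation[OF X] .
  have e: "SO (- k) (SO (- d) X) = SO (- (d + k)) X" for k using SO_SO[OF X, of "- k" "- d"] by (simp add: algebra_simps)
  show ?thesis
    using L.frac_eq_one_iff[of s d y 0] s y unfolding fr_frac[OF X] Q_obj e by (simp add: star_act_rho)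
qed

lemma fr_expand:
  assumes X: "X \<in> obj T" and s: "s \<in> A d - p" and y: "y \<in> carrier (fobj F (SO (- d) X))" and t: "t \<in> A e - p"
  shows "fr X d s y = fr X (d + e) (t \<otimes>\<^bsub>R\<^esub> s) (fmap F (rh e t (SO (- d) X)) y)"
proof -
  interpret L: module_localisation R A "star_part T F X" "star_act T \<phi> F X" p using star_localisation[OF X] .
  show ?thesis
    using L.frac_expand[of s d y 0 t e] s t y unfolding fr_frac[OF X] by (simp add: star_act_rho)
qed

lemma fr_natural:
  assumes o: "X \<in> obj T" "Y \<in> obj T" and f: "f \<in> hom_set T X Y" and s: "s \<in> A d - p"
    and y: "y \<in> carrier (fobj F (SO (- d) Y))"
  shows "fmap Q f (fr Y d s y) = fr X d s (fmap F (SM (- d) f) y)"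
proof -
  note FA = Coh_additive[OF F]
  interpret L: module_localisation R A "star_part T F X" "star_act T \<phi> F X" p using star_localisation[OF o(1)] .
  interpret M: module_localisation R A "star_part T F Y" "star_act T \<phi> F Y" p using star_localisation[OF o(2)] .
  let ?m = "\<lambda>n. fmap F (SM (- n) f)"
  have mh: "group_hom (fobj F (SO (- n) Y)) (fobj F (SO (- n) X)) (?m n)" for n
    using af_group_hom[OF FA SO_in[OF o(1)] SO_in[OF o(2)] SM_in[OF o f]] .
  have m_in: "?m n z \<in> carrier (star_part T F X n)" if "z \<in> carrier (star_part T F Y n)" for n z
    using group_hom.hom_closed[OF mh] that by simp
  \<comment> \<open>The map on fractions is defined as a union over representatives. Naturality of
    the action carries a witness of equivalence from \<open>Y\<close> to \<open>X\<close>, so the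
    union collapses to one class.\<close>
  have rel: "fr X d' s' (?m d' y') = fr X e t (?m e z)"
    if r: "((d', s', y'), (e, t, z)) \<in> frac_rel A p (star_part T F Y) (star_act T \<phi> F Y) 0" for d' s' y' e t z
  proof -
    have fra: "(d', s', y') \<in> fractions A p (star_part T F Y) 0" "(e, t, z) \<in> fractions A p (star_part T F Y) 0"
      using r by (auto simp: frac_rel_def)
    have in1: "s' \<in> A d'" "t \<in> A e" "y' \<in> carrier (star_part T F Y d')" "z \<in> carrier (star_part T F Y e)"
      using fra by (auto simp: fractions_def)
    obtain k w where w: "w \<in> A k - p" and eq: "star_act T \<phi> F Y k (d' + e) w (star_act T \<phi> F Y e d' t y') =
        star_act T \<phi> F Y k (d' + e) w (sgn_act (star_part T F Y (d' + e)) (d' * e) (star_act T \<phi> F Y d' e s' z))"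
      using r by (auto simp: frac_rel_def)
    have sc: "star_act T \<phi> F Y d' e s' z \<in> carrier (star_part T F Y (d' + e))"
      "star_act T \<phi> F Y e d' t y' \<in> carrier (star_part T F Y (d' + e))"
      using group_hom.hom_closed[OF M.act_group_hom[OF in1(1)] in1(4)] group_hom.hom_closed[OF M.act_group_hom[OF in1(2)] in1(3)]
      by (auto simp: add.commute)
    have sgc: "sgn_act (star_part T F Y (d' + e)) (d' * e) (star_act T \<phi> F Y d' e s' z) \<in> carrier (star_part T F Y (d' + e))"
      using sc(1) group.inv_closed[OF M.part_grp sc(1)] by (simp add: sgn_act_def del: star_part_neg)
    have sgm: "?m (d' + e) (sgn_act (star_part T F Y (d' + e)) (d' * e) u) = sgn_act (star_part T F X (d' + e)) (d' * e) (?m (d' + e) u)"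
      if "u \<in> carrier (star_part T F Y (d' + e))" for u
      using group_hom.hom_inv[OF mh[of "d' + e"]] that by (simp add: sgn_act_def)
    have "?m (d' + e + k) (star_act T \<phi> F Y k (d' + e) w (star_act T \<phi> F Y e d' t y')) =
      ?m (d' + e + k) (star_act T \<phi> F Y k (d' + e) w (sgn_act (star_part T F Y (d' + e)) (d' * e) (star_act T \<phi> F Y d' e s' z)))"
      using eq by simp
    then have "star_act T \<phi> F X k (d' + e) w (star_act T \<phi> F X e d' t (?m d' y')) =
      star_act T \<phi> F X k (d' + e) w (sgn_act (star_part T F X (d' + e)) (d' * e) (star_act T \<phi> F X d' e s' (?m e z)))"
      using star_act_natural[OF FA o f _ sc(2), of w k] star_act_natural[OF FA o f _ sgc, of w k] w
        star_act_natural[OF FA o f in1(2,3)] star_act_natural[OF FA o f in1(1,4)] sgm[OF sc(1)]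
      by (simp only: DiffD1 add.commute[of e d'])
    then have "((d', s', ?m d' y'), (e, t, ?m e z)) \<in> frac_rel A p (star_part T F X) (star_act T \<phi> F X) 0"
      using fra w m_in[OF in1(3)] m_in[OF in1(4)] by (auto simp: frac_rel_def fractions_def)
    then show ?thesis unfolding fr_def using equiv_class_eq[OF L.equiv_frac_rel] by blast
  qed
  have "(d, s, y) \<in> fractions A p (star_part T F Y) 0" using s y by (auto simp: fractions_def)
  then have self: "(d, s, y) \<in> fr Y d s y" unfolding fr_def using equiv_class_self[OF M.equiv_frac_rel] by blast
  have "fmap Q f (fr Y d s y) = (\<Union>(d', s', y')\<in>fr Y d s y. fr X d' s' (?m d' y'))"
    using hom_src_tgt[OF o f] by (simp add: fractions_presheaf_def fr_def)
  also have "\<dots> = fr X d s (?m d y)"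
  proof -
    have "fr X d' s' (?m d' y') = fr X d s (?m d y)" if "(d', s', y') \<in> fr Y d s y" for d' s' y'
      using rel[of d s y d' s' y'] that by (simp add: fr_def)
    then show ?thesis using self by blast
  qed
  finally show ?thesis .
qed

text \<open>Localisation is exact: if the fraction with denominator \<open>s\<close> and numerator
  \<open>y\<close> becomes zero along \<open>u\<close>, some \<open>t\<close> makes the pulled back
  numerator vanish, hence the multiple of \<open>y\<close> by \<open>t\<close> lifts along
  \<open>v\<close>, and it represents the same fraction over the product of \<open>t\<close> and
  \<open>s\<close>. The lifting takes place after two suspensions, where only
  \<open>exact_pair\<close> is available.\<close>

lemma fractions_Coh: "Q \<in> Coh T"
proof -
  note FA = Coh_additive[OF F]
  have mult: "fr X d s (y \<otimes>\<^bsub>fobj F (SO (- d) X)\<^esub> z) = fr X d s y \<otimes>\<^bsub>fobj Q X\<^esub> fr X d s z"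
    if "X \<in> obj T" "s \<in> A d - p" "y \<in> carrier (fobj F (SO (- d) X))" "z \<in> carrier (fobj F (SO (- d) X))" for X d s y z
    using hom_mult[OF fr_hom] that by blast
  have cl: "fr X d s y \<in> carrier (fobj Q X)"
    if "X \<in> obj T" "s \<in> A d - p" "y \<in> carrier (fobj F (SO (- d) X))" for X d s y
    using hom_in_carrier[OF fr_hom] that by blast
  have mc: "fmap F (SM (- d) f) y \<in> carrier (fobj F (SO (- d) X))"
    if "X \<in> obj T" "Y \<in> obj T" "f \<in> hom_set T X Y" "y \<in> carrier (fobj F (SO (- d) Y))" for X Y f d y
    using af_closed[OF FA SO_in[OF that(1)] SO_in[OF that(2)] SM_in[OF that(1-3)] that(4)] .
  show ?thesis
    unfolding Coh_iff
  proof (intro conjI allI impI ballI additive_functorI)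
    fix X assume X: "X \<in> obj T"
    show "comm_group (fobj Q X)" unfolding Q_obj using module_localisation.comm_group_L[OF star_localisation[OF X]] .
  next
    fix X Y f assume o: "X \<in> obj T" "Y \<in> obj T" "f \<in> hom_set T X Y"
    show "fmap Q f \<in> hom (fobj Q Y) (fobj Q X)"
    proof (rule homI)
      fix x assume x: "x \<in> carrier (fobj Q Y)"
      obtain d s y where y: "s \<in> A d - p" "y \<in> carrier (fobj F (SO (- d) Y))" "x = fr Y d s y"
        using fr_surj[OF o(2) x] by blast
      then show "fmap Q f x \<in> carrier (fobj Q X)" using fr_natural[OF o y(1,2)] cl[OF o(1) y(1)] mc[OF o y(2)] by simp
      fix x' assume x': "x' \<in> carrier (fobj Q Y)"
      obtain d s y y' where y: "s \<in> A d - p" "y \<in> carrier (fobj F (SO (- d) Y))" "y' \<in> carrier (fobj F (SO (- d) Y))"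
        "x = fr Y d s y" "x' = fr Y d s y'" using fr_common[OF o(2) x x'] by blast
      have yy: "y \<otimes>\<^bsub>fobj F (SO (- d) Y)\<^esub> y' \<in> carrier (fobj F (SO (- d) Y))"
        using y group.is_monoid[OF af_group[OF FA SO_in[OF o(2)]]] monoid.m_closed by metis
      show "fmap Q f (x \<otimes>\<^bsub>fobj Q Y\<^esub> x') = fmap Q f x \<otimes>\<^bsub>fobj Q X\<^esub> fmap Q f x'"
        using mult[OF o(2) y(1-3), symmetric] fr_natural[OF o y(1)] yy y mult[OF o(1) y(1) mc[OF o y(2)] mc[OF o y(3)]]
          af_mult[OF FA SO_in[OF o(1)] SO_in[OF o(2)] SM_in[OF o] y(2,3)] by simp
    qed
  next
    fix X x assume X: "X \<in> obj T" and x: "x \<in> carrier (fobj Q X)"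
    obtain d s y where y: "s \<in> A d - p" "y \<in> carrier (fobj F (SO (- d) X))" "x = fr X d s y"
      using fr_surj[OF X x] by blast
    then show "fmap Q (idn T X) x = x"
      using fr_natural[OF X X idn_in[OF X] y(1,2)] SM_idn[OF X] af_idn[OF FA SO_in[OF X] y(2)] by simp
  next
    fix X Y Z f g x assume o: "X \<in> obj T" "Y \<in> obj T" "Z \<in> obj T" and f: "f \<in> hom_set T X Y" and g: "g \<in> hom_set T Y Z"
      and x: "x \<in> carrier (fobj Q Z)"
    obtain d s y where y: "s \<in> A d - p" "y \<in> carrier (fobj F (SO (- d) Z))" "x = fr Z d s y"
      using fr_surj[OF o(3) x] by blast
    then show "fmap Q (g \<cdot>\<^bsub>T\<^esub> f) x = fmap Q f (fmap Q g x)"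
      using fr_natural[OF o(1,3) cmp_in[OF o f g] y(1,2)] fr_natural[OF o(2,3) g y(1,2)]
        fr_natural[OF o(1,2) f y(1) mc[OF o(2,3) g y(2)]] SM_cmp[OF o f g]
        af_cmp[OF FA SO_in[OF o(1)] SO_in[OF o(2)] SO_in[OF o(3)] SM_in[OF o(1,2) f] SM_in[OF o(2,3) g] y(2)] by simp
  next
    fix X Y f g x assume o: "X \<in> obj T" "Y \<in> obj T" and f: "f \<in> hom_set T X Y" and g: "g \<in> hom_set T X Y"
      and x: "x \<in> carrier (fobj Q Y)"
    obtain d s y where y: "s \<in> A d - p" "y \<in> carrier (fobj F (SO (- d) Y))" "x = fr Y d s y"
      using fr_surj[OF o(2) x] by blast
    have fg: "f \<otimes>\<^bsub>Hom T X Y\<^esub> g \<in> hom_set T X Y"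
      using hom_grp[OF o] f g group.is_monoid monoid.m_closed by metis
    show "fmap Q (f \<otimes>\<^bsub>Hom T X Y\<^esub> g) x = fmap Q f x \<otimes>\<^bsub>fobj Q X\<^esub> fmap Q g x"
      using y fr_natural[OF o fg y(1,2)] fr_natural[OF o f y(1,2)] fr_natural[OF o g y(1,2)] SM_mult[OF o f g]
        af_add[OF FA SO_in[OF o(1)] SO_in[OF o(2)] SM_in[OF o f] SM_in[OF o g] y(2)]
        mult[OF o(1) y(1) mc[OF o f y(2)] mc[OF o g y(2)]] by simp
  next
    fix X Y Z u v w x assume d: "dtri X Y Z u v w" and x: "x \<in> carrier (fobj Q Y)" and ux: "fmap Q u x = \<one>\<^bsub>fobj Q X\<^esub>"
    have o: "X \<in> obj T" "Y \<in> obj T" "Z \<in> obj T" and u: "u \<in> hom_set T X Y" and v: "v \<in> hom_set T Y Z"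
      using d unfolding dtri_def by auto
    obtain d s y where y: "s \<in> A d - p" "y \<in> carrier (fobj F (SO (- d) Y))" "x = fr Y d s y"
      using fr_surj[OF o(2) x] by blast
    let ?X = "SO (- d) X" and ?Y = "SO (- d) Y" and ?Z = "SO (- d) Z"
    have o': "?X \<in> obj T" "?Y \<in> obj T" "?Z \<in> obj T" using o by auto
    have u': "SM (- d) u \<in> hom_set T ?X ?Y" using SM_in[OF o(1,2) u] .
    have "fr X d s (fmap F (SM (- d) u) y) = \<one>\<^bsub>fobj Q X\<^esub>" using ux y fr_natural[OF o(1,2) u y(1,2)] by simp
    then obtain k t where t: "t \<in> A k - p"
      and ty: "fmap F (rh k t ?X) (fmap F (SM (- d) u) y) = \<one>\<^bsub>fobj F (SO (- k) ?X)\<^esub>"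
      using fr_zero[OF o(1) y(1) mc[OF o(1,2) u y(2)]] by blast
    let ?y = "fmap F (rh k t ?Y) y"
    have tA: "t \<in> A k" using t by simp
    have y': "?y \<in> carrier (fobj F (SO (- k) ?Y))" using af_closed[OF FA SO_in[OF o'(2)] o'(2) rho_in[OF tA o'(2)] y(2)] .
    have "fmap F (SM (- k) (SM (- d) u)) ?y = \<one>\<^bsub>fobj F (SO (- k) ?X)\<^esub>"
      using ty af_cmp[OF FA SO_in[OF o'(1)] SO_in[OF o'(2)] o'(2) SM_in[OF o'(1,2) u'] rho_in[OF tA o'(2)] y(2)]
        af_cmp[OF FA SO_in[OF o'(1)] o'(1,2) rho_in[OF tA o'(1)] u' y(2)] rho_natural[OF tA o'(1,2) u'] by simp
    moreover have "exact_pair (SO (- k) ?X) (SO (- k) ?Y) (SO (- k) ?Z) (SM (- k) (SM (- d) u)) (SM (- k) (SM (- d) v))"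
      using exact_pair_SM[OF o' exact_pair_SM[OF o dtri_exact_pair[OF d]]] .
    ultimately obtain z where z: "z \<in> carrier (fobj F (SO (- k) ?Z))" "?y = fmap F (SM (- k) (SM (- d) v)) z"
      using Coh_exact_pair[OF F SO_in[OF o'(1)] SO_in[OF o'(2)] SO_in[OF o'(3)] _ y'] by blast
    have e: "SO (- k) ?Z = SO (- (d + k)) Z" "SM (- k) (SM (- d) v) = SM (- (d + k)) v"
      using SO_SO[OF o(3), of "- k" "- d"] SM_SM[OF v o(2,3), of "- k" "- d"] by (simp_all add: algebra_simps)
    have ts: "t \<otimes>\<^bsub>R\<^esub> s \<in> A (d + k) - p"
      using mult_degree[of t k s d] mult_p[of t k s d] t y(1) by (simp add: add.commute)
    have "x = fr Y (d + k) (t \<otimes>\<^bsub>R\<^esub> s) ?y" using y(3) fr_expand[OF o(2) y(1,2) t] by simp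
    also have "\<dots> = fmap Q v (fr Z (d + k) (t \<otimes>\<^bsub>R\<^esub> s) z)"
      using z e fr_natural[OF o(2,3) v ts] by simp
    finally show "\<exists>z\<in>carrier (fobj Q Z). x = fmap Q v z" using cl[OF o(3) ts] z e by auto
  qed
qed

text \<open>Fractions are parametrised by a degree, a ring element and an element of
  \<open>'a\<close>. An infinite type absorbs such triples when the ring is small, so the transport
  to the universe is an isomorphism.\<close>

lemma localise_exists:
  assumes inf: "infinite (UNIV :: 'a set)" and small: "carrier R \<lesssim> (UNIV :: 'a set)"
  shows "\<exists>\<psi>. is_localisation p F (localise R A T \<phi> p F) \<psi>"
proof -
  let ?L = "localise R A T \<phi> p F"
  note QA = Coh_additive[OF fractions_Coh]
  have "(UNIV :: int set) \<lesssim> (UNIV :: nat set)" by (auto simp: lepoll_def intro: inj_to_nat)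
  then have i: "(UNIV :: int set) \<lesssim> (UNIV :: 'a set)"
    using inf infinite_le_lepoll lepoll_trans by blast
  have "(UNIV :: 'a set) \<times> (UNIV :: 'a set) \<approx> (UNIV :: 'a set)"
    using card_of_Times_same_infinite[OF inf] by (simp add: eqpoll_iff_card_of_ordIso)
  then have sq: "(UNIV :: 'a set) \<times> (UNIV :: 'a set) \<lesssim> (UNIV :: 'a set)" by (rule eqpoll_imp_lepoll)
  have triple: "(UNIV :: int set) \<times> carrier R \<times> (UNIV :: 'a set) \<lesssim> (UNIV :: 'a set)"
    by (rule lepoll_trans[OF times_lepoll_mono[OF i times_lepoll_mono[OF small lepoll_refl]]
      lepoll_trans[OF times_lepoll_mono[OF lepoll_refl sq] sq]])
  have sm: "carrier (fobj Q X) \<lesssim> (UNIV :: 'a set)" if X: "X \<in> obj T" for X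
  proof -
    have inc: "carrier (fobj Q X) \<subseteq> (\<lambda>(d, s, y). fr X d s y) ` ((UNIV :: int set) \<times> carrier R \<times> (UNIV :: 'a set))"
    proof
      fix x assume "x \<in> carrier (fobj Q X)"
      then obtain d s y where "s \<in> A d - p" "x = fr X d s y" using fr_surj[OF X] by blast
      then show "x \<in> (\<lambda>(d, s, y). fr X d s y) ` ((UNIV :: int set) \<times> carrier R \<times> (UNIV :: 'a set))"
        using degree_carrier by force
    qed
    show ?thesis by (rule lepoll_trans[OF subset_image_lepoll[OF inc] triple])
  qed
  have L: "?L = to_universe T Q" by (simp add: localise_def)
  obtain e :: "'o \<Rightarrow> (int \<times> 'r \<times> 'a) set \<Rightarrow> 'a" where Lg: "\<And>X. X \<in> obj T \<Longrightarrow> comm_group (fobj ?L X)"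
    and e: "\<And>X. X \<in> obj T \<Longrightarrow> e X \<in> iso (fobj Q X) (fobj ?L X)"
    and nat: "\<And>X Y f x. \<lbrakk>X \<in> obj T; Y \<in> obj T; f \<in> hom_set T X Y; x \<in> carrier (fobj Q Y)\<rbrakk>
      \<Longrightarrow> fmap ?L f (e Y x) = e X (fmap Q f x)"
    unfolding L using to_universe_iso[OF QA sm] by metis
  have eh: "e X \<in> hom (fobj Q X) (fobj ?L X)" if "X \<in> obj T" for X using e[OF that] by (simp add: iso_def)
  have cl: "fr X d s y \<in> carrier (fobj Q X)"
    if "X \<in> obj T" "s \<in> A d - p" "y \<in> carrier (fobj F (SO (- d) X))" for X d s y
    using hom_in_carrier[OF fr_hom] that by blast
  have e1: "x = \<one>\<^bsub>fobj Q X\<^esub>" if "X \<in> obj T" "x \<in> carrier (fobj Q X)" "e X x = \<one>\<^bsub>fobj ?L X\<^esub>" for X x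
  proof -
    have "e X \<one>\<^bsub>fobj Q X\<^esub> = \<one>\<^bsub>fobj ?L X\<^esub>"
      using hom_one[OF eh[OF that(1)] af_group[OF QA that(1)] comm_group.axioms(2)[OF Lg[OF that(1)]]] .
    moreover have "inj_on (e X) (carrier (fobj Q X))" using e[OF that(1)] by (simp add: iso_def bij_betw_def)
    ultimately show ?thesis
      using that monoid.one_closed[OF group.is_monoid[OF af_group[OF QA that(1)]]] by (metis inj_onD)
  qed
  have LC: "?L \<in> Coh T" by (rule Coh_iso[OF fractions_Coh, where e = e]) (rule Lg e nat; assumption)+
  have "is_localisation p F ?L (\<lambda>X d s y. e X (fr X d s y))"
    unfolding is_localisation_def
  proof (intro conjI LC ballI allI impI)
    fix X d s assume "X \<in> obj T" "s \<in> A d - p"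
    then show "(\<lambda>y. e X (fr X d s y)) \<in> hom (fobj F (SO (- d) X)) (fobj ?L X)"
      using hom_compose[OF fr_hom eh] by (simp add: comp_def)
  next
    fix X x assume X: "X \<in> obj T" and x: "x \<in> carrier (fobj ?L X)"
    obtain z where z: "z \<in> carrier (fobj Q X)" "x = e X z" using iso_surjE[OF e[OF X] x] .
    then show "\<exists>d. \<exists>s\<in>A d - p. \<exists>y\<in>carrier (fobj F (SO (- d) X)). x = e X (fr X d s y)"
      using fr_surj[OF X z(1)] by blast
  next
    fix X d s y assume a: "X \<in> obj T" "s \<in> A d - p" "y \<in> carrier (fobj F (SO (- d) X))" "e X (fr X d s y) = \<one>\<^bsub>fobj ?L X\<^esub>"
    then show "\<exists>k. \<exists>w\<in>A k - p. fmap F (rh k w (SO (- d) X)) y = \<one>\<^bsub>fobj F (SO (- k) (SO (- d) X))\<^esub>"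
      using e1[OF a(1) cl[OF a(1-3)] a(4)] fr_zero[OF a(1-3)] by blast
  next
    fix X d s y k t assume a: "X \<in> obj T" "s \<in> A d - p" "y \<in> carrier (fobj F (SO (- d) X))" "t \<in> A k - p"
    show "e X (fr X d s y) = e X (fr X (d + k) (t \<otimes>\<^bsub>R\<^esub> s) (fmap F (rh k t (SO (- d) X)) y))"
      using fr_expand[OF a] by simp
  next
    fix X Y f d s y assume a: "X \<in> obj T" "Y \<in> obj T" "f \<in> hom_set T X Y" "s \<in> A d - p" "y \<in> carrier (fobj F (SO (- d) Y))"
    show "fmap ?L f (e Y (fr Y d s y)) = e X (fr X d s (fmap F (SM (- d) f) y))"
      using nat[OF a(1-3) cl[OF a(2,4,5)]] fr_natural[OF a] by simp
  qed
  then show ?thesis by blast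
qed

end

end

section \<open>The functors \<open>i\<^sup>*i\<^sub>*\<close>\<close>

context triangulated_category
begin

lemma biproductE:
  assumes "X \<in> obj T" "Y \<in> obj T"
  obtains P i j p q where "P \<in> obj T" "i \<in> hom_set T X P" "j \<in> hom_set T Y P" "p \<in> hom_set T P X" "q \<in> hom_set T P Y"
    "p \<cdot> i = idn T X" "q \<cdot> j = idn T Y" "p \<cdot> j = zer Y X" "q \<cdot> i = zer X Y"
    "(i \<cdot> p) \<otimes>\<^bsub>Hom T P P\<^esub> (j \<cdot> q) = idn T P"
  using biproducts[OF assms] by (elim bexE conjE) (rule that)

text \<open>\<open>\<gamma> X C f c\<close> is the element of the colimit represented by \<open>f : X \<rightarrow> C\<close> in the copy of \<open>H\<^sub>C\<close>
  belonging to \<open>c \<in> F(C)\<close>. The last condition comes from the category of the \<open>(C, c)\<close> being filtered.\<close>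

definition is_Gamma ::
  "'o set \<Rightarrow> ('o, 'm, 'a) presheaf \<Rightarrow> ('o, 'm, 'b) presheaf \<Rightarrow> ('o \<Rightarrow> 'o \<Rightarrow> 'm \<Rightarrow> 'a \<Rightarrow> 'b) \<Rightarrow> bool"
  where "is_Gamma D F G \<gamma> \<longleftrightarrow> additive_functor T G \<and>
    (\<forall>X\<in>obj T. \<forall>C\<in>D. \<forall>c\<in>carrier (fobj F C). (\<lambda>f. \<gamma> X C f c) \<in> hom (Hom T X C) (fobj G X)) \<and>
    (\<forall>X\<in>obj T. \<forall>C\<in>D. \<forall>f\<in>hom_set T X C. \<gamma> X C f \<in> hom (fobj F C) (fobj G X)) \<and>
    (\<forall>X\<in>obj T. \<forall>C\<in>D. \<forall>C'\<in>D. \<forall>f\<in>hom_set T X C. \<forall>a\<in>hom_set T C C'. \<forall>c\<in>carrier (fobj F C').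
      \<gamma> X C' (a \<cdot> f) c = \<gamma> X C f (fmap F a c)) \<and>
    (\<forall>X\<in>obj T. \<forall>Y\<in>obj T. \<forall>k\<in>hom_set T X Y. \<forall>C\<in>D. \<forall>f\<in>hom_set T Y C. \<forall>c\<in>carrier (fobj F C).
      fmap G k (\<gamma> Y C f c) = \<gamma> X C (f \<cdot> k) c) \<and>
    (\<forall>X\<in>obj T. \<forall>x\<in>carrier (fobj G X). \<exists>C\<in>D. \<exists>f\<in>hom_set T X C. \<exists>c\<in>carrier (fobj F C). x = \<gamma> X C f c) \<and>
    (\<forall>X\<in>obj T. \<forall>C\<in>D. \<forall>f\<in>hom_set T X C. \<forall>c\<in>carrier (fobj F C). \<gamma> X C f c = \<one>\<^bsub>fobj G X\<^esub> \<longrightarrow>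
      (\<exists>B\<in>D. \<exists>a\<in>hom_set T C B. \<exists>b\<in>carrier (fobj F B). a \<cdot> f = zer X B \<and> c = fmap F a b))"

text \<open>Formed for any set of objects, because the induction leads to supports of ideals that
  are not prime; \<open>Gamma_GammaD\<close> makes the connection with local cohomology.\<close>

definition GammaD :: "'o set \<Rightarrow> ('o, 'm, 'a) presheaf \<Rightarrow> ('o, 'm, 'a) presheaf"
  where "GammaD D F = upper_star (full_subcat T D) T id id (lower_star id id F)"

context
  fixes D :: "'o set" and F :: "('o, 'm, 'a) presheaf"
  assumes D: "thick D" and F: "F \<in> Coh T"
begin

abbreviation T' :: "('o, 'm) tricat" where "T' \<equiv> full_subcat T D"

definition J :: "('o \<times> ('o \<Rightarrow> 'm \<Rightarrow> 'a)) set" where "J = slice_obj T' F"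
definition yon :: "'o \<Rightarrow> 'a \<Rightarrow> 'o \<Rightarrow> 'm \<Rightarrow> 'a"
  where "yon X c = (\<lambda>Y\<in>D. \<lambda>g\<in>hom_set T Y X. fmap F g c)"
definition pt :: "'o \<times> ('o \<Rightarrow> 'm \<Rightarrow> 'a) \<Rightarrow> 'a" where "pt j = snd j (fst j) (idn T (fst j))"
definition Sm :: "'o \<Rightarrow> ('o \<times> ('o \<Rightarrow> 'm \<Rightarrow> 'a) \<Rightarrow> 'm) monoid" where "Sm Y = sum_group J (\<lambda>j. Hom T Y (fst j))"
definition ij :: "'o \<Rightarrow> 'o \<times> ('o \<Rightarrow> 'm \<Rightarrow> 'a) \<Rightarrow> 'm \<Rightarrow> 'o \<times> ('o \<Rightarrow> 'm \<Rightarrow> 'a) \<Rightarrow> 'm"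
  where "ij Y j h = sum_inj J (\<lambda>j. Hom T Y (fst j)) j h"
definition gens :: "'o \<Rightarrow> ('o \<times> ('o \<Rightarrow> 'm \<Rightarrow> 'a) \<Rightarrow> 'm) set"
  where "gens Y = {ij Y j h \<otimes>\<^bsub>Sm Y\<^esub> inv\<^bsub>Sm Y\<^esub> (ij Y j' (a \<cdot> h)) | j j' a h.
     j \<in> J \<and> j' \<in> J \<and> a \<in> hom_set T (fst j) (fst j') \<and> fmap F a (pt j') = pt j \<and> h \<in> hom_set T Y (fst j)}"
definition Nm :: "'o \<Rightarrow> ('o \<times> ('o \<Rightarrow> 'm \<Rightarrow> 'a) \<Rightarrow> 'm) set" where "Nm Y = generate (Sm Y) (gens Y)"
definition cls :: "'o \<Rightarrow> ('o \<times> ('o \<Rightarrow> 'm \<Rightarrow> 'a) \<Rightarrow> 'm) \<Rightarrow> ('o \<times> ('o \<Rightarrow> 'm \<Rightarrow> 'a) \<Rightarrow> 'm) set"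
  where "cls Y x = Nm Y #>\<^bsub>Sm Y\<^esub> x"
abbreviation GQ :: "('o, 'm, ('o \<times> ('o \<Rightarrow> 'm \<Rightarrow> 'a) \<Rightarrow> 'm) set) presheaf"
  where "GQ \<equiv> colim_presheaf T' T id id F"

lemma Dobj: "X \<in> D \<Longrightarrow> X \<in> obj T" using thick_obj[OF D] .

lemma T'_simps: "obj T' = D" "Hom T' = Hom T" "cmp T' = cmp T"
  using Dobj by (auto simp: full_subcat_def)

lemmas FA = Coh_additive[OF F]

lemma yon_in:
  assumes X: "X \<in> D" and c: "c \<in> carrier (fobj F X)"
  shows "(X, yon X c) \<in> J" "pt (X, yon X c) = c"
proof -
  note Xo = Dobj[OF X]
  have "restrict (\<lambda>g. fmap F g c) (hom_set T Y X) \<in> hom (Hom T Y X) (fobj F Y)" if Y: "Y \<in> D" for Y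
    using group_hom.homh[OF af_eval_group_hom[OF FA Dobj[OF Y] Xo c]] hom_grp[OF Dobj[OF Y] Xo]
    by (auto simp: hom_def monoid.m_closed[OF group.is_monoid])
  moreover have "fmap F (x \<cdot> f) c = fmap F f (fmap F x c) \<and> x \<cdot> f \<in> hom_set T Y X"
    if "Y \<in> D" "Z \<in> D" "f \<in> hom_set T Y Z" "x \<in> hom_set T Z X" for Y Z f x
    using af_cmp[OF FA Dobj[OF that(1)] Dobj[OF that(2)] Xo that(3,4) c]
      cmp_in[OF Dobj[OF that(1)] Dobj[OF that(2)] Xo that(3,4)] by simp
  ultimately have "yon X c \<in> nat_trans T' (representable T' X) F"
    by (auto simp: nat_trans_def T'_simps representable_def yon_def)
  then show "(X, yon X c) \<in> J" using X by (simp add: J_def slice_obj_def T'_simps)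
  show "pt (X, yon X c) = c" using X Xo idn_in[OF Xo] af_idn[OF FA Xo c] by (simp add: pt_def yon_def)
qed

text \<open>Yoneda inside the subcategory: naturality along maps into the representing object
  recovers the transformation from its value at the identity. Objects of the index category thus
  become pairs of an object and a point.\<close>

lemma J_mem:
  assumes j: "j \<in> J"
  shows "fst j \<in> D" "pt j \<in> carrier (fobj F (fst j))" "j = (fst j, yon (fst j) (pt j))"
proof -
  obtain X \<eta> where j': "j = (X, \<eta>)" "X \<in> D" and \<eta>: "\<eta> \<in> nat_trans T' (representable T' X) F"
    using j by (auto simp: J_def slice_obj_def T'_simps)
  note Xo = Dobj[OF j'(2)]
  have \<eta>h: "\<eta> Y \<in> hom (Hom T Y X) (fobj F Y)" "\<eta> Y \<in> extensional (hom_set T Y X)" if "Y \<in> D" for Y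
    using \<eta> that by (auto simp: nat_trans_def T'_simps representable_def)
  have nat: "\<eta> Y (x \<cdot> f) = fmap F f (\<eta> Z x)" if "Y \<in> D" "Z \<in> D" "f \<in> hom_set T Y Z" "x \<in> hom_set T Z X" for Y Z f x
    using \<eta> that by (auto simp: nat_trans_def T'_simps representable_def)
  show "fst j \<in> D" using j' by simp
  show p: "pt j \<in> carrier (fobj F (fst j))" using hom_in_carrier[OF \<eta>h(1)[OF j'(2)] idn_in[OF Xo]] j' by (simp add: pt_def)
  have "\<eta> = yon X (pt j)"
  proof
    fix Y show "\<eta> Y = yon X (pt j) Y"
    proof (cases "Y \<in> D")
      case False
      have "\<eta> \<in> extensional D" using \<eta> by (auto simp: nat_trans_def T'_simps PiE_def)
      then show ?thesis using False by (simp add: yon_def extensional_def)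
    next
      case Y: True
      show ?thesis
      proof (rule extensionalityI[OF \<eta>h(2)[OF Y]])
        show "yon X (pt j) Y \<in> extensional (hom_set T Y X)" using Y by (simp add: yon_def)
        show "\<eta> Y g = yon X (pt j) Y g" if g: "g \<in> hom_set T Y X" for g
          using nat[OF Y j'(2) g idn_in[OF Xo]] idn_left[OF Dobj[OF Y] Xo g] g Y j' by (simp add: yon_def pt_def)
      qed
    qed
  qed
  then show "j = (fst j, yon (fst j) (pt j))" using j' by simp
qed

lemma slice_hom_iff:
  assumes j: "j \<in> J" and j': "j' \<in> J"
  shows "a \<in> slice_hom T' j j' \<longleftrightarrow> a \<in> hom_set T (fst j) (fst j') \<and> fmap F a (pt j') = pt j"
proof
  note m = J_mem[OF j] J_mem[OF j']
  note o = Dobj[OF m(1)] Dobj[OF m(4)]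
  have yv: "snd l Y g = fmap F g (pt l)" if "l \<in> J" "Y \<in> D" "g \<in> hom_set T Y (fst l)" for l Y g
    using arg_cong[OF J_mem(3)[OF that(1)], of snd] that(2,3) by (simp add: yon_def)
  assume a: "a \<in> slice_hom T' j j'"
  then have ah: "a \<in> hom_set T (fst j) (fst j')"
    and "\<And>Y g. \<lbrakk>Y \<in> D; g \<in> hom_set T Y (fst j)\<rbrakk> \<Longrightarrow> snd j' Y (a \<cdot> g) = snd j Y g"
    by (auto simp: slice_hom_def T'_simps)
  from this(2)[OF m(1) idn_in[OF o(1)]] have "snd j' (fst j) a = pt j"
    using idn_right[OF o ah] by (simp add: pt_def)
  then show "a \<in> hom_set T (fst j) (fst j') \<and> fmap F a (pt j') = pt j" using ah yv[OF j' m(1) ah] by simp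
next
  note m = J_mem[OF j] J_mem[OF j']
  note o = Dobj[OF m(1)] Dobj[OF m(4)]
  have yv: "snd l Y g = fmap F g (pt l)" if "l \<in> J" "Y \<in> D" "g \<in> hom_set T Y (fst l)" for l Y g
    using arg_cong[OF J_mem(3)[OF that(1)], of snd] that(2,3) by (simp add: yon_def)
  assume a: "a \<in> hom_set T (fst j) (fst j') \<and> fmap F a (pt j') = pt j"
  have "snd j' Y (a \<cdot> g) = snd j Y g" if "Y \<in> D" "g \<in> hom_set T Y (fst j)" for Y g
    using a that yv[OF j that] yv[OF j' that(1) cmp_in[OF Dobj[OF that(1)] o that(2)]]
      af_cmp[OF FA Dobj[OF that(1)] o that(2) _ m(5)] by simp
  then show "a \<in> slice_hom T' j j'" using a by (simp add: slice_hom_def T'_simps)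
qed

text \<open>First half of filteredness. On the biproduct the sum of the two points, pulled back
  along the projections, restricts to each of them; \<open>P\<close> stays in \<open>D\<close> by
  thickness.\<close>

lemma point_sum:
  assumes C: "C \<in> D" "C' \<in> D" and c: "c \<in> carrier (fobj F C)" "c' \<in> carrier (fobj F C')"
  obtains P i j e where "P \<in> D" "i \<in> hom_set T C P" "j \<in> hom_set T C' P" "e \<in> carrier (fobj F P)"
    "fmap F i e = c" "fmap F j e = c'"
proof -
  note o = Dobj[OF C(1)] Dobj[OF C(2)]
  obtain P i j p q where P: "P \<in> obj T" and h: "i \<in> hom_set T C P" "j \<in> hom_set T C' P"
      "p \<in> hom_set T P C" "q \<in> hom_set T P C'"
    and e: "p \<cdot> i = idn T C" "q \<cdot> j = idn T C'" "p \<cdot> j = zer C' C" "q \<cdot> i = zer C C'"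
      "(i \<cdot> p) \<otimes>\<^bsub>Hom T P P\<^esub> (j \<cdot> q) = idn T P"
    using biproductE[OF o] .
  have PD: "P \<in> D" using thick_biproduct[OF D C P h e(5)] .
  let ?e = "fmap F p c \<otimes>\<^bsub>fobj F P\<^esub> fmap F q c'"
  have pq: "fmap F p c \<in> carrier (fobj F P)" "fmap F q c' \<in> carrier (fobj F P)"
    using af_closed[OF FA P o(1) h(3) c(1)] af_closed[OF FA P o(2) h(4) c(2)] by auto
  have eP: "?e \<in> carrier (fobj F P)"
    using monoid.m_closed[OF group.is_monoid[OF af_group[OF FA P]] pq] .
  have i: "fmap F i ?e = c"
    using af_mult[OF FA o(1) P h(1) pq] af_cmp[OF FA o(1) P o(1) h(1,3) c(1)] af_cmp[OF FA o(1) P o(2) h(1,4) c(2)]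
      e af_idn[OF FA o(1) c(1)] af_zer[OF FA o c(2)] c monoid.r_one[OF group.is_monoid[OF af_group[OF FA o(1)]]] by simp
  have j: "fmap F j ?e = c'"
    using af_mult[OF FA o(2) P h(2) pq] af_cmp[OF FA o(2) P o(1) h(2,3) c(1)] af_cmp[OF FA o(2) P o(2) h(2,4) c(2)]
      e af_idn[OF FA o(2) c(2)] af_zer[OF FA o(2,1) c(1)] c monoid.l_one[OF group.is_monoid[OF af_group[OF FA o(2)]]] by simp
  show thesis using that[OF PD h(1,2) eP i j] .
qed

lemma lower_star_id: "lower_star id id F = F"
  by (simp add: lower_star_def)

lemma colim_sum_Sm: "colim_sum T' T id F Y = Sm Y"
  by (simp add: colim_sum_def Sm_def J_def)

lemma colim_rel_Nm: "colim_rel T' T id id F Y = Nm Y"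
proof -
  have "colim_inj T' T id F Y j h = ij Y j h" for j h
    unfolding colim_inj_def ij_def sum_inj_def J_def id_apply by (rule refl)
  then show ?thesis
    unfolding colim_rel_def Nm_def gens_def colim_sum_Sm J_def[symmetric]
    using slice_hom_iff by (intro arg_cong[where f = "generate (Sm Y)"]) fastforce
qed

lemma GQ_obj: "fobj GQ Y = Sm Y Mod Nm Y"
  by (simp add: colim_presheaf_def colim_sum_Sm colim_rel_Nm)

lemma GQ_map: "X \<in> obj T \<Longrightarrow> Y \<in> obj T \<Longrightarrow> k \<in> hom_set T X Y \<Longrightarrow>
  fmap GQ k C = (\<Union>c\<in>C. cls X (\<lambda>j\<in>J. c j \<cdot> k))"
  using hom_src_tgt[of X Y k] by (simp add: colim_presheaf_def colim_sum_Sm colim_rel_Nm cls_def J_def)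

section \<open>The quotient group at one object and its relations\<close>

context
  fixes Y assumes Y: "Y \<in> obj T"
begin

lemma part_cg: "j \<in> J \<Longrightarrow> comm_group (Hom T Y (fst j))"
  using hom_group[OF Y Dobj[OF J_mem(1)]] .

lemma Sm_cg: "comm_group (Sm Y)"
  unfolding Sm_def by (rule sum_comm_group) (rule part_cg)

lemma Sm_group: "group (Sm Y)"
  using Sm_cg comm_group.axioms(2) by blast

lemma ij_in: "\<lbrakk>j \<in> J; h \<in> hom_set T Y (fst j)\<rbrakk> \<Longrightarrow> ij Y j h \<in> carrier (Sm Y)"
  unfolding ij_def Sm_def by (rule sum_inj_in[OF part_cg])

lemma ij_hom: "j \<in> J \<Longrightarrow> ij Y j \<in> hom (Hom T Y (fst j)) (Sm Y)"
  unfolding ij_def[abs_def] Sm_def by (rule sum_inj_hom[OF part_cg])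

lemma gens_in: "gens Y \<subseteq> carrier (Sm Y)"
proof
  fix g assume "g \<in> gens Y"
  then obtain j j' a h where g: "g = ij Y j h \<otimes>\<^bsub>Sm Y\<^esub> inv\<^bsub>Sm Y\<^esub> (ij Y j' (a \<cdot> h))" "j \<in> J" "j' \<in> J"
    "a \<in> hom_set T (fst j) (fst j')" "h \<in> hom_set T Y (fst j)" by (auto simp: gens_def)
  have "a \<cdot> h \<in> hom_set T Y (fst j')" using cmp_in[OF Y Dobj[OF J_mem(1)[OF g(2)]] Dobj[OF J_mem(1)[OF g(3)]] g(5,4)] .
  then show "g \<in> carrier (Sm Y)"
    using g ij_in group.is_monoid[OF Sm_group] monoid.m_closed group.inv_closed[OF Sm_group] by metis
qed

lemma Nm_subgroup: "subgroup (Nm Y) (Sm Y)"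
  unfolding Nm_def using group.generate_is_subgroup[OF Sm_group gens_in] .

lemma Nm_normal: "Nm Y \<lhd> Sm Y"
  using comm_group.normal_iff_subgroup[OF Sm_cg] Nm_subgroup by (rule iffD2)

lemma cls_hom: "cls Y \<in> hom (Sm Y) (fobj GQ Y)"
  unfolding GQ_obj cls_def[abs_def] using normal.r_coset_hom_Mod[OF Nm_normal] .

lemma cls_surj: "C \<in> carrier (fobj GQ Y) \<Longrightarrow> \<exists>x\<in>carrier (Sm Y). C = cls Y x"
  unfolding GQ_obj cls_def by (auto simp: FactGroup_def RCOSETS_def)

lemma cls_eq:
  assumes "x \<in> carrier (Sm Y)" "y \<in> carrier (Sm Y)" "x \<otimes>\<^bsub>Sm Y\<^esub> inv\<^bsub>Sm Y\<^esub> y \<in> Nm Y"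
  shows "cls Y x = cls Y y"
proof -
  interpret S: group "Sm Y" by (rule Sm_group)
  have "x = (x \<otimes>\<^bsub>Sm Y\<^esub> inv\<^bsub>Sm Y\<^esub> y) \<otimes>\<^bsub>Sm Y\<^esub> y" using assms by (simp add: S.m_assoc)
  then have "x \<in> Nm Y #>\<^bsub>Sm Y\<^esub> y" using assms(3) by (auto simp: r_coset_def)
  then show ?thesis unfolding cls_def using S.repr_independence[OF _ assms(2) Nm_subgroup] by simp
qed

lemma one_GQ: "\<one>\<^bsub>fobj GQ Y\<^esub> = Nm Y"
  unfolding GQ_obj by (simp add: FactGroup_def)

lemma cls_self: "x \<in> carrier (Sm Y) \<Longrightarrow> x \<in> cls Y x"
  unfolding cls_def using group.rcos_self[OF Sm_group _ Nm_subgroup] .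

lemma cls_one: "\<lbrakk>x \<in> carrier (Sm Y); cls Y x = \<one>\<^bsub>fobj GQ Y\<^esub>\<rbrakk> \<Longrightarrow> x \<in> Nm Y"
  using cls_self one_GQ by blast

lemma cls_Nm: "x \<in> Nm Y \<Longrightarrow> cls Y x = \<one>\<^bsub>fobj GQ Y\<^esub>"
  unfolding cls_def one_GQ using group.coset_join2[OF Sm_group _ Nm_subgroup] subgroup.mem_carrier[OF Nm_subgroup] by blast

text \<open>The following data exhibits \<open>x\<close> as an element that becomes zero in a single member
  \<open>(D\<^sub>0, d)\<close> of the index category.\<close>

definition dat where
  "dat x K D0 d a \<Phi> \<longleftrightarrow> x \<in> carrier (Sm Y) \<and> {j \<in> J. x j \<noteq> zer Y (fst j)} \<subseteq> K \<and> K \<subseteq> J \<and> D0 \<in> D \<and>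
    d \<in> carrier (fobj F D0) \<and> \<Phi> \<in> hom (Sm Y) (Hom T Y D0) \<and> \<Phi> x = zer Y D0 \<and>
    (\<forall>k\<in>K. a k \<in> hom_set T (fst k) D0 \<and> fmap F (a k) d = pt k \<and> (\<forall>h\<in>hom_set T Y (fst k). \<Phi> (ij Y k h) = a k \<cdot> h))"

text \<open>The new index and the old target are joined by \<open>point_sum\<close>. The enlarged
  homomorphism is prescribed on the new summand without restraint, because \<open>x\<close> has no
  entry there and so is still sent to zero.\<close>

lemma dat_extend:
  assumes dt: "dat x K D0 d a \<Phi>" and j: "j \<in> J"
  shows "\<exists>D1 d1 a1 \<Phi>1. dat x (insert j K) D1 d1 a1 \<Phi>1"
proof (cases "j \<in> K")
  case True then show ?thesis using dt by (auto simp: insert_absorb)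
next
  case jK: False
  note c = dt[unfolded dat_def]
  note x = c[THEN conjunct1] c[THEN conjunct2, THEN conjunct1] c[THEN conjunct2, THEN conjunct2, THEN conjunct1]
  note c = c[THEN conjunct2, THEN conjunct2, THEN conjunct2]
  note D0 = c[THEN conjunct1] and d = c[THEN conjunct2, THEN conjunct1]
  note c = c[THEN conjunct2, THEN conjunct2]
  note \<Phi> = c[THEN conjunct1] c[THEN conjunct2, THEN conjunct1]
  note c = c[THEN conjunct2, THEN conjunct2, THEN bspec]
  note k = c[THEN conjunct1] c[THEN conjunct2, THEN conjunct1] c[THEN conjunct2, THEN conjunct2, THEN bspec]
  note jm = J_mem[OF j]
  note D0o = Dobj[OF D0] and jo = Dobj[OF jm(1)]
  obtain P i i' d' where PD: "P \<in> D" and h: "i \<in> hom_set T D0 P" "i' \<in> hom_set T (fst j) P"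
    and dP: "d' \<in> carrier (fobj F P)" and id: "fmap F i d' = d" and i'd: "fmap F i' d' = pt j"
    using point_sum[OF D0 jm(1) d jm(2)] .
  note P = Dobj[OF PD]
  let ?f = "\<lambda>k. if k = j then (\<lambda>h. i' \<cdot> h) else (\<lambda>h. i \<cdot> \<Phi> (ij Y k h))"
  have iP: "(\<lambda>u. i \<cdot> \<Phi> u) \<in> hom (Sm Y) (Hom T Y P)"
    using hom_compose[OF \<Phi>(1) group_hom.homh[OF postcomp_hom[OF Y D0o P h(1)]]] by (simp add: comp_def)
  have f: "?f k \<in> hom (Hom T Y (fst k)) (Hom T Y P)" if "k \<in> J" for k
    using group_hom.homh[OF postcomp_hom[OF Y jo P h(2)]] hom_compose[OF ij_hom[OF that] iP] by (auto simp: comp_def)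
  have "\<exists>\<Psi>\<in>hom (sum_group J (\<lambda>j. Hom T Y (fst j))) (Hom T Y P).
      \<forall>k\<in>J. \<forall>g\<in>carrier (Hom T Y (fst k)). \<Psi> (sum_inj J (\<lambda>j. Hom T Y (fst j)) k g) = ?f k g"
    by (rule sum_hom_exists[OF part_cg hom_group[OF Y P] f])
  then obtain \<Psi> where \<Psi>: "\<Psi> \<in> hom (Sm Y) (Hom T Y P)" "\<And>k g. \<lbrakk>k \<in> J; g \<in> hom_set T Y (fst k)\<rbrakk> \<Longrightarrow> \<Psi> (ij Y k g) = ?f k g"
    unfolding Sm_def ij_def by blast
  have "\<Psi> x = i \<cdot> \<Phi> x"
  proof (rule sum_hom_ext[OF part_cg \<Psi>(1)[unfolded Sm_def] iP[unfolded Sm_def] hom_grp[OF Y P] x(2) _ x(1)[unfolded Sm_def]])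
    fix k g assume "k \<in> J" "k \<in> K" "g \<in> carrier (Hom T Y (fst k))"
    then show "\<Psi> (sum_inj J (\<lambda>j. Hom T Y (fst j)) k g) = i \<cdot> \<Phi> (sum_inj J (\<lambda>j. Hom T Y (fst j)) k g)"
      using \<Psi>(2)[of k g] jK by (auto simp: ij_def)
  qed
  then have \<Psi>x: "\<Psi> x = zer Y P" using \<Phi>(2) cmp_zer_right[OF Y D0o P h(1)] by simp
  let ?a = "\<lambda>k. if k = j then i' else i \<cdot> a k"
  have "dat x (insert j K) P d' ?a \<Psi>"
    unfolding dat_def
  proof (intro conjI ballI)
    fix k assume kK: "k \<in> insert j K"
    have "k \<in> J" using kK j x(3) by blast
    note ko = Dobj[OF J_mem(1)[OF this]] and kJ = this
    show "?a k \<in> hom_set T (fst k) P" using kK h(2) cmp_in[OF ko D0o P k(1) h(1)] by auto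
    show "fmap F (?a k) d' = pt k"
      using kK i'd id k(2) af_cmp[OF FA ko D0o P k(1) h(1) dP] by auto
    fix g assume g: "g \<in> hom_set T Y (fst k)"
    show "\<Psi> (ij Y k g) = ?a k \<cdot> g"
      using \<Psi>(2)[OF kJ g] kK k(3)[OF _ g] cmp_assoc[OF Y ko D0o P g k(1) h(1)] by auto
  qed (use x j PD dP \<Psi>(1) \<Psi>x in auto)
  then show ?thesis by blast
qed

text \<open>Second half of filteredness. The two arrows out of \<open>j\<close> differ by
  \<open>?\<delta>\<close>, which pulls \<open>d\<close> back to zero; exactness of \<open>F\<close>
  lifts \<open>d\<close> to a point of the cone of \<open>?\<delta>\<close>, and in the cone the two
  arrows coincide.\<close>

lemma dat_coequalise:
  assumes dt: "dat x K D0 d a \<Phi>" and j: "j \<in> K" and j': "j' \<in> K" and a0: "a0 \<in> hom_set T (fst j) (fst j')"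
    and a0p: "fmap F a0 (pt j') = pt j"
  shows "\<exists>D1 d1 a1 \<Phi>1. dat x K D1 d1 a1 \<Phi>1 \<and> a1 j = a1 j' \<cdot> a0"
proof -
  note c = dt[unfolded dat_def]
  note x = c[THEN conjunct1] c[THEN conjunct2, THEN conjunct1] c[THEN conjunct2, THEN conjunct2, THEN conjunct1]
  note c = c[THEN conjunct2, THEN conjunct2, THEN conjunct2]
  note D0 = c[THEN conjunct1] and d = c[THEN conjunct2, THEN conjunct1]
  note c = c[THEN conjunct2, THEN conjunct2]
  note \<Phi> = c[THEN conjunct1] c[THEN conjunct2, THEN conjunct1]
  note c = c[THEN conjunct2, THEN conjunct2, THEN bspec]
  note k = c[THEN conjunct1] c[THEN conjunct2, THEN conjunct1] c[THEN conjunct2, THEN conjunct2, THEN bspec]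
  have jJ: "j \<in> J" "j' \<in> J" using j j' x by auto
  note jm = J_mem[OF jJ(1)] and jm' = J_mem[OF jJ(2)]
  note D0o = Dobj[OF D0] and jo = Dobj[OF jm(1)] and jo' = Dobj[OF jm'(1)]
  interpret G: comm_group "Hom T (fst j) D0" using hom_group[OF jo D0o] .
  have aa: "a j' \<cdot> a0 \<in> hom_set T (fst j) D0" using cmp_in[OF jo jo' D0o a0 k(1)[OF j']] .
  let ?\<delta> = "a j \<otimes>\<^bsub>Hom T (fst j) D0\<^esub> inv\<^bsub>Hom T (fst j) D0\<^esub> (a j' \<cdot> a0)"
  have \<delta>: "?\<delta> \<in> hom_set T (fst j) D0" using k(1)[OF j] aa by simp
  obtain B b w where t: "dtri (fst j) D0 B ?\<delta> b w" using dtri_cone[OF jo D0o \<delta>] .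
  have B: "B \<in> D" using thick_cone[OF D t jm(1) D0] .
  note Bo = Dobj[OF B]
  have b: "b \<in> hom_set T D0 B" using t by (simp add: dtri_def)
  have "fmap F (a j' \<cdot> a0) d = pt j" using af_cmp[OF FA jo jo' D0o a0 k(1)[OF j'] d] k(2)[OF j'] a0p by simp
  then have "fmap F ?\<delta> d = pt j \<otimes>\<^bsub>fobj F (fst j)\<^esub> inv\<^bsub>fobj F (fst j)\<^esub> (pt j)"
    using af_add[OF FA jo D0o k(1)[OF j] G.inv_closed[OF aa] d] af_inv[OF FA jo D0o aa d] k(2)[OF j] by simp
  then have "fmap F ?\<delta> d = \<one>\<^bsub>fobj F (fst j)\<^esub>" using group.r_inv[OF af_group[OF FA jo] jm(2)] by simp
  then obtain d1 where d1: "d1 \<in> carrier (fobj F B)" "d = fmap F b d1"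
    using F t d unfolding Coh_iff by blast
  have "b \<cdot> ?\<delta> = (b \<cdot> a j) \<otimes>\<^bsub>Hom T (fst j) B\<^esub> inv\<^bsub>Hom T (fst j) B\<^esub> (b \<cdot> (a j' \<cdot> a0))"
    using cmp_add_right[OF jo D0o Bo k(1)[OF j] G.inv_closed[OF aa] b] cmp_inv_right[OF jo D0o Bo aa b] by simp
  then have "(b \<cdot> a j) \<otimes>\<^bsub>Hom T (fst j) B\<^esub> inv\<^bsub>Hom T (fst j) B\<^esub> (b \<cdot> (a j' \<cdot> a0)) = zer (fst j) B"
    using dtri_comp_zer[OF t] by simp
  then have eq: "b \<cdot> a j = b \<cdot> (a j' \<cdot> a0)"
    using group.inv_solve_right'[OF hom_grp[OF jo Bo]] cmp_in[OF jo D0o Bo k(1)[OF j] b] cmp_in[OF jo D0o Bo aa b]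
      zer_in[OF jo Bo] monoid.l_one[OF group.is_monoid[OF hom_grp[OF jo Bo]]] by (metis group.inv_equality group.inv_inv group.inv_closed hom_grp[OF jo Bo])
  have "dat x K B d1 (\<lambda>k. b \<cdot> a k) (\<lambda>u. b \<cdot> \<Phi> u)"
    unfolding dat_def
  proof (intro conjI ballI)
    show "(\<lambda>u. b \<cdot> \<Phi> u) \<in> hom (Sm Y) (Hom T Y B)"
      using hom_compose[OF \<Phi>(1) group_hom.homh[OF postcomp_hom[OF Y D0o Bo b]]] by (simp add: comp_def)
    show "b \<cdot> \<Phi> x = zer Y B" using \<Phi>(2) cmp_zer_right[OF Y D0o Bo b] by simp
    fix l assume l: "l \<in> K"
    then have "l \<in> J" using x by blast
    note lo = Dobj[OF J_mem(1)[OF this]]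
    show "b \<cdot> a l \<in> hom_set T (fst l) B" using cmp_in[OF lo D0o Bo k(1)[OF l] b] .
    show "fmap F (b \<cdot> a l) d1 = pt l" using af_cmp[OF FA lo D0o Bo k(1)[OF l] b d1(1)] d1(2) k(2)[OF l] by simp
    fix g assume g: "g \<in> hom_set T Y (fst l)"
    show "b \<cdot> \<Phi> (ij Y l g) = (b \<cdot> a l) \<cdot> g" using k(3)[OF l g] cmp_assoc[OF Y lo D0o Bo g k(1)[OF l] b] by simp
  qed (use x B d1 in auto)
  moreover have "b \<cdot> a j = (b \<cdot> a j') \<cdot> a0" using eq cmp_assoc[OF jo jo' D0o Bo a0 k(1)[OF j'] b] by simp
  ultimately show ?thesis by blast
qed

text \<open>Both indices of the generator are adjoined and its arrow \<open>a0\<close> is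
  coequalised; then the homomorphism takes equal values on the two halves of the generator and kills
  it. The assumption on \<open>g\<close> is phrased so that it covers a generator as well as its
  inverse.\<close>

lemma dat_step:
  assumes dt: "dat x K D0 d a \<Phi>" and j: "j \<in> J" and j': "j' \<in> J" and a0: "a0 \<in> hom_set T (fst j) (fst j')"
    and a0p: "fmap F a0 (pt j') = pt j" and h: "h \<in> hom_set T Y (fst j)"
    and g: "g \<in> carrier (Sm Y)" "{k \<in> J. g k \<noteq> zer Y (fst k)} \<subseteq> {j, j'}"
    and g0: "\<forall>B\<in>obj T. \<forall>\<Psi>\<in>hom (Sm Y) (Hom T Y B). \<Psi> (ij Y j h) = \<Psi> (ij Y j' (a0 \<cdot> h)) \<longrightarrow> \<Psi> g = zer Y B"
  shows "\<exists>K D0 d a \<Phi>. dat (g \<otimes>\<^bsub>Sm Y\<^esub> x) K D0 d a \<Phi>"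
proof -
  obtain D1 d1 a1 \<Phi>1 where "dat x (insert j K) D1 d1 a1 \<Phi>1" using dat_extend[OF dt j] by blast
  then obtain D2 d2 a2 \<Phi>2 where "dat x (insert j' (insert j K)) D2 d2 a2 \<Phi>2" using dat_extend[OF _ j'] by blast
  then obtain B d a \<Phi> where dt: "dat x (insert j' (insert j K)) B d a \<Phi>" and eq: "a j = a j' \<cdot> a0"
    using dat_coequalise[of x "insert j' (insert j K)" D2 d2 a2 \<Phi>2 j j' a0] a0 a0p by blast
  let ?K = "insert j' (insert j K)"
  note c = dt[unfolded dat_def]
  note x = c[THEN conjunct1] c[THEN conjunct2, THEN conjunct1] c[THEN conjunct2, THEN conjunct2, THEN conjunct1]
  note c = c[THEN conjunct2, THEN conjunct2, THEN conjunct2]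
  note B = c[THEN conjunct1] and d = c[THEN conjunct2, THEN conjunct1]
  note c = c[THEN conjunct2, THEN conjunct2]
  note \<Phi> = c[THEN conjunct1] c[THEN conjunct2, THEN conjunct1]
  note c = c[THEN conjunct2, THEN conjunct2, THEN bspec]
  note k = c[THEN conjunct1] c[THEN conjunct2, THEN conjunct2, THEN bspec]
  note jo = Dobj[OF J_mem(1)[OF j]] and jo' = Dobj[OF J_mem(1)[OF j']] and Bo = Dobj[OF B]
  have ah: "a0 \<cdot> h \<in> hom_set T Y (fst j')" using cmp_in[OF Y jo jo' h a0] .
  have "\<Phi> (ij Y j h) = \<Phi> (ij Y j' (a0 \<cdot> h))"
    using k(2)[of j h] k(2)[of j' "a0 \<cdot> h"] h ah eq cmp_assoc[OF Y jo jo' Bo h a0 k(1)[of j']] by simp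
  then have "\<Phi> g = zer Y B" using g0[rule_format, OF Bo \<Phi>(1)] by blast
  then have \<Phi>gx: "\<Phi> (g \<otimes>\<^bsub>Sm Y\<^esub> x) = zer Y B"
    using hom_mult[OF \<Phi>(1) g(1) x(1)] \<Phi>(2) monoid.l_one[OF group.is_monoid[OF hom_grp[OF Y Bo]] zer_in[OF Y Bo]] by simp
  have "(g \<otimes>\<^bsub>Sm Y\<^esub> x) k = zer Y (fst k)" if "k \<in> J" "k \<notin> ?K" for k
  proof -
    have "g k = zer Y (fst k)" "x k = zer Y (fst k)" using that g(2) x(2) by auto
    then show ?thesis
      using that monoid.l_one[OF group.is_monoid[OF hom_grp[OF Y Dobj[OF J_mem(1)[OF that(1)]]]]]
        zer_in[OF Y Dobj[OF J_mem(1)[OF that(1)]]] by (simp add: Sm_def)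
  qed
  then have "{k \<in> J. (g \<otimes>\<^bsub>Sm Y\<^esub> x) k \<noteq> zer Y (fst k)} \<subseteq> ?K" by blast
  then have "dat (g \<otimes>\<^bsub>Sm Y\<^esub> x) ?K B d a \<Phi>"
    using dt \<Phi>gx monoid.m_closed[OF group.is_monoid[OF Sm_group] g(1) x(1)] unfolding dat_def by blast
  then show ?thesis by blast
qed

lemma Sm_inv:
  assumes "x \<in> carrier (Sm Y)" "k \<in> J" shows "(inv\<^bsub>Sm Y\<^esub> x) k = inv\<^bsub>Hom T Y (fst k)\<^esub> (x k)"
proof -
  have "inv\<^bsub>Sm Y\<^esub> x = (\<lambda>i\<in>J. inv\<^bsub>Hom T Y (fst i)\<^esub> (x i))"
    unfolding Sm_def by (rule inv_sum_group) (use assms(1) comm_group.axioms(2)[OF part_cg] in \<open>auto simp: Sm_def\<close>)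
  then show ?thesis using assms(2) by simp
qed

lemma genD:
  assumes "g \<in> gens Y"
  obtains j j' a0 h where "j \<in> J" "j' \<in> J" "a0 \<in> hom_set T (fst j) (fst j')" "fmap F a0 (pt j') = pt j"
    "h \<in> hom_set T Y (fst j)" "g \<in> carrier (Sm Y)"
    "\<forall>k\<in>J. k \<notin> {j, j'} \<longrightarrow> g k = zer Y (fst k)"
    "\<forall>B\<in>obj T. \<forall>\<Psi>\<in>hom (Sm Y) (Hom T Y B). \<Psi> (ij Y j h) = \<Psi> (ij Y j' (a0 \<cdot> h)) \<longrightarrow> \<Psi> g = zer Y B"
proof -
  interpret S: comm_group "Sm Y" by (rule Sm_cg)
  obtain j j' a0 h where g: "g = ij Y j h \<otimes>\<^bsub>Sm Y\<^esub> inv\<^bsub>Sm Y\<^esub> (ij Y j' (a0 \<cdot> h))" and j: "j \<in> J" "j' \<in> J"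
    and a0: "a0 \<in> hom_set T (fst j) (fst j')" "fmap F a0 (pt j') = pt j" and h: "h \<in> hom_set T Y (fst j)"
    using assms by (auto simp: gens_def)
  have ah: "a0 \<cdot> h \<in> hom_set T Y (fst j')" using cmp_in[OF Y Dobj[OF J_mem(1)[OF j(1)]] Dobj[OF J_mem(1)[OF j(2)]] h a0(1)] .
  note u = ij_in[OF j(1) h] and v = ij_in[OF j(2) ah]
  have gk: "g k = zer Y (fst k)" if k: "k \<in> J" "k \<notin> {j, j'}" for k
  proof -
    interpret H: comm_group "Hom T Y (fst k)" using part_cg[OF k(1)] .
    have "g k = ij Y j h k \<otimes>\<^bsub>Hom T Y (fst k)\<^esub> (inv\<^bsub>Sm Y\<^esub> (ij Y j' (a0 \<cdot> h))) k"
      using k(1) unfolding g by (simp add: Sm_def)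
    then show ?thesis unfolding Sm_inv[OF v k(1)] using k by (simp add: ij_def sum_inj_def)
  qed
  have g0: "\<Psi> g = zer Y B" if B: "B \<in> obj T" and \<Psi>: "\<Psi> \<in> hom (Sm Y) (Hom T Y B)"
    and eq: "\<Psi> (ij Y j h) = \<Psi> (ij Y j' (a0 \<cdot> h))" for \<Psi> B
  proof -
    interpret P: group_hom "Sm Y" "Hom T Y B" \<Psi>
      using \<Psi> hom_grp[OF Y B] Sm_group by (simp add: group_hom_def group_hom_axioms_def)
    show ?thesis unfolding g using u v eq by simp
  qed
  have gS: "g \<in> carrier (Sm Y)" using gens_in assms by blast
  show thesis by (rule that[OF j a0 h gS]) (intro ballI impI gk g0; assumption)+
qed

text \<open>The claim is strengthened to a product with any \<open>x\<close> that already carries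
  such data. Factors are then added one at a time, and two independent data never have to be
  merged.\<close>

lemma dat_Nm:
  assumes n: "n \<in> Nm Y" shows "\<exists>K D0 d a \<Phi>. dat n K D0 d a \<Phi>"
proof -
  interpret S: comm_group "Sm Y" by (rule Sm_cg)
  have "dat x K D0 d a \<Phi> \<Longrightarrow> \<exists>K D0 d a \<Phi>. dat (n \<otimes>\<^bsub>Sm Y\<^esub> x) K D0 d a \<Phi>" for x K D0 d a \<Phi>
    using n unfolding Nm_def
  proof (induction arbitrary: x K D0 d a \<Phi> rule: generate.induct)
    case one
    moreover from this have "x \<in> carrier (Sm Y)" by (simp add: dat_def)
    ultimately show ?case using S.l_one by metis
  next
    case (eng n1 n2)
    have n: "n1 \<in> carrier (Sm Y)" "n2 \<in> carrier (Sm Y)"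
      using eng.hyps S.generate_in_carrier[OF gens_in] by auto
    have x: "x \<in> carrier (Sm Y)" using eng.prems by (simp add: dat_def)
    obtain K D0 d a \<Phi> where "dat (n2 \<otimes>\<^bsub>Sm Y\<^esub> x) K D0 d a \<Phi>" using eng.IH(2)[OF eng.prems] by blast
    from eng.IH(1)[OF this] show ?case using S.m_assoc[OF n x] by metis
  next
    case (incl g)
    from genD[OF incl.hyps] obtain j j' a0 h where g: "j \<in> J" "j' \<in> J" "a0 \<in> hom_set T (fst j) (fst j')"
      "fmap F a0 (pt j') = pt j" "h \<in> hom_set T Y (fst j)" "g \<in> carrier (Sm Y)"
      "\<forall>k\<in>J. k \<notin> {j, j'} \<longrightarrow> g k = zer Y (fst k)"
      "\<forall>B\<in>obj T. \<forall>\<Psi>\<in>hom (Sm Y) (Hom T Y B). \<Psi> (ij Y j h) = \<Psi> (ij Y j' (a0 \<cdot> h)) \<longrightarrow> \<Psi> g = zer Y B" .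
    have "{k \<in> J. g k \<noteq> zer Y (fst k)} \<subseteq> {j, j'}" using g(7) by blast
    from dat_step[OF incl.prems g(1-6) this g(8)] show ?case .
  next
    case (inv g)
    from genD[OF inv.hyps] obtain j j' a0 h where g: "j \<in> J" "j' \<in> J" "a0 \<in> hom_set T (fst j) (fst j')"
      "fmap F a0 (pt j') = pt j" "h \<in> hom_set T Y (fst j)" "g \<in> carrier (Sm Y)"
      "\<forall>k\<in>J. k \<notin> {j, j'} \<longrightarrow> g k = zer Y (fst k)"
      "\<forall>B\<in>obj T. \<forall>\<Psi>\<in>hom (Sm Y) (Hom T Y B). \<Psi> (ij Y j h) = \<Psi> (ij Y j' (a0 \<cdot> h)) \<longrightarrow> \<Psi> g = zer Y B" .
    have "(inv\<^bsub>Sm Y\<^esub> g) k = zer Y (fst k)" if k: "k \<in> J" "k \<notin> {j, j'}" for k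
      using g(7)[rule_format, OF k] k(1) Sm_inv[OF g(6) k(1)] monoid.inv_one[OF group.is_monoid[OF comm_group.axioms(2)[OF part_cg[OF k(1)]]]]
      by simp
    then have s: "{k \<in> J. (inv\<^bsub>Sm Y\<^esub> g) k \<noteq> zer Y (fst k)} \<subseteq> {j, j'}" by blast
    have "\<forall>B\<in>obj T. \<forall>\<Psi>\<in>hom (Sm Y) (Hom T Y B). \<Psi> (ij Y j h) = \<Psi> (ij Y j' (a0 \<cdot> h)) \<longrightarrow>
      \<Psi> (inv\<^bsub>Sm Y\<^esub> g) = zer Y B"
    proof (intro ballI impI)
      fix B \<Psi> assume B: "B \<in> obj T" and \<Psi>: "\<Psi> \<in> hom (Sm Y) (Hom T Y B)"
        and eq: "\<Psi> (ij Y j h) = \<Psi> (ij Y j' (a0 \<cdot> h))"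
      interpret P: group_hom "Sm Y" "Hom T Y B" \<Psi>
        using \<Psi> hom_grp[OF Y B] Sm_group by (simp add: group_hom_def group_hom_axioms_def)
      show "\<Psi> (inv\<^bsub>Sm Y\<^esub> g) = zer Y B" using g(6) g(8)[rule_format, OF B \<Psi> eq] by simp
    qed
    from dat_step[OF inv.prems g(1-5) S.inv_closed[OF g(6)] s this] show ?case .
  qed
  moreover obtain N where N: "zero_object T N" using zero_object by blast
  then have ND: "N \<in> D" using thick_zero[OF D] by blast
  have one1: "\<one>\<^bsub>Sm Y\<^esub> k = zer Y (fst k)" if "k \<in> J" for k using that by (simp add: Sm_def)
  \<comment> \<open>The starting point: no indices at all, and a zero object as target.\<close>
  have "dat \<one>\<^bsub>Sm Y\<^esub> {} N \<one>\<^bsub>fobj F N\<^esub> (\<lambda>_. undefined) (\<lambda>_. zer Y N)"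
    unfolding dat_def
    using ND S.one_closed monoid.one_closed[OF group.is_monoid[OF af_group[OF FA Dobj[OF ND]]]]
      zer_in[OF Y Dobj[OF ND]] monoid.l_one[OF group.is_monoid[OF hom_grp[OF Y Dobj[OF ND]]]]
      one1
    by (auto simp: hom_def)
  ultimately have "\<exists>K D0 d a \<Phi>. dat (n \<otimes>\<^bsub>Sm Y\<^esub> \<one>\<^bsub>Sm Y\<^esub>) K D0 d a \<Phi>" by blast
  moreover have "n \<in> carrier (Sm Y)" using subgroup.mem_carrier[OF Nm_subgroup n] .
  ultimately show ?thesis by simp
qed

end

section \<open>Representatives of classes in the colimit\<close>

definition gam where "gam X C f c = cls X (ij X (C, yon C c) f)"
definition res where "res k x = (\<lambda>j\<in>J. x j \<cdot> k)"

lemma gam_hom: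
  assumes "X \<in> obj T" "C \<in> D" "c \<in> carrier (fobj F C)"
  shows "(\<lambda>f. gam X C f c) \<in> hom (Hom T X C) (fobj GQ X)"
  using hom_compose[OF ij_hom[OF assms(1) yon_in(1)[OF assms(2,3)]] cls_hom[OF assms(1)]]
  by (simp add: gam_def comp_def)

lemma gam_closed:
  assumes "X \<in> obj T" "C \<in> D" "f \<in> hom_set T X C" "c \<in> carrier (fobj F C)"
  shows "gam X C f c \<in> carrier (fobj GQ X)"
  using hom_in_carrier[OF gam_hom[OF assms(1,2,4)] assms(3)] .

lemma gam_dinatural:
  assumes X: "X \<in> obj T" and C: "C \<in> D" "C' \<in> D" and f: "f \<in> hom_set T X C" and a: "a \<in> hom_set T C C'"
    and c: "c \<in> carrier (fobj F C')"
  shows "gam X C' (a \<cdot> f) c = gam X C f (fmap F a c)"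
proof -
  have Fc: "fmap F a c \<in> carrier (fobj F C)" using af_closed[OF FA Dobj[OF C(1)] Dobj[OF C(2)] a c] .
  note j = yon_in[OF C(1) Fc] and j' = yon_in[OF C(2) c]
  have af: "a \<cdot> f \<in> hom_set T X C'" using cmp_in[OF X Dobj[OF C(1)] Dobj[OF C(2)] f a] .
  have "ij X (C, yon C (fmap F a c)) f \<otimes>\<^bsub>Sm X\<^esub> inv\<^bsub>Sm X\<^esub> (ij X (C', yon C' c) (a \<cdot> f)) \<in> gens X"
    unfolding gens_def using j j' a f
    by (intro CollectI exI[of _ "(C, yon C (fmap F a c))"] exI[of _ "(C', yon C' c)"] exI[of _ a] exI[of _ f]) simp
  then have "ij X (C, yon C (fmap F a c)) f \<otimes>\<^bsub>Sm X\<^esub> inv\<^bsub>Sm X\<^esub> (ij X (C', yon C' c) (a \<cdot> f)) \<in> Nm X"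
    unfolding Nm_def by (rule generate.incl)
  then show ?thesis
    unfolding gam_def using cls_eq[OF X ij_in[OF X j(1)] ij_in[OF X j'(1)]] f af by simp
qed

lemma gam_sum:
  assumes X: "X \<in> obj T" and C: "C \<in> D" "C' \<in> D" and f: "f \<in> hom_set T X C" "f' \<in> hom_set T X C'"
    and c: "c \<in> carrier (fobj F C)" "c' \<in> carrier (fobj F C')"
  shows "\<exists>P\<in>D. \<exists>i\<in>hom_set T C P. \<exists>j\<in>hom_set T C' P. \<exists>e\<in>carrier (fobj F P). fmap F i e = c \<and> fmap F j e = c' \<and>
    gam X C f c \<otimes>\<^bsub>fobj GQ X\<^esub> gam X C' f' c' = gam X P ((i \<cdot> f) \<otimes>\<^bsub>Hom T X P\<^esub> (j \<cdot> f')) e"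
proof -
  obtain P i j e where P: "P \<in> D" and h: "i \<in> hom_set T C P" "j \<in> hom_set T C' P" and e: "e \<in> carrier (fobj F P)"
    and ie: "fmap F i e = c" "fmap F j e = c'" using point_sum[OF C c] .
  have "i \<cdot> f \<in> hom_set T X P" "j \<cdot> f' \<in> hom_set T X P"
    using cmp_in[OF X Dobj[OF C(1)] Dobj[OF P] f(1) h(1)] cmp_in[OF X Dobj[OF C(2)] Dobj[OF P] f(2) h(2)] by auto
  from hom_mult[OF gam_hom[OF X P e] this]
  have "gam X C f c \<otimes>\<^bsub>fobj GQ X\<^esub> gam X C' f' c' = gam X P ((i \<cdot> f) \<otimes>\<^bsub>Hom T X P\<^esub> (j \<cdot> f')) e"
    using gam_dinatural[OF X C(1) P f(1) h(1) e] gam_dinatural[OF X C(2) P f(2) h(2) e] ie by simp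
  then show ?thesis using P h e ie by blast
qed

text \<open>For the same \<open>f\<close>, the sum of the two classes lives on the object
  \<open>P\<close> over the composite of \<open>f\<close> with the sum of \<open>i\<close> and
  \<open>j\<close>. Pulling the point \<open>e\<close> back along that sum gives the sum of the
  points, so dinaturality finishes the argument.\<close>

lemma gam_hom_point:
  assumes X: "X \<in> obj T" and C: "C \<in> D" and f: "f \<in> hom_set T X C"
  shows "gam X C f \<in> hom (fobj F C) (fobj GQ X)"
proof (rule homI)
  show "gam X C f c \<in> carrier (fobj GQ X)" if "c \<in> carrier (fobj F C)" for c using gam_closed[OF X C f that] .
  fix c c' assume c: "c \<in> carrier (fobj F C)" "c' \<in> carrier (fobj F C)"
  note Co = Dobj[OF C]
  obtain P i j e where P: "P \<in> D" and i: "i \<in> hom_set T C P" and j: "j \<in> hom_set T C P" and e: "e \<in> carrier (fobj F P)"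
    and ie: "fmap F i e = c" "fmap F j e = c'"
    and s: "gam X C f c \<otimes>\<^bsub>fobj GQ X\<^esub> gam X C f c' = gam X P ((i \<cdot> f) \<otimes>\<^bsub>Hom T X P\<^esub> (j \<cdot> f)) e"
    using gam_sum[OF X C C f f c] by blast
  note Po = Dobj[OF P]
  have ijh: "i \<otimes>\<^bsub>Hom T C P\<^esub> j \<in> hom_set T C P" using monoid.m_closed[OF group.is_monoid[OF hom_grp[OF Co Po]] i j] .
  have "gam X P ((i \<otimes>\<^bsub>Hom T C P\<^esub> j) \<cdot> f) e = gam X C f (fmap F (i \<otimes>\<^bsub>Hom T C P\<^esub> j) e)"
    using gam_dinatural[OF X C P f ijh e] .
  then show "gam X C f (c \<otimes>\<^bsub>fobj F C\<^esub> c') = gam X C f c \<otimes>\<^bsub>fobj GQ X\<^esub> gam X C f c'"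
    using s cmp_add_left[OF X Co Po f i j] af_add[OF FA Co Po i j e] ie by simp
qed

text \<open>A sum of classes on different index objects is rewritten by \<open>gam_sum\<close> as
  one class on their biproduct, so finitely many summands collapse to a single
  representative.\<close>

lemma gam_surj:
  assumes X: "X \<in> obj T" and x: "x \<in> carrier (fobj GQ X)"
  shows "\<exists>C\<in>D. \<exists>f\<in>hom_set T X C. \<exists>c\<in>carrier (fobj F C). x = gam X C f c"
proof -
  obtain y where y: "y \<in> carrier (Sm X)" "x = cls X y" using cls_surj[OF X x] by blast
  let ?P = "\<lambda>y. \<exists>C\<in>D. \<exists>f\<in>hom_set T X C. \<exists>c\<in>carrier (fobj F C). cls X y = gam X C f c"
  have "?P y"
  proof (rule sum_group_induct[OF part_cg[OF X] y(1)[unfolded Sm_def] subset_UNIV, where P = ?P])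
    obtain N where N: "zero_object T N" using zero_object by blast
    then have ND: "N \<in> D" using thick_zero[OF D] by blast
    note No = Dobj[OF ND]
    have c: "\<one>\<^bsub>fobj F N\<^esub> \<in> carrier (fobj F N)" using monoid.one_closed[OF group.is_monoid[OF af_group[OF FA No]]] .
    have g: "group (fobj GQ X)" unfolding GQ_obj using normal.factorgroup_is_group[OF Nm_normal[OF X]] .
    have "gam X N (zer X N) \<one>\<^bsub>fobj F N\<^esub> = \<one>\<^bsub>fobj GQ X\<^esub>" using hom_one[OF gam_hom[OF X ND c] hom_grp[OF X No] g] .
    moreover have "cls X \<one>\<^bsub>Sm X\<^esub> = \<one>\<^bsub>fobj GQ X\<^esub>" using hom_one[OF cls_hom[OF X] Sm_group[OF X] g] .
    ultimately show "?P \<one>\<^bsub>sum_group J (\<lambda>j. Hom T X (fst j))\<^esub>"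
      unfolding Sm_def[symmetric] using ND zer_in[OF X No] c by metis
  next
    fix j h y assume j: "j \<in> J" and h: "h \<in> carrier (Hom T X (fst j))"
      and y: "y \<in> carrier (sum_group J (\<lambda>j. Hom T X (fst j)))" and IH: "?P y"
    obtain C f c where C: "C \<in> D" and f: "f \<in> hom_set T X C" and c: "c \<in> carrier (fobj F C)" and yc: "cls X y = gam X C f c"
      using IH by blast
    note jm = J_mem[OF j]
    have cj: "cls X (ij X j h) = gam X (fst j) h (pt j)" unfolding gam_def using jm(3) by simp
    have "cls X (ij X j h \<otimes>\<^bsub>Sm X\<^esub> y) = gam X (fst j) h (pt j) \<otimes>\<^bsub>fobj GQ X\<^esub> gam X C f c"
      using hom_mult[OF cls_hom[OF X] ij_in[OF X j h]] y cj yc by (simp add: Sm_def)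
    moreover obtain P i l e where P: "P \<in> D" and i: "i \<in> hom_set T (fst j) P" and l: "l \<in> hom_set T C P" and e: "e \<in> carrier (fobj F P)"
      and s: "gam X (fst j) h (pt j) \<otimes>\<^bsub>fobj GQ X\<^esub> gam X C f c = gam X P ((i \<cdot> h) \<otimes>\<^bsub>Hom T X P\<^esub> (l \<cdot> f)) e"
      using gam_sum[OF X jm(1) C h f jm(2) c] by blast
    moreover have "(i \<cdot> h) \<otimes>\<^bsub>Hom T X P\<^esub> (l \<cdot> f) \<in> hom_set T X P"
      using cmp_in[OF X Dobj[OF jm(1)] Dobj[OF P] h i] cmp_in[OF X Dobj[OF C] Dobj[OF P] f l]
        monoid.m_closed[OF group.is_monoid[OF hom_grp[OF X Dobj[OF P]]]] by blast
    ultimately show "?P (sum_inj J (\<lambda>j. Hom T X (fst j)) j h \<otimes>\<^bsub>sum_group J (\<lambda>j. Hom T X (fst j))\<^esub> y)"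
      unfolding Sm_def[symmetric] ij_def[symmetric] using e by metis
  qed
  then show ?thesis using y(2) by simp
qed

text \<open>The representative lies in the subgroup of relations and therefore carries data by
  \<open>dat_Nm\<close>. After its own index is adjoined, the arrow belonging to that index is the
  required map, and the common point is the required \<open>b\<close>.\<close>

lemma gam_zero:
  assumes X: "X \<in> obj T" and C: "C \<in> D" and f: "f \<in> hom_set T X C" and c: "c \<in> carrier (fobj F C)"
    and z: "gam X C f c = \<one>\<^bsub>fobj GQ X\<^esub>"
  shows "\<exists>B\<in>D. \<exists>a\<in>hom_set T C B. \<exists>b\<in>carrier (fobj F B). a \<cdot> f = zer X B \<and> c = fmap F a b"
proof -
  let ?j = "(C, yon C c)"
  note j = yon_in[OF C c]
  have "ij X ?j f \<in> carrier (Sm X)" using ij_in[OF X j(1)] f by simp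
  then have "ij X ?j f \<in> Nm X" using cls_one[OF X] z unfolding gam_def by blast
  then obtain K D0 d a \<Phi> where "dat X (ij X ?j f) K D0 d a \<Phi>" using dat_Nm[OF X] by blast
  then obtain D1 d1 a1 \<Phi>1 where dt: "dat X (ij X ?j f) (insert ?j K) D1 d1 a1 \<Phi>1" using dat_extend[OF X _ j(1)] by blast
  note c = dt[unfolded dat_def[OF X]]
  note c = c[THEN conjunct2, THEN conjunct2, THEN conjunct2]
  note D1 = c[THEN conjunct1] and d1 = c[THEN conjunct2, THEN conjunct1]
  note c = c[THEN conjunct2, THEN conjunct2, THEN conjunct2]
  note z1 = c[THEN conjunct1]
  note k = c[THEN conjunct2, THEN bspec, OF insertI1]
  have "a1 ?j \<in> hom_set T C D1" using k by simp
  moreover have "c = fmap F (a1 ?j) d1" using k j(2) by simp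
  moreover have "a1 ?j \<cdot> f = zer X D1" using k z1 f by simp
  ultimately show ?thesis using D1 d1 by blast
qed

lemma res_hom:
  assumes o: "X \<in> obj T" "Y \<in> obj T" and k: "k \<in> hom_set T X Y"
  shows "res k \<in> hom (Sm Y) (Sm X)"
proof (rule homI)
  note jo = Dobj[OF J_mem(1)]
  have car: "x \<in> carrier (Sm Z) \<longleftrightarrow> x \<in> (\<Pi>\<^sub>E j\<in>J. hom_set T Z (fst j)) \<and> finite {j \<in> J. x j \<noteq> zer Z (fst j)}"
    if "Z \<in> obj T" for Z x
    unfolding Sm_def by (subst sum_carrier[OF part_cg[OF that]]) auto
  fix x assume x: "x \<in> carrier (Sm Y)"
  have m: "z j \<in> hom_set T Y (fst j)" if "z \<in> carrier (Sm Y)" "j \<in> J" for z j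
    using that unfolding car[OF o(2)] by (auto simp: PiE_iff)
  have "{j \<in> J. res k x j \<noteq> zer X (fst j)} \<subseteq> {j \<in> J. x j \<noteq> zer Y (fst j)}"
    using cmp_zer_left[OF o jo k] by (auto simp: res_def)
  moreover have "finite {j \<in> J. x j \<noteq> zer Y (fst j)}" using x car[OF o(2)] by blast
  ultimately have "finite {j \<in> J. res k x j \<noteq> zer X (fst j)}" by (rule finite_subset)
  moreover have "res k x \<in> (\<Pi>\<^sub>E j\<in>J. hom_set T X (fst j))"
    using cmp_in[OF o jo k] m[OF x] by (auto simp: res_def)
  ultimately show "res k x \<in> carrier (Sm X)" unfolding car[OF o(1)] by blast
  fix y assume y: "y \<in> carrier (Sm Y)"
  show "res k (x \<otimes>\<^bsub>Sm Y\<^esub> y) = res k x \<otimes>\<^bsub>Sm X\<^esub> res k y"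
    unfolding Sm_def mult_sum_group res_def
    using cmp_add_left[OF o jo k] m[OF x] m[OF y] by (auto intro!: restrict_ext)
qed

lemma res_ij:
  assumes o: "X \<in> obj T" "Y \<in> obj T" and k: "k \<in> hom_set T X Y"
  shows "res k (ij Y j h) = ij X j (h \<cdot> k)"
  using cmp_zer_left[OF o Dobj[OF J_mem(1)] k] unfolding res_def ij_def sum_inj_def by (auto intro!: restrict_ext)

lemma res_Nm:
  assumes o: "X \<in> obj T" "Y \<in> obj T" and k: "k \<in> hom_set T X Y" and n: "n \<in> Nm Y"
  shows "res k n \<in> Nm X"
proof -
  interpret r: group_hom "Sm Y" "Sm X" "res k"
    using res_hom[OF o k] Sm_group o by (simp add: group_hom_def group_hom_axioms_def)
  note sub = Nm_subgroup[OF o(1)]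
  have gen: "res k g \<in> Nm X" if g: "g \<in> gens Y" for g
  proof -
    obtain j j' a h where g: "g = ij Y j h \<otimes>\<^bsub>Sm Y\<^esub> inv\<^bsub>Sm Y\<^esub> (ij Y j' (a \<cdot> h))" and j: "j \<in> J" "j' \<in> J"
      and a: "a \<in> hom_set T (fst j) (fst j')" "fmap F a (pt j') = pt j" and h: "h \<in> hom_set T Y (fst j)"
      using g by (auto simp: gens_def)
    note jo = Dobj[OF J_mem(1)[OF j(1)]] Dobj[OF J_mem(1)[OF j(2)]]
    have ah: "a \<cdot> h \<in> hom_set T Y (fst j')" using cmp_in[OF o(2) jo h a(1)] .
    have "res k g = ij X j (h \<cdot> k) \<otimes>\<^bsub>Sm X\<^esub> inv\<^bsub>Sm X\<^esub> (ij X j' (a \<cdot> (h \<cdot> k)))"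
      unfolding g using ij_in[OF o(2) j(1) h] ij_in[OF o(2) j(2) ah] res_ij[OF o k] cmp_assoc[OF o jo k h a(1)] by simp
    moreover have "h \<cdot> k \<in> hom_set T X (fst j)" using cmp_in[OF o jo(1) k h] .
    ultimately have "res k g \<in> gens X" using j a unfolding gens_def by blast
    then show ?thesis unfolding Nm_def by (rule generate.incl)
  qed
  show ?thesis
    using n unfolding Nm_def[of Y]
  proof (induction rule: generate.induct)
    case one then show ?case using subgroup.one_closed[OF sub] r.hom_one by metis
  next
    case (incl g) then show ?case using gen by blast
  next
    case (inv g)
    have "g \<in> carrier (Sm Y)" using inv gens_in[OF o(2)] by blast
    then show ?case using gen[OF inv] subgroup.m_inv_closed[OF sub] r.hom_inv by metis
  next
    case (eng n m)
    have "n \<in> carrier (Sm Y)" "m \<in> carrier (Sm Y)"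
      using eng group.generate_in_carrier[OF Sm_group[OF o(2)] gens_in[OF o(2)]] by auto
    then show ?case using eng subgroup.m_closed[OF sub] r.hom_mult by metis
  qed
qed

lemma GQ_map_cls:
  assumes o: "X \<in> obj T" "Y \<in> obj T" and k: "k \<in> hom_set T X Y" and x: "x \<in> carrier (Sm Y)"
  shows "fmap GQ k (cls Y x) = cls X (res k x)"
proof -
  interpret r: group_hom "Sm Y" "Sm X" "res k"
    using res_hom[OF o k] Sm_group o by (simp add: group_hom_def group_hom_axioms_def)
  interpret c: group_hom "Sm X" "fobj GQ X" "cls X"
    using cls_hom[OF o(1)] Sm_group[OF o(1)] normal.factorgroup_is_group[OF Nm_normal[OF o(1)]]
    by (simp add: group_hom_def group_hom_axioms_def GQ_obj)
  have "cls X (res k c) = cls X (res k x)" if c: "c \<in> cls Y x" for c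
  proof -
    obtain n where n: "n \<in> Nm Y" "c = n \<otimes>\<^bsub>Sm Y\<^esub> x" using c by (auto simp: cls_def r_coset_def)
    have nc: "n \<in> carrier (Sm Y)" using subgroup.mem_carrier[OF Nm_subgroup[OF o(2)] n(1)] .
    have "cls X (res k n) = \<one>\<^bsub>fobj GQ X\<^esub>" using cls_Nm[OF o(1) res_Nm[OF o k n(1)]] .
    then show ?thesis using n(2) nc x by simp
  qed
  then show ?thesis
    using cls_self[OF o(2) x] unfolding GQ_map[OF o k] res_def[symmetric] by blast
qed

lemma gam_natural:
  assumes o: "X \<in> obj T" "Y \<in> obj T" and k: "k \<in> hom_set T X Y" and C: "C \<in> D" and f: "f \<in> hom_set T Y C"
    and c: "c \<in> carrier (fobj F C)"
  shows "fmap GQ k (gam Y C f c) = gam X C (f \<cdot> k) c"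
proof -
  have "ij Y (C, yon C c) f \<in> carrier (Sm Y)" using ij_in[OF o(2) yon_in(1)[OF C c]] f by simp
  then show ?thesis unfolding gam_def using GQ_map_cls[OF o k] res_ij[OF o k] by simp
qed

lemma GQ_is_Gamma: "is_Gamma D F GQ gam"
proof -
  have A: "additive_functor T GQ"
  proof (rule additive_functorI)
    fix X assume X: "X \<in> obj T"
    show "comm_group (fobj GQ X)" unfolding GQ_obj using comm_group.abelian_FactGroup[OF Sm_cg[OF X] Nm_subgroup[OF X]] .
  next
    fix X Y k assume o: "X \<in> obj T" "Y \<in> obj T" "k \<in> hom_set T X Y"
    show "fmap GQ k \<in> hom (fobj GQ Y) (fobj GQ X)"
    proof (rule homI)
      fix x assume "x \<in> carrier (fobj GQ Y)"
      then obtain y where y: "y \<in> carrier (Sm Y)" "x = cls Y y" using cls_surj[OF o(2)] by blast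
      have ry: "res k y \<in> carrier (Sm X)" using hom_in_carrier[OF res_hom[OF o] y(1)] .
      show "fmap GQ k x \<in> carrier (fobj GQ X)"
        using GQ_map_cls[OF o y(1)] y(2) hom_in_carrier[OF cls_hom[OF o(1)] ry] by simp
      fix x' assume "x' \<in> carrier (fobj GQ Y)"
      then obtain y' where y': "y' \<in> carrier (Sm Y)" "x' = cls Y y'" using cls_surj[OF o(2)] by blast
      have ry': "res k y' \<in> carrier (Sm X)" using hom_in_carrier[OF res_hom[OF o] y'(1)] .
      have yy: "y \<otimes>\<^bsub>Sm Y\<^esub> y' \<in> carrier (Sm Y)" using monoid.m_closed[OF group.is_monoid[OF Sm_group[OF o(2)]] y(1) y'(1)] .
      show "fmap GQ k (x \<otimes>\<^bsub>fobj GQ Y\<^esub> x') = fmap GQ k x \<otimes>\<^bsub>fobj GQ X\<^esub> fmap GQ k x'"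
        using GQ_map_cls[OF o yy] GQ_map_cls[OF o y(1)] GQ_map_cls[OF o y'(1)] y(2) y'(2)
          hom_mult[OF cls_hom[OF o(2)] y(1) y'(1)] hom_mult[OF cls_hom[OF o(1)] ry ry'] hom_mult[OF res_hom[OF o] y(1) y'(1)]
        by simp
    qed
  next
    fix X x assume X: "X \<in> obj T" and "x \<in> carrier (fobj GQ X)"
    then obtain C f c where c: "C \<in> D" "f \<in> hom_set T X C" "c \<in> carrier (fobj F C)" "x = gam X C f c" using gam_surj by blast
    then show "fmap GQ (idn T X) x = x"
      using gam_natural[OF X X idn_in[OF X] c(1,2,3)] idn_right[OF X Dobj[OF c(1)] c(2)] by simp
  next
    fix X Y Z k l x assume o: "X \<in> obj T" "Y \<in> obj T" "Z \<in> obj T" and k: "k \<in> hom_set T X Y" and l: "l \<in> hom_set T Y Z"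
      and x: "x \<in> carrier (fobj GQ Z)"
    obtain C f c where c: "C \<in> D" "f \<in> hom_set T Z C" "c \<in> carrier (fobj F C)" "x = gam Z C f c" using gam_surj[OF o(3) x] by blast
    note Co = Dobj[OF c(1)]
    show "fmap GQ (l \<cdot> k) x = fmap GQ k (fmap GQ l x)"
      using c(4) gam_natural[OF o(1,3) cmp_in[OF o k l] c(1,2,3)] gam_natural[OF o(2,3) l c(1,2,3)]
        gam_natural[OF o(1,2) k c(1) cmp_in[OF o(2,3) Co l c(2)] c(3)] cmp_assoc[OF o Co k l c(2)] by simp
  next
    fix X Y k l x assume o: "X \<in> obj T" "Y \<in> obj T" and k: "k \<in> hom_set T X Y" and l: "l \<in> hom_set T X Y"
      and x: "x \<in> carrier (fobj GQ Y)"
    obtain C f c where c: "C \<in> D" "f \<in> hom_set T Y C" "c \<in> carrier (fobj F C)" "x = gam Y C f c" using gam_surj[OF o(2) x] by blast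
    note Co = Dobj[OF c(1)]
    have kl: "k \<otimes>\<^bsub>Hom T X Y\<^esub> l \<in> hom_set T X Y" using monoid.m_closed[OF group.is_monoid[OF hom_grp[OF o]] k l] .
    show "fmap GQ (k \<otimes>\<^bsub>Hom T X Y\<^esub> l) x = fmap GQ k x \<otimes>\<^bsub>fobj GQ X\<^esub> fmap GQ l x"
      using c(4) gam_natural[OF o kl c(1-3)] gam_natural[OF o k c(1-3)] gam_natural[OF o l c(1-3)]
        cmp_add_right[OF o Co k l c(2)]
        hom_mult[OF gam_hom[OF o(1) c(1,3)] cmp_in[OF o Co k c(2)] cmp_in[OF o Co l c(2)]] by simp
  qed
  show ?thesis
    unfolding is_Gamma_def using A gam_hom gam_hom_point gam_dinatural gam_natural gam_surj gam_zero
    by (intro conjI ballI impI) simp_all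
qed

section \<open>Consequences of the description by representatives\<close>

lemma
  fixes G :: "('o, 'm, 'b) presheaf"
  assumes g: "is_Gamma D F G \<gamma>" and X: "X \<in> obj T"
  shows Gamma_hom: "\<lbrakk>C \<in> D; c \<in> carrier (fobj F C)\<rbrakk> \<Longrightarrow> (\<lambda>f. \<gamma> X C f c) \<in> hom (Hom T X C) (fobj G X)"
    and Gamma_hom_point: "\<lbrakk>C \<in> D; f \<in> hom_set T X C\<rbrakk> \<Longrightarrow> \<gamma> X C f \<in> hom (fobj F C) (fobj G X)"
    and Gamma_dinatural: "\<lbrakk>C \<in> D; C' \<in> D; f \<in> hom_set T X C; a \<in> hom_set T C C'; c \<in> carrier (fobj F C')\<rbrakk>
      \<Longrightarrow> \<gamma> X C' (a \<cdot> f) c = \<gamma> X C f (fmap F a c)"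
    and Gamma_natural: "\<lbrakk>Y \<in> obj T; k \<in> hom_set T X Y; C \<in> D; f \<in> hom_set T Y C; c \<in> carrier (fobj F C)\<rbrakk>
      \<Longrightarrow> fmap G k (\<gamma> Y C f c) = \<gamma> X C (f \<cdot> k) c"
    and Gamma_surj: "x \<in> carrier (fobj G X) \<Longrightarrow> \<exists>C\<in>D. \<exists>f\<in>hom_set T X C. \<exists>c\<in>carrier (fobj F C). x = \<gamma> X C f c"
    and Gamma_zero: "\<lbrakk>C \<in> D; f \<in> hom_set T X C; c \<in> carrier (fobj F C); \<gamma> X C f c = \<one>\<^bsub>fobj G X\<^esub>\<rbrakk>
      \<Longrightarrow> \<exists>B\<in>D. \<exists>a\<in>hom_set T C B. \<exists>b\<in>carrier (fobj F B). a \<cdot> f = zer X B \<and> c = fmap F a b"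
  using g X by (simp_all add: is_Gamma_def)

lemma Gamma_additive: "is_Gamma D F G \<gamma> \<Longrightarrow> additive_functor T G"
  by (simp add: is_Gamma_def)

text \<open>If a class vanishes along \<open>u\<close>, its representative composed with
  \<open>u\<close> becomes zero after a map \<open>a\<close> inside \<open>D\<close>. The composite
  of \<open>a\<close> and \<open>f\<close> then factors over \<open>v\<close>, while dinaturality
  says that this composite represents the same class.\<close>

lemma Gamma_Coh:
  fixes G :: "('o, 'm, 'b) presheaf"
  assumes g: "is_Gamma D F G \<gamma>" shows "G \<in> Coh T"
  unfolding Coh_iff
proof (intro conjI allI impI ballI)
  show "additive_functor T G" using Gamma_additive[OF g] .
  fix X Y Z u v w y assume d: "dtri X Y Z u v w" and y: "y \<in> carrier (fobj G Y)" and uy: "fmap G u y = \<one>\<^bsub>fobj G X\<^esub>"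
  have o: "X \<in> obj T" "Y \<in> obj T" "Z \<in> obj T" and u: "u \<in> hom_set T X Y" and v: "v \<in> hom_set T Y Z"
    using d unfolding dtri_def by auto
  obtain C f c where C: "C \<in> D" and f: "f \<in> hom_set T Y C" and c: "c \<in> carrier (fobj F C)" and yc: "y = \<gamma> Y C f c"
    using Gamma_surj[OF g o(2) y] by blast
  note Co = Dobj[OF C]
  have fu: "f \<cdot> u \<in> hom_set T X C" using cmp_in[OF o(1,2) Co u f] .
  have "\<gamma> X C (f \<cdot> u) c = \<one>\<^bsub>fobj G X\<^esub>" using uy yc Gamma_natural[OF g o(1,2) u C f c] by simp
  then obtain B a b where B: "B \<in> D" and a: "a \<in> hom_set T C B" and b: "b \<in> carrier (fobj F B)"
    and z: "a \<cdot> (f \<cdot> u) = zer X B" and cb: "c = fmap F a b"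
    using Gamma_zero[OF g o(1) C fu c] by blast
  note Bo = Dobj[OF B]
  have af: "a \<cdot> f \<in> hom_set T Y B" using cmp_in[OF o(2) Co Bo f a] .
  have "(a \<cdot> f) \<cdot> u = zer X B" using z cmp_assoc[OF o(1,2) Co Bo u f a] by simp
  then obtain h where h: "h \<in> hom_set T Z B" "a \<cdot> f = h \<cdot> v" using weak_cokernel[OF d Bo af] by blast
  have "y = fmap G v (\<gamma> Z B h b)"
    using yc cb Gamma_dinatural[OF g o(2) C B f a b] h Gamma_natural[OF g o(2,3) v B h(1) b] by simp
  moreover have "\<gamma> Z B h b \<in> carrier (fobj G Z)" using hom_in_carrier[OF Gamma_hom_point[OF g o(3) B h(1)] b] .
  ultimately show "\<exists>z\<in>carrier (fobj G Z). y = fmap G v z" by blast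
qed

text \<open>The target of a representative may be replaced by an isomorphic object from a small set,
  which remains in \<open>D\<close> since \<open>D\<close> is closed under retracts. Then only a
  small set of triples of object, morphism and point is left.\<close>

lemma GQ_small:
  assumes inf: "infinite (UNIV :: 'a set)" and small: "essentially_small (UNIV :: 'a set) T" and X: "X \<in> obj T"
  shows "carrier (fobj GQ X) \<lesssim> (UNIV :: 'a set)"
proof -
  obtain S0 where S0: "S0 \<subseteq> obj T" "S0 \<lesssim> (UNIV :: 'a set)" "\<And>X. X \<in> obj T \<Longrightarrow> \<exists>Y\<in>S0. isos T X Y \<noteq> {}"
    using small unfolding essentially_small_def by blast
  have hs: "hom_set T X C \<lesssim> (UNIV :: 'a set)" if "C \<in> obj T" for C
    using small X that unfolding essentially_small_def by blast
  obtain g :: "'o \<Rightarrow> 'a" where g: "inj_on g S0" using S0(2) by (auto simp: lepoll_def)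
  have "\<exists>e :: 'm \<Rightarrow> 'a. inj_on e (hom_set T X C)" if "C \<in> obj T" for C
    using hs[OF that] by (auto simp: lepoll_def)
  then obtain e :: "'o \<Rightarrow> 'm \<Rightarrow> 'a" where e: "\<And>C. C \<in> obj T \<Longrightarrow> inj_on (e C) (hom_set T X C)" by metis
  let ?\<Sigma> = "SIGMA C:S0. hom_set T X C \<times> (UNIV :: 'a set)"
  have inj: "inj_on (\<lambda>(C, f, c). (g C, e C f, c)) ?\<Sigma>"
  proof (rule inj_onI)
    fix x y assume xy: "x \<in> ?\<Sigma>" "y \<in> ?\<Sigma>" and eq: "(\<lambda>(C, f, c). (g C, e C f, c)) x = (\<lambda>(C, f, c). (g C, e C f, c)) y"
    obtain C f c where x: "x = (C, f, c)" "C \<in> S0" "f \<in> hom_set T X C" using xy(1) by auto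
    obtain C' f' c' where y: "y = (C', f', c')" "C' \<in> S0" "f' \<in> hom_set T X C'" using xy(2) by auto
    have "C = C'" using inj_onD[OF g _ x(2) y(2)] eq x y by simp
    moreover from this have "f = f'" using inj_onD[OF e[of C] _ x(3)] y(3) eq x y S0(1) by auto
    ultimately show "x = y" using eq x y by simp
  qed
  have sq: "(UNIV :: ('a \<times> 'a) set) \<lesssim> (UNIV :: 'a set)"
    using card_of_Times_same_infinite[OF inf] eqpoll_imp_lepoll unfolding eqpoll_iff_card_of_ordIso[symmetric] by force
  have "(UNIV :: ('a \<times> 'a \<times> 'a) set) \<lesssim> (UNIV :: ('a \<times> 'a) set)"
    using times_lepoll_mono[OF lepoll_refl[of "UNIV :: 'a set"] sq] by simp
  from lepoll_trans[OF this sq] have cube: "(UNIV :: ('a \<times> 'a \<times> 'a) set) \<lesssim> (UNIV :: 'a set)" .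
  have "?\<Sigma> \<lesssim> (UNIV :: ('a \<times> 'a \<times> 'a) set)" using inj unfolding lepoll_def by blast
  from lepoll_trans[OF this cube] have \<Sigma>: "?\<Sigma> \<lesssim> (UNIV :: 'a set)" .
  have "carrier (fobj GQ X) \<subseteq> (\<lambda>(C, f, c). gam X C f c) ` ?\<Sigma>"
  proof
    fix x assume "x \<in> carrier (fobj GQ X)"
    then obtain C f c where C: "C \<in> D" and f: "f \<in> hom_set T X C" and c: "c \<in> carrier (fobj F C)" and x: "x = gam X C f c"
      using gam_surj[OF X] by blast
    note Co = Dobj[OF C]
    obtain C0 a where C0: "C0 \<in> S0" "a \<in> isos T C C0" using S0(3)[OF Co] by blast
    then obtain b where a: "a \<in> hom_set T C C0" and b: "b \<in> hom_set T C0 C" "b \<cdot> a = idn T C" "a \<cdot> b = idn T C0"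
      by (auto simp: isos_def)
    have C0o: "C0 \<in> obj T" using C0 S0(1) by blast
    have C0D: "C0 \<in> D" using thick_retract[OF D C C0o b(1) a b(3)] .
    have bc: "fmap F b c \<in> carrier (fobj F C0)" using af_closed[OF FA C0o Co b(1) c] .
    have "fmap F a (fmap F b c) = c" using af_cmp[OF FA Co C0o Co a b(1) c] b(2) af_idn[OF FA Co c] by simp
    then have "x = gam X C0 (a \<cdot> f) (fmap F b c)" using gam_dinatural[OF X C C0D f a bc] x by simp
    moreover have "a \<cdot> f \<in> hom_set T X C0" using cmp_in[OF X Co C0o f a] .
    ultimately show "x \<in> (\<lambda>(C, f, c). gam X C f c) ` ?\<Sigma>" using C0(1) by force
  qed
  then show ?thesis by (rule lepoll_trans[OF subset_image_lepoll \<Sigma>])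
qed

lemma GammaD_exists:
  assumes inf: "infinite (UNIV :: 'a set)" and small: "essentially_small (UNIV :: 'a set) T"
  shows "\<exists>\<gamma>. is_Gamma D F (GammaD D F) \<gamma>"
proof -
  let ?G = "GammaD D F"
  note Q = GQ_is_Gamma
  note QA = Gamma_additive[OF Q]
  have L: "?G = to_universe T GQ" by (simp add: GammaD_def upper_star_def lower_star_id)
  obtain e where Lg: "\<And>X. X \<in> obj T \<Longrightarrow> comm_group (fobj ?G X)"
    and e: "\<And>X. X \<in> obj T \<Longrightarrow> e X \<in> iso (fobj GQ X) (fobj ?G X)"
    and nat: "\<And>X Y f x. \<lbrakk>X \<in> obj T; Y \<in> obj T; f \<in> hom_set T X Y; x \<in> carrier (fobj GQ Y)\<rbrakk>
      \<Longrightarrow> fmap ?G f (e Y x) = e X (fmap GQ f x)"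
    unfolding L using to_universe_iso[OF QA GQ_small[OF inf small]] by metis
  have eh: "e X \<in> hom (fobj GQ X) (fobj ?G X)" if "X \<in> obj T" for X using e[OF that] by (simp add: iso_def)
  have e1: "x = \<one>\<^bsub>fobj GQ X\<^esub>" if "X \<in> obj T" "x \<in> carrier (fobj GQ X)" "e X x = \<one>\<^bsub>fobj ?G X\<^esub>" for X x
  proof -
    have "e X \<one>\<^bsub>fobj GQ X\<^esub> = \<one>\<^bsub>fobj ?G X\<^esub>"
      using hom_one[OF eh[OF that(1)] af_group[OF QA that(1)] comm_group.axioms(2)[OF Lg[OF that(1)]]] .
    moreover have "inj_on (e X) (carrier (fobj GQ X))" using e[OF that(1)] by (simp add: iso_def bij_betw_def)
    ultimately show ?thesis
      using that monoid.one_closed[OF group.is_monoid[OF af_group[OF QA that(1)]]] by (metis inj_onD)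
  qed
  have GC: "?G \<in> Coh T" by (rule Coh_iso[OF Gamma_Coh[OF Q], where e = e]) (rule Lg e nat; assumption)+
  have "is_Gamma D F ?G (\<lambda>X C f c. e X (gam X C f c))"
    unfolding is_Gamma_def
  proof (intro conjI ballI impI)
    show "additive_functor T ?G" using Coh_additive[OF GC] .
  next
    fix X C c assume "X \<in> obj T" "C \<in> D" "c \<in> carrier (fobj F C)"
    then show "(\<lambda>f. e X (gam X C f c)) \<in> hom (Hom T X C) (fobj ?G X)"
      using hom_compose[OF gam_hom eh] by (simp add: comp_def)
  next
    fix X C f assume "X \<in> obj T" "C \<in> D" "f \<in> hom_set T X C"
    then show "(\<lambda>c. e X (gam X C f c)) \<in> hom (fobj F C) (fobj ?G X)"
      using hom_compose[OF gam_hom_point eh] by (simp add: comp_def)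
  next
    fix X C C' f a c assume "X \<in> obj T" "C \<in> D" "C' \<in> D" "f \<in> hom_set T X C" "a \<in> hom_set T C C'" "c \<in> carrier (fobj F C')"
    then show "e X (gam X C' (a \<cdot> f) c) = e X (gam X C f (fmap F a c))" using gam_dinatural by simp
  next
    fix X Y k C f c assume a: "X \<in> obj T" "Y \<in> obj T" "k \<in> hom_set T X Y" "C \<in> D" "f \<in> hom_set T Y C" "c \<in> carrier (fobj F C)"
    show "fmap ?G k (e Y (gam Y C f c)) = e X (gam X C (f \<cdot> k) c)"
      using nat[OF a(1-3) gam_closed[OF a(2,4,5,6)]] gam_natural[OF a] by simp
  next
    fix X x assume X: "X \<in> obj T" and x: "x \<in> carrier (fobj ?G X)"
    obtain z where z: "z \<in> carrier (fobj GQ X)" "x = e X z" using iso_surjE[OF e[OF X] x] .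
    then show "\<exists>C\<in>D. \<exists>f\<in>hom_set T X C. \<exists>c\<in>carrier (fobj F C). x = e X (gam X C f c)" using gam_surj[OF X z(1)] by blast
  next
    fix X C f c assume a: "X \<in> obj T" "C \<in> D" "f \<in> hom_set T X C" "c \<in> carrier (fobj F C)" "e X (gam X C f c) = \<one>\<^bsub>fobj ?G X\<^esub>"
    show "\<exists>B\<in>D. \<exists>b\<in>hom_set T C B. \<exists>d\<in>carrier (fobj F B). b \<cdot> f = zer X B \<and> c = fmap F b d"
      using gam_zero[OF a(1-4) e1[OF a(1) gam_closed[OF a(1-4)] a(5)]] .
  qed
  then show ?thesis by blast
qed

end

end

section \<open>Maps between the functors \<open>i\<^sup>*i\<^sub>*F\<close>\<close>

context triangulated_category
begin

text \<open>The universal property of the colimit, from the clauses of \<open>is_Gamma\<close>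
  alone. If a class vanishes, an arrow of \<open>D\<close> turns its morphism into zero, and
  dinaturality of \<open>\<theta>\<close> gives value zero; hence values depend only on
  classes.\<close>

lemma Gamma_lift:
  fixes F :: "('o, 'm, 'a) presheaf" and G :: "('o, 'm, 'b) presheaf" and H :: "('o, 'm, 'c) presheaf"
  assumes D: "thick D" and F: "F \<in> Coh T" and g: "is_Gamma D F G \<gamma>" and H: "additive_functor T H"
    and hom: "\<And>X C c. \<lbrakk>X \<in> obj T; C \<in> D; c \<in> carrier (fobj F C)\<rbrakk> \<Longrightarrow> (\<lambda>f. \<theta> X C f c) \<in> hom (Hom T X C) (fobj H X)"
    and dinat: "\<And>X C C' f a c. \<lbrakk>X \<in> obj T; C \<in> D; C' \<in> D; f \<in> hom_set T X C; a \<in> hom_set T C C';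
      c \<in> carrier (fobj F C')\<rbrakk> \<Longrightarrow> \<theta> X C' (a \<cdot> f) c = \<theta> X C f (fmap F a c)"
    and nat: "\<And>X Y k C f c. \<lbrakk>X \<in> obj T; Y \<in> obj T; k \<in> hom_set T X Y; C \<in> D; f \<in> hom_set T Y C;
      c \<in> carrier (fobj F C)\<rbrakk> \<Longrightarrow> fmap H k (\<theta> Y C f c) = \<theta> X C (f \<cdot> k) c"
  shows "\<exists>\<beta>\<in>nat_trans T G H. \<forall>X\<in>obj T. \<forall>C\<in>D. \<forall>f\<in>hom_set T X C. \<forall>c\<in>carrier (fobj F C).
    \<beta> X (\<gamma> X C f c) = \<theta> X C f c"
proof -
  note Do = thick_obj[OF D]
  note GA = Gamma_additive[OF D F g]
  have \<gamma>h: "group_hom (Hom T X C) (fobj G X) (\<lambda>f. \<gamma> X C f c)" if "X \<in> obj T" "C \<in> D" "c \<in> carrier (fobj F C)" for X C c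
    using hom_grp[OF that(1) Do[OF that(2)]] af_group[OF GA that(1)] Gamma_hom[OF D F g that]
    by (simp add: group_hom_def group_hom_axioms_def)
  have \<theta>h: "group_hom (Hom T X C) (fobj H X) (\<lambda>f. \<theta> X C f c)" if "X \<in> obj T" "C \<in> D" "c \<in> carrier (fobj F C)" for X C c
    using hom_grp[OF that(1) Do[OF that(2)]] af_group[OF H that(1)] hom[OF that]
    by (simp add: group_hom_def group_hom_axioms_def)
  have zero: "\<theta> X C f c = \<one>\<^bsub>fobj H X\<^esub>"
    if X: "X \<in> obj T" and C: "C \<in> D" and f: "f \<in> hom_set T X C" and c: "c \<in> carrier (fobj F C)"
      and z: "\<gamma> X C f c = \<one>\<^bsub>fobj G X\<^esub>" for X C f c
  proof -
    obtain B a b where B: "B \<in> D" and a: "a \<in> hom_set T C B" and b: "b \<in> carrier (fobj F B)"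
      and af: "a \<cdot> f = zer X B" and cb: "c = fmap F a b"
      using Gamma_zero[OF D F g X C f c z] by blast
    have "\<theta> X C f c = \<theta> X B (zer X B) b" using dinat[OF X C B f a b] cb af by simp
    then show ?thesis using group_hom.hom_one[OF \<theta>h[OF X B b]] by simp
  qed
  \<comment> \<open>Two representatives are moved to one index object with one point. From then on
    only their morphisms differ, and these can be subtracted.\<close>
  have step: "\<exists>P\<in>D. \<exists>u\<in>hom_set T X P. \<exists>u'\<in>hom_set T X P. \<exists>d\<in>carrier (fobj F P).
      \<gamma> X C f c = \<gamma> X P u d \<and> \<theta> X C f c = \<theta> X P u d \<and> \<gamma> X C' f' c' = \<gamma> X P u' d \<and> \<theta> X C' f' c' = \<theta> X P u' d"
    if X: "X \<in> obj T" and C: "C \<in> D" and f: "f \<in> hom_set T X C" and c: "c \<in> carrier (fobj F C)"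
      and C': "C' \<in> D" and f': "f' \<in> hom_set T X C'" and c': "c' \<in> carrier (fobj F C')" for X C f c C' f' c'
  proof -
    obtain P i j e where P: "P \<in> D" "i \<in> hom_set T C P" "j \<in> hom_set T C' P" "e \<in> carrier (fobj F P)"
      "fmap F i e = c" "fmap F j e = c'"
      using point_sum[OF D F C C' c c'] .
    show ?thesis
      using P(1,4) cmp_in[OF X Do[OF C] Do[OF P(1)] f P(2)] cmp_in[OF X Do[OF C'] Do[OF P(1)] f' P(3)]
        Gamma_dinatural[OF D F g X C P(1) f P(2,4)] Gamma_dinatural[OF D F g X C' P(1) f' P(3,4)]
        dinat[OF X C P(1) f P(2,4)] dinat[OF X C' P(1) f' P(3,4)] P(5,6)
      by (intro bexI[where x = P] bexI[where x = "i \<cdot> f"] bexI[where x = "j \<cdot> f'"] bexI[where x = e]) simp_all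
  qed
  \<comment> \<open>The difference of the two morphisms represents zero, so \<open>zero\<close>
    applies to it.\<close>
  have wd: "\<theta> X C f c = \<theta> X C' f' c'"
    if a: "X \<in> obj T" "C \<in> D" "f \<in> hom_set T X C" "c \<in> carrier (fobj F C)"
      "C' \<in> D" "f' \<in> hom_set T X C'" "c' \<in> carrier (fobj F C')" and eq: "\<gamma> X C f c = \<gamma> X C' f' c'" for X C f c C' f' c'
  proof -
    obtain P u u' d where P: "P \<in> D" and u: "u \<in> hom_set T X P" "u' \<in> hom_set T X P" and d: "d \<in> carrier (fobj F P)"
      and e: "\<gamma> X C f c = \<gamma> X P u d" "\<theta> X C f c = \<theta> X P u d" "\<gamma> X C' f' c' = \<gamma> X P u' d" "\<theta> X C' f' c' = \<theta> X P u' d"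
      using step[OF a] by (elim bexE conjE) (rule that)
    interpret g: group_hom "Hom T X P" "fobj G X" "\<lambda>f. \<gamma> X P f d" using \<gamma>h[OF a(1) P d] .
    interpret t: group_hom "Hom T X P" "fobj H X" "\<lambda>f. \<theta> X P f d" using \<theta>h[OF a(1) P d] .
    have iu: "inv\<^bsub>Hom T X P\<^esub> u' \<in> hom_set T X P" using inv_in[OF a(1) Do[OF P] u(2)] .
    have v: "u \<otimes>\<^bsub>Hom T X P\<^esub> inv\<^bsub>Hom T X P\<^esub> u' \<in> hom_set T X P" using u(1) iu by simp
    have "\<gamma> X P (u \<otimes>\<^bsub>Hom T X P\<^esub> inv\<^bsub>Hom T X P\<^esub> u') d = \<one>\<^bsub>fobj G X\<^esub>"
      using g.hom_mult[OF u(1) iu] g.hom_inv[OF u(2)] eq e g.hom_closed[OF u(2)] by simp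
    from zero[OF a(1) P v d this] have "\<theta> X P u d \<otimes>\<^bsub>fobj H X\<^esub> inv\<^bsub>fobj H X\<^esub> (\<theta> X P u' d) = \<one>\<^bsub>fobj H X\<^esub>"
      using t.hom_mult[OF u(1) iu] t.hom_inv[OF u(2)] by simp
    from t.H.inv_equality[OF this t.H.inv_closed[OF t.hom_closed[OF u(2)]] t.hom_closed[OF u(1)]]
    have "\<theta> X P u d = \<theta> X P u' d" using t.H.inv_inv[OF t.hom_closed[OF u(2)]] by simp
    then show ?thesis using e by simp
  qed
  define b where "b = (\<lambda>X x. SOME y. \<exists>C\<in>D. \<exists>f\<in>hom_set T X C. \<exists>c\<in>carrier (fobj F C). x = \<gamma> X C f c \<and> y = \<theta> X C f c)"
  have b: "b X (\<gamma> X C f c) = \<theta> X C f c"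
    if a: "X \<in> obj T" "C \<in> D" "f \<in> hom_set T X C" "c \<in> carrier (fobj F C)" for X C f c
    unfolding b_def
  proof (rule some_equality)
    show "\<exists>C'\<in>D. \<exists>f'\<in>hom_set T X C'. \<exists>c'\<in>carrier (fobj F C'). \<gamma> X C f c = \<gamma> X C' f' c' \<and> \<theta> X C f c = \<theta> X C' f' c'"
      using a by blast
    show "y = \<theta> X C f c" if "\<exists>C'\<in>D. \<exists>f'\<in>hom_set T X C'. \<exists>c'\<in>carrier (fobj F C'). \<gamma> X C f c = \<gamma> X C' f' c' \<and> y = \<theta> X C' f' c'" for y
      using that by (elim bexE conjE) (simp add: wd[OF a])
  qed
  have \<gamma>c: "\<gamma> X C f c \<in> carrier (fobj G X)" if a: "X \<in> obj T" "C \<in> D" "f \<in> hom_set T X C" "c \<in> carrier (fobj F C)" for X C f c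
    using group_hom.hom_closed[OF \<gamma>h[OF a(1,2,4)] a(3)] .
  have bh: "b X \<in> hom (fobj G X) (fobj H X)" if X: "X \<in> obj T" for X
  proof (rule homI)
    fix x assume "x \<in> carrier (fobj G X)"
    then obtain C f c where x: "C \<in> D" "f \<in> hom_set T X C" "c \<in> carrier (fobj F C)" "x = \<gamma> X C f c"
      using Gamma_surj[OF D F g X] by blast
    show "b X x \<in> carrier (fobj H X)"
      unfolding x(4) b[OF X x(1-3)] by (rule group_hom.hom_closed[OF \<theta>h[OF X x(1,3)] x(2)])
  next
    fix x y assume "x \<in> carrier (fobj G X)" "y \<in> carrier (fobj G X)"
    then obtain C f c C' f' c' where x: "C \<in> D" "f \<in> hom_set T X C" "c \<in> carrier (fobj F C)" "x = \<gamma> X C f c"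
      and y: "C' \<in> D" "f' \<in> hom_set T X C'" "c' \<in> carrier (fobj F C')" "y = \<gamma> X C' f' c'"
      using Gamma_surj[OF D F g X] by meson
    obtain P u u' d where P: "P \<in> D" and u: "u \<in> hom_set T X P" "u' \<in> hom_set T X P" and d: "d \<in> carrier (fobj F P)"
      and e: "\<gamma> X C f c = \<gamma> X P u d" "\<theta> X C f c = \<theta> X P u d" "\<gamma> X C' f' c' = \<gamma> X P u' d" "\<theta> X C' f' c' = \<theta> X P u' d"
      using step[OF X x(1-3) y(1-3)] by (elim bexE conjE) (rule that)
    interpret g: group_hom "Hom T X P" "fobj G X" "\<lambda>f. \<gamma> X P f d" using \<gamma>h[OF X P d] .
    interpret t: group_hom "Hom T X P" "fobj H X" "\<lambda>f. \<theta> X P f d" using \<theta>h[OF X P d] .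
    have v: "u \<otimes>\<^bsub>Hom T X P\<^esub> u' \<in> hom_set T X P" using u by simp
    show "b X (x \<otimes>\<^bsub>fobj G X\<^esub> y) = b X x \<otimes>\<^bsub>fobj H X\<^esub> b X y"
      using b[OF X P v d] b[OF X P u(1) d] b[OF X P u(2) d] g.hom_mult[OF u] t.hom_mult[OF u] x(4) y(4) e by simp
  qed
  have bn: "b X (fmap G k x) = fmap H k (b Y x)"
    if o: "X \<in> obj T" "Y \<in> obj T" and k: "k \<in> hom_set T X Y" and x: "x \<in> carrier (fobj G Y)" for X Y k x
  proof -
    obtain C f c where x: "C \<in> D" "f \<in> hom_set T Y C" "c \<in> carrier (fobj F C)" "x = \<gamma> Y C f c"
      using Gamma_surj[OF D F g o(2) x] by blast
    show ?thesis
      unfolding x(4) Gamma_natural[OF D F g o k x(1-3)] b[OF o(2) x(1-3)] nat[OF o k x(1-3)]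
      by (rule b[OF o(1) x(1) cmp_in[OF o Do[OF x(1)] k x(2)] x(3)])
  qed
  show ?thesis
    by (rule bexI[OF _ nat_transI[OF bh bn GA]]) (simp_all add: b \<gamma>c)
qed

lemma nat_trans_unshift:
  assumes "\<beta> \<in> nat_trans T G (shift T (- k) H)" and G: "additive_functor T G"
  shows "\<exists>\<beta>'\<in>nat_trans T (shift T k G) H. \<forall>X\<in>obj T. \<forall>x\<in>carrier (fobj G X). \<beta>' (SO k X) x = \<beta> X x"
proof -
  have s: "SO k (SO (- k) X) = X" if "X \<in> obj T" for X using that by (simp add: SO_SO)
  have s': "SO (- k) (SO k X) = X" if "X \<in> obj T" for X using that by (simp add: SO_SO)
  let ?b = "\<lambda>X\<in>obj T. \<lambda>x\<in>carrier (fobj (shift T k G) X). \<beta> (SO (- k) X) x"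
  have "?b \<in> nat_trans T (shift T k G) H"
  proof (rule nat_transI)
    fix X assume X: "X \<in> obj T"
    show "\<beta> (SO (- k) X) \<in> hom (fobj (shift T k G) X) (fobj H X)"
      using nat_trans_hom[OF assms(1) SO_in[OF X, of "- k"]] s[OF X] by simp
  next
    fix X Y f x assume o: "X \<in> obj T" "Y \<in> obj T" and f: "f \<in> hom_set T X Y" and x: "x \<in> carrier (fobj (shift T k G) Y)"
    have "SM k (SM (- k) f) = f" using SM_SM[OF f o, of k "- k"] by simp
    then show "\<beta> (SO (- k) X) (fmap (shift T k G) f x) = fmap H f (\<beta> (SO (- k) Y) x)"
      using nat_trans_natural[OF assms(1) SO_in[OF o(1), of "- k"] SO_in[OF o(2), of "- k"] SM_in[OF o f]] x by simp
  qed (rule shift_additive[OF G])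
  then show ?thesis by (rule bexI[rotated]) (simp add: s')
qed

text \<open>A morphism \<open>X \<rightarrow> C\<close> with a point of \<open>F(C)\<close> is sent to \<open>\<Sigma>\<^sup>kX \<rightarrow> \<Sigma>\<^sup>kC \<rightarrow> E(C)\<close> with a point of
  \<open>F'(E(C))\<close>, where \<open>E(C)\<close> need only be weakly functorial in \<open>C\<close>.\<close>

lemma Gamma_map:
  fixes F :: "('o, 'm, 'a) presheaf" and G :: "('o, 'm, 'b) presheaf"
    and F' :: "('o, 'm, 'c) presheaf" and G' :: "('o, 'm, 'd) presheaf"
  assumes D: "thick D" and F: "F \<in> Coh T" and g: "is_Gamma D F G \<gamma>"
    and D': "thick D'" and F': "F' \<in> Coh T" and g': "is_Gamma D' F' G' \<gamma>'"
    and E: "\<And>C. C \<in> D \<Longrightarrow> E C \<in> D'" and i: "\<And>C. C \<in> D \<Longrightarrow> i C \<in> hom_set T (SO k C) (E C)"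
    and \<tau>: "\<And>C c. \<lbrakk>C \<in> D; c \<in> carrier (fobj F C)\<rbrakk> \<Longrightarrow> \<tau> C c \<in> carrier (fobj F' (E C))"
    and dn: "\<And>C C' a. \<lbrakk>C \<in> D; C' \<in> D; a \<in> hom_set T C C'\<rbrakk> \<Longrightarrow> \<exists>h\<in>hom_set T (E C) (E C').
      h \<cdot> i C = i C' \<cdot> SM k a \<and> (\<forall>c\<in>carrier (fobj F C'). fmap F' h (\<tau> C' c) = \<tau> C (fmap F a c))"
  shows "\<exists>\<beta>\<in>nat_trans T (shift T k G) G'. \<forall>X\<in>obj T. \<forall>C\<in>D. \<forall>f\<in>hom_set T X C. \<forall>c\<in>carrier (fobj F C).
    \<beta> (SO k X) (\<gamma> X C f c) = \<gamma>' (SO k X) (E C) (i C \<cdot> SM k f) (\<tau> C c)"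
proof -
  note Do = thick_obj[OF D] and Do' = thick_obj[OF D']
  note GA = Gamma_additive[OF D F g] and GA' = Gamma_additive[OF D' F' g']
  let ?\<theta> = "\<lambda>X C f c. \<gamma>' (SO k X) (E C) (i C \<cdot> SM k f) (\<tau> C c)"
  have "\<exists>\<beta>\<in>nat_trans T G (shift T (- k) G'). \<forall>X\<in>obj T. \<forall>C\<in>D. \<forall>f\<in>hom_set T X C. \<forall>c\<in>carrier (fobj F C).
    \<beta> X (\<gamma> X C f c) = ?\<theta> X C f c"
  proof (rule Gamma_lift[OF D F g shift_additive[OF GA']])
    fix X C c assume X: "X \<in> obj T" and C: "C \<in> D" and c: "c \<in> carrier (fobj F C)"
    note o = SO_in[OF X, of k] SO_in[OF Do[OF C], of k] Do'[OF E[OF C]]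
    have "(\<lambda>f. SM k f) \<in> hom (Hom T X C) (Hom T (SO k X) (SO k C))"
      by (rule homI) (simp_all add: SM_in[OF X Do[OF C]] SM_mult[OF X Do[OF C]])
    from hom_compose[OF hom_compose[OF this group_hom.homh[OF postcomp_hom[OF o i[OF C]]]]
        Gamma_hom[OF D' F' g' o(1) E[OF C] \<tau>[OF C c]]]
    show "(\<lambda>f. ?\<theta> X C f c) \<in> hom (Hom T X C) (fobj (shift T (- k) G') X)" by (simp add: comp_def)
  next
    fix X C C' f a c assume X: "X \<in> obj T" and C: "C \<in> D" and C': "C' \<in> D" and f: "f \<in> hom_set T X C"
      and a: "a \<in> hom_set T C C'" and c: "c \<in> carrier (fobj F C')"
    obtain h where h: "h \<in> hom_set T (E C) (E C')" and hi: "h \<cdot> i C = i C' \<cdot> SM k a"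
      and hc: "fmap F' h (\<tau> C' c) = \<tau> C (fmap F a c)"
      using dn[OF C C' a] c by blast
    note o = SO_in[OF X, of k] SO_in[OF Do[OF C], of k] SO_in[OF Do[OF C'], of k]
    note Sf = SM_in[OF X Do[OF C] f, of k] and Sa = SM_in[OF Do[OF C] Do[OF C'] a, of k]
    have "i C' \<cdot> SM k (a \<cdot> f) = (i C' \<cdot> SM k a) \<cdot> SM k f"
      using SM_cmp[OF X Do[OF C] Do[OF C'] f a] cmp_assoc[OF o Do'[OF E[OF C']] Sf Sa i[OF C']] by simp
    also have "\<dots> = h \<cdot> (i C \<cdot> SM k f)"
      unfolding hi[symmetric] by (rule cmp_assoc[OF o(1,2) Do'[OF E[OF C]] Do'[OF E[OF C']] Sf i[OF C] h])
    finally show "?\<theta> X C' (a \<cdot> f) c = ?\<theta> X C f (fmap F a c)"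
      using Gamma_dinatural[OF D' F' g' o(1) E[OF C] E[OF C'] cmp_in[OF o(1,2) Do'[OF E[OF C]] Sf i[OF C]] h \<tau>[OF C' c]]
        hc by simp
  next
    fix X Y m C f c assume X: "X \<in> obj T" and Y: "Y \<in> obj T" and m: "m \<in> hom_set T X Y" and C: "C \<in> D"
      and f: "f \<in> hom_set T Y C" and c: "c \<in> carrier (fobj F C)"
    note o = SO_in[OF X, of k] SO_in[OF Y, of k] SO_in[OF Do[OF C], of k] Do'[OF E[OF C]]
    note Sf = SM_in[OF Y Do[OF C] f, of k] and Sm = SM_in[OF X Y m, of k]
    show "fmap (shift T (- k) G') m (?\<theta> Y C f c) = ?\<theta> X C (f \<cdot> m) c"
      using Gamma_natural[OF D' F' g' o(1,2) Sm E[OF C] cmp_in[OF o(2-4) Sf i[OF C]] \<tau>[OF C c]]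
        cmp_assoc[OF o Sm Sf i[OF C]] SM_cmp[OF X Y Do[OF C] m f] by simp
  qed
  then obtain \<beta> where b: "\<beta> \<in> nat_trans T G (shift T (- k) G')" and
    e: "\<forall>X\<in>obj T. \<forall>C\<in>D. \<forall>f\<in>hom_set T X C. \<forall>c\<in>carrier (fobj F C). \<beta> X (\<gamma> X C f c) = ?\<theta> X C f c" by (elim bexE)
  obtain \<beta>' where b': "\<beta>' \<in> nat_trans T (shift T k G) G'" and
    e': "\<forall>X\<in>obj T. \<forall>x\<in>carrier (fobj G X). \<beta>' (SO k X) x = \<beta> X x"
    using nat_trans_unshift[OF b GA] by (elim bexE)
  show ?thesis
  proof (rule bexI[OF _ b'], intro ballI)
    fix X C f c assume a: "X \<in> obj T" "C \<in> D" "f \<in> hom_set T X C" "c \<in> carrier (fobj F C)"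
    have "\<gamma> X C f c \<in> carrier (fobj G X)" using hom_in_carrier[OF Gamma_hom[OF D F g a(1,2,4)] a(3)] .
    from e'[rule_format, OF a(1) this] e[rule_format, OF a]
    show "\<beta>' (SO k X) (\<gamma> X C f c) = ?\<theta> X C f c" by simp
  qed
qed

lemma Gamma_map_0:
  fixes F :: "('o, 'm, 'a) presheaf" and G :: "('o, 'm, 'b) presheaf"
    and F' :: "('o, 'm, 'c) presheaf" and G' :: "('o, 'm, 'd) presheaf"
  assumes D: "thick D" and F: "F \<in> Coh T" and g: "is_Gamma D F G \<gamma>"
    and D': "thick D'" and F': "F' \<in> Coh T" and g': "is_Gamma D' F' G' \<gamma>'"
    and DD: "D \<subseteq> D'" and \<tau>: "\<And>C c. \<lbrakk>C \<in> D; c \<in> carrier (fobj F C)\<rbrakk> \<Longrightarrow> \<tau> C c \<in> carrier (fobj F' C)"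
    and dn: "\<And>C C' a c. \<lbrakk>C \<in> D; C' \<in> D; a \<in> hom_set T C C'; c \<in> carrier (fobj F C')\<rbrakk> \<Longrightarrow>
      fmap F' a (\<tau> C' c) = \<tau> C (fmap F a c)"
  shows "\<exists>\<beta>\<in>nat_trans T G G'. \<forall>X\<in>obj T. \<forall>C\<in>D. \<forall>f\<in>hom_set T X C. \<forall>c\<in>carrier (fobj F C).
    \<beta> X (\<gamma> X C f c) = \<gamma>' X C f (\<tau> C c)"
proof -
  note Do = thick_obj[OF D]
  have "\<exists>\<beta>\<in>nat_trans T (shift T 0 G) G'. \<forall>X\<in>obj T. \<forall>C\<in>D. \<forall>f\<in>hom_set T X C. \<forall>c\<in>carrier (fobj F C).
    \<beta> (SO 0 X) (\<gamma> X C f c) = \<gamma>' (SO 0 X) C (idn T C \<cdot> SM 0 f) (\<tau> C c)"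
  proof (rule Gamma_map[OF D F g D' F' g'])
    fix C C' a assume C: "C \<in> D" "C' \<in> D" "a \<in> hom_set T C C'"
    show "\<exists>h\<in>hom_set T C C'. h \<cdot> idn T C = idn T C' \<cdot> SM 0 a \<and>
        (\<forall>c\<in>carrier (fobj F C'). fmap F' h (\<tau> C' c) = \<tau> C (fmap F a c))"
      using C dn[OF C] idn_left[OF Do[OF C(1)] Do[OF C(2)] C(3)] idn_right[OF Do[OF C(1)] Do[OF C(2)] C(3)]
      by (intro bexI[OF _ C(3)]) simp
  qed (use DD \<tau> Do idn_in in auto)
  then obtain \<beta> where b: "\<beta> \<in> nat_trans T (shift T 0 G) G'" and
    e: "\<forall>X\<in>obj T. \<forall>C\<in>D. \<forall>f\<in>hom_set T X C. \<forall>c\<in>carrier (fobj F C).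
      \<beta> (SO 0 X) (\<gamma> X C f c) = \<gamma>' (SO 0 X) C (idn T C \<cdot> SM 0 f) (\<tau> C c)" by (elim bexE)
  have "\<beta> \<in> nat_trans T G G'" using b by (simp add: nat_trans_def)
  then show ?thesis by (rule bexI[rotated]) (use e Do idn_left in auto)
qed

text \<open>Over all of \<open>T\<close> every class is already represented by its value in
  \<open>F\<close>. The criterion for zero comes from the cone of \<open>f\<close>, to which a point
  vanishing along \<open>f\<close> lifts. This connects the functors for subcategories with
  \<open>F\<close> itself.\<close>

lemma full_is_Gamma:
  assumes F: "F \<in> Coh T"
  shows "is_Gamma (obj T) F F (\<lambda>X C f c. fmap F f c)"
proof -
  note FA = Coh_additive[OF F]
  have "\<exists>B\<in>obj T. \<exists>a\<in>hom_set T C B. \<exists>b\<in>carrier (fobj F B). a \<cdot> f = zer X B \<and> c = fmap F a b"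
    if o: "X \<in> obj T" "C \<in> obj T" and f: "f \<in> hom_set T X C" and c: "c \<in> carrier (fobj F C)"
      and z: "fmap F f c = \<one>\<^bsub>fobj F X\<^esub>" for X C f c
  proof -
    obtain B v w where d: "dtri X C B f v w" using dtri_cone[OF o f] .
    have B: "B \<in> obj T" "v \<in> hom_set T C B" using d by (auto simp: dtri_def)
    obtain b where "b \<in> carrier (fobj F B)" "c = fmap F v b"
      using Coh_exact_pair[OF F o B(1) dtri_exact_pair[OF d] c z] .
    then show ?thesis using B dtri_comp_zer[OF d] by blast
  qed
  moreover have "\<exists>C\<in>obj T. \<exists>f\<in>hom_set T X C. \<exists>c\<in>carrier (fobj F C). x = fmap F f c"
    if "X \<in> obj T" "x \<in> carrier (fobj F X)" for X x
    using that idn_in af_idn[OF FA that] by metis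
  ultimately show ?thesis
    unfolding is_Gamma_def
    by (intro conjI ballI impI)
      (simp_all add: FA af_hom[OF FA] af_cmp[OF FA] group_hom.homh[OF af_eval_group_hom[OF FA]])
qed

end

section \<open>Localising subcategories generated by local cohomology\<close>

context graded_commutative_ring
begin

text \<open>Sorting the factors exchanges homogeneous elements only, so each exchange costs a sign
  at most. Whether an object is killed does not depend on that sign.\<close>

lemma power_mult_sign:
  assumes r: "r \<in> A d" and s: "s \<in> A e"
  shows "(r \<otimes> s) [^] (n::nat) = r [^] n \<otimes> s [^] n \<or> (r \<otimes> s) [^] n = \<ominus> (r [^] n \<otimes> s [^] n)"
proof (induction n)
  case (Suc n)
  let ?r = "r [^] n" and ?s = "s [^] n"
  note c = degree_carrier[OF r] degree_carrier[OF s]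
  have rs: "?r \<in> carrier R" "?s \<in> carrier R" using c by simp_all
  have "?s \<otimes> r = r \<otimes> ?s \<or> ?s \<otimes> r = \<ominus> (r \<otimes> ?s)"
    using graded_comm[OF power_degree[OF s, of n] r] by (simp split: if_splits)
  moreover have "(?r \<otimes> ?s) \<otimes> (r \<otimes> s) = ?r \<otimes> ((?s \<otimes> r) \<otimes> s)" using c rs by (simp add: m_assoc)
  moreover have "?r \<otimes> ((r \<otimes> ?s) \<otimes> s) = (?r \<otimes> r) \<otimes> (?s \<otimes> s)" using c rs by (simp add: m_assoc)
  ultimately have "(?r \<otimes> ?s) \<otimes> (r \<otimes> s) = (?r \<otimes> r) \<otimes> (?s \<otimes> s) \<or>
      (?r \<otimes> ?s) \<otimes> (r \<otimes> s) = \<ominus> ((?r \<otimes> r) \<otimes> (?s \<otimes> s))"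
    using c rs by (auto simp: l_minus r_minus)
  then show ?case using Suc.IH c rs by (auto simp: l_minus)
qed simp

end

context linear_triangulated_category
begin

lemma kills_mult_power:
  assumes s: "s \<in> A e" and r: "r \<in> A d" and X: "X \<in> obj T" and k: "nil X (e + d) (s \<otimes>\<^bsub>R\<^esub> r)"
  shows "\<exists>n::nat. kills X (int n * e + int n * d) (s [^]\<^bsub>R\<^esub> n \<otimes>\<^bsub>R\<^esub> r [^]\<^bsub>R\<^esub> n)"
proof -
  obtain n :: nat where n: "kills X (int n * (e + d)) ((s \<otimes>\<^bsub>R\<^esub> r) [^]\<^bsub>R\<^esub> n)" using k by (auto simp: nil_def)
  let ?m = "int n * e + int n * d"
  have sr: "s [^]\<^bsub>R\<^esub> n \<otimes>\<^bsub>R\<^esub> r [^]\<^bsub>R\<^esub> n \<in> A ?m" using mult_degree[OF power_degree[OF s] power_degree[OF r]] .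
  have "kills X ?m ((s \<otimes>\<^bsub>R\<^esub> r) [^]\<^bsub>R\<^esub> n)" using n by (simp add: distrib_left)
  moreover have "kills X ?m (s [^]\<^bsub>R\<^esub> n \<otimes>\<^bsub>R\<^esub> r [^]\<^bsub>R\<^esub> n)"
    if "kills X ?m (\<ominus>\<^bsub>R\<^esub> (s [^]\<^bsub>R\<^esub> n \<otimes>\<^bsub>R\<^esub> r [^]\<^bsub>R\<^esub> n))"
  proof -
    interpret G: group "Hom T (SO (- ?m) X) X" using hom_grp X by simp
    show ?thesis using that rho_minus[OF sr X] rho_in[OF sr X] G.inv_inv G.inv_one unfolding kills_def by metis
  qed
  ultimately show ?thesis using power_mult_sign[OF s r, of n] by metis
qed

section \<open>Membership of local cohomology in a fixed localising subcategory\<close>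

context
  fixes \<C> :: "('o, 'm, 'a) presheaf set"
  assumes noeth: "noetherian_ring R" and inf: "infinite (UNIV :: 'a set)"
    and small: "carrier R \<lesssim> (UNIV :: 'a set)" and ess: "essentially_small (UNIV :: 'a set) T"
    and loc: "localising T \<C>"
begin

text \<open>All functors with the properties of the colimit are included, not just the chosen one.
  For the full subcategory \<open>F\<close> itself is one of them, and that case gives the final
  conclusion.\<close>

definition good :: "'o set \<Rightarrow> ('o, 'm, 'a) presheaf \<Rightarrow> bool"
  where "good D F \<longleftrightarrow> (\<forall>G \<gamma>. is_Gamma D F (G :: ('o, 'm, 'a) presheaf) \<gamma> \<longrightarrow> G \<in> \<C>)"

lemma good_GammaD:
  assumes "thick D" "F \<in> Coh T" "good D F" shows "GammaD D F \<in> \<C>"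
  using GammaD_exists[OF assms(1,2) inf ess] assms(3) unfolding good_def by blast

lemma degree_index_small: "(SIGMA d:UNIV. A d - q) \<lesssim> (UNIV :: 'a set)"
proof -
  have "(UNIV :: int set) \<lesssim> (UNIV :: nat set)" by (auto simp: lepoll_def intro: inj_to_nat)
  then have i: "(UNIV :: int set) \<lesssim> (UNIV :: 'a set)"
    using inf infinite_le_lepoll lepoll_trans by blast
  have "(UNIV :: 'a set) \<times> (UNIV :: 'a set) \<approx> (UNIV :: 'a set)"
    using card_of_Times_same_infinite[OF inf] unfolding eqpoll_iff_card_of_ordIso by simp
  then have sq: "(UNIV :: 'a set) \<times> (UNIV :: 'a set) \<lesssim> (UNIV :: 'a set)" by (rule eqpoll_imp_lepoll)
  have "(SIGMA d:UNIV. A d - q) \<subseteq> (UNIV :: int set) \<times> carrier R" using degree_carrier by auto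
  from lepoll_trans[OF subset_imp_lepoll[OF this] lepoll_trans[OF times_lepoll_mono[OF i small] sq]] show ?thesis .
qed

lemma objsupp_degree:
  assumes r: "r \<in> A d" shows "X \<in> objsupp {r} \<longleftrightarrow> X \<in> obj T \<and> nil X d r"
  using nil_iff_vanish[OF noeth _ r] by (auto simp: objsupp_def)

lemma objsupp_power_subset: "r \<in> carrier R \<Longrightarrow> objsupp {r [^]\<^bsub>R\<^esub> (n::nat)} \<subseteq> objsupp {r}"
  using prime_power by (auto simp: objsupp_def)

lemma objsupp_power:
  assumes r: "r \<in> carrier R" shows "objsupp {r [^]\<^bsub>R\<^esub> (Suc n)} = objsupp {r}"
proof -
  have "r [^]\<^bsub>R\<^esub> (Suc n) \<in> q" if q: "q \<in> Spec R A" "r \<in> q" for q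
    using ideal.I_l_closed[OF prime_ideal(1)[OF q(1)] q(2), of "r [^]\<^bsub>R\<^esub> n"] r by simp
  then show ?thesis using objsupp_power_subset[OF r, of "Suc n"] by (auto simp: objsupp_def)
qed

text \<open>The cone stays in the thick subcategory of objects supported on \<open>B\<close>, and
  \<open>s\<close> is nilpotent on it. Objects satisfying one more support condition are always
  produced in this way.\<close>

lemma cone_objsupp:
  assumes B: "B \<subseteq> homog" and s: "s \<in> A d" and E: "E \<in> objsupp B"
    and t: "dtri (SO (- d) E) E W (rh d s E) i j"
  shows "W \<in> objsupp (insert s B)"
proof -
  note D = thick_objsupp[OF noeth B]
  have "W \<in> objsupp B" using thick_cone[OF D t thick_SO[OF D E] E] .
  moreover have "W \<in> objsupp {s}"
    using objsupp_degree[OF s, of W] cone_nil[OF s thick_obj[OF D E] t] t by (simp add: dtri_def)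
  ultimately show ?thesis using objsupp_insert by blast
qed

lemma localisation_closed:
  assumes F: "F \<in> \<C>" and q: "\<one>\<^bsub>R\<^esub> \<notin> q" "\<And>r d s e. \<lbrakk>r \<in> A d; r \<notin> q; s \<in> A e; s \<notin> q\<rbrakk> \<Longrightarrow> r \<otimes>\<^bsub>R\<^esub> s \<notin> q"
  shows "localise R A T \<phi> q F \<in> \<C>"
proof -
  let ?L = "localise R A T \<phi> q F"
  note FC = localising_Coh[OF loc F]
  have "\<exists>\<psi>. is_localisation q F ?L \<psi>" by (rule localise_exists[OF FC q(1) _ inf small]) (rule q(2))
  then obtain \<psi> where lo: "is_localisation q F ?L \<psi>" by blast
  show ?thesis
  proof (rule localising_quotient[OF inf loc degree_index_small])
    fix j assume j: "j \<in> (SIGMA d:UNIV. A d - q)"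
    show "shift T (fst j) F \<in> \<C>" using localising_shift[OF loc F] .
    show "(\<lambda>X\<in>obj T. \<lambda>x\<in>carrier (fobj (shift T (fst j) F) X). \<psi> X (fst j) (snd j) x) \<in> nat_trans T (shift T (fst j) F) ?L"
    proof (rule nat_transI)
      show "\<psi> X (fst j) (snd j) \<in> hom (fobj (shift T (fst j) F) X) (fobj ?L X)" if "X \<in> obj T" for X
        using lo that j unfolding is_localisation_def by auto
      show "\<psi> X (fst j) (snd j) (fmap (shift T (fst j) F) f x) = fmap ?L f (\<psi> Y (fst j) (snd j) x)"
        if "X \<in> obj T" "Y \<in> obj T" "f \<in> hom_set T X Y" "x \<in> carrier (fobj (shift T (fst j) F) Y)" for X Y f x
        using lo that j unfolding is_localisation_def by auto
    qed (rule shift_additive[OF Coh_additive[OF FC]])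
  next
    show "?L \<in> Coh T" using lo by (simp add: is_localisation_def)
  next
    fix X x assume X: "X \<in> obj T" and x: "x \<in> carrier (fobj ?L X)"
    have "\<exists>d. \<exists>s\<in>A d - q. \<exists>y\<in>carrier (fobj F (SO (- d) X)). x = \<psi> X d s y"
      using lo X x unfolding is_localisation_def by blast
    then obtain d s y where "s \<in> A d - q" "y \<in> carrier (fobj F (SO (- d) X))" "x = \<psi> X d s y" by blast
    then show "\<exists>j\<in>(SIGMA d:UNIV. A d - q). \<exists>y\<in>carrier (fobj (shift T (fst j) F) X).
        x = (\<lambda>X\<in>obj T. \<lambda>x\<in>carrier (fobj (shift T (fst j) F) X). \<psi> X (fst j) (snd j) x) X y"
      using X by (intro bexI[where x = "(d, s)"] bexI[where x = y]) auto
  qed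
qed

text \<open>If the unit lies in the generated ideal, it kills every object supported on
  \<open>B\<close>, so the identities of these objects are zero and all classes vanish.\<close>

lemma good_unit:
  assumes B: "B \<subseteq> homog" and one: "\<one>\<^bsub>R\<^esub> \<in> genideal R B" and F: "F \<in> Coh T"
  shows "good (objsupp B) F"
  unfolding good_def
proof (intro allI impI)
  fix G :: "('o, 'm, 'a) presheaf" and \<gamma> assume g: "is_Gamma (objsupp B) F G \<gamma>"
  note D = thick_objsupp[OF noeth B]
  note GC = Gamma_Coh[OF D F g]
  have id0: "idn T C = zer C C" if C: "C \<in> objsupp B" for C
  proof -
    note Co = thick_obj[OF D C]
    have "C \<in> objsupp (genideal R B)" using C objsupp_genideal[OF subset_trans[OF B homog_carrier]] by simp
    then have "C \<in> objsupp {\<one>\<^bsub>R\<^esub>}" using one unfolding objsupp_def by blast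
    then have "kills C 0 \<one>\<^bsub>R\<^esub>" using objsupp_degree[OF one_degree, of C] by (auto simp: nil_def)
    then show ?thesis using rho_one[OF Co] by (simp add: kills_def)
  qed
  have triv: "x = \<one>\<^bsub>fobj G X\<^esub>" if X: "X \<in> obj T" and x: "x \<in> carrier (fobj G X)" for X x
  proof -
    obtain C f c where C: "C \<in> objsupp B" and f: "f \<in> hom_set T X C" and c: "c \<in> carrier (fobj F C)" and x: "x = \<gamma> X C f c"
      using Gamma_surj[OF D F g X x] by blast
    note Co = thick_obj[OF D C]
    have "f = zer X C" using idn_left[OF X Co f] id0[OF C] cmp_zer_left[OF X Co Co f] by simp
    then show ?thesis
      using x hom_one[OF Gamma_hom[OF D F g X C c] hom_grp[OF X Co] af_group[OF Coh_additive[OF GC] X]] by simp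
  qed
  obtain P \<iota> where P: "is_coproduct T ({} :: 'a set) (\<lambda>_. F) P \<iota>" using coproduct_exists[OF inf, of "{}" "\<lambda>_. F"] by auto
  then have PC: "P \<in> \<C>" using loc unfolding localising_def by blast
  have PA: "additive_functor T P" using Coh_additive[OF localising_Coh[OF loc PC]] .
  show "G \<in> \<C>"
  proof (rule localising_quotient[OF inf loc])
    show "{()} \<lesssim> (UNIV :: 'a set)" by (auto simp: lepoll_def inj_on_def)
    show "P \<in> \<C>" by fact
    show "G \<in> Coh T" by fact
    show "(\<lambda>X\<in>obj T. \<lambda>x\<in>carrier (fobj P X). \<one>\<^bsub>fobj G X\<^esub>) \<in> nat_trans T P G"
      using zero_nat_trans[OF PA Coh_additive[OF GC]] .
    fix X x assume X: "X \<in> obj T" and x: "x \<in> carrier (fobj G X)"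
    have "\<one>\<^bsub>fobj P X\<^esub> \<in> carrier (fobj P X)" using monoid.one_closed[OF group.is_monoid[OF af_group[OF PA X]]] .
    then show "\<exists>j\<in>{()}. \<exists>y\<in>carrier (fobj P X). x = (\<lambda>X\<in>obj T. \<lambda>x\<in>carrier (fobj P X). \<one>\<^bsub>fobj G X\<^esub>) X y"
      using triv[OF X x] X by auto
  qed
qed

text \<open>Classes that die after localisation come from the objects supported on one further
  \<open>w\<close> of the multiplicative set: such a class is moved to a fibre where its point is
  annihilated by \<open>w\<close>, and then lifted to the cone of \<open>w\<close>.\<close>

lemma good_localisation_kernel:
  assumes F: "F \<in> Coh T" and B: "B \<subseteq> homog"
    and q: "\<one>\<^bsub>R\<^esub> \<notin> q" "\<And>r d s e. \<lbrakk>r \<in> A d; r \<notin> q; s \<in> A e; s \<notin> q\<rbrakk> \<Longrightarrow> r \<otimes>\<^bsub>R\<^esub> s \<notin> q"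
    and L: "GammaD (objsupp B) (localise R A T \<phi> q F) \<in> \<C>"
    and w: "\<And>k w. w \<in> A k - q \<Longrightarrow> good (objsupp (insert w B)) F"
  shows "good (objsupp B) F"
  unfolding good_def
proof (intro allI impI)
  fix G :: "('o, 'm, 'a) presheaf" and \<gamma> assume g: "is_Gamma (objsupp B) F G \<gamma>"
  let ?D = "objsupp B" and ?L = "localise R A T \<phi> q F"
  let ?GL = "GammaD ?D ?L"
  note D = thick_objsupp[OF noeth B]
  note Do = thick_obj[OF D]
  note FA = Coh_additive[OF F]
  have "\<exists>\<psi>. is_localisation q F ?L \<psi>" by (rule localise_exists[OF F q(1) _ inf small]) (rule q(2))
  then obtain \<psi> where lo: "is_localisation q F ?L \<psi>" by blast
  have LC: "?L \<in> Coh T" using lo by (simp add: is_localisation_def)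
  note LA = Coh_additive[OF LC]
  obtain \<gamma>' where g': "is_Gamma ?D ?L ?GL \<gamma>'" using GammaD_exists[OF D LC inf ess] by blast
  have one: "\<one>\<^bsub>R\<^esub> \<in> A 0 - q" using one_degree q(1) by simp
  have \<psi>0: "\<psi> X 0 \<one>\<^bsub>R\<^esub> \<in> hom (fobj F X) (fobj ?L X)" if "X \<in> obj T" for X
  proof -
    have "\<psi> X 0 \<one>\<^bsub>R\<^esub> \<in> hom (fobj F (SO (- 0) X)) (fobj ?L X)"
      using lo[unfolded is_localisation_def, THEN conjunct2, THEN conjunct1, rule_format, OF that one] .
    then show ?thesis by simp
  qed
  have \<psi>nat: "fmap ?L f (\<psi> Y 0 \<one>\<^bsub>R\<^esub> y) = \<psi> X 0 \<one>\<^bsub>R\<^esub> (fmap F f y)"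
    if "X \<in> obj T" "Y \<in> obj T" "f \<in> hom_set T X Y" "y \<in> carrier (fobj F Y)" for X Y f y
  proof -
    have "fmap ?L f (\<psi> Y 0 \<one>\<^bsub>R\<^esub> y) = \<psi> X 0 \<one>\<^bsub>R\<^esub> (fmap F (SM (- 0) f) y)"
      using lo[unfolded is_localisation_def, THEN conjunct2, THEN conjunct2, THEN conjunct2, THEN conjunct2, THEN conjunct2,
          rule_format, OF that(1-3) one] that(4) by simp
    then show ?thesis by simp
  qed
  have \<psi>exp: "\<psi> X 0 \<one>\<^bsub>R\<^esub> y = \<psi> X e (t \<otimes>\<^bsub>R\<^esub> \<one>\<^bsub>R\<^esub>) (fmap F (rh e t X) y)"
    if "X \<in> obj T" "y \<in> carrier (fobj F X)" "t \<in> A e - q" for X y e t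
    using lo[unfolded is_localisation_def, THEN conjunct2, THEN conjunct2, THEN conjunct2, THEN conjunct2, THEN conjunct1,
        rule_format, OF that(1) one _ that(3)] that(2) by simp
  have \<psi>zero: "\<exists>k. \<exists>w\<in>A k - q. fmap F (rh k w X) y = \<one>\<^bsub>fobj F (SO (- k) X)\<^esub>"
    if "X \<in> obj T" "y \<in> carrier (fobj F X)" "\<psi> X 0 \<one>\<^bsub>R\<^esub> y = \<one>\<^bsub>fobj ?L X\<^esub>" for X y
    using lo[unfolded is_localisation_def, THEN conjunct2, THEN conjunct2, THEN conjunct2, THEN conjunct1,
        rule_format, OF that(1) one] that(2,3) by simp
  have pow: "w [^]\<^bsub>R\<^esub> (n::nat) \<in> A (int n * k) - q" if "w \<in> A k - q" for w k n
  proof (induction n)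
    case 0 then show ?case using one by simp
  next
    case (Suc n)
    then show ?case using power_degree[of w k "Suc n"] q(2)[of "w [^]\<^bsub>R\<^esub> n" "int n * k" w k] that by simp
  qed
  \<comment> \<open>Some power of \<open>w\<close> acts as zero on \<open>C\<close>, so the point
    equals a fraction with zero numerator and that power as denominator.\<close>
  have \<psi>nil: "\<psi> C 0 \<one>\<^bsub>R\<^esub> c = \<one>\<^bsub>fobj ?L C\<^esub>"
    if w: "w \<in> A k - q" and C: "C \<in> objsupp {w}" and c: "c \<in> carrier (fobj F C)" for w k C c
  proof -
    have Co: "C \<in> obj T" using C by (simp add: objsupp_def)
    obtain n :: nat where n: "kills C (int n * k) (w [^]\<^bsub>R\<^esub> n)"
      using objsupp_degree[of w k C] w C by (auto simp: nil_def)
    let ?k = "int n * k" and ?w = "w [^]\<^bsub>R\<^esub> n"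
    have "fmap F (rh ?k ?w C) c = \<one>\<^bsub>fobj F (SO (- ?k) C)\<^esub>"
      using n af_zer[OF FA SO_in[OF Co] Co c] by (simp add: kills_def)
    moreover have "?w \<otimes>\<^bsub>R\<^esub> \<one>\<^bsub>R\<^esub> \<in> A ?k - q" using pow[OF w, of n] degree_carrier[of ?w ?k] by simp
    then have "\<psi> C ?k (?w \<otimes>\<^bsub>R\<^esub> \<one>\<^bsub>R\<^esub>) \<in> hom (fobj F (SO (- ?k) C)) (fobj ?L C)"
      using lo[unfolded is_localisation_def, THEN conjunct2, THEN conjunct1, rule_format, OF Co] by blast
    ultimately show ?thesis
      using \<psi>exp[OF Co c pow[OF w, of n]] hom_one[OF _ af_group[OF FA SO_in[OF Co]] af_group[OF LA Co]] by metis
  qed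
  have "\<exists>\<beta>\<in>nat_trans T G ?GL. \<forall>X\<in>obj T. \<forall>C\<in>?D. \<forall>f\<in>hom_set T X C. \<forall>c\<in>carrier (fobj F C).
      \<beta> X (\<gamma> X C f c) = \<gamma>' X C f (\<psi> C 0 \<one>\<^bsub>R\<^esub> c)"
    by (rule Gamma_map_0[OF D F g D LC g' subset_refl])
      (simp_all add: hom_in_carrier[OF \<psi>0[OF Do]] \<psi>nat[OF Do Do])
  then obtain \<beta> where b: "\<beta> \<in> nat_trans T G ?GL" and
    be: "\<forall>X\<in>obj T. \<forall>C\<in>?D. \<forall>f\<in>hom_set T X C. \<forall>c\<in>carrier (fobj F C). \<beta> X (\<gamma> X C f c) = \<gamma>' X C f (\<psi> C 0 \<one>\<^bsub>R\<^esub> c)"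
    by (elim bexE)
  let ?J = "SIGMA d:UNIV. A d - q"
  let ?Gw = "\<lambda>j. GammaD (objsupp (insert (snd j) B)) F"
  have "\<exists>\<alpha>. \<alpha> \<in> nat_trans T (?Gw j) G \<and>
      (\<forall>X\<in>obj T. \<forall>x\<in>carrier (fobj (?Gw j) X). \<beta> X (\<alpha> X x) = \<one>\<^bsub>fobj ?GL X\<^esub>) \<and>
      (\<forall>X\<in>obj T. \<forall>C\<in>objsupp (insert (snd j) B). \<forall>f\<in>hom_set T X C. \<forall>c\<in>carrier (fobj F C).
        \<exists>y\<in>carrier (fobj (?Gw j) X). \<gamma> X C f c = \<alpha> X y)" if j: "j \<in> ?J" for j
  proof -
    let ?Dw = "objsupp (insert (snd j) B)"
    have wj: "snd j \<in> A (fst j) - q" using j by auto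
    have Bw: "insert (snd j) B \<subseteq> homog" using B wj by (auto simp: homog_def)
    note Dw = thick_objsupp[OF noeth Bw]
    have sub: "?Dw \<subseteq> ?D" using objsupp_insert by blast
    obtain \<gamma>w where gw: "is_Gamma ?Dw F (?Gw j) \<gamma>w" using GammaD_exists[OF Dw F inf ess] by blast
    have "\<exists>\<alpha>\<in>nat_trans T (?Gw j) G. \<forall>X\<in>obj T. \<forall>C\<in>?Dw. \<forall>f\<in>hom_set T X C. \<forall>c\<in>carrier (fobj F C).
        \<alpha> X (\<gamma>w X C f c) = \<gamma> X C f c"
      by (rule Gamma_map_0[OF Dw F gw D F g sub]) simp_all
    then obtain \<alpha> where a: "\<alpha> \<in> nat_trans T (?Gw j) G" and
      ae: "\<forall>X\<in>obj T. \<forall>C\<in>?Dw. \<forall>f\<in>hom_set T X C. \<forall>c\<in>carrier (fobj F C). \<alpha> X (\<gamma>w X C f c) = \<gamma> X C f c"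
      by (elim bexE)
    have "\<beta> X (\<alpha> X x) = \<one>\<^bsub>fobj ?GL X\<^esub>" if X: "X \<in> obj T" and x: "x \<in> carrier (fobj (?Gw j) X)" for X x
    proof -
      obtain C f c where C: "C \<in> ?Dw" and f: "f \<in> hom_set T X C" and c: "c \<in> carrier (fobj F C)" and x: "x = \<gamma>w X C f c"
        using Gamma_surj[OF Dw F gw X x] by blast
      have CD: "C \<in> ?D" using C sub by blast
      have "C \<in> objsupp {snd j}" using C objsupp_insert by blast
      from \<psi>nil[OF wj this c] have "\<beta> X (\<alpha> X x) = \<gamma>' X C f \<one>\<^bsub>fobj ?L C\<^esub>"
        using x ae[rule_format, OF X C f c] be[rule_format, OF X CD f c] by simp
      then show ?thesis
        using hom_one[OF Gamma_hom_point[OF D LC g' X CD f] af_group[OF LA Do[OF CD]] af_group[OF Gamma_additive[OF D LC g'] X]]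
        by simp
    qed
    moreover have "\<exists>y\<in>carrier (fobj (?Gw j) X). \<gamma> X C f c = \<alpha> X y"
      if a: "X \<in> obj T" "C \<in> ?Dw" "f \<in> hom_set T X C" "c \<in> carrier (fobj F C)" for X C f c
      using ae[rule_format, OF a] hom_in_carrier[OF Gamma_hom_point[OF Dw F gw a(1-3)] a(4)]
      by (intro bexI[where x = "\<gamma>w X C f c"]) simp_all
    ultimately show ?thesis using a by blast
  qed
  then have "\<forall>j\<in>?J. \<exists>\<alpha>. \<alpha> \<in> nat_trans T (?Gw j) G \<and>
      (\<forall>X\<in>obj T. \<forall>x\<in>carrier (fobj (?Gw j) X). \<beta> X (\<alpha> X x) = \<one>\<^bsub>fobj ?GL X\<^esub>) \<and>
      (\<forall>X\<in>obj T. \<forall>C\<in>objsupp (insert (snd j) B). \<forall>f\<in>hom_set T X C. \<forall>c\<in>carrier (fobj F C).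
        \<exists>y\<in>carrier (fobj (?Gw j) X). \<gamma> X C f c = \<alpha> X y)" by (intro ballI)
  from bchoice[OF this] obtain \<alpha> where \<alpha>: "\<forall>j\<in>?J. \<alpha> j \<in> nat_trans T (?Gw j) G \<and>
      (\<forall>X\<in>obj T. \<forall>x\<in>carrier (fobj (?Gw j) X). \<beta> X (\<alpha> j X x) = \<one>\<^bsub>fobj ?GL X\<^esub>) \<and>
      (\<forall>X\<in>obj T. \<forall>C\<in>objsupp (insert (snd j) B). \<forall>f\<in>hom_set T X C. \<forall>c\<in>carrier (fobj F C).
        \<exists>y\<in>carrier (fobj (?Gw j) X). \<gamma> X C f c = \<alpha> j X y)" by (elim exE)
  show "G \<in> \<C>"
  proof (rule localising_extension[OF inf loc degree_index_small])
    fix j assume j: "j \<in> ?J"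
    then have wj: "snd j \<in> A (fst j) - q" by auto
    then have "insert (snd j) B \<subseteq> homog" using B by (auto simp: homog_def)
    from good_GammaD[OF thick_objsupp[OF noeth this] F w[OF wj]] show "?Gw j \<in> \<C>" .
    show "\<alpha> j \<in> nat_trans T (?Gw j) G" using \<alpha>[rule_format, OF j] by (elim conjE)
    show "\<beta> X (\<alpha> j X x) = \<one>\<^bsub>fobj ?GL X\<^esub>" if "X \<in> obj T" "x \<in> carrier (fobj (?Gw j) X)" for X x
      using \<alpha>[rule_format, OF j, THEN conjunct2, THEN conjunct1, rule_format, OF that] .
  next
    show "G \<in> Coh T" using Gamma_Coh[OF D F g] .
    show "?GL \<in> \<C>" using L .
    show "\<beta> \<in> nat_trans T G ?GL" using b .
  next
    fix X x assume X: "X \<in> obj T" and x: "x \<in> carrier (fobj G X)" and bx: "\<beta> X x = \<one>\<^bsub>fobj ?GL X\<^esub>"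
    obtain C f c where C: "C \<in> ?D" and f: "f \<in> hom_set T X C" and c: "c \<in> carrier (fobj F C)" and xe: "x = \<gamma> X C f c"
      using Gamma_surj[OF D F g X x] by blast
    note Co = Do[OF C]
    have \<psi>c: "\<psi> C 0 \<one>\<^bsub>R\<^esub> c \<in> carrier (fobj ?L C)" using hom_in_carrier[OF \<psi>0[OF Co] c] .
    have "\<gamma>' X C f (\<psi> C 0 \<one>\<^bsub>R\<^esub> c) = \<one>\<^bsub>fobj ?GL X\<^esub>" using bx xe be[rule_format, OF X C f c] by simp
    from Gamma_zero[OF D LC g' X C f \<psi>c this] obtain B0 a b where B0: "B0 \<in> ?D" and a: "a \<in> hom_set T C B0"
      and b: "b \<in> carrier (fobj ?L B0)" and af: "a \<cdot>\<^bsub>T\<^esub> f = zer X B0" and cb: "\<psi> C 0 \<one>\<^bsub>R\<^esub> c = fmap ?L a b"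
      by blast
    note B0o = Do[OF B0]
    \<comment> \<open>On the fibre of \<open>a\<close> the restricted point is zero as a fraction,
      while \<open>f\<close> factors through the fibre, so the class loses nothing by
      restriction.\<close>
    obtain E e v where d: "dtri E C B0 e a v" using dtri_fibre[OF Co B0o a] .
    have E: "E \<in> ?D" using thick_fibre[OF D d C B0] .
    note Eo = Do[OF E]
    have e: "e \<in> hom_set T E C" using d by (simp add: dtri_def)
    obtain f' where f': "f' \<in> hom_set T X E" "f = e \<cdot>\<^bsub>T\<^esub> f'" using weak_kernel[OF d X f af] .
    have ec: "fmap F e c \<in> carrier (fobj F E)" using af_closed[OF FA Eo Co e c] .
    have "\<psi> E 0 \<one>\<^bsub>R\<^esub> (fmap F e c) = fmap ?L e (fmap ?L a b)" using \<psi>nat[OF Eo Co e c] cb by simp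
    also have "\<dots> = \<one>\<^bsub>fobj ?L E\<^esub>"
      using af_cmp[OF LA Eo Co B0o e a b] dtri_comp_zer[OF d] af_zer[OF LA Eo B0o b] by simp
    finally obtain k w where wk: "w \<in> A k - q" and we: "fmap F (rh k w E) (fmap F e c) = \<one>\<^bsub>fobj F (SO (- k) E)\<^esub>"
      using \<psi>zero[OF Eo ec] by blast
    have wA: "w \<in> A k" using wk by simp
    \<comment> \<open>A point annihilated by \<open>w\<close> lifts to the cone of \<open>w\<close>
      on \<open>E\<close>; this moves the class to the smaller support.\<close>
    obtain W i j where dw: "dtri (SO (- k) E) E W (rh k w E) i j" using dtri_cone[OF SO_in[OF Eo] Eo rho_in[OF wA Eo]] .
    have W: "W \<in> objsupp (insert w B)" using cone_objsupp[OF B wA E dw] .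
    then have WD: "W \<in> ?D" using objsupp_insert by blast
    have i: "i \<in> hom_set T E W" using dw by (simp add: dtri_def)
    obtain y where y: "y \<in> carrier (fobj F W)" "fmap F e c = fmap F i y"
      using Coh_exact_pair[OF F SO_in[OF Eo] Eo Do[OF WD] dtri_exact_pair[OF dw] ec we] .
    have "x = \<gamma> X W (i \<cdot>\<^bsub>T\<^esub> f') y"
      using xe f'(2) Gamma_dinatural[OF D F g X E C f'(1) e c] Gamma_dinatural[OF D F g X E WD f'(1) i y(1)] y(2) by simp
    moreover have "(k, w) \<in> ?J" using wk by simp
    moreover have "i \<cdot>\<^bsub>T\<^esub> f' \<in> hom_set T X W" using cmp_in[OF X Eo Do[OF WD] f'(1) i] .
    ultimately show "\<exists>j\<in>?J. \<exists>y\<in>carrier (fobj (?Gw j) X). x = \<alpha> j X y"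
      using \<alpha>[rule_format, of "(k, w)", THEN conjunct2, THEN conjunct2, rule_format, of X W "i \<cdot>\<^bsub>T\<^esub> f'" y] X W y(1)
      by (intro bexI[where x = "(k, w)"]) simp_all
  qed
qed

text \<open>A power of \<open>s\<close> times a power of \<open>r\<close> kills each object
  involved, so the power of \<open>r\<close> factors through the cone of the power of
  \<open>s\<close>, an object supported on \<open>s\<close>. As the power of \<open>r\<close> is
  invertible after localisation, every point of the localised functor comes from such a
  cone.\<close>

lemma localisation_product_closed:
  assumes F: "F \<in> Coh T" and B: "B \<subseteq> homog" and s: "s \<in> A e" and r: "r \<in> A d"
    and sr: "s \<otimes>\<^bsub>R\<^esub> r \<in> genideal R B" and rq: "r \<notin> q"
    and q: "\<one>\<^bsub>R\<^esub> \<notin> q" "\<And>r d s e. \<lbrakk>r \<in> A d; r \<notin> q; s \<in> A e; s \<notin> q\<rbrakk> \<Longrightarrow> r \<otimes>\<^bsub>R\<^esub> s \<notin> q"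
    and gs: "good (objsupp (insert s B)) F"
  shows "GammaD (objsupp B) (localise R A T \<phi> q F) \<in> \<C>"
proof -
  let ?D = "objsupp B" and ?L = "localise R A T \<phi> q F" and ?Ds = "objsupp (insert s B)"
  let ?GL = "GammaD ?D ?L" and ?Gs = "GammaD ?Ds F"
  note D = thick_objsupp[OF noeth B]
  note Do = thick_obj[OF D]
  note FA = Coh_additive[OF F]
  have B0: "insert s B \<subseteq> homog" using B s by (auto simp: homog_def)
  note D0 = thick_objsupp[OF noeth B0]
  have sub: "?Ds \<subseteq> ?D" using objsupp_insert by blast
  have "\<exists>\<psi>. is_localisation q F ?L \<psi>" by (rule localise_exists[OF F q(1) _ inf small]) (rule q(2))
  then obtain \<psi> where lo: "is_localisation q F ?L \<psi>" by blast
  have LC: "?L \<in> Coh T" using lo by (simp add: is_localisation_def)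
  obtain \<gamma>' where g': "is_Gamma ?D ?L ?GL \<gamma>'" using GammaD_exists[OF D LC inf ess] by blast
  obtain \<gamma>0 where g0: "is_Gamma ?Ds F ?Gs \<gamma>0" using GammaD_exists[OF D0 F inf ess] by blast
  have \<psi>hom: "\<psi> X m u \<in> hom (fobj F (SO (- m) X)) (fobj ?L X)" if "X \<in> obj T" "u \<in> A m - q" for X m u
    using lo[unfolded is_localisation_def, THEN conjunct2, THEN conjunct1, rule_format, OF that] .
  note \<psi>exp = lo[unfolded is_localisation_def, THEN conjunct2, THEN conjunct2, THEN conjunct2, THEN conjunct2, THEN conjunct1, rule_format]
  note \<psi>nat = lo[unfolded is_localisation_def, THEN conjunct2, THEN conjunct2, THEN conjunct2, THEN conjunct2, THEN conjunct2, rule_format]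
  have bk: "SO (- m) (SO m X) = X" "SO m (SO (- m) X) = X" if "X \<in> obj T" for X m
    using that by (simp_all add: SO_SO)
  have bkm: "SM (- m) (SM m f) = f" "SM m (SM (- m) f) = f" if "X \<in> obj T" "Y \<in> obj T" "f \<in> hom_set T X Y" for X Y f m
    using SM_SM[OF that(3,1,2), of "- m" m] SM_SM[OF that(3,1,2), of m "- m"] by simp_all
  let ?J = "SIGMA d:UNIV. A d - q"
  \<comment> \<open>For each denominator \<open>u\<close> of degree \<open>m\<close>: a class is
    shifted by \<open>m\<close> and its point is divided by \<open>u\<close>. The maps
    \<open>i\<close> of \<open>Gamma_map\<close> are identities here.\<close>
  have "\<exists>\<alpha>. \<alpha> \<in> nat_trans T (shift T (fst j) ?Gs) ?GL \<and>
      (\<forall>X\<in>obj T. \<forall>C\<in>?Ds. \<forall>f\<in>hom_set T X C. \<forall>c\<in>carrier (fobj F C). \<alpha> (SO (fst j) X) (\<gamma>0 X C f c) =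
        \<gamma>' (SO (fst j) X) (SO (fst j) C) (idn T (SO (fst j) C) \<cdot>\<^bsub>T\<^esub> SM (fst j) f) (\<psi> (SO (fst j) C) (fst j) (snd j) c))"
    if j: "j \<in> ?J" for j
  proof -
    let ?m = "fst j" and ?u = "snd j"
    have u: "?u \<in> A ?m - q" using j by auto
    have "\<exists>\<alpha>\<in>nat_trans T (shift T ?m ?Gs) ?GL. \<forall>X\<in>obj T. \<forall>C\<in>?Ds. \<forall>f\<in>hom_set T X C. \<forall>c\<in>carrier (fobj F C).
      \<alpha> (SO ?m X) (\<gamma>0 X C f c) =
        \<gamma>' (SO ?m X) (SO ?m C) (idn T (SO ?m C) \<cdot>\<^bsub>T\<^esub> SM ?m f) (\<psi> (SO ?m C) ?m ?u c)"
    proof (rule Gamma_map[OF D0 F g0 D LC g'])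
      fix C assume C: "C \<in> ?Ds"
      then have CD: "C \<in> ?D" using sub by blast
      show "SO ?m C \<in> ?D" using thick_SO[OF D CD] .
      show "idn T (SO ?m C) \<in> hom_set T (SO ?m C) (SO ?m C)" using idn_in[OF SO_in[OF Do[OF CD]]] .
      show "\<psi> (SO ?m C) ?m ?u c \<in> carrier (fobj ?L (SO ?m C))" if "c \<in> carrier (fobj F C)" for c
        using hom_in_carrier[OF \<psi>hom[OF SO_in[OF Do[OF CD]] u]] that bk(1)[OF Do[OF CD]] by simp
    next
      fix C C' a assume C: "C \<in> ?Ds" "C' \<in> ?Ds" and a: "a \<in> hom_set T C C'"
      have Co: "C \<in> obj T" "C' \<in> obj T" using C sub Do by blast+
      note Sa = SM_in[OF Co a, of ?m]
      show "\<exists>h\<in>hom_set T (SO ?m C) (SO ?m C'). h \<cdot>\<^bsub>T\<^esub> idn T (SO ?m C) = idn T (SO ?m C') \<cdot>\<^bsub>T\<^esub> SM ?m a \<and>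
          (\<forall>c\<in>carrier (fobj F C'). fmap ?L h (\<psi> (SO ?m C') ?m ?u c) = \<psi> (SO ?m C) ?m ?u (fmap F a c))"
      proof (intro bexI[OF _ Sa] conjI ballI)
        show "SM ?m a \<cdot>\<^bsub>T\<^esub> idn T (SO ?m C) = idn T (SO ?m C') \<cdot>\<^bsub>T\<^esub> SM ?m a"
          using idn_left[OF SO_in[OF Co(1)] SO_in[OF Co(2)] Sa] idn_right[OF SO_in[OF Co(1)] SO_in[OF Co(2)] Sa] by simp
        show "fmap ?L (SM ?m a) (\<psi> (SO ?m C') ?m ?u c) = \<psi> (SO ?m C) ?m ?u (fmap F a c)"
          if "c \<in> carrier (fobj F C')" for c
          using \<psi>nat[OF SO_in[OF Co(1)] SO_in[OF Co(2)] Sa u, of c] that bk(1)[OF Co(2)] bkm(1)[OF Co a] by simp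
      qed
    qed
    then show ?thesis by blast
  qed
  then have "\<forall>j\<in>?J. \<exists>\<alpha>. \<alpha> \<in> nat_trans T (shift T (fst j) ?Gs) ?GL \<and>
      (\<forall>X\<in>obj T. \<forall>C\<in>?Ds. \<forall>f\<in>hom_set T X C. \<forall>c\<in>carrier (fobj F C). \<alpha> (SO (fst j) X) (\<gamma>0 X C f c) =
        \<gamma>' (SO (fst j) X) (SO (fst j) C) (idn T (SO (fst j) C) \<cdot>\<^bsub>T\<^esub> SM (fst j) f) (\<psi> (SO (fst j) C) (fst j) (snd j) c))"
    by (intro ballI)
  from bchoice[OF this] obtain \<alpha> where \<alpha>: "\<forall>j\<in>?J. \<alpha> j \<in> nat_trans T (shift T (fst j) ?Gs) ?GL \<and>
      (\<forall>X\<in>obj T. \<forall>C\<in>?Ds. \<forall>f\<in>hom_set T X C. \<forall>c\<in>carrier (fobj F C). \<alpha> j (SO (fst j) X) (\<gamma>0 X C f c) =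
        \<gamma>' (SO (fst j) X) (SO (fst j) C) (idn T (SO (fst j) C) \<cdot>\<^bsub>T\<^esub> SM (fst j) f) (\<psi> (SO (fst j) C) (fst j) (snd j) c))"
    by (elim exE)
  show ?thesis
  proof (rule localising_quotient[OF inf loc degree_index_small])
    fix j assume j: "j \<in> ?J"
    show "shift T (fst j) ?Gs \<in> \<C>" using localising_shift[OF loc good_GammaD[OF D0 F gs]] .
    show "\<alpha> j \<in> nat_trans T (shift T (fst j) ?Gs) ?GL" using \<alpha>[rule_format, OF j] by (elim conjE)
  next
    show "?GL \<in> Coh T" using Gamma_Coh[OF D LC g'] .
  next
    fix X z assume X: "X \<in> obj T" and z: "z \<in> carrier (fobj ?GL X)"
    obtain C f y where C: "C \<in> ?D" and f: "f \<in> hom_set T X C" and y: "y \<in> carrier (fobj ?L C)" and zy: "z = \<gamma>' X C f y"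
      using Gamma_surj[OF D LC g' X z] by blast
    note Co = Do[OF C]
    obtain m0 u0 c where u0: "u0 \<in> A m0 - q" and c: "c \<in> carrier (fobj F (SO (- m0) C))" and yc: "y = \<psi> C m0 u0 c"
      using lo[unfolded is_localisation_def, THEN conjunct2, THEN conjunct2, THEN conjunct1, rule_format, OF Co y] by blast
    let ?C = "SO (- m0) C"
    have C1: "?C \<in> ?D" using thick_SO[OF D C] .
    note C1o = Do[OF C1]
    have "?C \<in> objsupp (genideal R B)" using C1 objsupp_genideal[OF subset_trans[OF B homog_carrier]] by simp
    then have "?C \<in> objsupp {s \<otimes>\<^bsub>R\<^esub> r}" using sr unfolding objsupp_def by blast
    then have "nil ?C (e + d) (s \<otimes>\<^bsub>R\<^esub> r)" using objsupp_degree[OF mult_degree[OF s r]] by blast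
    from kills_mult_power[OF s r C1o this] obtain n :: nat
      where n: "kills ?C (int n * e + int n * d) (s [^]\<^bsub>R\<^esub> n \<otimes>\<^bsub>R\<^esub> r [^]\<^bsub>R\<^esub> n)" by blast
    let ?e = "int n * e" and ?d = "int n * d" and ?s = "s [^]\<^bsub>R\<^esub> n" and ?t = "r [^]\<^bsub>R\<^esub> n"
    have sA: "?s \<in> A ?e" and tA: "?t \<in> A ?d" using power_degree[OF s] power_degree[OF r] by simp_all
    have tq: "?t \<notin> q"
    proof (induction n)
      case 0 then show ?case using q(1) by simp
    next
      case (Suc n) then show ?case using q(2)[OF power_degree[OF r] _ r rq] by simp
    qed
    let ?E = "SO (- ?d) ?C"
    have E: "?E \<in> ?D" using thick_SO[OF D C1] .
    note Eo = Do[OF E]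
    obtain W i v where dw: "dtri (SO (- ?e) ?E) ?E W (rh ?e ?s ?E) i v"
      using dtri_cone[OF SO_in[OF Eo] Eo rho_in[OF sA Eo]] .
    have i: "i \<in> hom_set T ?E W" and Wo: "W \<in> obj T" using dw by (simp_all add: dtri_def)
    have "W \<in> objsupp (insert ?s B)" using cone_objsupp[OF B sA E dw] .
    then have W: "W \<in> ?Ds" using objsupp_insert objsupp_power_subset[OF degree_carrier[OF s], of n] by blast
    then have WD: "W \<in> ?D" using sub by blast
    have "rh ?d ?t ?C \<cdot>\<^bsub>T\<^esub> rh ?e ?s ?E = zer (SO (- (?e + ?d)) ?C) ?C"
      using n rho_mult'[OF sA tA C1o] by (simp add: kills_def)
    moreover have "SO (- (?e + ?d)) ?C = SO (- ?e) ?E" using C1o by (simp add: SO_SO[OF C1o] del: SO_SO)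
    ultimately have "rh ?d ?t ?C \<cdot>\<^bsub>T\<^esub> rh ?e ?s ?E = zer (SO (- ?e) ?E) ?C" by simp
    \<comment> \<open>The action of the power of \<open>r\<close> vanishes after that of the power
      of \<open>s\<close>, hence extends over the cone of the latter.\<close>
    then obtain g where g: "g \<in> hom_set T W ?C" and gi: "rh ?d ?t ?C = g \<cdot>\<^bsub>T\<^esub> i"
      using weak_cokernel[OF dw C1o rho_in[OF tA C1o]] by blast
    define m where "m = m0 + ?d"
    let ?u = "?t \<otimes>\<^bsub>R\<^esub> u0" and ?c = "fmap F g c"
    have u0A: "u0 \<in> A m0" "u0 \<notin> q" using u0 by auto
    have u: "?u \<in> A m - q" using mult_degree[OF tA u0A(1)] q(2)[OF tA tq u0A] by (simp add: m_def add.commute)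
    have c1: "?c \<in> carrier (fobj F W)" using af_closed[OF FA Wo C1o g c] .
    have Em: "?E = SO (- m) C" using SO_SO[OF Co, of "- ?d" "- m0"] by (simp add: m_def algebra_simps)
    note i' = i[unfolded Em]
    note SC = SO_in[OF Co, of "- m"] and SW = SO_in[OF Wo, of m]
    have Si: "SM m i \<in> hom_set T C (SO m W)" using SM_in[OF SC Wo i', of m] bk(2)[OF Co] by simp
    let ?y = "\<psi> (SO m W) m ?u ?c"
    have y1: "?y \<in> carrier (fobj ?L (SO m W))"
      using hom_in_carrier[OF \<psi>hom[OF SW u]] c1 bk(1)[OF Wo, of m] by simp
    have tq': "?t \<in> A ?d - q" using tA tq by simp
    \<comment> \<open>The fraction is expanded by the power of \<open>r\<close>; its new numerator
      is the pullback along \<open>i\<close> of a point \<open>?c\<close> of the cone, so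
      \<open>y\<close> itself is the pullback of a fraction over the suspended cone.\<close>
    have "y = \<psi> C m ?u (fmap F (rh ?d ?t ?C) c)" using yc \<psi>exp[OF Co u0 c tq'] by (simp add: m_def)
    also have "fmap F (rh ?d ?t ?C) c = fmap F i ?c" unfolding gi using af_cmp[OF FA Eo Wo C1o i g c] .
    also have "\<psi> C m ?u (fmap F i ?c) = fmap ?L (SM m i) ?y"
      using \<psi>nat[OF Co SW Si u, of ?c] c1 bk(1)[OF Wo, of m] bkm(1)[OF SC Wo i', of m] by simp
    finally have yy: "y = fmap ?L (SM m i) ?y" .
    have Sif: "SM m i \<cdot>\<^bsub>T\<^esub> f \<in> hom_set T X (SO m W)" using cmp_in[OF X Co SW f Si] .
    have zz: "z = \<gamma>' X (SO m W) (SM m i \<cdot>\<^bsub>T\<^esub> f) ?y"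
      using zy yy Gamma_dinatural[OF D LC g' X C thick_SO[OF D WD] f Si y1] by simp
    \<comment> \<open>Shifting back by \<open>m\<close>, since the map for the denominator
      \<open>?u\<close> is evaluated on classes over the desuspended object.\<close>
    let ?f = "SM (- m) (SM m i \<cdot>\<^bsub>T\<^esub> f)"
    note SX = SO_in[OF X, of "- m"]
    have f0: "?f \<in> hom_set T (SO (- m) X) W" using SM_in[OF X SW Sif, of "- m"] bk(1)[OF Wo, of m] by simp
    have j: "(m, ?u) \<in> ?J" using u by simp
    have "\<alpha> (m, ?u) X (\<gamma>0 (SO (- m) X) W ?f ?c) = z"
      using \<alpha>[rule_format, OF j, THEN conjunct2, rule_format, OF SX W f0 c1] bk(2)[OF X, of m]
        bkm(2)[OF X SW Sif, of m] idn_left[OF X SW Sif] zz by simp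
    moreover have "\<gamma>0 (SO (- m) X) W ?f ?c \<in> carrier (fobj (shift T m ?Gs) X)"
      using hom_in_carrier[OF Gamma_hom_point[OF D0 F g0 SX W f0] c1] by simp
    ultimately show "\<exists>j\<in>?J. \<exists>y\<in>carrier (fobj (shift T (fst j) ?Gs) X). z = \<alpha> j X y"
      using j by (intro bexI[where x = "(m, ?u)"] bexI[where x = "\<gamma>0 (SO (- m) X) W ?f ?c"]) simp_all
  qed
qed

text \<open>An element of the kernel of \<open>i\<^sup>*i\<^sub>*F \<rightarrow> j\<^sup>*j\<^sub>*F\<close>, where \<open>i\<close> is the inclusion of the objects supported on
  \<open>B \<union> {r}\<close> and \<open>j\<close> of those supported on \<open>B\<close>, comes from a power of \<open>r\<close> acting on an object
  supported on \<open>B\<close>; the maps below are connecting maps of the resulting triangles.\<close>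

lemma good_insert:
  assumes F: "F \<in> Coh T" and B: "B \<subseteq> homog" and r: "r \<in> A d0" and GC: "GammaD (objsupp B) F \<in> \<C>"
  shows "good (objsupp (insert r B)) F"
  unfolding good_def
proof (intro allI impI)
  let ?D = "objsupp B" and ?D' = "objsupp (insert r B)"
  let ?G = "GammaD ?D F"
  fix G' :: "('o, 'm, 'a) presheaf" and \<gamma>' assume g': "is_Gamma ?D' F G' \<gamma>'"
  note D = thick_objsupp[OF noeth B]
  note Do = thick_obj[OF D]
  note FA = Coh_additive[OF F]
  have B': "insert r B \<subseteq> homog" using B r by (auto simp: homog_def)
  note D' = thick_objsupp[OF noeth B']
  note Do' = thick_obj[OF D']
  have sub: "?D' \<subseteq> ?D" using objsupp_insert by blast
  obtain \<gamma> where g: "is_Gamma ?D F ?G \<gamma>" using GammaD_exists[OF D F inf ess] by blast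
  have "\<exists>\<beta>\<in>nat_trans T G' ?G. \<forall>X\<in>obj T. \<forall>C\<in>?D'. \<forall>f\<in>hom_set T X C. \<forall>c\<in>carrier (fobj F C).
      \<beta> X (\<gamma>' X C f c) = \<gamma> X C f c"
    by (rule Gamma_map_0[OF D' F g' D F g sub]) simp_all
  then obtain \<beta> where b: "\<beta> \<in> nat_trans T G' ?G" and
    be: "\<forall>X\<in>obj T. \<forall>C\<in>?D'. \<forall>f\<in>hom_set T X C. \<forall>c\<in>carrier (fobj F C). \<beta> X (\<gamma>' X C f c) = \<gamma> X C f c"
    by (elim bexE)
  define dg where "dg = (\<lambda>n::nat. int n * d0)"
  define pw where "pw = (\<lambda>n::nat. r [^]\<^bsub>R\<^esub> n)"
  have pA: "pw n \<in> A (dg n)" for n using power_degree[OF r] by (simp add: pw_def dg_def)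
  \<comment> \<open>The shift by \<open>-1\<close> makes the last map of the triangle end in
    \<open>C\<close> itself, so a point of \<open>F\<close> on \<open>C\<close> can be pulled back
    along it. One triangle is fixed for every exponent and every object.\<close>
  have "\<exists>x. dtri (SO (- 1) C) (SO (dg n - 1) C) (fst x) (rh (dg n) (pw n) (SO (dg n - 1) C)) (fst (snd x)) (snd (snd x))"
    if C: "C \<in> obj T" for n C
  proof -
    note E = SO_in[OF C, of "dg n - 1"]
    have "SO (- dg n) (SO (dg n - 1) C) = SO (- 1) C" using SO_SO[OF C, of "- dg n" "dg n - 1"] by simp
    then have "rh (dg n) (pw n) (SO (dg n - 1) C) \<in> hom_set T (SO (- 1) C) (SO (dg n - 1) C)"
      using rho_in[OF pA E, of n] by simp
    then obtain W i j where "dtri (SO (- 1) C) (SO (dg n - 1) C) W (rh (dg n) (pw n) (SO (dg n - 1) C)) i j"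
      using dtri_cone[OF SO_in[OF C] E] by blast
    then show ?thesis by (intro exI[where x = "(W, i, j)"]) simp
  qed
  then have "\<forall>n. \<forall>C\<in>obj T. \<exists>x. dtri (SO (- 1) C) (SO (dg n - 1) C) (fst x)
    (rh (dg n) (pw n) (SO (dg n - 1) C)) (fst (snd x)) (snd (snd x))" by blast
  then obtain tr where tr: "\<And>n C. C \<in> obj T \<Longrightarrow> dtri (SO (- 1) C) (SO (dg n - 1) C) (fst (tr n C))
    (rh (dg n) (pw n) (SO (dg n - 1) C)) (fst (snd (tr n C))) (snd (snd (tr n C)))" by metis
  define W where "W = (\<lambda>n C. fst (tr n C))"
  define i where "i = (\<lambda>n C. fst (snd (tr n C)))"
  define j where "j = (\<lambda>n C. snd (snd (tr n C)))"
  have t: "dtri (SO (- 1) C) (SO (dg n - 1) C) (W n C) (rh (dg n) (pw n) (SO (dg n - 1) C)) (i n C) (j n C)"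
    if "C \<in> obj T" for n C using tr[OF that] by (simp add: W_def i_def j_def)
  have up: "susp_obj T (SO (- 1) C) = C" if "C \<in> obj T" for C using SO_succ[OF that, of "- 1"] by simp
  have down: "SO (- dg n) (SO (dg n - 1) C) = SO (- 1) C" if "C \<in> obj T" for n C
    using SO_SO[OF that, of "- dg n" "dg n - 1"] by simp
  have Wo: "W n C \<in> obj T" and i: "i n C \<in> hom_set T (SO (dg n - 1) C) (W n C)" and j: "j n C \<in> hom_set T (W n C) C"
    if "C \<in> obj T" for n C
    using t[OF that, of n] up[OF that] by (simp_all add: dtri_def)
  have ji: "j n C \<cdot>\<^bsub>T\<^esub> i n C = zer (SO (dg n - 1) C) C" if "C \<in> obj T" for n C
    using dtri_comp_zer[OF dtri_rotate[OF t[OF that, of n]]] up[OF that] by simp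
  have WD': "W n C \<in> ?D'" if C: "C \<in> ?D" for n C
  proof -
    have "W n C \<in> objsupp (insert (pw n) B)"
      by (rule cone_objsupp[OF B pA thick_SO[OF D C, of "dg n - 1"], where i = "i n C" and j = "j n C"])
        (use t[OF Do[OF C], of n] down[OF Do[OF C]] in simp)
    then show ?thesis
      using objsupp_insert objsupp_power_subset[OF degree_carrier[OF r], of n] unfolding pw_def by blast
  qed
  have "\<exists>\<alpha>\<in>nat_trans T (shift T (dg n - 1) ?G) G'. \<forall>X\<in>obj T. \<forall>C\<in>?D. \<forall>f\<in>hom_set T X C. \<forall>c\<in>carrier (fobj F C).
      \<alpha> (SO (dg n - 1) X) (\<gamma> X C f c) =
        \<gamma>' (SO (dg n - 1) X) (W n C) (i n C \<cdot>\<^bsub>T\<^esub> SM (dg n - 1) f) (fmap F (j n C) c)" for n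
  proof (rule Gamma_map[OF D F g D' F g'])
    fix C assume C: "C \<in> ?D"
    note Co = Do[OF C]
    show "W n C \<in> ?D'" using WD'[OF C] .
    show "i n C \<in> hom_set T (SO (dg n - 1) C) (W n C)" using i[OF Co] .
    show "fmap F (j n C) c \<in> carrier (fobj F (W n C))" if "c \<in> carrier (fobj F C)" for c
      using af_closed[OF FA Wo[OF Co] Co j[OF Co] that] .
  next
    fix C C' a assume C: "C \<in> ?D" "C' \<in> ?D" and a: "a \<in> hom_set T C C'"
    note Co = Do[OF C(1)] Do[OF C(2)]
    note S1 = SM_in[OF Co a, of "- 1"] and Sd = SM_in[OF Co a, of "dg n - 1"]
    have "SM (dg n - 1) a \<cdot>\<^bsub>T\<^esub> rh (dg n) (pw n) (SO (dg n - 1) C) =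
        rh (dg n) (pw n) (SO (dg n - 1) C') \<cdot>\<^bsub>T\<^esub> SM (- 1) a"
      using rho_natural[OF pA SO_in[OF Co(1)] SO_in[OF Co(2)] Sd] SM_SM[OF a Co, of "- dg n" "dg n - 1"] by simp
    from dtri_fill[OF t[OF Co(1), of n] t[OF Co(2), of n] S1 Sd this]
    obtain h where h: "h \<in> hom_set T (W n C) (W n C')" "h \<cdot>\<^bsub>T\<^esub> i n C = i n C' \<cdot>\<^bsub>T\<^esub> SM (dg n - 1) a"
      \<comment> \<open>This equation is responsible for the compatibility of the points, the one
        before it for that of the morphisms; the cone is only weakly functorial, and that is
        enough.\<close>
      "susp_mor T (SM (- 1) a) \<cdot>\<^bsub>T\<^esub> j n C = j n C' \<cdot>\<^bsub>T\<^esub> h" .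
    have aj: "a \<cdot>\<^bsub>T\<^esub> j n C = j n C' \<cdot>\<^bsub>T\<^esub> h" using h(3) SM_succ[OF Co a, of "- 1"] by simp
    have "fmap F h (fmap F (j n C') c) = fmap F (j n C) (fmap F a c)" if c: "c \<in> carrier (fobj F C')" for c
      using af_cmp[OF FA Wo[OF Co(1)] Wo[OF Co(2)] Co(2) h(1) j[OF Co(2)] c]
        af_cmp[OF FA Wo[OF Co(1)] Co j[OF Co(1)] a c, of n] aj by simp
    then show "\<exists>h\<in>hom_set T (W n C) (W n C'). h \<cdot>\<^bsub>T\<^esub> i n C = i n C' \<cdot>\<^bsub>T\<^esub> SM (dg n - 1) a \<and>
        (\<forall>c\<in>carrier (fobj F C'). fmap F h (fmap F (j n C') c) = fmap F (j n C) (fmap F a c))"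
      using h(1,2) by (intro bexI[where x = h] conjI ballI)
  qed
  then have "\<forall>n. \<exists>\<alpha>. \<alpha> \<in> nat_trans T (shift T (dg n - 1) ?G) G' \<and>
      (\<forall>X\<in>obj T. \<forall>C\<in>?D. \<forall>f\<in>hom_set T X C. \<forall>c\<in>carrier (fobj F C). \<alpha> (SO (dg n - 1) X) (\<gamma> X C f c) =
        \<gamma>' (SO (dg n - 1) X) (W n C) (i n C \<cdot>\<^bsub>T\<^esub> SM (dg n - 1) f) (fmap F (j n C) c))" unfolding Bex_def by (intro allI)
  from choice[OF this] obtain \<alpha> where \<alpha>: "\<forall>n. \<alpha> n \<in> nat_trans T (shift T (dg n - 1) ?G) G' \<and>
      (\<forall>X\<in>obj T. \<forall>C\<in>?D. \<forall>f\<in>hom_set T X C. \<forall>c\<in>carrier (fobj F C). \<alpha> n (SO (dg n - 1) X) (\<gamma> X C f c) =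
        \<gamma>' (SO (dg n - 1) X) (W n C) (i n C \<cdot>\<^bsub>T\<^esub> SM (dg n - 1) f) (fmap F (j n C) c))" by (elim exE)
  note \<alpha>e = \<alpha>[rule_format, THEN conjunct2, rule_format]
  show "G' \<in> \<C>"
  proof (rule localising_extension[OF inf loc])
    show "(UNIV :: nat set) \<lesssim> (UNIV :: 'a set)" using inf infinite_le_lepoll by blast
  next
    fix n :: nat
    show "shift T (dg n - 1) ?G \<in> \<C>" using localising_shift[OF loc GC] .
    show "\<alpha> n \<in> nat_trans T (shift T (dg n - 1) ?G) G'" using \<alpha>[rule_format, of n] by (elim conjE)
    fix X x assume X: "X \<in> obj T" and x: "x \<in> carrier (fobj (shift T (dg n - 1) ?G) X)"
    let ?k = "dg n - 1"
    let ?Y = "SO (- ?k) X"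
    have Y: "?Y \<in> obj T" and YX: "SO ?k ?Y = X" using X SO_SO[OF X, of ?k "- ?k"] by simp_all
    have "x \<in> carrier (fobj ?G ?Y)" using x by simp
    then obtain C f c where C: "C \<in> ?D" and f: "f \<in> hom_set T ?Y C" and c: "c \<in> carrier (fobj F C)" and xe: "x = \<gamma> ?Y C f c"
      using Gamma_surj[OF D F g Y] by blast
    note Co = Do[OF C]
    have Sf: "SM ?k f \<in> hom_set T X (SO ?k C)" using SM_in[OF Y Co f, of ?k] YX by simp
    have iSf: "i n C \<cdot>\<^bsub>T\<^esub> SM ?k f \<in> hom_set T X (W n C)" using cmp_in[OF X SO_in[OF Co] Wo[OF Co] Sf i[OF Co]] .
    have jc: "fmap F (j n C) c \<in> carrier (fobj F (W n C))" using af_closed[OF FA Wo[OF Co] Co j[OF Co] c] .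
    have WD: "W n C \<in> ?D" using WD'[OF C] sub by blast
    have "\<beta> X (\<alpha> n X x) = \<gamma> X (W n C) (i n C \<cdot>\<^bsub>T\<^esub> SM ?k f) (fmap F (j n C) c)"
      using \<alpha>e[OF Y C f c, of n] YX xe be[rule_format, OF X WD'[OF C] iSf jc] by simp
    also have "\<dots> = \<gamma> X C (j n C \<cdot>\<^bsub>T\<^esub> (i n C \<cdot>\<^bsub>T\<^esub> SM ?k f)) c"
      using Gamma_dinatural[OF D F g X WD C iSf j[OF Co] c] by simp
    \<comment> \<open>Consecutive maps of the rotated triangle compose to zero, which makes the
      composite with \<open>\<beta>\<close> vanish.\<close>
    also have "j n C \<cdot>\<^bsub>T\<^esub> (i n C \<cdot>\<^bsub>T\<^esub> SM ?k f) = zer X C"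
      using cmp_assoc[OF X SO_in[OF Co] Wo[OF Co] Co Sf i[OF Co] j[OF Co]] ji[OF Co, of n]
        cmp_zer_left[OF X SO_in[OF Co] Co Sf] by simp
    also have "\<gamma> X C (zer X C) c = \<one>\<^bsub>fobj ?G X\<^esub>"
      using hom_one[OF Gamma_hom[OF D F g X C c] hom_grp[OF X Co] af_group[OF Gamma_additive[OF D F g] X]] .
    finally show "\<beta> X (\<alpha> n X x) = \<one>\<^bsub>fobj ?G X\<^esub>" .
  next
    show "G' \<in> Coh T" using Gamma_Coh[OF D' F g'] .
    show "?G \<in> \<C>" using GC .
    show "\<beta> \<in> nat_trans T G' ?G" using b .
  next
    fix X x assume X: "X \<in> obj T" and x: "x \<in> carrier (fobj G' X)" and bx: "\<beta> X x = \<one>\<^bsub>fobj ?G X\<^esub>"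
    obtain C f c where C': "C \<in> ?D'" and f: "f \<in> hom_set T X C" and c: "c \<in> carrier (fobj F C)" and xe: "x = \<gamma>' X C f c"
      using Gamma_surj[OF D' F g' X x] by blast
    have C: "C \<in> ?D" using C' sub by blast
    note Co = Do[OF C]
    have "\<gamma> X C f c = \<one>\<^bsub>fobj ?G X\<^esub>" using bx xe be[rule_format, OF X C' f c] by simp
    from Gamma_zero[OF D F g X C f c this] obtain B0 a b where B0: "B0 \<in> ?D" and a: "a \<in> hom_set T C B0"
      and b: "b \<in> carrier (fobj F B0)" and af: "a \<cdot>\<^bsub>T\<^esub> f = zer X B0" and cb: "c = fmap F a b"
      by blast
    note B0o = Do[OF B0]
    obtain E e v where d: "dtri E C B0 e a v" using dtri_fibre[OF Co B0o a] .
    have E: "E \<in> ?D" using thick_fibre[OF D d C B0] .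
    note Eo = Do[OF E]
    have e: "e \<in> hom_set T E C" using d by (simp add: dtri_def)
    obtain f' where f': "f' \<in> hom_set T X E" "f = e \<cdot>\<^bsub>T\<^esub> f'" using weak_kernel[OF d X f af] .
    have ec: "fmap F e c = \<one>\<^bsub>fobj F E\<^esub>"
      using af_cmp[OF FA Eo Co B0o e a b] dtri_comp_zer[OF d] af_zer[OF FA Eo B0o b] cb by simp
    have "C \<in> objsupp {r}" using C' objsupp_insert by blast
    then obtain n where n: "kills C (dg n) (pw n)"
      using objsupp_degree[OF r, of C] by (auto simp: nil_def dg_def pw_def)
    let ?k = "dg n - 1"
    \<comment> \<open>Chosen so that the triangle fixed for \<open>C0\<close> has the object
      \<open>E\<close> as its middle term.\<close>
    define C0 where "C0 = SO (- ?k) E"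
    have C0D: "C0 \<in> ?D" using thick_SO[OF D E] by (simp add: C0_def)
    note C0o = Do[OF C0D]
    have EC0: "SO ?k C0 = E" unfolding C0_def using SO_SO[OF Eo, of ?k "- ?k"] by simp
    note tC = t[OF C0o, of n, unfolded EC0]
    have "e \<cdot>\<^bsub>T\<^esub> rh (dg n) (pw n) E = zer (SO (- dg n) E) C"
      using rho_natural[OF pA Eo Co e, of n] n cmp_zer_left[OF SO_in[OF Eo] SO_in[OF Co] Co SM_in[OF Eo Co e, of "- dg n"]]
      by (simp add: kills_def)
    moreover have "SO (- dg n) E = SO (- 1) C0" using down[OF C0o, of n] EC0 by simp
    ultimately have "e \<cdot>\<^bsub>T\<^esub> rh (dg n) (pw n) E = zer (SO (- 1) C0) C" by simp
    \<comment> \<open>As \<open>C\<close> is killed by this power of \<open>r\<close>, naturality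
      makes \<open>e\<close> vanish after the action on \<open>E\<close>, so \<open>e\<close>
      extends over the cone.\<close>
    then obtain q where q: "q \<in> hom_set T (W n C0) C" and qi: "e = q \<cdot>\<^bsub>T\<^esub> i n C0"
      using weak_cokernel[OF tC Co e] by blast
    have iE: "i n C0 \<in> hom_set T E (W n C0)" using i[OF C0o, of n] EC0 by simp
    have qc: "fmap F q c \<in> carrier (fobj F (W n C0))" using af_closed[OF FA Wo[OF C0o] Co q c] .
    have "fmap F (i n C0) (fmap F q c) = \<one>\<^bsub>fobj F E\<^esub>" using af_cmp[OF FA Eo Wo[OF C0o] Co iE q c] qi ec by simp
    moreover have "exact_pair E (W n C0) C0 (i n C0) (j n C0)"
      using dtri_exact_pair[OF dtri_rotate[OF tC]] up[OF C0o] by simp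
    \<comment> \<open>The point of the cone restricts to zero on \<open>E\<close>, hence comes from
      the next term \<open>C0\<close>. So the class has the form produced by the connecting map
      \<open>\<alpha> n\<close>.\<close>
    ultimately obtain b' where b': "b' \<in> carrier (fobj F C0)" "fmap F q c = fmap F (j n C0) b'"
      using Coh_exact_pair[OF F Eo Wo[OF C0o] C0o _ qc] by blast
    have if': "i n C0 \<cdot>\<^bsub>T\<^esub> f' \<in> hom_set T X (W n C0)" using cmp_in[OF X Eo Wo[OF C0o] f'(1) iE] .
    have "f = q \<cdot>\<^bsub>T\<^esub> (i n C0 \<cdot>\<^bsub>T\<^esub> f')" using f'(2) qi cmp_assoc[OF X Eo Wo[OF C0o] Co f'(1) iE q] by simp
    then have xx: "x = \<gamma>' X (W n C0) (i n C0 \<cdot>\<^bsub>T\<^esub> f') (fmap F (j n C0) b')"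
      using xe Gamma_dinatural[OF D' F g' X WD'[OF C0D] C' if' q c] b'(2) by simp
    let ?Y = "SO (- ?k) X"
    have Y: "?Y \<in> obj T" and YX: "SO ?k ?Y = X" using X SO_SO[OF X, of ?k "- ?k"] by simp_all
    have f0: "SM (- ?k) f' \<in> hom_set T ?Y C0" using SM_in[OF X Eo f'(1), of "- ?k"] by (simp add: C0_def)
    have ff: "SM ?k (SM (- ?k) f') = f'" using SM_SM[OF f'(1) X Eo, of ?k "- ?k"] by simp
    have "\<alpha> n X (\<gamma> ?Y C0 (SM (- ?k) f') b') = x" using \<alpha>e[OF Y C0D f0 b'(1), of n] YX ff xx by simp
    moreover have "\<gamma> ?Y C0 (SM (- ?k) f') b' \<in> carrier (fobj (shift T ?k ?G) X)"
      using hom_in_carrier[OF Gamma_hom_point[OF D F g Y C0D f0] b'(1)] by simp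
    ultimately show "\<exists>n\<in>UNIV. \<exists>y\<in>carrier (fobj (shift T (dg n - 1) ?G) X). x = \<alpha> n X y"
      by (intro bexI[where x = n] bexI[where x = "\<gamma> ?Y C0 (SM (- ?k) f') b'"]) simp_all
  qed
qed

lemma objsupp_empty: "objsupp {} = obj T"
  by (auto simp: objsupp_def)

text \<open>The generators are imposed one at a time. Without any of them the subcategory is all of
  \<open>T\<close>, where every functor fitting the description is a quotient of
  \<open>F\<close>.\<close>

lemma good_finite:
  assumes F: "F \<in> \<C>" and B: "finite B" "B \<subseteq> homog"
  shows "good (objsupp B) F"
  using B
proof (induction B rule: finite_induct)
  case empty
  note FC = localising_Coh[OF loc F]
  note D = thick_full
  note F0 = full_is_Gamma[OF FC]
  show ?case
    unfolding good_def objsupp_empty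
  proof (intro allI impI)
    fix G :: "('o, 'm, 'a) presheaf" and \<gamma> assume g: "is_Gamma (obj T) F G \<gamma>"
    have "\<exists>\<beta>\<in>nat_trans T F G. \<forall>X\<in>obj T. \<forall>C\<in>obj T. \<forall>f\<in>hom_set T X C. \<forall>c\<in>carrier (fobj F C).
        \<beta> X (fmap F f c) = \<gamma> X C f c"
      by (rule Gamma_map_0[OF D FC F0 D FC g subset_refl]) simp_all
    then obtain \<beta> where b: "\<beta> \<in> nat_trans T F G" and
      be: "\<forall>X\<in>obj T. \<forall>C\<in>obj T. \<forall>f\<in>hom_set T X C. \<forall>c\<in>carrier (fobj F C). \<beta> X (fmap F f c) = \<gamma> X C f c"
      by (elim bexE)
    show "G \<in> \<C>"
    proof (rule localising_quotient[OF inf loc])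
      show "{()} \<lesssim> (UNIV :: 'a set)" by (auto simp: lepoll_def inj_on_def)
      show "F \<in> \<C>" by fact
      show "G \<in> Coh T" using Gamma_Coh[OF D FC g] .
      show "\<beta> \<in> nat_trans T F G" by fact
      fix X x assume X: "X \<in> obj T" and x: "x \<in> carrier (fobj G X)"
      obtain C f c where C: "C \<in> obj T" "f \<in> hom_set T X C" "c \<in> carrier (fobj F C)" "x = \<gamma> X C f c"
        using Gamma_surj[OF D FC g X x] by blast
      have "fmap F f c \<in> carrier (fobj F X)" using af_closed[OF Coh_additive[OF FC] X C(1-3)] .
      then show "\<exists>j\<in>{()}. \<exists>y\<in>carrier (fobj F X). x = \<beta> X y" using be[rule_format, OF X C(1-3)] C(4)
        by (intro bexI[where x = "()"] bexI[where x = "fmap F f c"]) simp_all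
    qed
  qed
next
  case (insert r B)
  note FC = localising_Coh[OF loc F]
  have B: "B \<subseteq> homog" using insert.prems by blast
  obtain d where r: "r \<in> A d" using insert.prems by (auto simp: homog_def)
  show ?case
    using good_insert[OF FC B r good_GammaD[OF thick_objsupp[OF noeth B] FC insert.IH[OF B]]] .
qed

lemma objsupp_generators:
  assumes p: "p \<in> Spec R A"
  obtains B where "finite B" "B \<subseteq> homog" "objsupp p = objsupp B"
proof -
  obtain B where B: "finite B" "B \<subseteq> homog" "B \<subseteq> p" "\<And>I. \<lbrakk>ideal I R; B \<subseteq> I\<rbrakk> \<Longrightarrow> p \<subseteq> I"
    using homogeneous_generators[OF noeth prime_ideal(2)[OF p]] by metis
  have "objsupp p = objsupp B" using B(3) B(4)[OF prime_ideal(1)] unfolding objsupp_def by blast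
  with B(1,2) show ?thesis by (rule that)
qed

lemma Gamma_GammaD:
  assumes p: "p \<in> Spec R A"
  shows "Gamma R A T \<phi> p F = GammaD (objsupp p) (localise R A T \<phi> p F)"
  by (simp add: Gamma_def Gamma_supp_def GammaD_def supported_subcat_eq[OF p])

lemma prime_multiplicative:
  "\<lbrakk>p \<in> Spec R A; r \<in> A d; r \<notin> p; s \<in> A e; s \<notin> p\<rbrakk> \<Longrightarrow> r \<otimes>\<^bsub>R\<^esub> s \<notin> p"
  using prime_ideal(5) degree_carrier by metis

lemma localise_prime_closed:
  assumes "F \<in> \<C>" and p: "p \<in> Spec R A" shows "localise R A T \<phi> p F \<in> \<C>"
  by (rule localisation_closed[OF assms(1) prime_ideal(3)[OF p]])
    (rule prime_multiplicative[OF p])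

lemma Gamma_closed:
  assumes L: "localise R A T \<phi> p F \<in> \<C>" and p: "p \<in> Spec R A"
  shows "Gamma R A T \<phi> p F \<in> \<C>"
proof -
  obtain B where B: "finite B" "B \<subseteq> homog" and eq: "objsupp p = objsupp B" using objsupp_generators[OF p] .
  show ?thesis
    unfolding Gamma_GammaD[OF p] eq
    by (rule good_GammaD[OF thick_objsupp[OF noeth B(2)] localising_Coh[OF loc L] good_finite[OF L B]])
qed

text \<open>Noetherian induction on the ideal generated by \<open>B\<close>: if it is not prime, \<open>sr\<close> belonging to it,
  one inverts \<open>r\<close>, which makes objects supported on \<open>B\<close> supported on \<open>s\<close>.\<close>

lemma good_all:
  assumes F: "F \<in> Coh T" and G: "\<And>p. p \<in> Spec R A \<Longrightarrow> Gamma R A T \<phi> p F \<in> \<C>" and B0: "B0 \<subseteq> homog"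
  shows "good (objsupp B0) F"
proof (rule ccontr)
  let ?I = "{genideal R B | B. B \<subseteq> homog \<and> \<not> good (objsupp B) F}"
  assume "\<not> good (objsupp B0) F"
  then have ne: "?I \<noteq> {}" using B0 by blast
  have id: "ideal I R" if "I \<in> ?I" for I
    using that genideal_ideal homog_carrier by blast
  obtain M where M: "M \<in> ?I" and max: "\<forall>I. I \<in> ?I \<longrightarrow> M \<subseteq> I \<longrightarrow> I = M"
  proof (rule maximal_ideal_exists[OF noeth ne id])
    fix M assume "M \<in> ?I" "\<And>I. \<lbrakk>I \<in> ?I; M \<subseteq> I\<rbrakk> \<Longrightarrow> I = M"
    then show thesis by (intro that allI impI)
  qed
  from M obtain B where MB: "M = genideal R B" and B: "B \<subseteq> homog" and bad: "\<not> good (objsupp B) F" by blast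
  have Bc: "B \<subseteq> carrier R" using B homog_carrier by blast
  have supp: "objsupp M = objsupp B" unfolding MB by (rule objsupp_genideal[OF Bc])
  \<comment> \<open>Otherwise the enlarged set would generate a member of the family that contains
    \<open>M\<close> strictly.\<close>
  have ins: "good (objsupp (insert w B)) F" if w: "w \<in> A k" "w \<notin> M" for w k
  proof (rule ccontr)
    assume n: "\<not> good (objsupp (insert w B)) F"
    have h: "insert w B \<subseteq> homog" using B w by (auto simp: homog_def)
    then have c: "insert w B \<subseteq> carrier R" using homog_carrier by blast
    have "M \<subseteq> genideal R (insert w B)"
      unfolding MB using genideal_minimal[OF genideal_ideal[OF c]] genideal_self[OF c] by blast
    then have "genideal R (insert w B) = M" using max n h by blast
    then show False using genideal_self[OF c] w by blast
  qed
  have one: "\<one>\<^bsub>R\<^esub> \<notin> M" using bad good_unit[OF B _ F] MB by blast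
  show False
  proof (cases "\<exists>s e r d. s \<in> A e \<and> r \<in> A d \<and> s \<otimes>\<^bsub>R\<^esub> r \<in> M \<and> s \<notin> M \<and> r \<notin> M")
    \<comment> \<open>Now \<open>M\<close> is prime and \<open>objsupp B\<close> is the subcategory
      in the definition of local cohomology at \<open>M\<close>. The hypothesis covers the localised
      term, and maximality covers each \<open>w\<close> outside \<open>M\<close>.\<close>
    case False
    have p: "M \<in> Spec R A"
      by (rule homogeneous_prime[OF _ one]) (use False genideal_homogeneous[OF B] MB in blast)+
    have "good (objsupp B) F"
    proof (rule good_localisation_kernel[OF F B prime_ideal(3)[OF p] prime_multiplicative[OF p]])
      show "GammaD (objsupp B) (localise R A T \<phi> M F) \<in> \<C>" using G[OF p] Gamma_GammaD[OF p, of F] supp by simp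
      show "good (objsupp (insert w B)) F" if "w \<in> A k - M" for k w using ins that by blast
    qed
    then show False using bad by contradiction
  next
    case True
    then obtain s e r d where s: "s \<in> A e" "s \<notin> M" and r: "r \<in> A d" "r \<notin> M" and sr: "s \<otimes>\<^bsub>R\<^esub> r \<in> M" by blast
    note rc = degree_carrier[OF r(1)]
    \<comment> \<open>Localisation is taken with respect to the complement of a set, so inverting
      the powers of \<open>r\<close> means removing them from the carrier. This \<open>q\<close> is
      a mere set with multiplicative complement.\<close>
    define q where "q = carrier R - range (\<lambda>n::nat. r [^]\<^bsub>R\<^esub> n)"
    have q1: "\<one>\<^bsub>R\<^esub> \<notin> q" unfolding q_def using nat_pow_0[of r] by (metis DiffD2 rangeI)
    have rq: "r \<notin> q" unfolding q_def using nat_pow_eone[OF rc] by (metis DiffD2 rangeI)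
    have pw: "\<exists>n::nat. x = r [^]\<^bsub>R\<^esub> n" if "x \<in> A k" "x \<notin> q" for x k
      using that degree_carrier unfolding q_def by blast
    have qm: "x \<otimes>\<^bsub>R\<^esub> y \<notin> q" if xy: "x \<in> A k" "x \<notin> q" "y \<in> A l" "y \<notin> q" for x k y l
    proof -
      obtain m n :: nat where "x = r [^]\<^bsub>R\<^esub> m" "y = r [^]\<^bsub>R\<^esub> n" using pw[OF xy(1,2)] pw[OF xy(3,4)] by blast
      then have "x \<otimes>\<^bsub>R\<^esub> y = r [^]\<^bsub>R\<^esub> (m + n)" using nat_pow_mult[OF rc] by simp
      then show ?thesis unfolding q_def by blast
    qed
    have "good (objsupp B) F"
    proof (rule good_localisation_kernel[OF F B q1 qm])
      show "GammaD (objsupp B) (localise R A T \<phi> q F) \<in> \<C>"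
        by (rule localisation_product_closed[OF F B s(1) r(1) sr[unfolded MB] rq q1 _ ins[OF s]]) (rule qm)
      fix k w assume "w \<in> A k - q"
      then obtain n :: nat where n: "w = r [^]\<^bsub>R\<^esub> n" using pw by blast
      show "good (objsupp (insert w B)) F"
      \<comment> \<open>The zeroth power is the unit, whose support is trivial. A positive power has
        the same support as \<open>r\<close>, to which maximality applies.\<close>
      proof (cases n)
        case 0
        have h: "insert \<one>\<^bsub>R\<^esub> B \<subseteq> homog" using B one_degree by (auto simp: homog_def)
        then have "\<one>\<^bsub>R\<^esub> \<in> genideal R (insert \<one>\<^bsub>R\<^esub> B)"
          using genideal_self[OF subset_trans[OF _ homog_carrier]] by blast
        then show ?thesis using good_unit[OF h _ F] n 0 by simp
      next
        case (Suc m)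
        then have "objsupp (insert w B) = objsupp (insert r B)"
          using objsupp_power[OF rc, of m] n objsupp_insert[of w B] objsupp_insert[of r B] by simp
        then show ?thesis using ins[OF r] by simp
      qed
    qed
    then show False using bad by contradiction
  qed
qed

text \<open>The empty set of conditions gives the full subcategory, for which \<open>F\<close>
  itself has the properties of the colimit.\<close>

lemma Gamma_generate:
  assumes F: "F \<in> Coh T" and G: "\<And>p. p \<in> Spec R A \<Longrightarrow> Gamma R A T \<phi> p F \<in> \<C>"
  shows "F \<in> \<C>"
  using good_all[OF F G empty_subsetI] full_is_Gamma[OF F]
  unfolding good_def objsupp_empty by blast

end

end

text \<open>The assumptions on size make \<open>'a\<close> a universe: fractions, colimits and
  coproducts built from small data have values that inject into \<open>'a\<close> again.\<close>

theorem theorem5p5: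
  fixes R :: "('r, 'x) ring_scheme"
    and A :: "int \<Rightarrow> 'r set"
    and T :: "('o, 'm) tricat"
    and \<phi> :: "int \<Rightarrow> 'r \<Rightarrow> 'o \<Rightarrow> 'm"
    and F :: "('o, 'm, 'a) presheaf"
  assumes "linear_triangulated_category R A T \<phi>"
    and "noetherian_ring R"
    and "infinite (UNIV :: 'a set)"
    and "carrier R \<lesssim> (UNIV :: 'a set)"
    and "essentially_small (UNIV :: 'a set) T"
    and "F \<in> Coh T"
  shows "Loc T {F} = Loc T {Gamma R A T \<phi> p F | p. p \<in> Spec R A} \<and>
    Loc T {Gamma R A T \<phi> p F | p. p \<in> Spec R A} = Loc T {localise R A T \<phi> p F | p. p \<in> Spec R A}"
proof -
  interpret linear_triangulated_category R A T \<phi> by fact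
  let ?G = "{Gamma R A T \<phi> p F | p. p \<in> Spec R A}" and ?L = "{localise R A T \<phi> p F | p. p \<in> Spec R A}"
  \<comment> \<open>A generated subcategory is an intersection, so inclusions are tested on one
    localising subcategory at a time. Three inclusions then close a cycle.\<close>
  have mono: "Loc T X \<subseteq> Loc T Y" if "\<And>\<D>. \<lbrakk>localising T \<D>; Y \<subseteq> \<D>\<rbrakk> \<Longrightarrow> X \<subseteq> \<D>"
    for X Y :: "('o, 'm, 'a) presheaf set"
    using that unfolding Loc_def by blast
  have "Loc T ?L \<subseteq> Loc T {F}"
    by (rule mono) (use localise_prime_closed[OF assms(2-5)] in auto)
  moreover have "Loc T ?G \<subseteq> Loc T ?L"
    by (rule mono) (use Gamma_closed[OF assms(2-5)] in blast)
  moreover have "Loc T {F} \<subseteq> Loc T ?G"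
  proof (rule mono)
    fix \<D> assume loc: "localising T \<D>" and sub: "?G \<subseteq> \<D>"
    have "F \<in> \<D>" by (rule Gamma_generate[OF assms(2-5) loc assms(6)]) (use sub in blast)
    then show "{F} \<subseteq> \<D>" by simp
  qed
  ultimately show ?thesis by blast
qed

end
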